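(* Let $n\ge 3$, let $z_1,\dots,z_n\in\widehat{\mathbb C}$ be distinct, and let $\gamma\in\mathcal L(z_1,\dots,z_n;\tau)$ be a Jordan curve with the geodesic property. Then $\gamma$ determines a (complex) projective structure $Z_\gamma$ on $\Sigma=\widehat{\mathbb C}\smallsetminus\{z_1,\dots,z_n\}$ with a developing map $h$ whose holonomy representation takes values in $\mathrm{PSL}(2,\mathbb R)$. Moreover, if $\gamma$ is $C^1$ smooth, the holonomy around each puncture $z_k$ is parabolic.
   Context: $\widehat{\mathbb C}=\mathbb C\cup\{\infty\}$; $\mathbb H,\mathbb H^*$ are the upper and lower half-planes. $\mathcal L(z_1,\dots,z_n;\tau)$ is the isotopy class, relative to $z_1,\dots,z_n$, of Jordan curves through $z_1,\dots,z_n$ in this order that contains the Jordan curve $\tau$. Geodesic property: $\gamma\smallsetminus\{z_1,\dots,z_n\}=\gamma_1\cup\dots\cup\gamma_n$, with $\gamma_k$ the open arc between $z_k$ and $z_{k+1}$ ($z_{n+1}=z_1$), and each $\gamma_k$ is a hyperbolic geodesic in the simply connected domain $(\widehat{\mathbb C}\smallsetminus\gamma)\cup\gamma_k$. A projective structure on $\Sigma$ is a maximal atlas of charts whose coordinate changes are in $\mathrm{PSL}(2,\mathbb C)$; here it is required to induce the complex structure of $\Sigma$. Let $\Pi:\widetilde\Sigma\to\Sigma$ be the universal covering. A developing map of the structure is a holomorphic immersion $h:\widetilde\Sigma\to\widehat{\mathbb C}$ whose restrictions to small open sets are charts of the lifted structure (equivalently, the local branches of $h\circ\Pi^{-1}$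 are charts of the structure). For each deck transformation $\alpha$ there is $A_\alpha\in\mathrm{PSL}(2,\mathbb C)$ with $A_\alpha\circ h=h\circ\alpha$; identifying the deck group with $\pi_1(\Sigma)$, the homomorphism $\rho:\alpha\mapsto A_\alpha$ is the holonomy representation. The holonomy around $z_k$ is the image under $\rho$ of a simple loop around $z_k$ (defined up to conjugation). Construction of $Z_\gamma$: let $\Omega$ be the component of $\widehat{\mathbb C}\smallsetminus\gamma$ around which $z_1,\dots,z_n$ are ordered counterclockwise, $\Omega^*$ the other one, and $f:\mathbb H\to\Omega$ conformal. By the geodesic property $f^{-1}$ extends analytically across each arc $\gamma_k$ (to a conformal map of $\Omega\cup\Omega^*\cup\gamma_k$ onto $\mathbb H\cup\mathbb H^*\cup f^{-1}(\gamma_k)$), and each extension extends in turn across every arc, and so on. The resulting holomorphic map $h$ on $\widetilde\Sigma$ is the developing map of $Z_\gamma$; the structure does not depend on the choice of $f$.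
   Formalization: "Parabolic" is taken as trace squared equal to 4 in PSL(2,C), so the identity is allowed; with the identity excluded the claim fails, e.g. for a round circle through the marked points, whose holonomy is trivial. *)

theory Defs
  imports "HOL-Complex_Analysis.Complex_Analysis" "HOL-Algebra.Bij"
begin

section \<open>The Riemann sphere\<close>

datatype riemann_sphere = Fin (affine: complex) | Infty
  where "affine Infty = 0"

text \<open>The topology is that of the one-point compactification of the plane.\<close>

instantiation riemann_sphere :: topological_space
begin

definition open_riemann_sphere :: "riemann_sphere set \<Rightarrow> bool" where
  "open_riemann_sphere U \<longleftrightarrow>
     open (Fin -` U) \<and> (Infty \<in> U \<longrightarrow> compact (- (Fin -` U)))"

instance
proof
  show "open (UNIV :: riemann_sphere set)"
    by (simp add: open_riemann_sphere_def)
next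
  fix S T :: "riemann_sphere set"
  assume "open S" "open T"
  then show "open (S \<inter> T)"
    by (auto simp: open_riemann_sphere_def Compl_Int)
next
  fix K :: "riemann_sphere set set"
  assume K: "\<forall>S\<in>K. open S"
  have op: "open (Fin -` \<Union>K)"
    using K by (auto simp: open_riemann_sphere_def vimage_Union)
  moreover have "compact (- (Fin -` \<Union>K))" if "Infty \<in> \<Union>K"
  proof -
    from that obtain S where S: "S \<in> K" "Infty \<in> S" by blast
    then have "compact (- (Fin -` S))"
      using K by (auto simp: open_riemann_sphere_def)
    moreover have "- (Fin -` \<Union>K) = - (Fin -` S) \<inter> - (Fin -` \<Union>K)"
      using S by auto
    ultimately show ?thesis
      using op by (metis closed_Compl compact_Int_closed)
  qed
  ultimately show "open (\<Union>K)"
    by (simp add: open_riemann_sphere_def)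
qed

end

instance riemann_sphere :: t2_space
proof
  have fin: "\<exists>U V. open U \<and> open V \<and> Fin w \<in> U \<and> Infty \<in> V \<and> U \<inter> V = {}" for w
  proof (intro exI conjI)
    have "Fin -` (Fin ` ball w 1) = ball w 1" by auto
    then show "open (Fin ` ball w 1)" by (auto simp: open_riemann_sphere_def)
    have "Fin -` (- Fin ` cball w 1) = - cball w 1" by auto
    then show "open (- Fin ` cball w 1)" by (auto simp: open_riemann_sphere_def)
  qed auto
  fix x y :: riemann_sphere
  assume "x \<noteq> y"
  show "\<exists>U V. open U \<and> open V \<and> x \<in> U \<and> y \<in> V \<and> U \<inter> V = {}"
  proof (cases x; cases y)
    fix a b assume xy: "x = Fin a" "y = Fin b"
    with \<open>x \<noteq> y\<close> obtain U V where UV: "open U" "open V" "a \<in> U" "b \<in> V" "U \<inter> V = {}"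
      by (metis hausdorff)
    have "Fin -` (Fin ` W) = W" for W by auto
    then show ?thesis
      using UV xy
      by (intro exI[of _ "Fin ` U"] exI[of _ "Fin ` V"]) (auto simp: open_riemann_sphere_def)
  next
    fix a assume "x = Fin a" "y = Infty" then show ?thesis using fin by metis
  next
    fix b assume "x = Infty" "y = Fin b" then show ?thesis using fin by (metis Int_commute)
  next
    assume "x = Infty" "y = Infty" then show ?thesis using \<open>x \<noteq> y\<close> by simp
  qed
qed

fun moebius :: "complex \<Rightarrow> complex \<Rightarrow> complex \<Rightarrow> complex \<Rightarrow> riemann_sphere \<Rightarrow> riemann_sphere" where
  "moebius a b c d (Fin w) = (if c * w + d = 0 then Infty else Fin ((a * w + b) / (c * w + d)))"
| "moebius a b c d Infty = (if c = 0 then Infty else Fin (a / c))"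

text \<open>Elements of the projective groups are identified with the maps of the sphere they induce.\<close>

definition PSL2C :: "(riemann_sphere \<Rightarrow> riemann_sphere) set" where
  "PSL2C = {moebius a b c d | a b c d. a * d - b * c = 1}"

definition PSL2R :: "(riemann_sphere \<Rightarrow> riemann_sphere) set" where
  "PSL2R = {moebius (of_real a) (of_real b) (of_real c) (of_real d) | a b c d :: real.
              a * d - b * c = 1}"

text \<open>
  Parabolicity is the trace condition for an element of PSL(2,C), so the identity counts as a
  (degenerate) parabolic element. This cannot be avoided: if the Jordan curve considered below is
  a circle, then it is smooth, has the geodesic property for any choice of its marked points, and
  the resulting projective structure has trivial holonomy.
\<close>

definition parabolic :: "(riemann_sphere \<Rightarrow> riemann_sphere) \<Rightarrow> bool" where
  "parabolic A \<longleftrightarrow>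
     (\<exists>a b c d. a * d - b * c = 1 \<and> (a + d)\<^sup>2 = 4 \<and> A = moebius a b c d)"

definition inversion :: "riemann_sphere \<Rightarrow> riemann_sphere" where
  "inversion = moebius 0 1 1 0"

text \<open>Holomorphy is tested in the two standard charts, on the source and on the target.\<close>

definition holomorphic_sphere :: "(riemann_sphere \<Rightarrow> riemann_sphere) \<Rightarrow> riemann_sphere set \<Rightarrow> bool" where
  "holomorphic_sphere f U \<longleftrightarrow> open U \<and> continuous_on U f \<and>
     (\<forall>a\<in>{id, inversion}. \<forall>b\<in>{id, inversion}.
        (\<lambda>w. affine (b (f (a (Fin w))))) holomorphic_on
          {w. a (Fin w) \<in> U \<and> b (f (a (Fin w))) \<noteq> Infty})"

definition conformal_map ::
  "(riemann_sphere \<Rightarrow> riemann_sphere) \<Rightarrow> riemann_sphere set \<Rightarrow> riemann_sphere set \<Rightarrow> bool" where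
  "conformal_map f U V \<longleftrightarrow> holomorphic_sphere f U \<and> bij_betw f U V"

definition upper_half :: "riemann_sphere set" where
  "upper_half = Fin ` {w. Im w > 0}"

definition lower_half :: "riemann_sphere set" where
  "lower_half = Fin ` {w. Im w < 0}"

section \<open>Hyperbolic geodesics\<close>

definition hyp_dist :: "complex \<Rightarrow> complex \<Rightarrow> real" where
  "hyp_dist z w = arcosh (1 + (cmod (z - w))\<^sup>2 / (2 * Im z * Im w))"

definition geodesic_line :: "complex set \<Rightarrow> bool" where
  "geodesic_line L \<longleftrightarrow>
     (\<exists>g :: real \<Rightarrow> complex. (\<forall>t. Im (g t) > 0) \<and> (\<forall>s t. hyp_dist (g s) (g t) = \<bar>s - t\<bar>)
        \<and> L = range g)"

text \<open>
  The hyperbolic metric of a simply connected domain D is transported from the upper half-plane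
  by a Riemann map; geodesics are complete (bi-infinite).
\<close>

definition hyperbolic_geodesic :: "riemann_sphere set \<Rightarrow> riemann_sphere set \<Rightarrow> bool" where
  "hyperbolic_geodesic D A \<longleftrightarrow>
     (\<exists>\<phi> L. conformal_map \<phi> upper_half D \<and> geodesic_line L \<and> A = \<phi> ` Fin ` L)"

section \<open>Jordan curves through marked points\<close>

text \<open>
  The marked points are z 1, ..., z n. Jordan curves are point sets; their parametrizations are
  simple closed paths on the unit interval.
\<close>

definition jordan_param :: "(real \<Rightarrow> riemann_sphere) \<Rightarrow> riemann_sphere set \<Rightarrow> bool" where
  "jordan_param q \<gamma> \<longleftrightarrow> simple_path q \<and> pathfinish q = pathstart q \<and> path_image q = \<gamma>"

definition increasing_times :: "nat \<Rightarrow> (nat \<Rightarrow> real) \<Rightarrow> bool" where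
  "increasing_times n t \<longleftrightarrow> strict_mono_on {1..n} t \<and> t ` {1..n} \<subseteq> {0..<1}"

text \<open>The isotopy class of \<tau>: Jordan curves joined to \<tau> by a continuous family of Jordan curves
  that pass through the marked points, in their order, at fixed parameter values.\<close>

definition isotopy_class :: "nat \<Rightarrow> (nat \<Rightarrow> riemann_sphere) \<Rightarrow> riemann_sphere set \<Rightarrow> riemann_sphere set set" where
  "isotopy_class n z \<tau> =
     {\<gamma>. \<exists>(F :: real \<times> real \<Rightarrow> riemann_sphere) t.
        increasing_times n t \<and> continuous_on ({0..1} \<times> {0..1}) F \<and>
        (\<forall>s\<in>{0..1}. simple_path (\<lambda>x. F (s, x)) \<and> F (s, 1) = F (s, 0) \<and>
                    (\<forall>k\<in>{1..n}. F (s, t k) = z k)) \<and>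
        path_image (\<lambda>x. F (0, x)) = \<tau> \<and> path_image (\<lambda>x. F (1, x)) = \<gamma>}"

definition next_index :: "nat \<Rightarrow> nat \<Rightarrow> nat" where
  "next_index n k = (if k = n then 1 else k + 1)"

text \<open>The open arc of \<gamma> from z k to its successor. For n at least 3 it is the only component of \<gamma>
  minus the marked points that has both of these points in its closure.\<close>

definition open_arc :: "nat \<Rightarrow> (nat \<Rightarrow> riemann_sphere) \<Rightarrow> riemann_sphere set \<Rightarrow> nat \<Rightarrow> riemann_sphere set" where
  "open_arc n z \<gamma> k =
     (THE A. A \<in> components (\<gamma> - z ` {1..n}) \<and> {z k, z (next_index n k)} \<subseteq> closure A)"

definition geodesic_property :: "nat \<Rightarrow> (nat \<Rightarrow> riemann_sphere) \<Rightarrow> riemann_sphere set \<Rightarrow> bool" where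
  "geodesic_property n z \<gamma> \<longleftrightarrow>
     (\<forall>k\<in>{1..n}. hyperbolic_geodesic (- \<gamma> \<union> open_arc n z \<gamma> k) (open_arc n z \<gamma> k))"

text \<open>A regular closed curve of class C1 on the sphere, read in the plane after moving the curve
  away from infinity.\<close>

definition C1_smooth_curve :: "riemann_sphere set \<Rightarrow> bool" where
  "C1_smooth_curve \<gamma> \<longleftrightarrow>
     (\<exists>M\<in>PSL2C. \<exists>q :: real \<Rightarrow> complex.
        q C1_differentiable_on UNIV \<and> (\<forall>t. vector_derivative q (at t) \<noteq> 0) \<and>
        (\<forall>t. q (t + 1) = q t) \<and> inj_on q {0..<1} \<and> M ` \<gamma> = Fin ` range q)"

text \<open>
  The complementary component of \<gamma> around which the marked points are ordered counterclockwise: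
  when \<gamma> is traversed in the direction of the marked points and infinity is moved into the other
  component, \<gamma> winds once in the positive sense around each point of the component.
\<close>

definition positive_side :: "nat \<Rightarrow> (nat \<Rightarrow> riemann_sphere) \<Rightarrow> riemann_sphere set \<Rightarrow> riemann_sphere set" where
  "positive_side n z \<gamma> =
     (THE \<Omega>. \<Omega> \<in> components (- \<gamma>) \<and>
        (\<exists>q t. jordan_param q \<gamma> \<and> increasing_times n t \<and> (\<forall>k\<in>{1..n}. q (t k) = z k) \<and>
           (\<exists>M\<in>PSL2C. Infty \<notin> M ` (\<gamma> \<union> \<Omega>) \<and>
              (\<forall>x\<in>\<Omega>. winding_number (\<lambda>s. affine (M (q s))) (affine (M x)) = 1))))"

section \<open>Projective structures\<close>

text \<open>
  A chart on an open subset S of the sphere is a pair (U, \<phi>); only the values of \<phi> on U matter.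
  Requiring \<phi> to be holomorphic says that the projective structure induces the complex structure
  of S. As usual, coordinate changes are restrictions of elements of PSL(2,C) locally, i.e. on
  each component of the overlap.
\<close>

type_synonym chart = "riemann_sphere set \<times> (riemann_sphere \<Rightarrow> riemann_sphere)"

definition holomorphic_charts :: "riemann_sphere set \<Rightarrow> chart set" where
  "holomorphic_charts S = {(U, \<phi>). U \<subseteq> S \<and> holomorphic_sphere \<phi> U \<and> inj_on \<phi> U}"

definition compatible :: "chart \<Rightarrow> chart \<Rightarrow> bool" where
  "compatible c c' \<longleftrightarrow>
     (\<forall>x \<in> fst c \<inter> fst c'. \<exists>W. open W \<and> x \<in> W \<and> W \<subseteq> fst c \<inter> fst c' \<and>
        (\<exists>A\<in>PSL2C. \<forall>y\<in>W. snd c' y = A (snd c y)))"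

definition projective_atlas :: "riemann_sphere set \<Rightarrow> chart set \<Rightarrow> bool" where
  "projective_atlas S Z \<longleftrightarrow>
     Z \<subseteq> holomorphic_charts S \<and> \<Union>(fst ` Z) = S \<and> (\<forall>c\<in>Z. \<forall>c'\<in>Z. compatible c c')"

definition projective_structure :: "riemann_sphere set \<Rightarrow> chart set \<Rightarrow> bool" where
  "projective_structure S Z \<longleftrightarrow>
     projective_atlas S Z \<and> (\<forall>Z'. projective_atlas S Z' \<and> Z \<subseteq> Z' \<longrightarrow> Z' = Z)"

section \<open>Universal covering, developing maps and holonomy\<close>

text \<open>The complex structure of the covering surface X is the one lifted from S: functions on X are
  tested through the local inverses of the covering map p.\<close>

definition universal_covering :: "'a::topological_space set \<Rightarrow> ('a \<Rightarrow> riemann_sphere) \<Rightarrow> riemann_sphere set \<Rightarrow> bool" where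
  "universal_covering X p S \<longleftrightarrow> covering_space X p S \<and> simply_connected X"

definition holomorphic_on_cover :: "'a::topological_space set \<Rightarrow> ('a \<Rightarrow> riemann_sphere) \<Rightarrow> ('a \<Rightarrow> riemann_sphere) \<Rightarrow> bool" where
  "holomorphic_on_cover X p h \<longleftrightarrow>
     (\<forall>x\<in>X. \<exists>V. openin (top_of_set X) V \<and> x \<in> V \<and> inj_on p V \<and>
        holomorphic_sphere (h \<circ> inv_into V p) (p ` V))"

text \<open>Charts being injective and holomorphic, a developing map is a holomorphic immersion.\<close>

definition developing_map :: "'a::topological_space set \<Rightarrow> ('a \<Rightarrow> riemann_sphere) \<Rightarrow> chart set \<Rightarrow> ('a \<Rightarrow> riemann_sphere) \<Rightarrow> bool" where
  "developing_map X p Z h \<longleftrightarrow>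
     (\<forall>x\<in>X. \<exists>V. openin (top_of_set X) V \<and> x \<in> V \<and> inj_on p V \<and>
        (p ` V, h \<circ> inv_into V p) \<in> Z)"

definition deck_transformations :: "'a::topological_space set \<Rightarrow> ('a \<Rightarrow> riemann_sphere) \<Rightarrow> ('a \<Rightarrow> 'a) set" where
  "deck_transformations X p =
     {\<alpha> \<in> Bij X. homeomorphism X X \<alpha> (inv_into X \<alpha>) \<and> (\<forall>x\<in>X. p (\<alpha> x) = p x)}"

definition holonomy_representation ::
  "'a::topological_space set \<Rightarrow> ('a \<Rightarrow> riemann_sphere) \<Rightarrow> ('a \<Rightarrow> riemann_sphere)
     \<Rightarrow> (('a \<Rightarrow> 'a) \<Rightarrow> riemann_sphere \<Rightarrow> riemann_sphere) \<Rightarrow> bool" where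
  "holonomy_representation X p h \<rho> \<longleftrightarrow>
     \<rho> \<in> hom (BijGroup X\<lparr>carrier := deck_transformations X p\<rparr>) (BijGroup UNIV\<lparr>carrier := PSL2C\<rparr>) \<and>
     (\<forall>\<alpha>\<in>deck_transformations X p. \<forall>x\<in>X. \<rho> \<alpha> (h x) = h (\<alpha> x))"

definition simple_loop_around :: "nat \<Rightarrow> (nat \<Rightarrow> riemann_sphere) \<Rightarrow> nat \<Rightarrow> (real \<Rightarrow> riemann_sphere) \<Rightarrow> bool" where
  "simple_loop_around n z k c \<longleftrightarrow>
     simple_path c \<and> pathfinish c = pathstart c \<and> path_image c \<subseteq> - z ` {1..n} \<and>
     (\<exists>C\<in>components (- path_image c). C \<inter> z ` {1..n} = {z k})"

text \<open>The elements of PSL(2,C) that are the holonomy around the k-th puncture (for all choices of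
  the loop, its orientation and the base point): a loop c acts as the deck transformation
  taking the initial point of a lift of c to its end point.\<close>

definition holonomy_around ::
  "'a::topological_space set \<Rightarrow> ('a \<Rightarrow> riemann_sphere) \<Rightarrow> nat \<Rightarrow> (nat \<Rightarrow> riemann_sphere)
     \<Rightarrow> (('a \<Rightarrow> 'a) \<Rightarrow> riemann_sphere \<Rightarrow> riemann_sphere) \<Rightarrow> nat \<Rightarrow> (riemann_sphere \<Rightarrow> riemann_sphere) set" where
  "holonomy_around X p n z \<rho> k =
     {\<rho> \<alpha> | \<alpha> c g. \<alpha> \<in> deck_transformations X p \<and> simple_loop_around n z k c \<and>
        path g \<and> path_image g \<subseteq> X \<and> (\<forall>s\<in>{0..1}. p (g s) = c s) \<and>
        \<alpha> (pathstart g) = pathfinish g}"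

section \<open>The projective structure determined by a Jordan curve\<close>

text \<open>g is the extension of the inverse of f across the k-th arc.\<close>

definition extends_across ::
  "nat \<Rightarrow> (nat \<Rightarrow> riemann_sphere) \<Rightarrow> riemann_sphere set \<Rightarrow> (riemann_sphere \<Rightarrow> riemann_sphere) \<Rightarrow> nat
     \<Rightarrow> (riemann_sphere \<Rightarrow> riemann_sphere) \<Rightarrow> bool" where
  "extends_across n z \<gamma> f k g \<longleftrightarrow>
     conformal_map g (- \<gamma> \<union> open_arc n z \<gamma> k)
       (upper_half \<union> lower_half \<union> g ` open_arc n z \<gamma> k) \<and>
     (\<forall>w\<in>upper_half. g (f w) = w)"

text \<open>The maximal atlas generated by all these extensions.\<close>

definition curve_structure :: "nat \<Rightarrow> (nat \<Rightarrow> riemann_sphere) \<Rightarrow> riemann_sphere set \<Rightarrow> chart set" where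
  "curve_structure n z \<gamma> =
     {c \<in> holomorphic_charts (- z ` {1..n}).
        \<forall>f k g. conformal_map f upper_half (positive_side n z \<gamma>) \<and> k \<in> {1..n} \<and>
          extends_across n z \<gamma> f k g \<longrightarrow> compatible (- \<gamma> \<union> open_arc n z \<gamma> k, g) c}"

text \<open>
  h is obtained from the inverse of a conformal map f of the upper half-plane onto the positive
  side by analytic continuation on X, starting on a sheet V over the positive side. The identity
  theorem shows that h is determined by f and V.
\<close>

definition continued_map ::
  "'a::topological_space set \<Rightarrow> ('a \<Rightarrow> riemann_sphere) \<Rightarrow> nat \<Rightarrow> (nat \<Rightarrow> riemann_sphere)
     \<Rightarrow> riemann_sphere set \<Rightarrow> ('a \<Rightarrow> riemann_sphere) \<Rightarrow> bool" where
  "continued_map X p n z \<gamma> h \<longleftrightarrow> holomorphic_on_cover X p h \<and>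
     (\<exists>f V. conformal_map f upper_half (positive_side n z \<gamma>) \<and>
        openin (top_of_set X) V \<and> bij_betw p V (positive_side n z \<gamma>) \<and>
        (\<forall>x\<in>V. h x = inv_into upper_half f (p x)))"

end

theory Submission
  imports Defs
begin

text \<open>
  The geodesic property says that the Riemann map \<open>\<psi> k\<close> of \<open>D k\<close> (the complement of the curve together
  with the k-th open arc) onto the upper half-plane can be normalized so that the arc becomes the
  imaginary half-axis and the two sides of the curve become the two quadrants. Hence the square of
  \<open>\<psi> k\<close> is, up to an element of PSL(2,R), the extension \<open>g k\<close> of the inverse of \<open>f\<close>. Two such extensions agree
  on the positive side and differ on the other side by an automorphism of the lower half-plane, so all
  coordinate changes are real, and so is the holonomy.

  Around a puncture, the holonomy is conjugate to a power of the element \<open>A\<close> by which the extensions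
  across the two adjacent arcs differ. If the curve has a tangent there, a normal families argument
  shows that, after rescaling, the points \<open>\<plusminus> i r\<close> have asymptotically mirror-symmetric images under \<open>\<psi> k\<close> for
  both arcs. So the hyperbolic displacement of \<open>A\<close> tends to 0 along a sequence that leaves
  every compact subset of the half-plane, which forces \<open>A\<close> to have squared trace 4.
\<close>

text \<open>For a C1 curve the Riemann maps need have no derivative at a marked point, so nothing
  can be read off from boundary values there. Everything near a puncture is therefore expressed
  through interior points on the normal and through a displacement that tends to 0. The rescaled
  maps form a normal family, and the danger is a constant limit; it is excluded by a lower
  derivative bound at a point of the arc, where the map is normalized to take the value \<i>. In the
  Cayley coordinate the limit is real along the tangent ray, so it is symmetric under conjugation.
  Back in the half-plane this is reflection in the imaginary axis, which squaring turns into
  conjugation: hence images on one side are compared with conjugates of images on the other.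

  The cover carries only a topology, and a loop around a puncture is an arbitrary simple loop. The
  loop is enclosed in a disc free of other marked points, the punctured disc is unrolled by exp, and
  the developments on the two covers are matched along the two lifts of the loop. Direction and
  winding enter only through an integer \<open>m\<close>, so all integer powers of one parabolic
  element have to be handled.\<close>

abbreviation open_in :: "'a::topological_space set \<Rightarrow> 'a set \<Rightarrow> bool" where
  "open_in X \<equiv> openin (top_of_set X)"

lemmas conformal_simps = conformal_map_def bij_betw_def

section \<open>Moebius transformations and holomorphic maps of the sphere\<close>

text \<open>With nonzero determinants, numerator and denominator never vanish together; this settles
  the pole of the inner map and the point Infty, and elsewhere the fractions combine by clearing
  denominators.\<close>

lemma moebius_compose:
 assumes "a * d - b * c \<noteq> 0" "a' * d' - b' * c' \<noteq> 0" shows "moebius a b c d (moebius a' b' c' d' x) =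
  moebius (a * a' + b * c') (a * b' + b * d') (c * a' + d * c') (c * b' + d * d') x"
proof (cases x)
 case (Fin w)
 have den: "(c * a' + d * c') * w + (c * b' + d * d') = c * (a' * w + b') + d * (c' * w + d')"
  and num: "(a * a' + b * c') * w + (a * b' + b * d') = a * (a' * w + b') + b * (c' * w + d')" by (auto simp: algebra_simps)
 show ?thesis
 proof (cases "c' * w + d' = 0")
  case True
  have "a' * w + b' \<noteq> 0"
  proof
   assume "a' * w + b' = 0"
   then have "b' = - a' * w" "d' = - c' * w" using True by (auto simp: algebra_simps eq_neg_iff_add_eq_0)
   then show False using assms by (simp add: algebra_simps)
  qed
  then show ?thesis using True Fin by (simp add: den num)
 next
  case False
  let ?u = "a' * w + b'" and ?v = "c' * w + d'"
  have "c * (?u / ?v) + d = (c * ?u + d * ?v) / ?v" "a * (?u / ?v) + b = (a * ?u + b * ?v) / ?v" using False by (auto simp: field_simps)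
  then show ?thesis using False Fin by (simp add: den num)
 qed
next
 case Infty
 show ?thesis
 proof (cases "c' = 0")
  case True
  then show ?thesis using assms Infty by auto
 next
  case False
  have "c * (a' / c') + d = (c * a' + d * c') / c'" "a * (a' / c') + b = (a * a' + b * c') / c'" using False by (auto simp: field_simps)
  then show ?thesis using False Infty by simp
 qed
qed

lemma moebius_1: "moebius 1 0 0 1 = id"
proof
 fix x show "moebius 1 0 0 1 x = id x" by (cases x) auto
qed

lemma moebius_scale: "s \<noteq> 0 \<Longrightarrow> moebius (s * a) (s * b) (s * c) (s * d) = moebius a b c d"
proof
 fix x assume s: "s \<noteq> 0"
 show "moebius (s * a) (s * b) (s * c) (s * d) x = moebius a b c d x"
 proof (cases x)
  case (Fin w)
  have "s * c * w + s * d = s * (c * w + d)" "s * a * w + s * b = s * (a * w + b)" by (auto simp: algebra_simps)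
  then show ?thesis using s Fin by simp
 qed (use s in auto)
qed

lemma moebius_PSL2C:
 assumes "a * d - b * c \<noteq> 0" shows "moebius a b c d \<in> PSL2C"
proof -
 define s where "s = 1 / csqrt (a * d - b * c)"
 have s: "s \<noteq> 0" "s\<^sup>2 * (a * d - b * c) = 1" using assms by (auto simp: s_def power_divide)
 have "moebius a b c d = moebius (s * a) (s * b) (s * c) (s * d)" using moebius_scale s by simp
 moreover have "(s * a) * (s * d) - (s * b) * (s * c) = 1" using s by (simp add: power2_eq_square algebra_simps)
 ultimately show ?thesis unfolding PSL2C_def by blast
qed

text \<open>Dividing by the square root of the determinant keeps the entries real only if the
  determinant is positive; a negative one would belong to a map that exchanges the
  half-planes.\<close>

lemma moebius_PSL2R:
 assumes "a * d - b * c > (0::real)" shows "moebius (of_real a) (of_real b) (of_real c) (of_real d) \<in> PSL2R"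
proof -
 define s where "s = 1 / sqrt (a * d - b * c)"
 have s: "s \<noteq> 0" "s\<^sup>2 * (a * d - b * c) = 1" using assms by (auto simp: s_def power_divide)
 have "moebius (of_real a) (of_real b) (of_real c) (of_real d)
   = moebius (of_real (s * a)) (of_real (s * b)) (of_real (s * c)) (of_real (s * d))" using moebius_scale[of "of_real s"] s by simp
 moreover have "(s * a) * (s * d) - (s * b) * (s * c) = 1" using s by (simp add: power2_eq_square algebra_simps)
 ultimately show ?thesis unfolding PSL2R_def by blast
qed

lemma PSL2R_subset_PSL2C: "PSL2R \<subseteq> PSL2C"
proof
 fix A assume "A \<in> PSL2R"
 then obtain a b c d :: real where
  A: "A = moebius (of_real a) (of_real b) (of_real c) (of_real d)" "a * d - b * c = 1" by (auto simp: PSL2R_def)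
 then have "complex_of_real a * of_real d - of_real b * of_real c = 1" by (metis of_real_1 of_real_diff of_real_mult)
 with A show "A \<in> PSL2C" unfolding PSL2C_def by blast
qed

lemma id_PSL2R: "id \<in> PSL2R" and id_PSL2C: "id \<in> PSL2C"
proof -
 show "id \<in> PSL2R" using moebius_PSL2R[of 1 1 0 0] by (simp add: moebius_1)
 then show "id \<in> PSL2C" using PSL2R_subset_PSL2C by blast
qed

lemma PSL2C_comp:
 assumes "A \<in> PSL2C" "B \<in> PSL2C" shows "A \<circ> B \<in> PSL2C"
proof -
 obtain a b c d a' b' c' d' where
  A: "A = moebius a b c d" "a * d - b * c = 1" and B: "B = moebius a' b' c' d'" "a' * d' - b' * c' = 1" using assms by (auto simp: PSL2C_def)
 have "A \<circ> B = moebius (a * a' + b * c') (a * b' + b * d') (c * a' + d * c') (c * b' + d * d')"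
  unfolding A(1) B(1) o_def by (rule ext, rule moebius_compose) (use A B in auto)
 moreover have "(a * a' + b * c') * (c * b' + d * d') - (a * b' + b * d') * (c * a' + d * c')
  = (a * d - b * c) * (a' * d' - b' * c')" by (simp add: algebra_simps)
 ultimately show ?thesis using A B by (simp only:) (rule moebius_PSL2C, simp)
qed

lemma PSL2R_comp:
 assumes "A \<in> PSL2R" "B \<in> PSL2R" shows "A \<circ> B \<in> PSL2R"
proof -
 obtain a b c d a' b' c' d' :: real where
  A: "A = moebius (of_real a) (of_real b) (of_real c) (of_real d)" "a * d - b * c = 1" and
  B: "B = moebius (of_real a') (of_real b') (of_real c') (of_real d')" "a' * d' - b' * c' = 1" using assms by (auto simp: PSL2R_def)
 have n: "complex_of_real a * of_real d - of_real b * of_real c \<noteq> 0" "complex_of_real a' * of_real d' - of_real b' * of_real c' \<noteq> 0"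
  using A B by (metis of_real_1 of_real_diff of_real_mult zero_neq_one)+
 have "A \<circ> B = moebius (of_real (a * a' + b * c')) (of_real (a * b' + b * d'))
   (of_real (c * a' + d * c')) (of_real (c * b' + d * d'))"
  unfolding A(1) B(1) o_def of_real_add of_real_mult by (rule ext, rule moebius_compose[OF n])
 moreover have "(a * a' + b * c') * (c * b' + d * d') - (a * b' + b * d') * (c * a' + d * c')
  = (a * d - b * c) * (a' * d' - b' * c')" by (simp add: algebra_simps)
 ultimately show ?thesis using A B by (simp only:) (rule moebius_PSL2R, simp)
qed

lemma moebius_inverse:
 assumes "a * d - b * c \<noteq> 0" shows "moebius a b c d (moebius d (-b) (-c) a x) = x" "moebius d (-b) (-c) a (moebius a b c d x) = x"
proof -
 have n: "d * a - (-b) * (-c) \<noteq> 0" using assms by (simp add: mult.commute)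
 have "moebius (a*d-b*c) 0 0 (a*d-b*c) = id" using moebius_scale[of "a*d-b*c" 1 0 0 1] assms by (simp add: moebius_1)
 moreover have "moebius a b c d (moebius d (-b) (-c) a x) = moebius (a*d-b*c) 0 0 (a*d-b*c) x"
  "moebius d (-b) (-c) a (moebius a b c d x) = moebius (a*d-b*c) 0 0 (a*d-b*c) x"
  by (simp_all only: moebius_compose[OF assms n] moebius_compose[OF n assms]) (simp_all add: algebra_simps)
 ultimately show "moebius a b c d (moebius d (-b) (-c) a x) = x" "moebius d (-b) (-c) a (moebius a b c d x) = x" by simp_all
qed

lemma PSL2C_inverse:
 assumes "A \<in> PSL2C" obtains B where "B \<in> PSL2C" "\<And>x. A (B x) = x" "\<And>x. B (A x) = x"
proof -
 obtain a b c d where A: "A = moebius a b c d" "a * d - b * c = 1" using assms by (auto simp: PSL2C_def)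
 show ?thesis using moebius_inverse[of a d b c] A by (intro that[OF moebius_PSL2C[of d a "-b" "-c"]]) (auto simp: mult.commute)
qed

lemma PSL2R_inverse:
 assumes "A \<in> PSL2R" obtains B where "B \<in> PSL2R" "\<And>x. A (B x) = x" "\<And>x. B (A x) = x"
proof -
 obtain a b c d :: real where
  A: "A = moebius (of_real a) (of_real b) (of_real c) (of_real d)" "a * d - b * c = 1" using assms by (auto simp: PSL2R_def)
 have n: "complex_of_real a * of_real d - of_real b * of_real c \<noteq> 0" using A by (metis of_real_1 of_real_diff of_real_mult zero_neq_one)
 have "moebius (of_real d) (of_real (-b)) (of_real (-c)) (of_real a) \<in> PSL2R"
  by (rule moebius_PSL2R) (use A in \<open>simp add: mult.commute\<close>)
 then show ?thesis using moebius_inverse[OF n] A by (intro that) auto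
qed

section \<open>Topology of the sphere and continuity of Moebius maps\<close>

lemma inversion_PSL2C: "inversion \<in> PSL2C" unfolding inversion_def by (rule moebius_PSL2C) simp

lemma inversion_simps [simp]:
 "inversion Infty = Fin 0" "inversion (Fin 0) = Infty" "w \<noteq> 0 \<Longrightarrow> inversion (Fin w) = Fin (1 / w)" by (auto simp: inversion_def)

lemma inversion_inversion [simp]: "inversion (inversion x) = x"
proof (cases x)
 case (Fin w) then show ?thesis by (cases "w = 0") auto
qed simp

lemma open_Fin_image_iff: "open (Fin ` A) \<longleftrightarrow> open A"
proof -
 have "Fin -` Fin ` A = A" by auto
 then show ?thesis by (auto simp: open_riemann_sphere_def)
qed

lemma open_Fin_vimage: "open U \<Longrightarrow> open (Fin -` U)" by (simp add: open_riemann_sphere_def)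

lemma continuous_on_Fin: "continuous_on S Fin" by (rule continuous_on_subset[of UNIV]) (auto intro!: open_Fin_vimage simp: continuous_on_open_vimage)

lemma continuous_on_affine: "Infty \<notin> S \<Longrightarrow> continuous_on S affine"
proof (rule continuous_on_subset[of "range Fin"])
 have "affine -` B \<inter> range Fin = Fin ` B" for B by force
 then show "continuous_on (range Fin) affine" by (subst continuous_on_open_vimage) (auto simp: open_Fin_image_iff)
 show "Infty \<notin> S \<Longrightarrow> S \<subseteq> range Fin" using riemann_sphere.exhaust by blast
qed

lemma Fin_affine: "x \<noteq> Infty \<Longrightarrow> Fin (affine x) = x" by (cases x) auto

lemma open_vimage_affine_moebius:
 assumes "a \<noteq> 0" "open U" shows "open (moebius a b 0 1 -` U)"
proof -
 let ?f = "\<lambda>w. a * w + b" and ?g = "\<lambda>w. (w - b) / a"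
 have e: "Fin -` moebius a b 0 1 -` U = ?f -` (Fin -` U)" by auto
 have "?f -` (Fin -` U) = ?g ` (Fin -` U)" using assms(1) by (force simp: image_iff)
 moreover have "compact (?g ` (- (Fin -` U)))" if "Infty \<in> U"
  by (rule compact_continuous_image) (use assms that in \<open>auto simp: open_riemann_sphere_def intro!: continuous_intros\<close>)
 moreover have "?g ` (- (Fin -` U)) = - (?g ` (Fin -` U))" using assms(1) by (intro bij_image_Compl_eq o_bij[of ?f]) auto
 moreover have "open (?f -` (Fin -` U))" by (rule open_vimage) (use assms in \<open>auto intro!: continuous_intros open_Fin_vimage\<close>)
 ultimately show ?thesis by (auto simp: open_riemann_sphere_def e)
qed

lemma open_vimage_inversion:
 assumes "open U" shows "open (inversion -` U)"
proof -
 let ?V = "Fin -` U"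
 have V: "open ?V" and K: "Infty \<in> U \<Longrightarrow> compact (- ?V)" using assms by (auto simp: open_riemann_sphere_def)
 have eq: "Fin -` inversion -` U = {w. w \<noteq> 0 \<and> 1 / w \<in> ?V} \<union> (if Infty \<in> U then {0} else {})"
 proof (rule Set.set_eqI)
  fix w show "w \<in> Fin -` inversion -` U \<longleftrightarrow> w \<in> {w. w \<noteq> 0 \<and> 1 / w \<in> ?V} \<union> (if Infty \<in> U then {0} else {})"
   by (cases "w = 0") auto
 qed
 have o1: "open {w. w \<noteq> 0 \<and> 1 / w \<in> ?V}"
 proof -
  have "open (- {0} \<inter> (\<lambda>w. 1 / w) -` ?V)" by (rule continuous_open_preimage) (use V in \<open>auto intro!: continuous_intros\<close>)
  also have "- {0} \<inter> (\<lambda>w. 1 / w) -` ?V = {w. w \<noteq> 0 \<and> 1 / w \<in> ?V}" by auto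
  finally show ?thesis .
 qed
 have op: "open (Fin -` inversion -` U)"
 proof (cases "Infty \<in> U")
  case True
  then obtain B where B: "B > 0" "\<And>w. w \<notin> ?V \<Longrightarrow> norm w \<le> B"
   using compact_imp_bounded[OF K] by (auto simp: bounded_pos)
  \<comment> \<open>The complement of \<open>?V\<close> has norm at most \<open>B\<close>, so
    inverting a point of modulus below \<open>1 / (B + 1)\<close> lands in
    \<open>?V\<close>.\<close>
  have "w \<noteq> 0 \<longrightarrow> 1 / w \<in> ?V" if w: "w \<in> ball 0 (1 / (B + 1))" for w
  proof (intro impI)
   assume w0: "w \<noteq> 0"
   have "B < norm (1 / w)" using w w0 B norm_ge_zero[of w] by (simp add: norm_divide field_simps del: norm_ge_zero)
   then show "1 / w \<in> ?V" using B(2)[of "1 / w"] by force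
  qed
  then have "Fin -` inversion -` U = {w. w \<noteq> 0 \<and> 1 / w \<in> ?V} \<union> ball 0 (1 / (B + 1))" using True B unfolding eq by auto
  then show ?thesis using o1 by (auto simp: open_Un)
 qed (use o1 eq in auto)
 have "compact (- (Fin -` inversion -` U))" if "Infty \<in> inversion -` U"
 proof -
  have "0 \<in> ?V" using that by auto
  then obtain r where r: "r > 0" "ball 0 r \<subseteq> ?V" using V by (meson open_contains_ball)
  have "norm w \<le> 1 / r" if "w \<notin> Fin -` inversion -` U" for w
  proof (cases "w = 0")
   case False
   then have "1 / w \<notin> ?V" using that unfolding eq by auto
   then have "\<not> norm (1 / w) < r" using r by auto
   then show ?thesis using r False by (auto simp: norm_divide field_simps)
  qed (use r in auto)
  then have "bounded (- (Fin -` inversion -` U))" by (auto simp: bounded_iff)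
  then show ?thesis using op by (simp add: compact_eq_bounded_closed closed_Compl)
 qed
 then show ?thesis using op by (simp add: open_riemann_sphere_def)
qed

lemma continuous_on_moebius:
 assumes "a * d - b * c \<noteq> 0" shows "continuous_on S (moebius a b c d)"
proof (rule continuous_on_subset[of UNIV])
 show "continuous_on UNIV (moebius a b c d)"
 proof (cases "c = 0")
  case True
  then have d: "d \<noteq> 0" "a \<noteq> 0" using assms by auto
  then have "moebius a b c d = moebius (a / d) (b / d) 0 1" using moebius_scale[of d "a / d" "b / d" 0 1] True by simp
  then show ?thesis using open_vimage_affine_moebius[of "a / d" _ "b / d"] d by (auto simp: continuous_on_open_vimage)
 next
  case False
  let ?D = "a * d - b * c"
  \<comment> \<open>Division with remainder,
    \<open>(a w + b) / (c w + d) = a / c - ?D / (c (c w + d))\<close>: an affine map after an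
    inversion after an affine map.\<close>
  have "moebius a b c d x = moebius (- ?D / c) (a / c) 0 1 (inversion (moebius c d 0 1 x))" for x
  proof -
   have 1: "inversion (moebius c d 0 1 x) = moebius 0 1 c d x" unfolding inversion_def using False by (subst moebius_compose) auto
   have "moebius (- ?D / c) (a / c) 0 1 (moebius 0 1 c d x)
     = moebius (- ?D / c * 0 + a / c * c) (- ?D / c * 1 + a / c * d) (0 * 0 + 1 * c) (0 * 1 + 1 * d) x"
    by (rule moebius_compose) (use False assms in auto)
   moreover have "- ?D / c * 0 + a / c * c = a" "- ?D / c * 1 + a / c * d = b" using False by (auto simp: field_simps)
   ultimately show ?thesis using 1 by simp
  qed
  then have "moebius a b c d -` U = moebius c d 0 1 -` inversion -` moebius (- ?D / c) (a / c) 0 1 -` U" for U by auto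
  then show ?thesis using open_vimage_affine_moebius open_vimage_inversion False assms by (auto simp: continuous_on_open_vimage)
 qed
qed auto

lemma continuous_on_PSL2C: "A \<in> PSL2C \<Longrightarrow> continuous_on S A" by (auto simp: PSL2C_def intro!: continuous_on_moebius)

lemma open_vimage_PSL2C: "A \<in> PSL2C \<Longrightarrow> open U \<Longrightarrow> open (A -` U)"
 using continuous_on_PSL2C[of A UNIV] by (auto simp: continuous_on_open_vimage)

lemma open_image_PSL2C:
 assumes "A \<in> PSL2C" "open U" shows "open (A ` U)"
proof -
 obtain B where B: "B \<in> PSL2C" "\<And>x. A (B x) = x" "\<And>x. B (A x) = x" using PSL2C_inverse assms by blast
 then have "A ` U = B -` U" by (auto simp: image_iff) metis
 then show ?thesis using open_vimage_PSL2C B assms by simp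
qed

lemma PSL2C_inj: "A \<in> PSL2C \<Longrightarrow> inj_on A S" by (metis PSL2C_inverse inj_on_inverseI)

lemma PSL2C_holomorphic:
 assumes "P \<in> PSL2C" shows "open {w. P (Fin w) \<noteq> Infty}" "(\<lambda>w. affine (P (Fin w))) holomorphic_on {w. P (Fin w) \<noteq> Infty}"
proof -
 obtain a b c d where P: "P = moebius a b c d" "a * d - b * c = 1" using assms by (auto simp: PSL2C_def)
 have eq: "{w. P (Fin w) \<noteq> Infty} = {w. c * w + d \<noteq> 0}" using P by auto
 show "open {w. P (Fin w) \<noteq> Infty}" unfolding eq by (intro open_Collect_neq continuous_intros)
 have "(\<lambda>w. (a * w + b) / (c * w + d)) holomorphic_on {w. c * w + d \<noteq> 0}" by (intro holomorphic_intros) auto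
 then show "(\<lambda>w. affine (P (Fin w))) holomorphic_on {w. P (Fin w) \<noteq> Infty}"
  unfolding eq by (rule holomorphic_transform) (use P in auto)
qed

section \<open>Holomorphy at a point, tested in Moebius charts\<close>

lemma obtain_chart:
 obtains a where "a \<in> {id, inversion}" "a \<in> PSL2C" "a x \<noteq> Infty" "\<And>y. a (a y) = y"
proof (cases x)
 case Fin then show ?thesis using that[of id] id_PSL2C by auto
next
 case Infty then show ?thesis using that[of inversion] inversion_PSL2C by auto
qed

definition hol_at :: "(riemann_sphere \<Rightarrow> riemann_sphere) \<Rightarrow> riemann_sphere \<Rightarrow> bool" where
 "hol_at f x \<longleftrightarrow> (\<exists>A\<in>PSL2C. \<exists>B\<in>PSL2C. \<exists>F w r. r > 0 \<and> x = A (Fin w) \<and> F holomorphic_on ball w r \<and>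
   (\<forall>v\<in>ball w r. f (A (Fin v)) = B (Fin (F v))))"

text \<open>A change of chart is a Moebius map, so the expression in the prescribed charts is a
  composite of three holomorphic maps; \<open>S1\<close>, \<open>S2\<close>, \<open>S3\<close> are
  the domains on which one, two and all three of them are defined.\<close>

lemma hol_at_rep:
 assumes f: "hol_at f x" and P: "P \<in> PSL2C" "x = P (Fin u)" and b: "b \<in> PSL2C" "b (f x) \<noteq> Infty"
 obtains r where "r > 0" "(\<lambda>v. affine (b (f (P (Fin v))))) holomorphic_on ball u r"
  "\<And>v. v \<in> ball u r \<Longrightarrow> b (f (P (Fin v))) \<noteq> Infty"
proof -
 obtain A B F w r where A: "A \<in> PSL2C" "B \<in> PSL2C" "r > 0" "x = A (Fin w)" "F holomorphic_on ball w r"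
  and fA: "\<And>v. v \<in> ball w r \<Longrightarrow> f (A (Fin v)) = B (Fin (F v))" using f unfolding hol_at_def by blast
 obtain A' where A': "A' \<in> PSL2C" "\<And>x. A (A' x) = x" "\<And>x. A' (A x) = x" using PSL2C_inverse A(1) by blast
 define N where "N = A' \<circ> P"
 have N: "N \<in> PSL2C" unfolding N_def by (rule PSL2C_comp) (use A' P in auto)
 define b' where "b' = b \<circ> B"
 have b': "b' \<in> PSL2C" unfolding b'_def by (rule PSL2C_comp) (use A b in auto)
 have Nu: "N (Fin u) = Fin w" using A A' P by (simp add: N_def)
 define S1 where "S1 = {v. N (Fin v) \<noteq> Infty}"
 have S1: "open S1" "(\<lambda>v. affine (N (Fin v))) holomorphic_on S1" unfolding S1_def using PSL2C_holomorphic[OF N] by auto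
 define S2 where "S2 = S1 \<inter> (\<lambda>v. affine (N (Fin v))) -` ball w r"
 have S2: "open S2" unfolding S2_def by (rule continuous_open_preimage) (use S1 in \<open>auto intro: holomorphic_on_imp_continuous_on\<close>)
 have holF: "(\<lambda>v. F (affine (N (Fin v)))) holomorphic_on S2"
  by (rule holomorphic_on_compose_gen[of "\<lambda>v. affine (N (Fin v))" _ F "ball w r", unfolded o_def])
   (use S1 A in \<open>auto simp: S2_def intro: holomorphic_on_subset\<close>)
 define S3 where "S3 = S2 \<inter> (\<lambda>v. F (affine (N (Fin v)))) -` {w. b' (Fin w) \<noteq> Infty}"
 have S3: "open S3" unfolding S3_def by (rule continuous_open_preimage)
   (use S2 holF PSL2C_holomorphic[OF b'] in \<open>auto intro: holomorphic_on_imp_continuous_on\<close>)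
 have hol3: "(\<lambda>v. affine (b' (Fin (F (affine (N (Fin v))))))) holomorphic_on S3"
  by (rule holomorphic_on_compose_gen[of "\<lambda>v. F (affine (N (Fin v)))" _ "\<lambda>w. affine (b' (Fin w))" "{w. b' (Fin w) \<noteq> Infty}", unfolded o_def])
   (use holF PSL2C_holomorphic[OF b'] in \<open>auto simp: S3_def intro: holomorphic_on_subset\<close>)
 have eq: "b (f (P (Fin v))) = b' (Fin (F (affine (N (Fin v)))))" if "v \<in> S2" for v
 proof -
  have v: "affine (N (Fin v)) \<in> ball w r" "N (Fin v) \<noteq> Infty" using that by (auto simp: S2_def S1_def)
  have "A (Fin (affine (N (Fin v)))) = P (Fin v)" using v A' by (simp add: Fin_affine) (simp add: N_def)
  then show ?thesis using fA[OF v(1)] by (simp add: b'_def)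
 qed
 have u2: "u \<in> S2" using Nu A by (auto simp: S2_def S1_def)
 have "b' (Fin (F (affine (N (Fin u))))) \<noteq> Infty" using eq[OF u2] b P by simp
 then have "u \<in> S3" using u2 by (auto simp: S3_def)
 then obtain s where s: "s > 0" "ball u s \<subseteq> S3" using S3 by (auto simp: open_contains_ball)
 show ?thesis
 proof (rule that[OF s(1)])
  have sub: "v \<in> S2 \<and> b' (Fin (F (affine (N (Fin v))))) \<noteq> Infty" if "v \<in> ball u s" for v using that s by (auto simp: S3_def)
  show "(\<lambda>v. affine (b (f (P (Fin v))))) holomorphic_on ball u s"
   by (rule holomorphic_transform[OF holomorphic_on_subset[OF hol3 s(2)]]) (use sub eq in auto)
  show "b (f (P (Fin v))) \<noteq> Infty" if "v \<in> ball u s" for v using sub[OF that] eq by simp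
 qed
qed

lemma hol_atI:
 assumes "A \<in> PSL2C" "B \<in> PSL2C" "r > 0" "x = A (Fin w)" "F holomorphic_on ball w r"
  "\<And>v. v \<in> ball w r \<Longrightarrow> f (A (Fin v)) = B (Fin (F v))" shows "hol_at f x" using assms unfolding hol_at_def by blast

lemma hol_at_cong:
 assumes "hol_at f x" "open U" "x \<in> U" "\<And>y. y \<in> U \<Longrightarrow> f y = g y" shows "hol_at g x"
proof -
 obtain a where a: "a \<in> PSL2C" "a x \<noteq> Infty" "\<And>y. a (a y) = y" using obtain_chart by blast
 obtain b where b: "b \<in> PSL2C" "b (f x) \<noteq> Infty" "\<And>y. b (b y) = y" using obtain_chart by blast
 have x: "x = a (Fin (affine (a x)))" using a by (simp add: Fin_affine)
 obtain r where r: "r > 0" "(\<lambda>v. affine (b (f (a (Fin v))))) holomorphic_on ball (affine (a x)) r"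
  "\<And>v. v \<in> ball (affine (a x)) r \<Longrightarrow> b (f (a (Fin v))) \<noteq> Infty" using hol_at_rep[OF assms(1) a(1) x b(1,2)] by blast
 have "open (Fin -` a -` U)" using assms a by (intro open_Fin_vimage open_vimage_PSL2C)
 moreover have "affine (a x) \<in> Fin -` a -` U" using x assms by simp
 ultimately obtain s where s: "s > 0" "ball (affine (a x)) s \<subseteq> Fin -` a -` U" by (meson open_contains_ball)
 show ?thesis
 proof (rule hol_atI[OF a(1) b(1), of "min r s"])
  show "(\<lambda>v. affine (b (f (a (Fin v))))) holomorphic_on ball (affine (a x)) (min r s)" by (rule holomorphic_on_subset[OF r(2)]) auto
  fix v assume v: "v \<in> ball (affine (a x)) (min r s)"
  then have "a (Fin v) \<in> U" using s by auto
  then have "g (a (Fin v)) = f (a (Fin v))" using assms by simp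
  also have "\<dots> = b (Fin (affine (b (f (a (Fin v))))))" using v r(3) b by (simp add: Fin_affine)
  finally show "g (a (Fin v)) = b (Fin (affine (b (f (a (Fin v))))))" .
 qed (use r s x in auto)
qed

lemma hol_at_continuous:
 assumes "hol_at f x" "open V" "f x \<in> V"
 obtains U where "open U" "x \<in> U" "f ` U \<subseteq> V"
proof -
 obtain A B F w r where A: "A \<in> PSL2C" "B \<in> PSL2C" "r > 0" "x = A (Fin w)" "F holomorphic_on ball w r"
  and fA: "\<And>v. v \<in> ball w r \<Longrightarrow> f (A (Fin v)) = B (Fin (F v))" using assms unfolding hol_at_def by blast
 have "open (Fin -` B -` V)" using assms A by (intro open_Fin_vimage open_vimage_PSL2C)
 then have "open (ball w r \<inter> F -` (Fin -` B -` V))" by (intro continuous_open_preimage holomorphic_on_imp_continuous_on A) auto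
 then have "open (A ` Fin ` (ball w r \<inter> F -` (Fin -` B -` V)))" using A by (simp add: open_image_PSL2C open_Fin_image_iff)
 then show ?thesis by (rule that) (use A fA assms in auto)
qed

text \<open>Continuity makes the planar test sets open, so each point of them has a disc that serves
  as local representation; conversely local representations give continuity and, in each pair of
  standard charts, differentiability.\<close>

lemma holomorphic_sphere_iff_hol_at:
 "holomorphic_sphere f U \<longleftrightarrow> open U \<and> (\<forall>x\<in>U. hol_at f x)"
proof (intro iffI conjI ballI)
 assume h: "holomorphic_sphere f U"
 then show oU: "open U" by (simp add: holomorphic_sphere_def)
 fix x assume x: "x \<in> U"
 obtain a where a: "a \<in> {id, inversion}" "a \<in> PSL2C" "a x \<noteq> Infty" "\<And>y. a (a y) = y" using obtain_chart by blast
 obtain b where b: "b \<in> {id, inversion}" "b \<in> PSL2C" "b (f x) \<noteq> Infty" "\<And>y. b (b y) = y" using obtain_chart by blast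
 let ?S = "{w. a (Fin w) \<in> U \<and> b (f (a (Fin w))) \<noteq> Infty}"
 have hol: "(\<lambda>w. affine (b (f (a (Fin w))))) holomorphic_on ?S" using h a(1) b(1) unfolding holomorphic_sphere_def by blast
 have "open (U \<inter> f -` (b -` (- {Infty})))"
  by (rule continuous_open_preimage) (use h b in \<open>auto simp: holomorphic_sphere_def intro: open_vimage_PSL2C\<close>)
 then have "open (Fin -` a -` (U \<inter> f -` (b -` (- {Infty}))))" using a by (intro open_Fin_vimage open_vimage_PSL2C)
 moreover have "Fin -` a -` (U \<inter> f -` (b -` (- {Infty}))) = ?S" by auto
 ultimately have "open ?S" by simp
 moreover have "affine (a x) \<in> ?S" using a b x by (simp add: Fin_affine)
 ultimately obtain r where r: "r > 0" "ball (affine (a x)) r \<subseteq> ?S" by (meson open_contains_ball)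
 show "hol_at f x"
 proof (rule hol_atI[OF a(2) b(2) r(1)])
  show "x = a (Fin (affine (a x)))" using a by (simp add: Fin_affine)
  show "(\<lambda>w. affine (b (f (a (Fin w))))) holomorphic_on ball (affine (a x)) r" using hol r holomorphic_on_subset by blast
  show "f (a (Fin v)) = b (Fin (affine (b (f (a (Fin v))))))" if "v \<in> ball (affine (a x)) r" for v using that r b by (auto simp: Fin_affine)
 qed
next
 assume h: "open U \<and> (\<forall>x\<in>U. hol_at f x)"
 have cont: "continuous_on U f"
 proof (subst continuous_on_open_vimage)
  show "open U" using h by simp
  show "\<forall>B. open B \<longrightarrow> open (f -` B \<inter> U)"
  proof (intro allI impI)
   fix B :: "riemann_sphere set" assume B: "open B"
   have "\<exists>T. open T \<and> x \<in> T \<and> T \<subseteq> f -` B \<inter> U" if x: "x \<in> f -` B \<inter> U" for x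
   proof -
    obtain T where "open T" "x \<in> T" "f ` T \<subseteq> B" using hol_at_continuous[of f x B] h B x by auto
    then show ?thesis using h x by (intro exI[of _ "T \<inter> U"]) auto
   qed
   then show "open (f -` B \<inter> U)" by (subst open_subopen) blast
  qed
 qed
 show "holomorphic_sphere f U" unfolding holomorphic_sphere_def
 proof (intro conjI ballI cont)
  show "open U" using h by simp
  fix a b assume ab: "a \<in> {id, inversion}" "b \<in> {id, inversion}"
  let ?S = "{w. a (Fin w) \<in> U \<and> b (f (a (Fin w))) \<noteq> Infty}"
  have abP: "a \<in> PSL2C" "b \<in> PSL2C" using ab id_PSL2C inversion_PSL2C by auto
  show "(\<lambda>w. affine (b (f (a (Fin w))))) holomorphic_on ?S" unfolding holomorphic_on_def
  proof
   fix w assume w: "w \<in> ?S"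
   have hx: "hol_at f (a (Fin w))" and ne: "b (f (a (Fin w))) \<noteq> Infty" using h w by auto
   obtain r where r: "r > 0" "(\<lambda>v. affine (b (f (a (Fin v))))) holomorphic_on ball w r" by (rule hol_at_rep[OF hx abP(1) refl abP(2) ne])
   then have "(\<lambda>v. affine (b (f (a (Fin v))))) field_differentiable (at w)"
    by (meson centre_in_ball holomorphic_on_imp_differentiable_at open_ball)
   then show "(\<lambda>v. affine (b (f (a (Fin v))))) field_differentiable (at w within ?S)" using field_differentiable_at_within by blast
  qed
 qed
qed

lemma hol_at_compose:
 assumes "hol_at f x" "hol_at g (f x)" shows "hol_at (\<lambda>y. g (f y)) x"
proof -
 obtain A B F w r where A: "A \<in> PSL2C" "B \<in> PSL2C" "r > 0" "x = A (Fin w)" "F holomorphic_on ball w r"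
  and fA: "\<And>v. v \<in> ball w r \<Longrightarrow> f (A (Fin v)) = B (Fin (F v))" using assms(1) unfolding hol_at_def by blast
 obtain b where b: "b \<in> PSL2C" "b (g (f x)) \<noteq> Infty" "\<And>y. b (b y) = y" using obtain_chart by blast
 have "f x = B (Fin (F w))" using A fA by simp
 then obtain s where s: "s > 0" "(\<lambda>v. affine (b (g (B (Fin v))))) holomorphic_on ball (F w) s"
  and sf: "\<And>v. v \<in> ball (F w) s \<Longrightarrow> b (g (B (Fin v))) \<noteq> Infty" using hol_at_rep[OF assms(2) A(2) _ b(1,2)] by metis
 have "open (ball w r \<inter> F -` ball (F w) s)" by (intro continuous_open_preimage holomorphic_on_imp_continuous_on A) auto
 moreover have "w \<in> ball w r \<inter> F -` ball (F w) s" using A s by auto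
 ultimately obtain t where t: "t > 0" "ball w t \<subseteq> ball w r \<inter> F -` ball (F w) s" by (meson open_contains_ball)
 show ?thesis
 proof (rule hol_atI[OF A(1) b(1) t(1) A(4)])
  show "(\<lambda>v. affine (b (g (B (Fin (F v)))))) holomorphic_on ball w t"
   by (rule holomorphic_on_compose_gen[of F _ "\<lambda>v. affine (b (g (B (Fin v))))" "ball (F w) s", unfolded o_def])
    (use t s A in \<open>auto intro: holomorphic_on_subset\<close>)
  fix v assume "v \<in> ball w t"
  then have v: "v \<in> ball w r" "F v \<in> ball (F w) s" using t by auto
  show "g (f (A (Fin v))) = b (Fin (affine (b (g (B (Fin (F v)))))))" using fA[OF v(1)] sf[OF v(2)] b by (simp add: Fin_affine)
 qed
qed

lemma hol_at_PSL2C: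
 assumes "M \<in> PSL2C" shows "hol_at M x"
proof -
 obtain a where a: "a \<in> PSL2C" "a x \<noteq> Infty" "\<And>y. a (a y) = y" using obtain_chart by blast
 show ?thesis by (rule hol_atI[OF a(1) PSL2C_comp[OF assms a(1)], of 1 _ "affine (a x)" "\<lambda>v. v"])
   (use a in \<open>auto simp: Fin_affine\<close>)
qed

lemma hol_at_Fin:
 assumes "F holomorphic_on S" "open S" "w \<in> S" shows "hol_at (\<lambda>x. Fin (F (affine x))) (Fin w)"
proof -
 obtain r where "r > 0" "ball w r \<subseteq> S" using assms by (meson open_contains_ball)
 then show ?thesis using assms by (intro hol_atI[OF id_PSL2C id_PSL2C, of r _ w F]) (auto intro: holomorphic_on_subset)
qed

lemma holomorphic_sphere_cong:
 assumes "\<And>x. x \<in> U \<Longrightarrow> f x = g x" shows "holomorphic_sphere f U \<longleftrightarrow> holomorphic_sphere g U"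
 unfolding holomorphic_sphere_iff_hol_at using assms by (auto intro: hol_at_cong)

lemma holomorphic_sphere_subset:
 "holomorphic_sphere f U \<Longrightarrow> V \<subseteq> U \<Longrightarrow> open V \<Longrightarrow> holomorphic_sphere f V"
 unfolding holomorphic_sphere_iff_hol_at by blast

lemma holomorphic_sphere_compose:
 "holomorphic_sphere f U \<Longrightarrow> holomorphic_sphere g V \<Longrightarrow> f ` U \<subseteq> V \<Longrightarrow> holomorphic_sphere (\<lambda>x. g (f x)) U"
 unfolding holomorphic_sphere_iff_hol_at using hol_at_compose by blast

lemma holomorphic_sphere_PSL2C: "M \<in> PSL2C \<Longrightarrow> open U \<Longrightarrow> holomorphic_sphere M U"
 unfolding holomorphic_sphere_iff_hol_at using hol_at_PSL2C by blast

lemma holomorphic_sphere_PSL2C_comp: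
 "holomorphic_sphere f U \<Longrightarrow> M \<in> PSL2C \<Longrightarrow> holomorphic_sphere (\<lambda>x. M (f x)) U"
 by (rule holomorphic_sphere_compose[where V = UNIV]) (auto intro: holomorphic_sphere_PSL2C)

lemma holomorphic_sphere_Fin:
 "F holomorphic_on S \<Longrightarrow> open S \<Longrightarrow> holomorphic_sphere (\<lambda>x. Fin (F (affine x))) (Fin ` S)"
 unfolding holomorphic_sphere_iff_hol_at using hol_at_Fin by (auto simp: open_Fin_image_iff)

lemma holomorphic_sphere_planar:
 assumes "holomorphic_sphere f U" "\<And>w. w \<in> S \<Longrightarrow> Fin w \<in> U \<and> f (Fin w) \<noteq> Infty"
 shows "(\<lambda>w. affine (f (Fin w))) holomorphic_on S"
proof -
 have "(\<lambda>w. affine (f (Fin w))) holomorphic_on {w. Fin w \<in> U \<and> f (Fin w) \<noteq> Infty}"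
  using assms(1) unfolding holomorphic_sphere_def by simp
 then show ?thesis by (rule holomorphic_on_subset) (use assms in auto)
qed

lemma holomorphic_sphere_continuous: "holomorphic_sphere f U \<Longrightarrow> continuous_on U f"
 and holomorphic_sphere_open: "holomorphic_sphere f U \<Longrightarrow> open U" by (simp_all add: holomorphic_sphere_def)

section \<open>Discs in the sphere and the identity theorem\<close>

lemma open_sphere_disc:
 assumes "open U" "x \<in> U"
 obtains A w r where "A \<in> PSL2C" "r > 0" "A (Fin w) = x" "A ` Fin ` ball w r \<subseteq> U"
proof -
 obtain a where a: "a \<in> PSL2C" "a x \<noteq> Infty" "\<And>y. a (a y) = y" using obtain_chart by blast
 have "open (Fin -` a -` U)" using assms a by (intro open_Fin_vimage open_vimage_PSL2C)
 moreover have "affine (a x) \<in> Fin -` a -` U" using a assms by (simp add: Fin_affine)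
 ultimately obtain s where "s > 0" "ball (affine (a x)) s \<subseteq> Fin -` a -` U" by (meson open_contains_ball)
 then show ?thesis using a by (intro that[of a s "affine (a x)"]) (auto simp: Fin_affine)
qed

lemma open_sphere_disc_open: "A \<in> PSL2C \<Longrightarrow> open (A ` Fin ` ball w r)" by (simp add: open_image_PSL2C open_Fin_image_iff)

lemma path_connected_sphere_disc: "A \<in> PSL2C \<Longrightarrow> path_connected (A ` Fin ` ball w r)"
 by (intro path_connected_continuous_image continuous_on_PSL2C continuous_on_Fin convex_imp_path_connected) auto

text \<open>The largest open set \<open>T\<close> of agreement also has an open complement in
  \<open>U\<close>: where the values differ they can be separated, and where they agree a disc
  meeting \<open>T\<close> lies in \<open>T\<close> by the planar identity theorem.\<close>

lemma sphere_identity: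
 assumes U: "connected U" and f: "holomorphic_sphere f U" and g: "holomorphic_sphere g U"
  and W: "open W" "W \<noteq> {}" "W \<subseteq> U" "\<And>x. x \<in> W \<Longrightarrow> f x = g x" and y: "y \<in> U" shows "f y = g y"
proof -
 have oU: "open U" using f by (simp add: holomorphic_sphere_def)
 have hf: "\<And>x. x \<in> U \<Longrightarrow> hol_at f x" and hg: "\<And>x. x \<in> U \<Longrightarrow> hol_at g x"
  using f g unfolding holomorphic_sphere_iff_hol_at by auto
 define T where "T = \<Union>{N. open N \<and> N \<subseteq> U \<and> (\<forall>x\<in>N. f x = g x)}"
 have oT: "open T" unfolding T_def by auto
 have Teq: "f x = g x" if "x \<in> T" for x using that by (auto simp: T_def)
 have "W \<subseteq> T" using W by (auto simp: T_def)
 have "\<exists>N. open N \<and> x \<in> N \<and> N \<subseteq> U - T" if x: "x \<in> U - T" for x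
 proof (cases "f x = g x")
  case False
  then obtain V1 V2 where V: "open V1" "open V2" "f x \<in> V1" "g x \<in> V2" "V1 \<inter> V2 = {}" by (metis hausdorff)
  obtain N1 where N1: "open N1" "x \<in> N1" "f ` N1 \<subseteq> V1" using hol_at_continuous[OF hf, of x V1] x V by auto
  obtain N2 where N2: "open N2" "x \<in> N2" "g ` N2 \<subseteq> V2" using hol_at_continuous[OF hg, of x V2] x V by auto
  have "f y \<noteq> g y" if "y \<in> N1 \<inter> N2" for y
  proof -
   have "f y \<in> V1" "g y \<in> V2" using that N1 N2 by auto
   then show ?thesis using V by (metis disjoint_iff)
  qed
  then show ?thesis using N1 N2 x oU Teq by (intro exI[of _ "N1 \<inter> N2 \<inter> U"]) (auto simp: open_Int)
 next
  case True
  obtain A w r0 where A: "A \<in> PSL2C" "r0 > 0" "A (Fin w) = x" "A ` Fin ` ball w r0 \<subseteq> U" using open_sphere_disc[OF oU, of x] x by blast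
  \<comment> \<open>Since \<open>f x = g x\<close>, a single target chart serves both maps.\<close>
  obtain b where b: "b \<in> PSL2C" "b (f x) \<noteq> Infty" "\<And>y. b (b y) = y" using obtain_chart by blast
  obtain r1 where r1: "r1 > 0" "(\<lambda>v. affine (b (f (A (Fin v))))) holomorphic_on ball w r1"
   "\<And>v. v \<in> ball w r1 \<Longrightarrow> b (f (A (Fin v))) \<noteq> Infty" using hol_at_rep[OF hf A(1) A(3)[symmetric] b(1,2)] x by blast
  obtain r2 where r2: "r2 > 0" "(\<lambda>v. affine (b (g (A (Fin v))))) holomorphic_on ball w r2"
   "\<And>v. v \<in> ball w r2 \<Longrightarrow> b (g (A (Fin v))) \<noteq> Infty"
   using hol_at_rep[OF hg A(1) A(3)[symmetric] b(1)] x b True by auto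
  define r where "r = min r0 (min r1 r2)"
  have r: "r > 0" using A r1 r2 by (auto simp: r_def)
  define N where "N = A ` Fin ` ball w r"
  have N: "open N" "x \<in> N" "N \<subseteq> U" using A r open_sphere_disc_open unfolding N_def by (auto simp: r_def)
  have "N \<inter> T = {}"
  proof (rule ccontr)
   assume ne: "N \<inter> T \<noteq> {}"
   define E where "E = ball w r \<inter> (Fin -` A -` T)"
   have oE: "open E" unfolding E_def using oT A by (intro open_Int open_Fin_vimage open_vimage_PSL2C) auto
   obtain e where e: "e \<in> E" using ne unfolding E_def N_def by blast
   have eq: "affine (b (f (A (Fin v)))) = affine (b (g (A (Fin v))))" if v: "v \<in> ball w r" for v
   proof (rule analytic_continuation_open[OF oE, of "ball w r" "\<lambda>v. affine (b (f (A (Fin v))))" "\<lambda>v. affine (b (g (A (Fin v))))"])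
    show "(\<lambda>v. affine (b (f (A (Fin v))))) holomorphic_on ball w r" by (rule holomorphic_on_subset[OF r1(2)]) (auto simp: r_def)
    show "(\<lambda>v. affine (b (g (A (Fin v))))) holomorphic_on ball w r" by (rule holomorphic_on_subset[OF r2(2)]) (auto simp: r_def)
    show "affine (b (f (A (Fin z)))) = affine (b (g (A (Fin z))))" if "z \<in> E" for z using that Teq by (auto simp: E_def)
   qed (use e v in \<open>auto simp: E_def\<close>)
   have "f y = g y" if y: "y \<in> N" for y
   proof -
    obtain v where v: "v \<in> ball w r" "y = A (Fin v)" using y by (auto simp: N_def)
    have "b (f y) \<noteq> Infty" "b (g y) \<noteq> Infty" using v r1 r2 by (auto simp: r_def)
    then have "b (f y) = b (g y)" using eq[OF v(1)] v by (metis Fin_affine)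
    then show ?thesis using b by metis
   qed
   then have "N \<subseteq> T" using N unfolding T_def by auto
   then show False using N x by auto
  qed
  then show ?thesis using N by (intro exI[of _ N]) auto
 qed
 then have "open (U - T)" by (subst open_subopen) blast
 moreover have "U \<subseteq> T \<union> (U - T)" "T \<inter> (U - T) \<inter> U = {}" by auto
 moreover have "T \<inter> U \<noteq> {}" using \<open>W \<subseteq> T\<close> W by auto
 ultimately have "(U - T) \<inter> U = {}" using connectedD[OF U oT] by metis
 then show ?thesis using y Teq by auto
qed

lemma connected_sphere: "connected (UNIV :: riemann_sphere set)"
proof (rule connectedI)
 fix A B :: "riemann_sphere set"
 assume AB: "open A" "open B" "A \<inter> UNIV \<noteq> {}" "B \<inter> UNIV \<noteq> {}" "A \<inter> B \<inter> UNIV = {}" "UNIV \<subseteq> A \<union> B"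
 \<comment> \<open>A disc is uncountable, so a nonempty open set cannot consist of Infty alone;
   connectedness is thus inherited from the plane.\<close>
 have ne: "Fin -` C \<noteq> {}" if C: "open C" "C \<noteq> {}" for C
 proof -
  obtain x where "x \<in> C" using C by auto
  obtain P w r where P: "P \<in> PSL2C" "r > 0" "P ` Fin ` ball w r \<subseteq> C" using open_sphere_disc C \<open>x \<in> C\<close> by metis
  have "inj_on Fin (ball w r)" by (simp add: inj_on_def)
  then have "infinite (P ` Fin ` ball w r)" using P uncountable_ball[of r w] by (metis PSL2C_inj countable_finite finite_image_iff)
  then have "\<not> P ` Fin ` ball w r \<subseteq> {Infty}" by (meson finite.emptyI finite.insertI finite_subset)
  then obtain y where "y \<in> C" "y \<noteq> Infty" using P by blast
  then show ?thesis by (cases y) auto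
 qed
 have "connected (UNIV :: complex set)" by (rule convex_connected) auto
 moreover have "open (Fin -` A)" "open (Fin -` B)" using AB by (auto intro: open_Fin_vimage)
 moreover have "Fin -` A \<inter> Fin -` B \<inter> UNIV = {}" "UNIV \<subseteq> Fin -` A \<union> Fin -` B" using AB by auto
 ultimately show False using connectedD[of UNIV "Fin -` A" "Fin -` B"] AB ne[of A] ne[of B] by simp
qed

lemma PSL2C_eqI:
 assumes "A \<in> PSL2C" "B \<in> PSL2C" "open W" "W \<noteq> {}" "\<And>x. x \<in> W \<Longrightarrow> A x = B x" shows "A = B"
 using sphere_identity[OF connected_sphere holomorphic_sphere_PSL2C holomorphic_sphere_PSL2C, of A B W] assms by auto

text \<open>In charts the map is an injective planar function \<open>u\<close>; its image is open,
  and its holomorphic inverse \<open>t\<close> represents the inverse of \<open>f\<close>.\<close>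

lemma inj_holomorphic_sphere_inverse:
 assumes f: "holomorphic_sphere f U" and inj: "inj_on f U" shows "open (f ` U)" "holomorphic_sphere (inv_into U f) (f ` U)"
proof -
 have oU: "open U" and hf: "\<And>x. x \<in> U \<Longrightarrow> hol_at f x" using f unfolding holomorphic_sphere_iff_hol_at by auto
 have *: "\<exists>N. open N \<and> f x \<in> N \<and> N \<subseteq> f ` U \<and> hol_at (inv_into U f) (f x)" if x: "x \<in> U" for x
 proof -
  obtain A w r0 where A: "A \<in> PSL2C" "r0 > 0" "A (Fin w) = x" "A ` Fin ` ball w r0 \<subseteq> U" using open_sphere_disc[OF oU, of x] x by blast
  obtain b where b: "b \<in> PSL2C" "b (f x) \<noteq> Infty" "\<And>y. b (b y) = y" using obtain_chart by blast
  define u where "u v = affine (b (f (A (Fin v))))" for v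
  obtain r1 where r1: "r1 > 0" "u holomorphic_on ball w r1" "\<And>v. v \<in> ball w r1 \<Longrightarrow> b (f (A (Fin v))) \<noteq> Infty"
   using hol_at_rep[OF hf A(1) A(3)[symmetric] b(1,2)] x unfolding u_def by blast
  define r where "r = min r0 r1"
  have r: "r > 0" using A r1 by (auto simp: r_def)
  have AU: "A (Fin v) \<in> U" if "v \<in> ball w r" for v using that A by (auto simp: r_def)
  have bu: "b (Fin (u v)) = f (A (Fin v))" if "v \<in> ball w r" for v using that r1 b by (auto simp: u_def r_def Fin_affine)
  have holu: "u holomorphic_on ball w r" by (rule holomorphic_on_subset[OF r1(2)]) (auto simp: r_def)
  have inju: "inj_on u (ball w r)"
  proof (rule inj_onI)
   fix v v' assume v: "v \<in> ball w r" "v' \<in> ball w r" "u v = u v'"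
   then have "f (A (Fin v)) = f (A (Fin v'))" using bu by metis
   then have "A (Fin v) = A (Fin v')" using inj AU v by (meson inj_onD)
   then show "v = v'" using PSL2C_inj[OF A(1), of UNIV] by (auto dest: injD)
  qed
  obtain t where t: "t holomorphic_on u ` ball w r" "\<And>v. v \<in> ball w r \<Longrightarrow> t (u v) = v"
   using holomorphic_has_inverse[OF holu _ inju] by (metis open_ball)
  have ou: "open (u ` ball w r)" using open_mapping_thm3[OF holu _ inju] by auto
  define N where "N = b ` Fin ` u ` ball w r"
  have N: "open N" "f x \<in> N" "N \<subseteq> f ` U"
  proof -
   show "open N" unfolding N_def using ou b by (simp add: open_image_PSL2C open_Fin_image_iff)
   have "f x = b (Fin (u w))" using bu[of w] r A by simp
   then show "f x \<in> N" unfolding N_def using r by simp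
   show "N \<subseteq> f ` U" unfolding N_def
   proof safe
    fix v assume "v \<in> ball w r"
    then show "b (Fin (u v)) \<in> f ` U" using bu AU by (metis imageI)
   qed
  qed
  have "u w \<in> u ` ball w r" using r by auto
  then obtain s where s: "s > 0" "ball (u w) s \<subseteq> u ` ball w r" using ou by (meson open_contains_ball)
  have "hol_at (inv_into U f) (f x)"
  proof (rule hol_atI[OF b(1) A(1) s(1)])
   show "f x = b (Fin (u w))" using bu[of w] r A by simp
   show "t holomorphic_on ball (u w) s" using t s holomorphic_on_subset by blast
   fix v assume "v \<in> ball (u w) s"
   then obtain v' where v': "v' \<in> ball w r" "v = u v'" using s by blast
   then show "inv_into U f (b (Fin v)) = A (Fin (t v))" using bu[OF v'(1)] t inj AU by (simp add: inv_into_f_f)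
  qed
  then show ?thesis using N by blast
 qed
 show o: "open (f ` U)" by (subst open_subopen) (use * in auto)
 show "holomorphic_sphere (inv_into U f) (f ` U)" unfolding holomorphic_sphere_iff_hol_at using o * by auto
qed

lemma conformal_map_inverse:
 assumes "conformal_map f U V" shows "open U" "open V" "conformal_map (inv_into U f) V U"
 using assms inj_holomorphic_sphere_inverse[of f U] bij_betw_inv_into[of f U V] by (auto simp: conformal_simps holomorphic_sphere_def)

lemma conformal_map_compose:
 "conformal_map f U V \<Longrightarrow> conformal_map g V W \<Longrightarrow> conformal_map (\<lambda>x. g (f x)) U W"
 unfolding conformal_map_def using bij_betw_trans[of f U V g W] by (auto simp: o_def bij_betw_def intro: holomorphic_sphere_compose)

lemma conformal_map_subset:
 assumes "conformal_map f U V" "U' \<subseteq> U" "open U'" shows "conformal_map f U' (f ` U')"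
 using assms by (auto simp: conformal_simps intro: holomorphic_sphere_subset inj_on_subset)

lemma open_image_inj_holomorphic:
 assumes "holomorphic_sphere f U" "inj_on f U" "W \<subseteq> U" "open W" shows "open (f ` W)" using inj_holomorphic_sphere_inverse(1)[of f W] assms
 by (meson holomorphic_sphere_subset inj_on_subset)

section \<open>Monodromy\<close>

text \<open>Two constant loops are freely homotopic, and the track of the base point under the
  homotopy is a path between them.\<close>

lemma simply_connected_imp_path_connected':
 fixes X :: "'a::topological_space set"
 assumes "simply_connected X" shows "path_connected X" unfolding path_connected_def
proof (intro ballI)
 fix x y assume xy: "x \<in> X" "y \<in> X"
 have "homotopic_loops X (\<lambda>t. x) (\<lambda>t. y)"
  using assms[unfolded simply_connected_def, rule_format, of "\<lambda>t. x" "\<lambda>t. y"] xy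
  by (auto simp: path_def pathfinish_def pathstart_def path_image_def)
 then obtain h where h: "continuous_on ({0..1::real} \<times> {0..1::real}) h" "h ` ({0..1} \<times> {0..1}) \<subseteq> X"
  "\<forall>t\<in>{0..1}. h (0, t) = x" "\<forall>t\<in>{0..1}. h (1, t) = y" unfolding homotopic_loops by auto
 have "continuous_on {0..1} (\<lambda>r. h (r, 0))" by (rule continuous_on_compose2[OF h(1)]) (auto intro!: continuous_intros)
 then show "\<exists>g. path g \<and> path_image g \<subseteq> X \<and> pathstart g = x \<and> pathfinish g = y"
  using h(2-4) by (intro exI[of _ "\<lambda>r. h (r, 0)"])
   (auto simp: path_def pathfinish_def pathstart_def path_image_def)
qed

text \<open>A locally constant family of fibres \<open>E\<close> over \<open>X\<close>: over each \<open>V x\<close> it is trivialised by the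
 sections \<open>\<sigma> x i\<close>.\<close>

locale local_sections =
 fixes X :: "'a::topological_space set" and V :: "'a \<Rightarrow> 'a set" and I :: "'a \<Rightarrow> 'i set"
  and E :: "'a \<Rightarrow> 'b set" and \<sigma> :: "'a \<Rightarrow> 'i \<Rightarrow> 'a \<Rightarrow> 'b"
 assumes openin_V: "x \<in> X \<Longrightarrow> open_in X (V x)" and in_V: "x \<in> X \<Longrightarrow> x \<in> V x"
  and path_connected_V: "x \<in> X \<Longrightarrow> path_connected (V x)"
  and bij_\<sigma>: "x \<in> X \<Longrightarrow> y \<in> V x \<Longrightarrow> bij_betw (\<lambda>i. \<sigma> x i y) (I x) (E y)"
  and compat_\<sigma>: "\<lbrakk>x \<in> X; x' \<in> X; u \<in> V x; u \<in> V x'; i \<in> I x; i' \<in> I x'; \<sigma> x i u = \<sigma> x' i' u\<rbrakk> \<Longrightarrow>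
   \<exists>N. open_in X N \<and> u \<in> N \<and> (\<forall>y\<in>N \<inter> V x \<inter> V x'. \<sigma> x i y = \<sigma> x' i' y)"
begin

text \<open>The fibres carry no topology. Continuity of a lift is replaced by being given, near each
  parameter, by one section with a fixed index.\<close>

definition lift :: "'k::topological_space set \<Rightarrow> ('k \<Rightarrow> 'a) \<Rightarrow> ('k \<Rightarrow> 'b) \<Rightarrow> bool" where
 "lift K c s \<longleftrightarrow> (\<forall>t\<in>K. \<exists>x\<in>X. \<exists>i\<in>I x. \<exists>N. open_in K N \<and> t \<in> N \<and>
   (\<forall>t'\<in>N. c t' \<in> V x \<and> s t' = \<sigma> x i (c t')))"

lemma V_subset: "x \<in> X \<Longrightarrow> V x \<subseteq> X" using openin_V openin_imp_subset by blast

lemma \<sigma>_in_E: "x \<in> X \<Longrightarrow> y \<in> V x \<Longrightarrow> i \<in> I x \<Longrightarrow> \<sigma> x i y \<in> E y"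
 using bij_\<sigma> bij_betwE by fast

lemma \<sigma>_surj: "x \<in> X \<Longrightarrow> y \<in> V x \<Longrightarrow> b \<in> E y \<Longrightarrow> \<exists>i\<in>I x. \<sigma> x i y = b"
 using bij_\<sigma> unfolding bij_betw_def by (metis imageE)

lemma \<sigma>_inj: "x \<in> X \<Longrightarrow> y \<in> V x \<Longrightarrow> i \<in> I x \<Longrightarrow> j \<in> I x \<Longrightarrow> \<sigma> x i y = \<sigma> x j y \<longleftrightarrow> i = j"
 using bij_\<sigma> unfolding bij_betw_def inj_on_def by blast

lemma liftE:
 assumes "lift K c s" "t \<in> K"
 obtains x i N where "x \<in> X" "i \<in> I x" "open_in K N" "t \<in> N"
  "\<And>t'. t' \<in> N \<Longrightarrow> c t' \<in> V x" "\<And>t'. t' \<in> N \<Longrightarrow> s t' = \<sigma> x i (c t')"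
proof -
 obtain x i N where "x \<in> X" "i \<in> I x" "open_in K N" "t \<in> N" "\<forall>t'\<in>N. c t' \<in> V x \<and> s t' = \<sigma> x i (c t')"
  using bspec[OF assms(1)[unfolded lift_def] assms(2)] by (elim bexE exE conjE)
 then show ?thesis using that by simp
qed

lemma lift_in_E: "lift K c s \<Longrightarrow> t \<in> K \<Longrightarrow> s t \<in> E (c t)" by (metis liftE \<sigma>_in_E)

lemma lift_const:
 assumes "x \<in> X" "i \<in> I x" "c ` K \<subseteq> V x" shows "lift K c (\<lambda>t. \<sigma> x i (c t))" unfolding lift_def
proof
 fix t assume "t \<in> K"
 then show "\<exists>y\<in>X. \<exists>j\<in>I y. \<exists>N. open_in K N \<and> t \<in> N \<and> (\<forall>t'\<in>N. c t' \<in> V y \<and> \<sigma> x i (c t') = \<sigma> y j (c t'))"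
  using assms by (intro bexI[of _ x] bexI[of _ i] exI[of _ K]) auto
qed

lemma lift_compose:
 assumes s: "lift K c s" and f: "continuous_on K' f" "f ` K' \<subseteq> K" and eq: "\<And>t. t \<in> K' \<Longrightarrow> c' t = c (f t)"
  and eq': "\<And>t. t \<in> K' \<Longrightarrow> s' t = s (f t)" shows "lift K' c' s'" unfolding lift_def
proof
 fix t assume t: "t \<in> K'"
 then have ft: "f t \<in> K" using f by auto
 obtain x i N where N: "x \<in> X" "i \<in> I x" "open_in K N" "f t \<in> N"
  "\<And>t'. t' \<in> N \<Longrightarrow> c t' \<in> V x" "\<And>t'. t' \<in> N \<Longrightarrow> s t' = \<sigma> x i (c t')" by (rule liftE[OF s ft]) (rule that)
 have "open_in K' (K' \<inter> f -` N)" using continuous_openin_preimage[OF f(1) _ N(3)] f(2) by (simp add: image_subset_iff_funcset)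
 then show "\<exists>x\<in>X. \<exists>i\<in>I x. \<exists>N. open_in K' N \<and> t \<in> N \<and> (\<forall>t'\<in>N. c' t' \<in> V x \<and> s' t' = \<sigma> x i (c' t'))"
  using N t eq eq' by (intro bexI[of _ x] bexI[of _ i] exI[of _ "K' \<inter> f -` N"]) auto
qed

lemma lift_subset: "lift K c s \<Longrightarrow> K' \<subseteq> K \<Longrightarrow> lift K' c s"
 by (rule lift_compose[of K c s K' "\<lambda>x. x"]) auto

text \<open>Both lifts can be written near \<open>t\<close> with sections of the same
  trivialisation, where distinct indices never agree; so agreement of two lifts is both an open and
  a closed condition.\<close>

lemma lift_agree_locally:
 assumes c: "continuous_on K c" "c ` K \<subseteq> X" and s: "lift K c s" and s': "lift K c s'" and t: "t \<in> K"
 obtains N where "open_in K N" "t \<in> N" "\<And>t'. t' \<in> N \<Longrightarrow> s t' = s' t' \<longleftrightarrow> s t = s' t"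
proof -
 obtain x i N where N: "x \<in> X" "i \<in> I x" "open_in K N" "t \<in> N"
  "\<And>t'. t' \<in> N \<Longrightarrow> c t' \<in> V x" "\<And>t'. t' \<in> N \<Longrightarrow> s t' = \<sigma> x i (c t')" by (rule liftE[OF s t]) (rule that)
 obtain x' i' N' where N': "x' \<in> X" "i' \<in> I x'" "open_in K N'" "t \<in> N'"
  "\<And>t'. t' \<in> N' \<Longrightarrow> c t' \<in> V x'" "\<And>t'. t' \<in> N' \<Longrightarrow> s' t' = \<sigma> x' i' (c t')" by (rule liftE[OF s' t]) (rule that)
 have "\<sigma> x' i' (c t) \<in> E (c t)" using N' \<sigma>_in_E by blast
 then obtain j where j: "j \<in> I x" "\<sigma> x j (c t) = \<sigma> x' i' (c t)" using \<sigma>_surj N by metis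
 obtain M where M: "open_in X M" "c t \<in> M" "\<forall>y\<in>M \<inter> V x \<inter> V x'. \<sigma> x j y = \<sigma> x' i' y"
  using compat_\<sigma>[OF N(1) N'(1) _ _ j(1) N'(2) j(2)] N N' by auto
 show ?thesis
 proof (rule that)
  have "open_in K (K \<inter> c -` M)" using continuous_openin_preimage[OF c(1) _ M(1)] c(2) by (simp add: image_subset_iff_funcset)
  then show "open_in K (N \<inter> N' \<inter> (K \<inter> c -` M))" using N N' by (blast intro: openin_Int)
  have *: "s t' = s' t' \<longleftrightarrow> i = j" if "t' \<in> N \<inter> N' \<inter> (K \<inter> c -` M)" for t'
   using that N(1,2,5,6) N'(5,6) M(3) \<sigma>_inj[OF N(1) _ N(2) j(1), of "c t'"] by (metis IntD1 IntD2 IntI vimageD)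
  have t3: "t \<in> N \<inter> N' \<inter> (K \<inter> c -` M)" using N N' M t by auto
  show "t \<in> N \<inter> N' \<inter> (K \<inter> c -` M)" by fact
  show "s t' = s' t' \<longleftrightarrow> s t = s' t" if "t' \<in> N \<inter> N' \<inter> (K \<inter> c -` M)" for t'
   using *[OF that] *[OF t3] by simp
 qed
qed

lemma lift_unique:
 assumes K: "connected K" and c: "continuous_on K c" "c ` K \<subseteq> X" and s: "lift K c s" and s': "lift K c s'"
  and t0: "t0 \<in> K" "s t0 = s' t0" and t: "t \<in> K" shows "s t = s' t"
proof -
 let ?A = "{t \<in> K. s t = s' t}"
 have "open_in K ?A"
 proof (subst openin_subopen, intro ballI)
  fix t assume t: "t \<in> ?A"
  then obtain N where "open_in K N" "t \<in> N" "\<And>t'. t' \<in> N \<Longrightarrow> s t' = s' t' \<longleftrightarrow> s t = s' t"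
   using lift_agree_locally[OF c s s'] by blast
  moreover from this(1) have "N \<subseteq> K" by (rule openin_imp_subset)
  ultimately show "\<exists>T. open_in K T \<and> t \<in> T \<and> T \<subseteq> ?A" using t by (intro exI[of _ N] conjI) blast+
 qed
 moreover have "open_in K (K - ?A)"
 proof (subst openin_subopen, intro ballI)
  fix t assume t: "t \<in> K - ?A"
  then obtain N where "open_in K N" "t \<in> N" "\<And>t'. t' \<in> N \<Longrightarrow> s t' = s' t' \<longleftrightarrow> s t = s' t"
   using lift_agree_locally[OF c s s'] by blast
  moreover from this(1) have "N \<subseteq> K" by (rule openin_imp_subset)
  ultimately show "\<exists>T. open_in K T \<and> t \<in> T \<and> T \<subseteq> K - ?A" using t by (intro exI[of _ N] conjI) blast+
 qed
 ultimately have "?A = {} \<or> ?A = K" using K[unfolded connected_clopen, rule_format, of ?A] by (auto simp: closedin_def)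
 then show ?thesis using t0 t by auto
qed

lemma lift_union:
 assumes K: "closed K1" "closed K2" and c: "continuous_on (K1 \<union> K2) c" "c ` (K1 \<union> K2) \<subseteq> X"
  and s1: "lift K1 c s1" and s2: "lift K2 c s2" and eq: "\<And>t. t \<in> K1 \<inter> K2 \<Longrightarrow> s1 t = s2 t"
 shows "lift (K1 \<union> K2) c (\<lambda>t. if t \<in> K1 then s1 t else s2 t)" (is "lift _ _ ?s") unfolding lift_def
proof
 fix t assume t: "t \<in> K1 \<union> K2"
 let ?P = "\<exists>x\<in>X. \<exists>i\<in>I x. \<exists>N. open_in (K1 \<union> K2) N \<and> t \<in> N \<and> (\<forall>t'\<in>N. c t' \<in> V x \<and> ?s t' = \<sigma> x i (c t'))"
 consider "t \<in> K1 - K2" | "t \<in> K2 - K1" | "t \<in> K1 \<inter> K2" using t by auto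
 then show ?P
 proof cases
  case 1
  obtain x i N where N: "x \<in> X" "i \<in> I x" "open_in K1 N" "t \<in> N"
   "\<And>t'. t' \<in> N \<Longrightarrow> c t' \<in> V x" "\<And>t'. t' \<in> N \<Longrightarrow> s1 t' = \<sigma> x i (c t')" by (rule liftE[OF s1 DiffD1[OF 1]]) (rule that)
  obtain T where T: "open T" "N = K1 \<inter> T" using N(3) by (auto simp: openin_open)
  \<comment> \<open>Removing the closed set \<open>K2\<close> leaves a relatively open set on which
    the first lift alone decides.\<close>
  have "(K1 \<union> K2) \<inter> (T \<inter> - K2) \<subseteq> N" using T by auto
  then show ?P
   using N T 1 K by (intro bexI[of _ x] bexI[of _ i] exI[of _ "(K1 \<union> K2) \<inter> (T \<inter> - K2)"] conjI ballI openin_open_Int)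
    (auto simp: open_Int open_Compl)
 next
  case 2
  obtain x i N where N: "x \<in> X" "i \<in> I x" "open_in K2 N" "t \<in> N"
   "\<And>t'. t' \<in> N \<Longrightarrow> c t' \<in> V x" "\<And>t'. t' \<in> N \<Longrightarrow> s2 t' = \<sigma> x i (c t')" by (rule liftE[OF s2 DiffD1[OF 2]]) (rule that)
  obtain T where T: "open T" "N = K2 \<inter> T" using N(3) by (auto simp: openin_open)
  have "(K1 \<union> K2) \<inter> (T \<inter> - K1) \<subseteq> N" using T by auto
  then show ?P
   using N T 2 K by (intro bexI[of _ x] bexI[of _ i] exI[of _ "(K1 \<union> K2) \<inter> (T \<inter> - K1)"] conjI ballI openin_open_Int)
    (auto simp: open_Int open_Compl)
 next
  case 3
  obtain x i N where N: "x \<in> X" "i \<in> I x" "open_in K1 N" "t \<in> N"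
   "\<And>t'. t' \<in> N \<Longrightarrow> c t' \<in> V x" "\<And>t'. t' \<in> N \<Longrightarrow> s1 t' = \<sigma> x i (c t')" by (rule liftE[OF s1 IntD1[OF 3]]) (rule that)
  obtain x' i' N' where N': "x' \<in> X" "i' \<in> I x'" "open_in K2 N'" "t \<in> N'"
   "\<And>t'. t' \<in> N' \<Longrightarrow> c t' \<in> V x'" "\<And>t'. t' \<in> N' \<Longrightarrow> s2 t' = \<sigma> x' i' (c t')" by (rule liftE[OF s2 IntD2[OF 3]]) (rule that)
  have eqt: "\<sigma> x i (c t) = \<sigma> x' i' (c t)" using eq[OF 3] N(4,6) N'(4,6) by metis
  obtain M where M: "open_in X M" "c t \<in> M" "\<forall>y\<in>M \<inter> V x \<inter> V x'. \<sigma> x i y = \<sigma> x' i' y"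
   using compat_\<sigma>[OF N(1) N'(1) _ _ N(2) N'(2) eqt] N N' by auto
  obtain T where T: "open T" "N = K1 \<inter> T" using N(3) by (auto simp: openin_open)
  obtain T' where T': "open T'" "N' = K2 \<inter> T'" using N'(3) by (auto simp: openin_open)
  define L where "L = (K1 \<union> K2) \<inter> c -` (M \<inter> V x)"
  have oL: "open_in (K1 \<union> K2) L" unfolding L_def using continuous_openin_preimage[OF c(1) _ openin_Int[OF M(1) openin_V[OF N(1)]]] c(2)
   by (simp add: image_subset_iff_funcset)
  define J where "J = L \<inter> ((K1 \<union> K2) \<inter> (T \<inter> T'))"
  have "open_in (K1 \<union> K2) J" unfolding J_def using oL T T' by (intro openin_Int openin_open_Int) auto
  moreover have "t \<in> J" using N N' M T T' 3 by (auto simp: J_def L_def)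
  moreover have "c t' \<in> V x \<and> ?s t' = \<sigma> x i (c t')" if t': "t' \<in> J" for t'
  proof
   have cM: "c t' \<in> M" "c t' \<in> V x" using t' by (auto simp: J_def L_def)
   then show "c t' \<in> V x" by simp
   show "?s t' = \<sigma> x i (c t')"
   proof (cases "t' \<in> K1")
    case True
    then have "t' \<in> N" using t' T by (auto simp: J_def)
    then show ?thesis using N(6) True by simp
   next
    case False
    then have "t' \<in> N'" using t' T' by (auto simp: J_def)
    then have "s2 t' = \<sigma> x' i' (c t')" "c t' \<in> V x'" using N'(5,6) by auto
    then show ?thesis using False cM M(3) by auto
   qed
  qed
  ultimately show ?P using N(1,2) by (intro bexI[of _ x] bexI[of _ i] exI[of _ J]) auto
 qed
qed

text \<open>Any value may be prescribed at any point, not only at a base point. This lets a lift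
  pass from one piece to the next through a connected overlap, where uniqueness glues the
  two.\<close>

definition liftable :: "'k::topological_space set \<Rightarrow> ('k \<Rightarrow> 'a) \<Rightarrow> bool" where
 "liftable K c \<longleftrightarrow> (\<forall>t\<in>K. \<forall>b\<in>E (c t). \<exists>s. lift K c s \<and> s t = b)"

lemma liftable_subset: "liftable K c \<Longrightarrow> K' \<subseteq> K \<Longrightarrow> liftable K' c"
 unfolding liftable_def by (meson lift_subset subsetD)

lemma liftable_local:
 assumes "x \<in> X" "c ` K \<subseteq> V x" shows "liftable K c" unfolding liftable_def
proof (intro ballI)
 fix t b assume "t \<in> K" "b \<in> E (c t)"
 then obtain i where "i \<in> I x" "\<sigma> x i (c t) = b" using \<sigma>_surj assms by (metis imageI subsetD)
 then show "\<exists>s. lift K c s \<and> s t = b" using lift_const[OF assms(1) _ assms(2)] by blast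
qed

lemma liftable_union:
 assumes K: "closed K1" "closed K2" "connected (K1 \<inter> K2)" "K1 \<inter> K2 \<noteq> {}"
  and c: "continuous_on (K1 \<union> K2) c" "c ` (K1 \<union> K2) \<subseteq> X" and L: "liftable K1 c" "liftable K2 c"
 shows "liftable (K1 \<union> K2) c"
proof -
 have *: "\<exists>s. lift (K1 \<union> K2) c s \<and> s t = b"
  if K: "closed K1" "closed K2" "connected (K1 \<inter> K2)" "K1 \<inter> K2 \<noteq> {}"
  and c: "continuous_on (K1 \<union> K2) c" "c ` (K1 \<union> K2) \<subseteq> X" and L: "liftable K1 c" "liftable K2 c"
  and t: "t \<in> K1" "b \<in> E (c t)" for K1 K2 :: "'c set" and t b
 proof -
  obtain s1 where s1: "lift K1 c s1" "s1 t = b" using L t unfolding liftable_def by blast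
  obtain u where u: "u \<in> K1" "u \<in> K2" using K by auto
  then have "s1 u \<in> E (c u)" using lift_in_E s1 by blast
  then obtain s2 where s2: "lift K2 c s2" "s2 u = s1 u" using L u unfolding liftable_def by blast
  have cI: "continuous_on (K1 \<inter> K2) c" by (rule continuous_on_subset[OF c(1)]) auto
  have cX: "c ` (K1 \<inter> K2) \<subseteq> X" using c by auto
  have l1: "lift (K1 \<inter> K2) c s1" by (rule lift_subset[OF s1(1)]) auto
  have l2: "lift (K1 \<inter> K2) c s2" by (rule lift_subset[OF s2(1)]) auto
  have "s1 v = s2 v" if "v \<in> K1 \<inter> K2" for v by (rule lift_unique[OF K(3) cI cX l1 l2 _ s2(2)[symmetric] that]) (use u in auto)
  then have "lift (K1 \<union> K2) c (\<lambda>t. if t \<in> K1 then s1 t else s2 t)" using lift_union[OF K(1,2) c s1(1) s2(1)] by blast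
  then show ?thesis using t s1 by (intro exI[of _ "\<lambda>t. if t \<in> K1 then s1 t else s2 t"]) auto
 qed
 show ?thesis unfolding liftable_def
 proof (intro ballI)
  fix t b assume "t \<in> K1 \<union> K2" and b: "b \<in> E (c t)"
  then consider "t \<in> K1" | "t \<in> K2" by auto
  then show "\<exists>s. lift (K1 \<union> K2) c s \<and> s t = b"
  proof cases
   case 1 then show ?thesis using *[of K1 K2 t b] K c L b by blast
  next
   case 2 then show ?thesis using *[of K2 K1 t b] K c L b by (simp add: Un_commute Int_commute)
  qed
 qed
qed

text \<open>Two bisections: one along the second coordinate lifts over thin strips
  \<open>J \<times> {0..1}\<close>, one along the first coordinate joins the strips. The overlaps
  are products of an interval with a point, hence connected.\<close>

lemma liftable_square:
 fixes c :: "real \<times> real \<Rightarrow> 'a"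
 assumes c: "continuous_on ({0..1} \<times> {0..1}) c" "c ` ({0..1} \<times> {0..1}) \<subseteq> X" shows "liftable ({0..1} \<times> {0..1}) c"
proof -
 have sub: "continuous_on K c \<and> c ` K \<subseteq> X" if "K \<subseteq> {0..1} \<times> {0..1}" for K
  using c that by (auto intro: continuous_on_subset)
 have strip: "\<exists>d>0. liftable (({s - d..s + d} \<inter> {0..1}) \<times> {0..1}) c" if s: "s \<in> {0..1}" for s
 proof -
  define P where "P a b \<longleftrightarrow> (0 \<le> a \<longrightarrow> b \<le> 1 \<longrightarrow> (\<exists>d>0. liftable (({s - d..s + d} \<inter> {0..1}) \<times> {a..b}) c))"
   for a b
  have "P 0 1"
  proof (rule Bolzano)
   fix a b c' :: real assume P: "P a b" "P b c'" and le: "a \<le> b" "b \<le> c'"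
   show "P a c'" unfolding P_def
   proof (intro impI)
    assume bd: "0 \<le> a" "c' \<le> 1"
    obtain d1 where d1: "d1 > 0" "liftable (({s - d1..s + d1} \<inter> {0..1}) \<times> {a..b}) c" using P(1) bd le unfolding P_def by auto
    obtain d2 where d2: "d2 > 0" "liftable (({s - d2..s + d2} \<inter> {0..1}) \<times> {b..c'}) c" using P(2) bd le unfolding P_def by auto
    define d where "d = min d1 d2"
    define J where "J = {s - d..s + d} \<inter> {0..1}"
    have sJ: "s \<in> J" using s d1 d2 by (auto simp: J_def d_def)
    have J: "connected J" "closed J" unfolding J_def by (auto intro!: convex_connected convex_Int)
    have L1: "liftable (J \<times> {a..b}) c" by (rule liftable_subset[OF d1(2)]) (auto simp: J_def d_def)
    have L2: "liftable (J \<times> {b..c'}) c" by (rule liftable_subset[OF d2(2)]) (auto simp: J_def d_def)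
    have U: "J \<times> {a..b} \<union> J \<times> {b..c'} = J \<times> {a..c'}" using le by auto
    have I: "J \<times> {a..b} \<inter> J \<times> {b..c'} = J \<times> {b}" using le by auto
    have sq: "J \<times> {a..c'} \<subseteq> {0..1} \<times> {0..1}" using bd by (auto simp: J_def)
    have "liftable (J \<times> {a..b} \<union> J \<times> {b..c'}) c"
    proof (rule liftable_union[OF _ _ _ _ _ _ L1 L2])
     show "continuous_on (J \<times> {a..b} \<union> J \<times> {b..c'}) c" "c ` (J \<times> {a..b} \<union> J \<times> {b..c'}) \<subseteq> X"
      unfolding U using sub[OF sq] by auto
     show "connected (J \<times> {a..b} \<inter> J \<times> {b..c'})" "J \<times> {a..b} \<inter> J \<times> {b..c'} \<noteq> {}"
      unfolding I using sJ J by (auto intro: connected_Times)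
    qed (use J in \<open>auto intro: closed_Times\<close>)
    then have "liftable (J \<times> {a..c'}) c" unfolding U .
    moreover have "d > 0" using d1 d2 by (simp add: d_def)
    ultimately show "\<exists>d>0. liftable (({s - d..s + d} \<inter> {0..1}) \<times> {a..c'}) c" unfolding J_def by blast
   qed
  next
   fix t :: real assume t: "0 \<le> t" "t \<le> 1"
   have st: "(s, t) \<in> {0..1} \<times> {0..1}" using s t by auto
   then have cX: "c (s, t) \<in> X" using c by auto
   have "open_in ({0..1} \<times> {0..1}) (({0..1} \<times> {0..1}) \<inter> c -` V (c (s, t)))"
    using continuous_openin_preimage[OF c(1) _ openin_V[OF cX]] c(2) by (simp add: image_subset_iff_funcset)
   then have "\<exists>e>0. \<forall>u\<in>{0..1} \<times> {0..1}. dist u (s, t) < e \<longrightarrow> u \<in> ({0..1} \<times> {0..1}) \<inter> c -` V (c (s, t))"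
    by (intro bspec[OF conjunct2[OF iffD1[OF openin_euclidean_subtopology_iff]]]) (use st in_V[OF cX] in auto)
   then obtain e where e: "e > 0" "\<And>u. u \<in> {0..1} \<times> {0..1} \<Longrightarrow> dist u (s, t) < e \<Longrightarrow> c u \<in> V (c (s, t))"
    by auto
   \<comment> \<open>In the small rectangle the coordinates differ from \<open>(s, t)\<close> by at
     most \<open>e/3\<close> and by less than \<open>e/2\<close>, which adds up to less than
     \<open>e\<close>.\<close>
   show "\<exists>d>0. \<forall>a b. a \<le> t \<and> t \<le> b \<and> b - a < d \<longrightarrow> P a b"
   proof (intro exI[of _ "e/2"] conjI allI impI)
    show "e / 2 > 0" using e by simp
    fix a b assume ab: "a \<le> t \<and> t \<le> b \<and> b - a < e / 2"
    show "P a b" unfolding P_def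
    proof (intro impI exI[of _ "e/3"] conjI)
     assume bd: "0 \<le> a" "b \<le> 1"
     show "liftable (({s - e/3..s + e/3} \<inter> {0..1}) \<times> {a..b}) c"
     proof (rule liftable_local[OF cX], safe)
      fix s' t' assume st': "s' \<in> {s - e/3..s + e/3}" "s' \<in> {0..1}" "t' \<in> {a..b}"
      have "dist (s', t') (s, t) \<le> \<bar>s' - s\<bar> + \<bar>t' - t\<bar>"
       unfolding dist_prod_def by (simp add: dist_real_def sqrt_sum_squares_le_sum_abs)
      also have "\<dots> < e" using st' ab by auto
      finally show "c (s', t') \<in> V (c (s, t))" using e(2) st' bd by auto
     qed
    qed (use e in auto)
   qed
  qed auto
  then show ?thesis by (auto simp: P_def)
 qed
 define Q where "Q a b \<longleftrightarrow> (0 \<le> a \<longrightarrow> b \<le> 1 \<longrightarrow> liftable ({a..b} \<times> {0..1}) c)" for a b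
 have "Q 0 1"
 proof (rule Bolzano)
  fix a b c' :: real assume Q: "Q a b" "Q b c'" and le: "a \<le> b" "b \<le> c'"
  show "Q a c'" unfolding Q_def
  proof (intro impI)
   assume bd: "0 \<le> a" "c' \<le> 1"
   have U: "{a..b} \<times> {0..1} \<union> {b..c'} \<times> {0..1} = {a..c'} \<times> {0..1::real}" using le by auto
   have I: "{a..b} \<times> {0..1} \<inter> {b..c'} \<times> {0..1} = {b} \<times> {0..1::real}" using le by auto
   have sq: "{a..c'} \<times> {0..1} \<subseteq> {0..1} \<times> {0..1::real}" using bd by auto
   have "liftable ({a..b} \<times> {0..1} \<union> {b..c'} \<times> {0..1}) c"
   proof (rule liftable_union)
    show "continuous_on ({a..b} \<times> {0..1} \<union> {b..c'} \<times> {0..1}) c" "c ` ({a..b} \<times> {0..1} \<union> {b..c'} \<times> {0..1}) \<subseteq> X"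
     unfolding U using sub[OF sq] by auto
    show "connected ({a..b} \<times> {0..1} \<inter> {b..c'} \<times> {0..1::real})" "{a..b} \<times> {0..1} \<inter> {b..c'} \<times> {0..1::real} \<noteq> {}"
     unfolding I by (auto intro!: connected_Times)
    show "liftable ({a..b} \<times> {0..1}) c" "liftable ({b..c'} \<times> {0..1}) c" using Q bd le unfolding Q_def by auto
   qed (auto intro: closed_Times)
   then show "liftable ({a..c'} \<times> {0..1}) c" unfolding U .
  qed
 next
  fix s :: real assume s: "0 \<le> s" "s \<le> 1"
  then obtain d where d: "d > 0" "liftable (({s - d..s + d} \<inter> {0..1}) \<times> {0..1}) c" using strip[of s] by auto
  show "\<exists>d>0. \<forall>a b. a \<le> s \<and> s \<le> b \<and> b - a < d \<longrightarrow> Q a b"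
  proof (intro exI[of _ d] conjI allI impI)
   show "d > 0" by fact
   fix a b assume ab: "a \<le> s \<and> s \<le> b \<and> b - a < d"
   show "Q a b" unfolding Q_def by (intro impI, rule liftable_subset[OF d(2)]) (use ab in auto)
  qed
 qed auto
 then show ?thesis by (simp add: Q_def)
qed

text \<open>A path is treated as a square that is constant in the first coordinate, so the
  two-dimensional result covers it.\<close>

lemma path_lift_exists:
 assumes g: "path g" "path_image g \<subseteq> X" and b: "b \<in> E (pathstart g)"
 obtains s where "lift {0..1} g s" "s 0 = b"
proof -
 have c: "continuous_on ({0..1} \<times> {0..1}) (\<lambda>u::real \<times> real. g (snd u))"
  using g(1) unfolding path_def by (rule continuous_on_compose2[OF _ continuous_on_snd[OF continuous_on_id]]) auto
 moreover have "(\<lambda>u::real \<times> real. g (snd u)) ` ({0..1} \<times> {0..1}) \<subseteq> X" using g(2) by (auto simp: path_image_def)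
 ultimately have "liftable ({0..1} \<times> {0..1}) (\<lambda>u::real \<times> real. g (snd u))" by (rule liftable_square)
 moreover have "(0::real, 0) \<in> {0..1} \<times> {0..1::real}" by simp
 moreover have "b \<in> E (g (snd (0::real, 0)))" using b by (simp add: pathstart_def)
 ultimately obtain s where s: "lift ({0..1} \<times> {0..1}) (\<lambda>u::real \<times> real. g (snd u)) s" "s (0, 0) = b"
  unfolding liftable_def by blast
 have "lift {0..1} g (\<lambda>t. s (0, t))" by (rule lift_compose[OF s(1), of _ "\<lambda>t. (0, t)"]) (auto intro!: continuous_intros)
 then show ?thesis using that s by simp
qed

text \<open>Lift a free homotopy to a constant loop. Over the constant loop the lift is constant, so
  its ends agree; the lifts along the two sides \<open>h (r, 0) = h (r, 1)\<close> then agree at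
  \<open>r = 1\<close>, hence also at \<open>r = 0\<close>.\<close>

lemma loop_lift_closed:
 assumes X: "simply_connected X" and g: "path g" "path_image g \<subseteq> X" "pathfinish g = pathstart g" and s: "lift {0..1} g s" shows "s 1 = s 0"
proof -
 define x0 where "x0 = pathstart g"
 have x0: "x0 \<in> X" using g unfolding x0_def by blast
 have "homotopic_loops X g (\<lambda>t. x0)" using X[unfolded simply_connected_def, rule_format, of g "\<lambda>t. x0"] g x0
  by (auto simp: path_def pathfinish_def pathstart_def path_image_def)
 then obtain h where h: "continuous_on ({0..1::real} \<times> {0..1::real}) h" "h ` ({0..1} \<times> {0..1}) \<subseteq> X"
  "\<forall>x\<in>{0..1}. h (0, x) = g x" "\<forall>x\<in>{0..1}. h (1, x) = x0"
  "\<forall>t\<in>{0..1}. pathfinish (h \<circ> Pair t) = pathstart (h \<circ> Pair t)" unfolding homotopic_loops by auto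
 have hl: "h (r, 1) = h (r, 0)" if "r \<in> {0..1}" for r using h(5) that by (auto simp: pathfinish_def pathstart_def)
 have "s 0 \<in> E (h (0, 0))" using lift_in_E[OF s, of 0] h(3) by simp
 then obtain S where S: "lift ({0..1} \<times> {0..1}) h S" "S (0, 0) = s 0" using liftable_square[OF h(1,2)] unfolding liftable_def by fastforce
 have conn: "connected {0..1::real}" by simp
 have 1: "S (0, 1) = s 1"
 proof (rule lift_unique[OF conn _ _ _ s])
  show "continuous_on {0..1} g" "g ` {0..1} \<subseteq> X" using g by (auto simp: path_def path_image_def)
  show "lift {0..1} g (\<lambda>t. S (0, t))"
   by (rule lift_compose[OF S(1), of _ "\<lambda>t. (0, t)"]) (use h(3) in \<open>auto intro!: continuous_intros\<close>)
 qed (use S in auto)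
 have E1: "S (1, 0) \<in> E x0" using lift_in_E[OF S(1), of "(1, 0)"] h(4) by simp
 obtain i where i: "i \<in> I x0" "\<sigma> x0 i x0 = S (1, 0)" using \<sigma>_surj[OF x0 in_V[OF x0] E1] by auto
 have 2: "S (1, 1) = S (1, 0)"
 proof (rule lift_unique[OF conn, of "\<lambda>t. x0" "\<lambda>t. S (1, t)" "\<lambda>t. \<sigma> x0 i x0" 0 1, unfolded i(2)])
  show "lift {0..1} (\<lambda>t. x0) (\<lambda>t. S (1, t))"
   by (rule lift_compose[OF S(1), of _ "\<lambda>t. (1, t)"]) (use h(4) in \<open>auto intro!: continuous_intros\<close>)
  show "lift {0..1::real} (\<lambda>t. x0) (\<lambda>t. S (1, 0))"
   using lift_const[OF x0 i(1), of "\<lambda>t. x0" "{0..1::real}"] in_V[OF x0] i(2) by auto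
 qed (use x0 in auto)
 have "S (0, 1) = S (0, 0)"
 proof (rule lift_unique[OF conn, of "\<lambda>r. h (r, 0)" "\<lambda>r. S (r, 1)" "\<lambda>r. S (r, 0)" 1 0])
  show "continuous_on {0..1} (\<lambda>r. h (r, 0))" by (rule continuous_on_compose2[OF h(1)]) (auto intro!: continuous_intros)
  show "(\<lambda>r. h (r, 0)) ` {0..1} \<subseteq> X" using h(2) by auto
  show "lift {0..1} (\<lambda>r. h (r, 0)) (\<lambda>r. S (r, 1))"
   by (rule lift_compose[OF S(1), of _ "\<lambda>r. (r, 1)"]) (use hl in \<open>auto intro!: continuous_intros\<close>)
  show "lift {0..1} (\<lambda>r. h (r, 0)) (\<lambda>r. S (r, 0))"
   by (rule lift_compose[OF S(1), of _ "\<lambda>r. (r, 0)"]) (auto intro!: continuous_intros)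
 qed (use 2 in auto)
 then show ?thesis using 1 S by simp
qed

theorem monodromy:
 assumes X: "simply_connected X" and x0: "x0 \<in> X" and b0: "b0 \<in> E x0"
 obtains S where "S x0 = b0" "\<And>x. x \<in> X \<Longrightarrow> S x \<in> E x"
  "\<And>x. x \<in> X \<Longrightarrow> \<exists>i\<in>I x. \<forall>y\<in>V x. S y = \<sigma> x i y"
proof -
 \<comment> \<open>\<open>b\<close> is reachable over \<open>y\<close>: it is the end of a lift,
   started at \<open>b0\<close>, of some path from \<open>x0\<close> to \<open>y\<close>.\<close>
 define R where "R y b \<longleftrightarrow> (\<exists>g s. path g \<and> path_image g \<subseteq> X \<and> pathstart g = x0 \<and> pathfinish g = y
   \<and> lift {0..1} g s \<and> s 0 = b0 \<and> s 1 = b)" for y b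
 have conn: "connected {0..1::real}" by simp
 have ex: "\<exists>b. R y b" if y: "y \<in> X" for y
 proof -
  obtain g where g: "path g" "path_image g \<subseteq> X" "pathstart g = x0" "pathfinish g = y"
   using simply_connected_imp_path_connected'[OF X] x0 y unfolding path_connected_def by blast
  then obtain s where "lift {0..1} g s" "s 0 = b0" using path_lift_exists[of g b0] b0 by auto
  then show ?thesis using g unfolding R_def by blast
 qed
 have unique: "b = b'" if R: "R y b" "R y b'" for y b b'
 proof -
  obtain g s where g: "path g" "path_image g \<subseteq> X" "pathstart g = x0" "pathfinish g = y"
   "lift {0..1} g s" "s 0 = b0" "s 1 = b" using R(1) unfolding R_def by blast
  obtain g' s' where g': "path g'" "path_image g' \<subseteq> X" "pathstart g' = x0" "pathfinish g' = y"
   "lift {0..1} g' s'" "s' 0 = b0" "s' 1 = b'" using R(2) unfolding R_def by blast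
  \<comment> \<open>The lift of this closed path closes up. Its first half runs to the end of
    \<open>s\<close>, its second half traversed backwards runs to the end of \<open>s'\<close>, and
    both meet at parameter 1/2.\<close>
  let ?l = "g +++ reversepath g'"
  have l: "path ?l" "path_image ?l \<subseteq> X" "pathstart ?l = x0" "pathfinish ?l = x0" using g g' by (auto simp: path_image_join)
  obtain s2 where s2: "lift {0..1} ?l s2" "s2 0 = b0" using path_lift_exists[of ?l b0] l b0 by auto
  have s21: "s2 1 = b0" using loop_lift_closed[OF X l(1,2) _ s2(1)] l s2 by simp
  have "s2 (1/2) = s 1"
  proof (rule lift_unique[OF conn _ _ _ g(5), of "\<lambda>t. s2 (t / 2)" 0 1, simplified])
   show "continuous_on {0..1} g" "g ` {0..1} \<subseteq> X" using g by (auto simp: path_def path_image_def)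
   show "lift {0..1} g (\<lambda>t. s2 (t / 2))"
    by (rule lift_compose[OF s2(1), of _ "\<lambda>t. t / 2"]) (auto intro!: continuous_intros simp: joinpaths_def)
  qed (use s2 g in auto)
  moreover have "s2 (1/2) = s' 1"
  proof (rule lift_unique[OF conn _ _ _ g'(5), of "\<lambda>t. s2 (1 - t / 2)" 0 1, simplified])
   show "continuous_on {0..1} g'" "g' ` {0..1} \<subseteq> X" using g' by (auto simp: path_def path_image_def)
   show "lift {0..1} g' (\<lambda>t. s2 (1 - t / 2))"
   proof (rule lift_compose[OF s2(1), of _ "\<lambda>t. 1 - t / 2"])
    fix t :: real assume t: "t \<in> {0..1}"
    show "g' t = ?l (1 - t / 2)"
    proof (cases "t = 1")
     case True
     have "?l (1/2) = pathfinish g" by (simp add: joinpaths_def pathfinish_def)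
     then show ?thesis using True g(4) g'(4) by (simp add: pathfinish_def)
    next
     case False
     then show ?thesis using t by (auto simp: joinpaths_def reversepath_def field_simps)
    qed
   qed (auto intro!: continuous_intros)
  qed (use s21 g' in auto)
  ultimately show ?thesis using g g' by simp
 qed
 define S where "S y = (SOME b. R y b)" for y
 have RS: "R y (S y)" if "y \<in> X" for y using ex[OF that] unfolding S_def by (rule someI_ex)
 show ?thesis
 proof (rule that)
  have "R x0 b0" unfolding R_def
  proof -
   obtain i where i: "i \<in> I x0" "\<sigma> x0 i x0 = b0" using \<sigma>_surj[OF x0 in_V[OF x0] b0] by auto
   have "lift {0..1::real} (\<lambda>t. x0) (\<lambda>t. b0)"
    using lift_const[OF x0 i(1), of "\<lambda>t. x0" "{0..1::real}"] in_V[OF x0] i(2) by auto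
   then show "\<exists>g s. path g \<and> path_image g \<subseteq> X \<and> pathstart g = x0 \<and> pathfinish g = x0
     \<and> lift {0..1} g s \<and> s 0 = b0 \<and> s 1 = b0" using x0 by (intro exI[of _ "\<lambda>t. x0"] exI[of _ "\<lambda>t. b0"])
     (auto simp: path_def path_image_def pathstart_def pathfinish_def)
  qed
  then show "S x0 = b0" using RS[OF x0] unique by blast
  show "S x \<in> E x" if x: "x \<in> X" for x
  proof -
   obtain g s where g: "pathfinish g = x" "lift {0..1} g s" "s 1 = S x" using RS[OF x] unfolding R_def by blast
   show ?thesis using lift_in_E[OF g(2), of 1] g by (simp add: pathfinish_def)
  qed
  show "\<exists>i\<in>I x. \<forall>y\<in>V x. S y = \<sigma> x i y" if x: "x \<in> X" for x
  proof -
   obtain g s where g: "path g" "path_image g \<subseteq> X" "pathstart g = x0" "pathfinish g = x"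
    "lift {0..1} g s" "s 0 = b0" "s 1 = S x" using RS[OF x] unfolding R_def by blast
   have "S x \<in> E x" using lift_in_E[OF g(5), of 1] g by (simp add: pathfinish_def)
   then obtain i where i: "i \<in> I x" "\<sigma> x i x = S x" using \<sigma>_surj[OF x in_V[OF x]] by auto
   have "S y = \<sigma> x i y" if y: "y \<in> V x" for y
   proof -
    obtain e where e: "path e" "path_image e \<subseteq> V x" "pathstart e = x" "pathfinish e = y"
     using path_connected_V[OF x] in_V[OF x] y unfolding path_connected_def by blast
    \<comment> \<open>Past \<open>x\<close> the path stays in \<open>V x\<close>, where the section
      with the fixed index \<open>i\<close> continues the lift; so \<open>\<sigma> x i y\<close> is
      reachable over \<open>y\<close>.\<close>
    let ?l = "g +++ e"
    have l: "path ?l" "path_image ?l \<subseteq> X" "pathstart ?l = x0" "pathfinish ?l = y"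
     using g e V_subset[OF x] by (auto simp: path_image_join)
    have e1: "e (2 * t - 1) = ?l t" if "t \<in> {1/2..1}" for t
    proof (cases "t = 1/2")
     case True
     have "?l (1/2) = pathfinish g" by (simp add: joinpaths_def pathfinish_def)
     then show ?thesis using g(4) e(3) unfolding True by (simp add: pathstart_def)
    next
     case False then show ?thesis using that by (auto simp: joinpaths_def)
    qed
    have U: "{0..1/2} \<union> {1/2..1} = {0..1::real}" by auto
    have "lift ({0..1/2} \<union> {1/2..1}) ?l (\<lambda>t. if t \<in> {0..1/2} then s (2 * t) else \<sigma> x i (e (2 * t - 1)))"
    proof (rule lift_union)
     show "continuous_on ({0..1/2} \<union> {1/2..1}) ?l" "?l ` ({0..1/2} \<union> {1/2..1}) \<subseteq> X"
      unfolding U using l by (auto simp: path_def path_image_def)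
     show "lift {0..1/2} ?l (\<lambda>t. s (2 * t))"
      by (rule lift_compose[OF g(5), of _ "\<lambda>t. 2 * t"]) (auto intro!: continuous_intros simp: joinpaths_def)
     have "lift {0..1} e (\<lambda>t. \<sigma> x i (e t))" by (rule lift_const[OF x i(1)]) (use e in \<open>auto simp: path_image_def\<close>)
     then show "lift {1/2..1} ?l (\<lambda>t. \<sigma> x i (e (2 * t - 1)))"
      by (rule lift_compose[of _ _ _ _ "\<lambda>t. 2 * t - 1"]) (use e1 in \<open>auto intro!: continuous_intros\<close>)
     fix t :: real assume "t \<in> {0..1/2} \<inter> {1/2..1}"
     then have "t = 1/2" by auto
     show "s (2 * t) = \<sigma> x i (e (2 * t - 1))" using g(7) e(3) i unfolding \<open>t = 1/2\<close> by (simp add: pathstart_def)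
    qed auto
    then have "R y (\<sigma> x i y)" unfolding R_def U
     using l e(4) g(6) by (intro exI[of _ ?l] exI[of _ "\<lambda>t. if t \<in> {0..1/2} then s (2 * t) else \<sigma> x i (e (2 * t - 1))"])
      (auto simp: pathfinish_def)
    moreover have "y \<in> X" using V_subset x y by blast
    ultimately show ?thesis using unique RS by blast
   qed
   then show ?thesis using i by blast
  qed
 qed
qed

end

section \<open>Developing maps of an atlas with real transition maps\<close>

text \<open>Developments need only a local homeomorphism to the sphere. Besides coverings this
  includes their open subsets and the exponential coordinate near a puncture.\<close>

definition spread :: "'a::topological_space set \<Rightarrow> ('a \<Rightarrow> riemann_sphere) \<Rightarrow> bool" where
 "spread X p \<longleftrightarrow> (\<forall>x\<in>X. \<exists>V. open_in X V \<and> x \<in> V \<and> open (p ` V) \<and> (\<exists>q. homeomorphism V (p ` V) p q))"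

lemma covering_space_spread:
 assumes c: "covering_space X p S" and S: "open S" shows "spread X p" unfolding spread_def
proof
 fix x assume x: "x \<in> X"
 then have "p x \<in> S" using c by (auto simp: covering_space_def)
 then obtain T v where T: "p x \<in> T" "open_in S T" "\<Union>v = X \<inter> p -` T"
  "\<forall>u\<in>v. open_in X u" "\<forall>u\<in>v. \<exists>q. homeomorphism u T p q" using c unfolding covering_space_def by metis
 have "x \<in> \<Union>v" unfolding T(3) using x T(1) by simp
 then obtain u where u: "u \<in> v" "x \<in> u" by auto
 obtain q where q: "homeomorphism u T p q" using T u by blast
 then have "p ` u = T" by (simp add: homeomorphism_def)
 moreover have "open T" using T(2) S by (rule openin_open_trans)
 ultimately show "\<exists>V. open_in X V \<and> x \<in> V \<and> open (p ` V) \<and> (\<exists>q. homeomorphism V (p ` V) p q)"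
  using T(4) u q by (intro exI[of _ u]) auto
qed

lemma spread_small:
 assumes X: "spread X p" and x: "x \<in> X" and N: "open_in X N" "x \<in> N" and U: "open U" "p x \<in> U"
 obtains V q where "open_in X V" "x \<in> V" "V \<subseteq> N" "p ` V \<subseteq> U" "open (p ` V)"
  "path_connected (p ` V)" "path_connected V" "homeomorphism V (p ` V) p q"
proof -
 obtain V0 q where V0: "open_in X V0" "x \<in> V0" "open (p ` V0)" "homeomorphism V0 (p ` V0) p q" using X x unfolding spread_def by blast
 have V0X: "V0 \<subseteq> X" using V0 openin_imp_subset by blast
 have contp: "continuous_on V0 p" and contq: "continuous_on (p ` V0) q" and qp: "\<And>y. y \<in> V0 \<Longrightarrow> q (p y) = y"
  using V0(4) unfolding homeomorphism_def by auto
 have qV: "q ` p ` V0 = V0" using V0(4) unfolding homeomorphism_def by auto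
 obtain T where T: "open T" "N = X \<inter> T" using N(1) by (auto simp: openin_open)
 have "open_in (p ` V0) (p ` V0 \<inter> q -` (V0 \<inter> T))"
  by (rule continuous_openin_preimage[OF contq, of V0]) (use qV T in \<open>auto intro: openin_open_Int\<close>)
 then have "open (p ` V0 \<inter> q -` (V0 \<inter> T))" using V0(3) by (rule openin_open_trans)
 then have oW: "open (p ` V0 \<inter> q -` (V0 \<inter> T) \<inter> U)" using U(1) by (rule open_Int)
 moreover have "p x \<in> p ` V0 \<inter> q -` (V0 \<inter> T) \<inter> U" using V0 qp N T U by auto
 ultimately obtain A w r where A: "A \<in> PSL2C" "r > 0" "A (Fin w) = p x"
  "A ` Fin ` ball w r \<subseteq> p ` V0 \<inter> q -` (V0 \<inter> T) \<inter> U" using open_sphere_disc by metis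
 define W where "W = A ` Fin ` ball w r"
 have W: "open W" "path_connected W" "p x \<in> W" "W \<subseteq> p ` V0 \<inter> q -` (V0 \<inter> T) \<inter> U"
  using A open_sphere_disc_open path_connected_sphere_disc unfolding W_def by (auto intro!: image_eqI[of "p x" A "Fin w"])
 define V where "V = V0 \<inter> p -` W"
 have pV: "p ` V = W" using W(4) unfolding V_def by auto
 show ?thesis
 proof (rule that)
  have "open_in V0 V" unfolding V_def by (rule continuous_openin_preimage_gen[OF contp W(1)])
  then show "open_in X V" using V0(1) openin_trans by blast
  show "x \<in> V" using V0 W by (simp add: V_def)
  show "V \<subseteq> N"
  proof
   fix y assume y: "y \<in> V"
   then have "p y \<in> W" "y \<in> V0" by (auto simp: V_def)
   then have "q (p y) \<in> T" using W by auto
   then show "y \<in> N" using qp \<open>y \<in> V0\<close> T V0X by auto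
  qed
  show "p ` V \<subseteq> U" "open (p ` V)" "path_connected (p ` V)" unfolding pV using W by auto
  show h: "homeomorphism V (p ` V) p q" by (rule homeomorphism_of_subsets[OF V0(4)]) (auto simp: V_def)
  have "V = q ` W" using h pV by (auto simp: homeomorphism_def)
  moreover have "continuous_on W q" by (rule continuous_on_subset[OF contq]) (use W in auto)
  ultimately show "path_connected V" using path_connected_continuous_image W by blast
 qed
qed

text \<open>The transition map may vary with the point, because overlaps may be disconnected: for
  the curve it differs on the two sides.\<close>

locale sphere_atlas =
 fixes K :: "'k set" and D :: "'k \<Rightarrow> riemann_sphere set" and g :: "'k \<Rightarrow> riemann_sphere \<Rightarrow> riemann_sphere"
 assumes hol_g: "k \<in> K \<Longrightarrow> holomorphic_sphere (g k) (D k)" and inj_g: "k \<in> K \<Longrightarrow> inj_on (g k) (D k)"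
  and transition: "\<lbrakk>j \<in> K; k \<in> K; y \<in> D j; y \<in> D k\<rbrakk> \<Longrightarrow>
   \<exists>T\<in>PSL2R. \<exists>W. open W \<and> y \<in> W \<and> W \<subseteq> D j \<inter> D k \<and> (\<forall>x\<in>W. g j x = T (g k x))"
begin

lemma open_D: "k \<in> K \<Longrightarrow> open (D k)" using hol_g holomorphic_sphere_open by blast

lemma rigid:
 assumes "k \<in> K" "A \<in> PSL2C" "B \<in> PSL2C" "open W" "W \<noteq> {}" "W \<subseteq> D k" "\<And>x. x \<in> W \<Longrightarrow> A (g k x) = B (g k x)"
 shows "A = B"
proof (rule PSL2C_eqI[OF assms(2,3)])
 show "open (g k ` W)" using open_image_inj_holomorphic[OF hol_g inj_g] assms by blast
qed (use assms in auto)

definition local_devel :: "'a::topological_space set \<Rightarrow> ('a \<Rightarrow> riemann_sphere) \<Rightarrow> ('a \<Rightarrow> riemann_sphere) \<Rightarrow> 'a \<Rightarrow> bool" where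
 "local_devel X p h x \<longleftrightarrow> (\<exists>V. open_in X V \<and> x \<in> V \<and>
  (\<exists>k\<in>K. \<exists>B\<in>PSL2R. p ` V \<subseteq> D k \<and> (\<forall>y\<in>V. h y = B (g k (p y)))))"

definition devel :: "'a::topological_space set \<Rightarrow> ('a \<Rightarrow> riemann_sphere) \<Rightarrow> ('a \<Rightarrow> riemann_sphere) \<Rightarrow> bool" where
 "devel X p h \<longleftrightarrow> (\<forall>x\<in>X. local_devel X p h x)"

lemma local_develE:
 assumes "local_devel X p h x"
 obtains V k B where "open_in X V" "x \<in> V" "k \<in> K" "B \<in> PSL2R" "p ` V \<subseteq> D k" "\<forall>y\<in>V. h y = B (g k (p y))"
 using assms unfolding local_devel_def by (elim exE conjE bexE) (rule that)

lemma develD: "devel X p h \<Longrightarrow> x \<in> X \<Longrightarrow> local_devel X p h x" unfolding devel_def by simp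

text \<open>A real transition map is absorbed into the coefficient, so the local expression can be
  written in any prescribed chart around \<open>p x\<close>.\<close>

lemma local_devel_chart:
 assumes X: "spread X p" and h: "local_devel X p h x" and x: "x \<in> X" and k: "k \<in> K" "p x \<in> D k" and N: "open_in X N" "x \<in> N"
 obtains V B where "open_in X V" "x \<in> V" "V \<subseteq> N" "p ` V \<subseteq> D k" "open (p ` V)" "path_connected V"
  "B \<in> PSL2R" "\<And>y. y \<in> V \<Longrightarrow> h y = B (g k (p y))"
proof -
 obtain V' j B' where V': "open_in X V'" "x \<in> V'" "j \<in> K" "B' \<in> PSL2R" "p ` V' \<subseteq> D j"
  "\<forall>y\<in>V'. h y = B' (g j (p y))" using h unfolding local_devel_def by blast
 have pj: "p x \<in> D j" using V' by auto
 obtain T W where T: "T \<in> PSL2R" "open W" "p x \<in> W" "W \<subseteq> D j \<inter> D k" "\<forall>x\<in>W. g j x = T (g k x)"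
  using transition[OF V'(3) k(1) pj k(2)] by blast
 have xN: "x \<in> N \<inter> V'" using N V' by blast
 obtain V where V: "open_in X V" "x \<in> V" "V \<subseteq> N \<inter> V'" "p ` V \<subseteq> W" "open (p ` V)" "path_connected V"
  by (rule spread_small[OF X x openin_Int[OF N(1) V'(1)] xN T(2,3)]) (rule that)
 show ?thesis
 proof (rule that)
  show "p ` V \<subseteq> D k" using V T by auto
  show "B' \<circ> T \<in> PSL2R" using PSL2R_comp V' T by blast
  show "h y = (B' \<circ> T) (g k (p y))" if "y \<in> V" for y
  proof -
   have "y \<in> V'" "p y \<in> W" using that V by auto
   then show ?thesis using V'(6) T(5) by simp
  qed
 qed (use V in auto)
qed

lemma devel_rigid:
 assumes X: "spread X p" and h: "local_devel X p h x" and x: "x \<in> X" and N: "open_in X N" "x \<in> N"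
  and AB: "A \<in> PSL2C" "B \<in> PSL2C" "\<And>y. y \<in> N \<Longrightarrow> A (h y) = B (h y)" shows "A = B"
proof -
 obtain k where k: "k \<in> K" "p x \<in> D k" using h unfolding local_devel_def by blast
 obtain V C where V: "open_in X V" "x \<in> V" "V \<subseteq> N" "p ` V \<subseteq> D k" "open (p ` V)"
  "C \<in> PSL2R" "\<And>y. y \<in> V \<Longrightarrow> h y = C (g k (p y))" by (rule local_devel_chart[OF X h x k N]) (rule that)
 have C: "C \<in> PSL2C" using V PSL2R_subset_PSL2C by blast
 have "A \<circ> C = B \<circ> C" by (rule rigid[OF k(1) PSL2C_comp[OF AB(1) C] PSL2C_comp[OF AB(2) C] V(5)])
   (use V AB in \<open>auto, metis subsetD\<close>)
 moreover obtain C' where "\<And>x. C (C' x) = x" using PSL2C_inverse C by blast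
 ultimately show ?thesis by (metis comp_apply ext)
qed

text \<open>Near a point both maps are real Moebius images of one chart, so they differ by some real
  \<open>B\<close>. By rigidity \<open>B\<close> is unique, hence locally constant, hence constant
  on the connected \<open>X\<close>.\<close>

lemma devel_unique:
 assumes X: "spread X p" "connected X" and h: "devel X p h" and h': "devel X p h'"
 obtains B where "B \<in> PSL2R" "\<And>x. x \<in> X \<Longrightarrow> h' x = B (h x)"
proof (cases "X = {}")
 case True show ?thesis by (rule that[OF id_PSL2R]) (simp add: True)
next
 case False
 then obtain x0 where x0: "x0 \<in> X" by blast
 define R where "R B x \<longleftrightarrow> (\<exists>V. open_in X V \<and> x \<in> V \<and> (\<forall>y\<in>V. h' y = B (h y)))" for B x
 have ex: "\<exists>B\<in>PSL2R. R B x" if x: "x \<in> X" for x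
 proof -
  have ld: "local_devel X p h x" "local_devel X p h' x" using h h' x unfolding devel_def by auto
  obtain k where k: "k \<in> K" "p x \<in> D k" using ld unfolding local_devel_def by blast
  obtain V C where V: "open_in X V" "x \<in> V" "C \<in> PSL2R" "\<And>y. y \<in> V \<Longrightarrow> h y = C (g k (p y))"
   by (rule local_devel_chart[OF X(1) ld(1) x k openin_subtopology_self x]) (rule that)
  obtain V' C' where V': "open_in X V'" "x \<in> V'" "C' \<in> PSL2R" "\<And>y. y \<in> V' \<Longrightarrow> h' y = C' (g k (p y))"
   by (rule local_devel_chart[OF X(1) ld(2) x k openin_subtopology_self x]) (rule that)
  obtain C1 where C1: "C1 \<in> PSL2R" "\<And>x. C1 (C x) = x" using PSL2R_inverse V by metis
  have "R (C' \<circ> C1) x" unfolding R_def by (intro exI[of _ "V \<inter> V'"]) (use V V' C1 in \<open>auto intro: openin_Int\<close>)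
  then show ?thesis using PSL2R_comp V' C1 by blast
 qed
 have uni: "A = B" if "R A x" "R B x" "A \<in> PSL2C" "B \<in> PSL2C" "x \<in> X" for A B x
 proof -
  obtain V W where V: "open_in X V" "x \<in> V" "\<forall>y\<in>V. h' y = A (h y)"
   and W: "open_in X W" "x \<in> W" "\<forall>y\<in>W. h' y = B (h y)" using \<open>R A x\<close> \<open>R B x\<close> unfolding R_def by blast
  show ?thesis by (rule devel_rigid[OF X(1) _ \<open>x \<in> X\<close> openin_Int[OF V(1) W(1)]])
    (use V W that h in \<open>auto simp: devel_def\<close>)
 qed
 obtain B where B: "B \<in> PSL2R" "R B x0" using ex x0 by blast
 let ?A = "{x \<in> X. R B x}"
 have "open_in X ?A"
 proof (subst openin_subopen, intro ballI)
  fix x assume "x \<in> ?A"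
  then obtain V where V: "open_in X V" "x \<in> V" "\<forall>y\<in>V. h' y = B (h y)" unfolding R_def by blast
  then have "V \<subseteq> ?A" unfolding R_def using openin_imp_subset by blast
  then show "\<exists>T. open_in X T \<and> x \<in> T \<and> T \<subseteq> ?A" using V by blast
 qed
 moreover have "open_in X (X - ?A)"
 proof (subst openin_subopen, intro ballI)
  fix x assume x: "x \<in> X - ?A"
  then obtain C where C: "C \<in> PSL2R" "R C x" using ex by blast
  then obtain V where V: "open_in X V" "x \<in> V" "\<forall>y\<in>V. h' y = C (h y)" unfolding R_def by blast
  have "B \<noteq> C" using C x by auto
  have "R C y" "y \<in> X" if "y \<in> V" for y using V that openin_imp_subset unfolding R_def by blast+
  then have "V \<subseteq> X - ?A" using uni[of B _ C] \<open>B \<noteq> C\<close> B C PSL2R_subset_PSL2C by blast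
  then show "\<exists>T. open_in X T \<and> x \<in> T \<and> T \<subseteq> X - ?A" using V by blast
 qed
 ultimately have "?A = {} \<or> ?A = X" using X(2)[unfolded connected_clopen, rule_format, of ?A] by (auto simp: closedin_def)
 then have "?A = X" using x0 B by auto
 then have "\<forall>x\<in>X. R B x" by blast
 then show ?thesis using that[OF B(1)] unfolding R_def by blast
qed

lemma devel_PSL2R:
 assumes h: "devel X p h" and A: "A \<in> PSL2R" shows "devel X p (\<lambda>x. A (h x))" unfolding devel_def local_devel_def
proof
 fix x assume "x \<in> X"
 then obtain V k B where V: "open_in X V" "x \<in> V" "k \<in> K" "B \<in> PSL2R" "p ` V \<subseteq> D k"
  "\<forall>y\<in>V. h y = B (g k (p y))" using develD[OF h] local_develE by metis
 then show "\<exists>V. open_in X V \<and> x \<in> V \<and> (\<exists>k\<in>K. \<exists>B\<in>PSL2R. p ` V \<subseteq> D k \<and> (\<forall>y\<in>V. A (h y) = B (g k (p y))))"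
  by (intro exI[of _ V] conjI bexI[of _ k] bexI[of _ "A \<circ> B"]) (auto intro: PSL2R_comp A)
qed

text \<open>Serves both for deck transformations and for translations of the exponential
  coordinate.\<close>

lemma devel_deck:
 assumes h: "devel X p h" and f: "continuous_on X f" "f ` X \<subseteq> X" "\<And>x. x \<in> X \<Longrightarrow> p (f x) = p x"
 shows "devel X p (\<lambda>x. h (f x))" unfolding devel_def local_devel_def
proof
 fix x assume x: "x \<in> X"
 then have "f x \<in> X" using f by auto
 then obtain V k B where V: "open_in X V" "f x \<in> V" "k \<in> K" "B \<in> PSL2R" "p ` V \<subseteq> D k"
  "\<forall>y\<in>V. h y = B (g k (p y))" using develD[OF h] local_develE by metis
 have "open_in X (X \<inter> f -` V)" using continuous_openin_preimage[OF f(1) _ V(1)] f(2) by (simp add: image_subset_iff_funcset)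
 moreover have "p ` (X \<inter> f -` V) \<subseteq> D k"
 proof
  fix u assume "u \<in> p ` (X \<inter> f -` V)"
  then obtain y where "y \<in> X" "f y \<in> V" "u = p (f y)" using f(3) by auto
  then show "u \<in> D k" using V(5) by auto
 qed
 ultimately show "\<exists>V. open_in X V \<and> x \<in> V \<and> (\<exists>k\<in>K. \<exists>B\<in>PSL2R. p ` V \<subseteq> D k \<and> (\<forall>y\<in>V. h (f y) = B (g k (p y))))"
  using x V f(3) by (intro exI[of _ "X \<inter> f -` V"] conjI bexI[of _ k] bexI[of _ B]) auto
qed

text \<open>Analytic continuation: near every point the identity theorem spreads an expression
  through a chart from a subset to a whole small sheet, so the set of points with such an expression
  is open and closed.\<close>

lemma devel_of_holomorphic:
 assumes X: "spread X p" "connected X" "p ` X \<subseteq> (\<Union>k\<in>K. D k)" and hol: "holomorphic_on_cover X p h"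
  and x0: "x0 \<in> X" "local_devel X p h x0" shows "devel X p h"
proof -
 let ?A = "{x \<in> X. local_devel X p h x}"
 have "open_in X ?A"
 proof (subst openin_subopen, intro ballI)
  fix x assume "x \<in> ?A"
  then obtain V k B where V: "open_in X V" "x \<in> V" "k \<in> K" "B \<in> PSL2R" "p ` V \<subseteq> D k"
   "\<forall>y\<in>V. h y = B (g k (p y))" unfolding local_devel_def by blast
  then have "V \<subseteq> ?A" unfolding local_devel_def using openin_imp_subset by blast
  then show "\<exists>T. open_in X T \<and> x \<in> T \<and> T \<subseteq> ?A" using V by blast
 qed
 moreover have "open_in X (X - ?A)"
 proof (subst openin_subopen, intro ballI)
  fix x assume x: "x \<in> X - ?A"
  then obtain k where k: "k \<in> K" "p x \<in> D k" using subsetD[OF X(3) imageI[of x X p]] by blast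
  obtain V1 where V1: "open_in X V1" "x \<in> V1" "inj_on p V1" "holomorphic_sphere (h \<circ> inv_into V1 p) (p ` V1)"
   using hol x unfolding holomorphic_on_cover_def by blast
  obtain V2 where V2: "open_in X V2" "x \<in> V2" "V2 \<subseteq> V1" "p ` V2 \<subseteq> D k" "open (p ` V2)" "path_connected (p ` V2)"
   by (rule spread_small[OF X(1) DiffD1[OF x] V1(1,2) open_D[OF k(1)] k(2)]) (rule that)
  have "V2 \<inter> ?A = {}"
  proof (rule ccontr)
   assume "V2 \<inter> ?A \<noteq> {}"
   then obtain u where u: "u \<in> V2" "u \<in> X" "local_devel X p h u" by blast
   have "p u \<in> D k" using u V2 by auto
   then obtain V B where V: "open_in X V" "u \<in> V" "V \<subseteq> V2" "open (p ` V)"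
    "B \<in> PSL2R" "\<And>y. y \<in> V \<Longrightarrow> h y = B (g k (p y))" using local_devel_chart[OF X(1) u(3,2) k(1) _ V2(1) u(1)] by metis
   have B: "B \<in> PSL2C" using V PSL2R_subset_PSL2C by blast
   have inv: "inv_into V1 p (p y) = y" if "y \<in> V2" for y using that V1(3) V2(3) by (simp add: inv_into_f_f subsetD)
   have eq: "(h \<circ> inv_into V1 p) v = B (g k v)" if v: "v \<in> p ` V2" for v
   proof (rule sphere_identity[of "p ` V2" "h \<circ> inv_into V1 p" "\<lambda>v. B (g k v)" "p ` V" v])
    show "connected (p ` V2)" using V2 path_connected_imp_connected by blast
    show "holomorphic_sphere (h \<circ> inv_into V1 p) (p ` V2)" by (rule holomorphic_sphere_subset[OF V1(4) image_mono[OF V2(3)] V2(5)])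
    show "holomorphic_sphere (\<lambda>v. B (g k v)) (p ` V2)"
     by (rule holomorphic_sphere_subset[OF holomorphic_sphere_PSL2C_comp[OF hol_g[OF k(1)] B] V2(4,5)])
    show "(h \<circ> inv_into V1 p) v = B (g k v)" if "v \<in> p ` V" for v using that V inv by auto
   qed (use V V2 v in auto)
   have "h y = B (g k (p y))" if "y \<in> V2" for y using eq[of "p y"] inv that by auto
   then have "local_devel X p h x" unfolding local_devel_def using V2 V k by blast
   then show False using x by auto
  qed
  then show "\<exists>T. open_in X T \<and> x \<in> T \<and> T \<subseteq> X - ?A" using V2(1,2) openin_imp_subset[OF V2(1)] by blast
 qed
 ultimately have "?A = {} \<or> ?A = X" using X(2)[unfolded connected_clopen, rule_format, of ?A] by (auto simp: closedin_def)
 then have "?A = X" using x0 by auto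
 then show ?thesis unfolding devel_def by blast
qed

text \<open>A development amounts to a coefficient in \<open>PSL2R\<close> in front of a reference
  chart at each point. These coefficients form a locally constant family, so monodromy yields a
  global choice.\<close>

lemma devel_exists:
 assumes X: "spread X p" "simply_connected X" "p ` X \<subseteq> (\<Union>k\<in>K. D k)"
 obtains h where "devel X p h"
proof (cases "X = {}")
 case True then show ?thesis using that unfolding devel_def by blast
next
 case False
 then obtain x0 where x0: "x0 \<in> X" by blast
 define Q where "Q j k y T \<longleftrightarrow> T \<in> PSL2R \<and> (\<exists>W. open W \<and> y \<in> W \<and> W \<subseteq> D j \<inter> D k \<and> (\<forall>x\<in>W. g j x = T (g k x)))"
  for j k y T
 define \<tau> where "\<tau> j k y = (SOME T. Q j k y T)" for j k y
 have \<tau>: "\<tau> j k y \<in> PSL2R \<and> (\<exists>W. open W \<and> y \<in> W \<and> W \<subseteq> D j \<inter> D k \<and> (\<forall>x\<in>W. g j x = \<tau> j k y (g k x)))"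
  if jk: "j \<in> K" "k \<in> K" "y \<in> D j" "y \<in> D k" for j k y
 proof -
  have "\<exists>T. Q j k y T" unfolding Q_def using transition[OF jk] by blast
  then have "Q j k y (\<tau> j k y)" unfolding \<tau>_def by (rule someI_ex)
  then show ?thesis unfolding Q_def .
 qed
 have "\<exists>k V. k \<in> K \<and> open_in X V \<and> x \<in> V \<and> path_connected V \<and> p ` V \<subseteq> D k" if x: "x \<in> X" for x
 proof -
  obtain k where k: "k \<in> K" "p x \<in> D k" using subsetD[OF X(3) imageI[OF x]] by blast
  show ?thesis by (rule spread_small[OF X(1) x openin_subtopology_self x open_D[OF k(1)] k(2)]) (use k in blast)
 qed
 then obtain k V where kV: "\<And>x. x \<in> X \<Longrightarrow> k x \<in> K \<and> open_in X (V x) \<and> x \<in> V x \<and> path_connected (V x) \<and> p ` V x \<subseteq> D (k x)"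
  by metis
 have VX: "V x \<subseteq> X" if "x \<in> X" for x using kV[OF that] openin_imp_subset by blast
 have kD: "p y \<in> D (k y)" if "y \<in> X" for y using kV[OF that] by auto
 have VD: "p y \<in> D (k x)" if "x \<in> X" "y \<in> V x" for x y using kV[OF that(1)] that by auto
 \<comment> \<open>Near \<open>y\<close> the local development \<open>B \<circ> g (k x)\<close>
   equals this coefficient applied to the reference chart \<open>g (k y)\<close>.\<close>
 define \<sigma> where "\<sigma> x B y = B \<circ> \<tau> (k x) (k y) (p y)" for x and B :: "riemann_sphere \<Rightarrow> riemann_sphere" and y
 interpret local_sections X V "\<lambda>x. PSL2R" "\<lambda>x. PSL2R" \<sigma>
 proof
  fix x assume x: "x \<in> X"
  show "open_in X (V x)" "x \<in> V x" "path_connected (V x)" using kV[OF x] by auto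
  fix y assume y: "y \<in> V x"
  have yX: "y \<in> X" using y VX x by blast
  have T: "\<tau> (k x) (k y) (p y) \<in> PSL2R" using \<tau>[of "k x" "k y" "p y"] kV x yX VD[OF x y] kD by auto
  then obtain T' where T': "T' \<in> PSL2R" "\<And>u. \<tau> (k x) (k y) (p y) (T' u) = u" "\<And>u. T' (\<tau> (k x) (k y) (p y) u) = u"
   using PSL2R_inverse by blast
  show "bij_betw (\<lambda>i. \<sigma> x i y) PSL2R PSL2R" by (rule bij_betw_byWitness[where f' = "\<lambda>B. B \<circ> T'"])
    (use T T' in \<open>auto simp: \<sigma>_def fun_eq_iff intro: PSL2R_comp\<close>)
 next
  fix x x' u B B'
  assume a: "x \<in> X" "x' \<in> X" "u \<in> V x" "u \<in> V x'" "B \<in> PSL2R" "B' \<in> PSL2R" "\<sigma> x B u = \<sigma> x' B' u"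
  have uX: "u \<in> X" using a VX by blast
  obtain W where W: "open W" "p u \<in> W" "W \<subseteq> D (k x) \<inter> D (k u)" "\<forall>v\<in>W. g (k x) v = \<tau> (k x) (k u) (p u) (g (k u) v)"
   using \<tau>[of "k x" "k u" "p u"] kV a uX VD[OF a(1,3)] kD by auto
  obtain W' where W': "open W'" "p u \<in> W'" "W' \<subseteq> D (k x') \<inter> D (k u)" "\<forall>v\<in>W'. g (k x') v = \<tau> (k x') (k u) (p u) (g (k u) v)"
   using \<tau>[of "k x'" "k u" "p u"] kV a uX VD[OF a(2,4)] kD by auto
  have eq: "B (g (k x) v) = B' (g (k x') v)" if "v \<in> W \<inter> W'" for v
   using W(4) W'(4) that fun_cong[OF a(7), of "g (k u) v"] by (simp add: \<sigma>_def)
  obtain N where N: "open_in X N" "u \<in> N" "p ` N \<subseteq> W \<inter> W'"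
   using spread_small[OF X(1) uX openin_subtopology_self uX, of "W \<inter> W'"] W W' by (metis IntI open_Int)
  show "\<exists>N. open_in X N \<and> u \<in> N \<and> (\<forall>y\<in>N \<inter> V x \<inter> V x'. \<sigma> x B y = \<sigma> x' B' y)"
  proof (intro exI conjI ballI)
   fix y assume y: "y \<in> N \<inter> V x \<inter> V x'"
   have yX: "y \<in> X" using y VX a by blast
   obtain M where M: "\<tau> (k x) (k y) (p y) \<in> PSL2R" "open M" "p y \<in> M" "M \<subseteq> D (k x) \<inter> D (k y)" "\<forall>v\<in>M. g (k x) v = \<tau> (k x) (k y) (p y) (g (k y) v)"
    using \<tau>[of "k x" "k y" "p y"] kV a(1) yX VD[OF a(1), of y] kD y by auto
   obtain M' where M': "\<tau> (k x') (k y) (p y) \<in> PSL2R" "open M'" "p y \<in> M'" "M' \<subseteq> D (k x') \<inter> D (k y)" "\<forall>v\<in>M'. g (k x') v = \<tau> (k x') (k y) (p y) (g (k y) v)"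
    using \<tau>[of "k x'" "k y" "p y"] kV a(2) yX VD[OF a(2), of y] kD y by auto
   show "\<sigma> x B y = \<sigma> x' B' y" unfolding \<sigma>_def
   proof (rule rigid[of "k y" _ _ "M \<inter> M' \<inter> W \<inter> W'"])
    show "B \<circ> \<tau> (k x) (k y) (p y) \<in> PSL2C" "B' \<circ> \<tau> (k x') (k y) (p y) \<in> PSL2C"
     using PSL2R_comp a M(1) M'(1) PSL2R_subset_PSL2C by blast+
    show "(B \<circ> \<tau> (k x) (k y) (p y)) (g (k y) v) = (B' \<circ> \<tau> (k x') (k y) (p y)) (g (k y) v)"
     if "v \<in> M \<inter> M' \<inter> W \<inter> W'" for v using that M(5) M'(5) eq[of v] by simp
    have "p y \<in> M \<inter> M' \<inter> W \<inter> W'" using M M' N y by auto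
    then show "M \<inter> M' \<inter> W \<inter> W' \<noteq> {}" by blast
   qed (use M M' W W' kV yX in auto)
  qed (use N in auto)
 qed
 obtain S where S: "\<And>x. x \<in> X \<Longrightarrow> \<exists>B\<in>PSL2R. \<forall>y\<in>V x. S y = \<sigma> x B y"
  by (rule monodromy[OF X(2) x0 id_PSL2R]) (rule that)
 have "devel X p (\<lambda>y. S y (g (k y) (p y)))" unfolding devel_def local_devel_def
 proof
  fix x assume x: "x \<in> X"
  then obtain B where B: "B \<in> PSL2R" "\<forall>y\<in>V x. S y = \<sigma> x B y" using S by blast
  have "S y (g (k y) (p y)) = B (g (k x) (p y))" if y: "y \<in> V x" for y
  proof -
   have yX: "y \<in> X" using y VX x by blast
   show ?thesis using B y \<tau>[of "k x" "k y" "p y"] kV x yX VD[OF x y] kD by (auto simp: \<sigma>_def)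
  qed
  then show "\<exists>V. open_in X V \<and> x \<in> V \<and> (\<exists>k'\<in>K. \<exists>B\<in>PSL2R. p ` V \<subseteq> D k' \<and> (\<forall>y\<in>V. S y (g (k y) (p y)) = B (g k' (p y))))"
   using kV[OF x] B by (intro exI[of _ "V x"] conjI bexI[of _ "k x"] bexI[of _ B]) auto
 qed
 then show ?thesis by (rule that)
qed

end

text \<open>A sheet over the image is the image of a lift of \<open>f\<close>. Monodromy over the
  convex set \<open>Y\<close> gives the lift, with the points of \<open>X\<close> above
  \<open>f y\<close> as the fibre at \<open>y\<close>.\<close>

lemma covering_sheet:
 fixes f :: "complex \<Rightarrow> riemann_sphere"
 assumes c: "covering_space X p S" and S: "open S" and Y: "convex Y" "open Y" "Y \<noteq> {}"
  and f: "continuous_on Y f" "inj_on f Y" "f ` Y \<subseteq> S" "\<And>W. open W \<Longrightarrow> W \<subseteq> Y \<Longrightarrow> open (f ` W)"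
 obtains V where "open_in X V" "bij_betw p V (f ` Y)"
proof -
 obtain y0 where y0: "y0 \<in> Y" using Y by blast
 have "\<exists>T v. f y \<in> T \<and> open T \<and> \<Union>v = X \<inter> p -` T \<and> (\<forall>u\<in>v. open_in X u) \<and> pairwise disjnt v \<and>
   (\<forall>u\<in>v. \<exists>q. homeomorphism u T p q)" if y: "y \<in> Y" for y
 proof -
  have "f y \<in> S" using y f by auto
  then show ?thesis using c S unfolding covering_space_def by (metis openin_open_eq)
 qed
 then obtain T v where T: "\<And>y. y \<in> Y \<Longrightarrow> f y \<in> T y \<and> open (T y) \<and> \<Union>(v y) = X \<inter> p -` T y \<and>
  (\<forall>u\<in>v y. open_in X u) \<and> pairwise disjnt (v y) \<and> (\<forall>u\<in>v y. \<exists>q. homeomorphism u (T y) p q)" by metis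
 have "\<exists>r>0. ball y r \<subseteq> Y \<inter> f -` T y" if y: "y \<in> Y" for y
 proof -
  have "open (Y \<inter> f -` T y)" using T[OF y] f(1) Y(2) by (intro continuous_open_preimage) auto
  then show ?thesis using T[OF y] y by (meson IntI open_contains_ball vimageI2)
 qed
 then obtain r where r: "\<And>y. y \<in> Y \<Longrightarrow> r y > 0 \<and> ball y (r y) \<subseteq> Y \<inter> f -` T y" by metis
 have rT: "f y' \<in> T y" "y' \<in> Y" if "y \<in> Y" "y' \<in> ball y (r y)" for y y' using r[OF that(1)] that(2) by blast+
 have inj: "inj_on p u" and img: "p ` u = T y" and uX: "open_in X u" "u \<subseteq> X" if yu: "y \<in> Y" "u \<in> v y" for y u
 proof -
  obtain q where q: "homeomorphism u (T y) p q" using T[OF yu(1)] yu(2) by blast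
  show "inj_on p u" "p ` u = T y" using q unfolding homeomorphism_def by (auto intro: inj_on_inverseI)
  show "open_in X u" using T[OF yu(1)] yu(2) by blast
  then show "u \<subseteq> X" by (rule openin_imp_subset)
 qed
 define \<sigma> where "\<sigma> y u y' = inv_into u p (f y')" for y :: complex and u y'
 have \<sigma>: "\<sigma> y u y' \<in> u" "p (\<sigma> y u y') = f y'" if "y \<in> Y" "u \<in> v y" "y' \<in> ball y (r y)" for y u y'
 proof -
  have "f y' \<in> p ` u" using rT(1)[OF that(1,3)] img[OF that(1,2)] by simp
  then show "\<sigma> y u y' \<in> u" "p (\<sigma> y u y') = f y'" unfolding \<sigma>_def by (auto intro: inv_into_into f_inv_into_f)
 qed
 interpret local_sections Y "\<lambda>y. ball y (r y)" v "\<lambda>y. {x \<in> X. p x = f y}" \<sigma>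
 proof
  fix y assume y: "y \<in> Y"
  show "open_in Y (ball y (r y))" using r[OF y] by (auto intro: open_subset)
  show "y \<in> ball y (r y)" "path_connected (ball y (r y))" using r[OF y] by (auto intro: convex_imp_path_connected)
  fix y' assume y': "y' \<in> ball y (r y)"
  show "bij_betw (\<lambda>u. \<sigma> y u y') (v y) {x \<in> X. p x = f y'}"
  proof (rule bij_betwI')
   fix u u' assume u: "u \<in> v y" "u' \<in> v y"
   show "(\<sigma> y u y' = \<sigma> y u' y') = (u = u')"
   proof
    assume "\<sigma> y u y' = \<sigma> y u' y'"
    then have "\<not> disjnt u u'" using \<sigma>(1)[OF y u(1) y'] \<sigma>(1)[OF y u(2) y'] by (auto simp: disjnt_def)
    then show "u = u'" using T[OF y] u unfolding pairwise_def by blast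
   qed auto
  next
   fix u assume u: "u \<in> v y"
   show "\<sigma> y u y' \<in> {x \<in> X. p x = f y'}" using \<sigma>[OF y u y'] uX[OF y u] by auto
  next
   fix x assume x: "x \<in> {x \<in> X. p x = f y'}"
   then have "x \<in> X \<inter> p -` T y" using rT(1)[OF y y'] by auto
   then obtain u where u: "u \<in> v y" "x \<in> u" using T[OF y] by blast
   then have "x = \<sigma> y u y'" using inj_onD[OF inj[OF y u(1)], of x "\<sigma> y u y'"] \<sigma>[OF y u(1) y'] x by auto
   then show "\<exists>u\<in>v y. x = \<sigma> y u y'" using u by blast
  qed
 next
  fix y y' w u u' assume a: "y \<in> Y" "y' \<in> Y" "w \<in> ball y (r y)" "w \<in> ball y' (r y')" "u \<in> v y" "u' \<in> v y'" "\<sigma> y u w = \<sigma> y' u' w"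
  have wY: "w \<in> Y" using rT(2)[OF a(1,3)] .
  have op: "open_in X (u \<inter> u')" using uX a by (auto intro: openin_Int)
  have "open (p ` (u \<inter> u'))"
  proof -
   obtain q where q: "homeomorphism u (T y) p q" using T[OF a(1)] a(5) by blast
   have "open_in u (u \<inter> u')" using op by (metis inf_le1 openin_subset_trans uX(2)[OF a(1,5)])
   then have "open_in (T y) (p ` (u \<inter> u'))" using homeomorphism_imp_open_map[OF q] by blast
   then show ?thesis by (rule openin_open_trans) (use T[OF a(1)] in simp)
  qed
  then have oN: "open (Y \<inter> f -` (p ` (u \<inter> u')))" using f(1) Y(2) by (intro continuous_open_preimage) auto
  show "\<exists>N. open_in Y N \<and> w \<in> N \<and> (\<forall>t\<in>N \<inter> ball y (r y) \<inter> ball y' (r y'). \<sigma> y u t = \<sigma> y' u' t)"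
  proof (intro exI conjI ballI)
   show "open_in Y (Y \<inter> f -` (p ` (u \<inter> u')))" using oN by (auto intro: open_subset)
   have "\<sigma> y u w \<in> u \<inter> u'" using \<sigma>(1)[OF a(1,5,3)] \<sigma>(1)[OF a(2,6,4)] a(7) by simp
   then show "w \<in> Y \<inter> f -` (p ` (u \<inter> u'))" using wY \<sigma>(2)[OF a(1,5,3)] by (auto intro!: image_eqI[of _ p "\<sigma> y u w"])
   fix t assume t: "t \<in> Y \<inter> f -` (p ` (u \<inter> u')) \<inter> ball y (r y) \<inter> ball y' (r y')"
   then obtain x where x: "x \<in> u" "x \<in> u'" "p x = f t" by auto
   have "\<sigma> y u t = x" using inj_onD[OF inj[OF a(1,5)], of "\<sigma> y u t" x] \<sigma>[OF a(1,5), of t] x t by auto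
   moreover have "\<sigma> y' u' t = x" using inj_onD[OF inj[OF a(2,6)], of "\<sigma> y' u' t" x] \<sigma>[OF a(2,6), of t] x t by auto
   ultimately show "\<sigma> y u t = \<sigma> y' u' t" by simp
  qed
 qed
 have "f y0 \<in> p ` X" using c y0 f by (auto simp: covering_space_def)
 then obtain x0 where x0: "x0 \<in> {x \<in> X. p x = f y0}" by auto
 obtain s where s: "\<And>y. y \<in> Y \<Longrightarrow> s y \<in> {x \<in> X. p x = f y}"
  "\<And>y. y \<in> Y \<Longrightarrow> \<exists>u\<in>v y. \<forall>y'\<in>ball y (r y). s y' = \<sigma> y u y'"
  by (rule monodromy[OF convex_imp_simply_connected[OF Y(1)] y0 x0]) (rule that)
 have contp: "continuous_on X p" using c by (simp add: covering_space_def)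
 show ?thesis
 proof (rule that[of "s ` Y"])
  show "open_in X (s ` Y)"
  proof (subst openin_subopen, intro ballI)
   fix x assume "x \<in> s ` Y"
   then obtain y where y: "y \<in> Y" "x = s y" by auto
   obtain u where u: "u \<in> v y" "\<forall>y'\<in>ball y (r y). s y' = \<sigma> y u y'" using s(2)[OF y(1)] by blast
   have yb: "y \<in> ball y (r y)" using r[OF y(1)] by simp
   have oF: "open (f ` ball y (r y))" using f(4)[of "ball y (r y)"] r[OF y(1)] by auto
   have "open_in X (u \<inter> (X \<inter> p -` (f ` ball y (r y))))"
    by (rule openin_Int[OF uX(1)[OF y(1) u(1)] continuous_openin_preimage_gen[OF contp oF]])
   moreover have "x \<in> u \<inter> (X \<inter> p -` (f ` ball y (r y)))" using y u(2) yb \<sigma>(1)[OF y(1) u(1) yb] s(1)[OF y(1)] by auto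
   moreover have "u \<inter> (X \<inter> p -` (f ` ball y (r y))) \<subseteq> s ` Y"
   proof
    fix x' assume x': "x' \<in> u \<inter> (X \<inter> p -` (f ` ball y (r y)))"
    then obtain y' where y': "y' \<in> ball y (r y)" "p x' = f y'" by auto
    have "s y' = x'" using u(2) y' inj_onD[OF inj[OF y(1) u(1)], of "\<sigma> y u y'" x'] \<sigma>[OF y(1) u(1) y'(1)] x' by auto
    moreover have "y' \<in> Y" using rT(2)[OF y(1) y'(1)] .
    ultimately show "x' \<in> s ` Y" by blast
   qed
   ultimately show "\<exists>T. open_in X T \<and> x \<in> T \<and> T \<subseteq> s ` Y" by blast
  qed
  show "bij_betw p (s ` Y) (f ` Y)" unfolding bij_betw_def
  proof
   show "inj_on p (s ` Y)"
   proof (rule inj_onI)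
    fix x x' assume "x \<in> s ` Y" "x' \<in> s ` Y" "p x = p x'"
    then obtain y y' where "y \<in> Y" "y' \<in> Y" "x = s y" "x' = s y'" "f y = f y'" using s(1) by auto
    then show "x = x'" using f(2) by (metis inj_onD)
   qed
   show "p ` s ` Y = f ` Y" using s(1) by (force simp: image_iff)
  qed
 qed
qed

section \<open>The upper half-plane\<close>

text \<open>In the upper half-plane this is \<open>2 * cosh d - 2\<close> for the hyperbolic
  distance \<open>d\<close>. Being algebraic, it also makes sense for two points of the lower
  half-plane.\<close>

definition hq :: "complex \<Rightarrow> complex \<Rightarrow> real" where
 "hq z w = (cmod (z - w))\<^sup>2 / (Im z * Im w)"

definition act :: "(riemann_sphere \<Rightarrow> riemann_sphere) \<Rightarrow> complex \<Rightarrow> complex" where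
 "act A w = affine (A (Fin w))"

lemma real_moebius_denominator:
 assumes "a * d - b * c = (1::real)" "Im w \<noteq> 0" shows "of_real c * w + of_real d \<noteq> 0"
proof
 assume e: "of_real c * w + of_real d = 0"
 have "Im (of_real c * w + of_real d) = 0" "Re (of_real c * w + of_real d) = 0" unfolding e by simp_all
 then have "c = 0" "c * Re w + d = 0" using assms by auto
 then have "c = 0" "d = 0" by auto
 then show False using assms by simp
qed

lemma real_moebius_Im:
 assumes "a * d - b * c = (1::real)" "Im w \<noteq> 0"
 shows "Im ((of_real a * w + of_real b) / (of_real c * w + of_real d)) = Im w / (cmod (of_real c * w + of_real d))\<^sup>2"
proof -
 have "Im (of_real a * w + of_real b) * Re (of_real c * w + of_real d)
  - Re (of_real a * w + of_real b) * Im (of_real c * w + of_real d) = (a * d - b * c) * Im w" by (simp add: algebra_simps)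
 then show ?thesis using assms by (simp add: Im_divide cmod_power2)
qed

lemma real_moebius_diff:
 assumes "a * d - b * c = (1::real)" "Im z \<noteq> 0" "Im w \<noteq> 0"
 shows "(of_real a * z + of_real b) / (of_real c * z + of_real d) - (of_real a * w + of_real b) / (of_real c * w + of_real d)
  = (z - w) / ((of_real c * z + of_real d) * (of_real c * w + of_real d))"
proof -
 let ?A = "of_real a :: complex" let ?B = "of_real b :: complex" let ?C = "of_real c :: complex" let ?D = "of_real d :: complex"
 have det: "?A * ?D - ?B * ?C = 1" using assms(1) by (metis of_real_1 of_real_diff of_real_mult)
 have n: "?C * z + ?D \<noteq> 0" "?C * w + ?D \<noteq> 0" using real_moebius_denominator assms by blast+
 have "(?A * z + ?B) * (?C * w + ?D) - (?A * w + ?B) * (?C * z + ?D) = (?A * ?D - ?B * ?C) * (z - w)" by (simp add: algebra_simps)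
 also have "\<dots> = z - w" using det by simp
 finally show ?thesis using n by (simp add: diff_frac_eq)
qed

lemma PSL2R_act:
 assumes "A \<in> PSL2R" "Im w \<noteq> 0" shows "A (Fin w) = Fin (act A w)" "Im (act A w) * Im w > 0"
proof -
 obtain a b c d :: real where
  A: "A = moebius (of_real a) (of_real b) (of_real c) (of_real d)" "a * d - b * c = 1" using assms by (auto simp: PSL2R_def)
 have n: "of_real c * w + of_real d \<noteq> 0" using real_moebius_denominator A assms by blast
 then show "A (Fin w) = Fin (act A w)" by (simp add: A act_def)
 have "Im (act A w) = Im w / (cmod (of_real c * w + of_real d))\<^sup>2" using real_moebius_Im[OF A(2) assms(2)] n by (simp add: A act_def)
 then show "Im (act A w) * Im w > 0" using n assms(2) by (simp add: zero_less_divide_iff power2_eq_square[symmetric])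
qed

lemma PSL2R_act_hq:
 assumes "A \<in> PSL2R" "Im z > 0" "Im w > 0" shows "hq (act A z) (act A w) = hq z w"
proof -
 obtain a b c d :: real where
  A: "A = moebius (of_real a) (of_real b) (of_real c) (of_real d)" "a * d - b * c = 1" using assms by (auto simp: PSL2R_def)
 have n: "of_real c * w + of_real d \<noteq> 0" "of_real c * z + of_real d \<noteq> 0" using real_moebius_denominator A assms by auto
 show ?thesis unfolding hq_def using n A assms real_moebius_diff[of a d b c z w] real_moebius_Im[of a d b c]
  by (simp add: act_def norm_divide norm_mult power_divide power_mult_distrib)
qed

lemma PSL2R_act_cnj:
 assumes "A \<in> PSL2R" "Im w \<noteq> 0" shows "act A (cnj w) = cnj (act A w)"
proof -
 obtain a b c d :: real where
  A: "A = moebius (of_real a) (of_real b) (of_real c) (of_real d)" "a * d - b * c = 1" using assms by (auto simp: PSL2R_def)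
 have "of_real c * w + of_real d \<noteq> 0" "of_real c * cnj w + of_real d \<noteq> 0" using real_moebius_denominator A assms by auto
 then show ?thesis by (simp add: A act_def)
qed

lemma PSL2R_half:
 assumes "A \<in> PSL2R" shows "A ` upper_half = upper_half" "A ` lower_half = lower_half"
proof -
 obtain B where B: "B \<in> PSL2R" "\<And>x. A (B x) = x" "\<And>x. B (A x) = x" using PSL2R_inverse assms by blast
 have *: "C (Fin w) \<in> upper_half" if "C \<in> PSL2R" "Im w > 0" for C w
  using PSL2R_act[OF that(1), of w] that(2) by (auto simp: upper_half_def zero_less_mult_iff)
 have **: "C (Fin w) \<in> lower_half" if "C \<in> PSL2R" "Im w < 0" for C w
  using PSL2R_act[OF that(1), of w] that(2) by (auto simp: lower_half_def zero_less_mult_iff)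
 show "A ` upper_half = upper_half"
 proof
  show "A ` upper_half \<subseteq> upper_half" using *[OF assms] by (auto simp: upper_half_def)
  show "upper_half \<subseteq> A ` upper_half"
  proof
   fix x assume "x \<in> upper_half"
   then have "B x \<in> upper_half" using *[OF B(1)] by (auto simp: upper_half_def)
   then show "x \<in> A ` upper_half" using B(2) by (metis imageI)
  qed
 qed
 show "A ` lower_half = lower_half"
 proof
  show "A ` lower_half \<subseteq> lower_half" using **[OF assms] by (auto simp: lower_half_def)
  show "lower_half \<subseteq> A ` lower_half"
  proof
   fix x assume "x \<in> lower_half"
   then have "B x \<in> lower_half" using **[OF B(1)] by (auto simp: lower_half_def)
   then show "x \<in> A ` lower_half" using B(2) by (metis imageI)
  qed
 qed
qed

lemma open_upper_half: "open upper_half" and open_lower_half: "open lower_half"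
 by (auto simp: upper_half_def lower_half_def open_Fin_image_iff open_halfspace_Im_gt open_halfspace_Im_lt)

lemma PSL2R_conformal_half:
 assumes "A \<in> PSL2R" shows "conformal_map A upper_half upper_half" "conformal_map A lower_half lower_half"
proof -
 have C: "A \<in> PSL2C" using assms PSL2R_subset_PSL2C by blast
 show "conformal_map A upper_half upper_half" "conformal_map A lower_half lower_half" unfolding conformal_simps
  using PSL2R_half[OF assms] holomorphic_sphere_PSL2C[OF C] PSL2C_inj[OF C] open_upper_half open_lower_half by auto
qed

subsection \<open>Geodesic lines\<close>

definition imag_ray :: "complex set" where "imag_ray = {w. Re w = 0 \<and> Im w > 0}"

text \<open>The points lie on a vertical line, which is translated, or on a half-circle with real
  centre, whose two ends are sent to 0 and Infty.\<close>

lemma geodesic_to_imag_ray: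
 assumes "Im u > 0" "Im v > 0" "u \<noteq> v"
 obtains A where "A \<in> PSL2R" "act A u \<in> imag_ray" "act A v \<in> imag_ray"
proof (cases "Re u = Re v")
 case True
 let ?A = "moebius (of_real 1) (of_real (- Re u)) (of_real 0) (of_real 1)"
 have "?A \<in> PSL2R" by (rule moebius_PSL2R) simp
 moreover have "act ?A u \<in> imag_ray" "act ?A v \<in> imag_ray" using True assms by (auto simp: act_def imag_ray_def)
 ultimately show ?thesis by (rule that)
next
 case False
 \<comment> \<open>The real point equidistant from \<open>u\<close> and \<open>v\<close>.\<close>
 define c where "c = ((cmod u)\<^sup>2 - (cmod v)\<^sup>2) / (2 * (Re u - Re v))"
 define r where "r = cmod (u - of_real c)"
 have "2 * (Re u - Re v) \<noteq> 0" using False by simp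
 then have "c * (2 * (Re u - Re v)) = (cmod u)\<^sup>2 - (cmod v)\<^sup>2" unfolding c_def by (rule nonzero_eq_divide_eq[THEN iffD1]) (rule refl)
 then have "(cmod (u - of_real c))\<^sup>2 = (cmod (v - of_real c))\<^sup>2" unfolding cmod_power2 by (simp add: power2_eq_square algebra_simps)
 then have rv: "r = cmod (v - of_real c)" unfolding r_def by (simp add: power2_eq_iff_nonneg)
 have "u - of_real c \<noteq> 0" using assms(1) by (auto simp: complex_eq_iff)
 then have r: "r > 0" unfolding r_def by simp
 \<comment> \<open>This is \<open>w \<mapsto> (w - (c - r)) / ((c + r) - w)\<close>, of determinant
   \<open>2 * r\<close>.\<close>
 let ?A = "moebius (of_real 1) (of_real (- (c - r))) (of_real (-1)) (of_real (c + r))"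
 have A: "?A \<in> PSL2R" by (rule moebius_PSL2R) (use r in simp)
 have *: "act ?A w \<in> imag_ray" if w: "Im w > 0" "r = cmod (w - of_real c)" for w
 proof -
  have n: "of_real (-1) * w + of_real (c + r) \<noteq> (0::complex)" using w by (auto simp: complex_eq_iff)
  have "act ?A w = (w - of_real (c - r)) / (of_real (c + r) - w)" using n by (simp add: act_def algebra_simps)
  moreover have "Re ((w - of_real (c - r)) / (of_real (c + r) - w)) = 0"
  proof -
   have "r\<^sup>2 = (Re w - c)\<^sup>2 + (Im w)\<^sup>2" using w(2) by (simp add: cmod_power2)
   then have "(Re w - (c - r)) * (c + r - Re w) - Im w * Im w = 0" by (simp add: power2_eq_square algebra_simps)
   then show ?thesis by (simp add: Re_divide)
  qed
  moreover have "Im (act ?A w) > 0" using PSL2R_act(2)[OF A, of w] w(1) by (simp add: zero_less_mult_iff)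
  ultimately show ?thesis by (simp add: imag_ray_def)
 qed
 show ?thesis by (rule that[OF A *[OF assms(1) r_def] *[OF assms(2) rv]])
qed

text \<open>Once two of its points are on the imaginary axis, every other point is pinned down by
  its distances to these two, and it turns out to lie on the axis as well.\<close>

lemma geodesic_line_image:
 assumes "geodesic_line L"
 obtains A where "A \<in> PSL2R" "Fin ` L = A ` Fin ` imag_ray"
proof -
 obtain g :: "real \<Rightarrow> complex" where g: "\<And>t. Im (g t) > 0" "\<And>s t. hyp_dist (g s) (g t) = \<bar>s - t\<bar>" "L = range g"
  using assms unfolding geodesic_line_def by blast
 have hq: "hq (g s) (g t) = 2 * cosh (s - t) - 2" for s t
 proof -
  have "0 \<le> hq (g s) (g t)" using g(1) by (simp add: hq_def less_imp_le)
  then have "cosh (arcosh (1 + hq (g s) (g t) / 2)) = 1 + hq (g s) (g t) / 2" by (intro cosh_arcosh_real) auto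
  moreover have "hyp_dist (g s) (g t) = arcosh (1 + hq (g s) (g t) / 2)" by (simp add: hyp_dist_def hq_def mult.commute mult.left_commute)
  ultimately have "1 + hq (g s) (g t) / 2 = cosh \<bar>s - t\<bar>" using g(2) by simp
  then show ?thesis by simp
 qed
 have "g 0 \<noteq> g 1"
 proof
  assume "g 0 = g 1"
  then have "cosh (1::real) = 1" using hq[of 1 0] by (simp add: hq_def)
  then show False using cosh_real_strict_mono[of 0 1] by simp
 qed
 then obtain A where A: "A \<in> PSL2R" "act A (g 0) \<in> imag_ray" "act A (g 1) \<in> imag_ray" using geodesic_to_imag_ray g(1) by metis
 define k where "k t = act A (g t)" for t
 have Imk: "Im (k t) > 0" for t using PSL2R_act(2)[OF A(1), of "g t"] g(1)[of t] by (simp add: k_def zero_less_mult_iff)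
 have hqk: "hq (k s) (k t) = 2 * cosh (s - t) - 2" for s t unfolding k_def using PSL2R_act_hq[OF A(1) g(1) g(1)] hq by simp
 have e: "(cmod (k s - k t))\<^sup>2 = (2 * cosh (s - t) - 2) * (Im (k s) * Im (k t))" for s t
  using hqk[of s t] Imk[of s] Imk[of t] by (simp add: hq_def field_simps)
 define y0 y1 where "y0 = Im (k 0)" and "y1 = Im (k 1)"
 have y: "y0 > 0" "y1 > 0" using Imk by (auto simp: y0_def y1_def)
 have R0: "Re (k 0) = 0" "Re (k 1) = 0" using A by (auto simp: k_def imag_ray_def)
 have e0: "(Re (k t))\<^sup>2 + (Im (k t) - y0)\<^sup>2 = (2 * cosh t - 2) * (Im (k t) * y0)" for t
  using e[of t 0] R0 by (simp add: cmod_power2 y0_def)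
 have e1: "(Re (k t))\<^sup>2 + (Im (k t) - y1)\<^sup>2 = (2 * cosh (t - 1) - 2) * (Im (k t) * y1)" for t
  using e[of t 1] R0 by (simp add: cmod_power2 y1_def)
 have c1: "2 * cosh 1 = exp 1 + 1 / exp (1::real)" by (simp add: cosh_def exp_minus inverse_eq_divide)
 have "(y1 - y0)\<^sup>2 = (exp 1 + 1 / exp 1 - 2) * (y1 * y0)" using e0[of 1] R0(2) unfolding y1_def[symmetric] c1 by simp
 then have "y1\<^sup>2 + y0\<^sup>2 = y1 * y0 * (exp 1 + 1 / exp 1)" by (simp add: power2_eq_square algebra_simps)
 then have "(y1 - exp 1 * y0) * (y1 - y0 / exp 1) = 0" by (simp add: power2_eq_square field_simps)
 then have "y1 - exp 1 * y0 = 0 \<or> y1 - y0 / exp 1 = 0" by (simp only: mult_eq_0_iff)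
 then have "y1 = exp 1 * y0 \<or> y1 = exp (-1) * y0" by (auto simp: exp_minus divide_inverse mult.commute)
 \<comment> \<open>The geodesic may run up or down the ray; \<open>s\<close> is its
   direction.\<close>
 then obtain s where s: "s \<in> {1, -1::real}" and y1: "y1 = exp s * y0" by blast
 have k: "k t = Complex 0 (y0 * exp (s * t))" for t
 proof -
  define E T w where "E = exp s" and "T = exp (s * t)" and "w = Im (k t)"
  have ET: "E > 0" "T > 0" "E\<^sup>2 - 1 \<noteq> 0" using s by (auto simp: E_def T_def simp flip: exp_double)
  have c: "2 * cosh t = T + 1 / T" "2 * cosh (t - 1) = T / E + E / T"
   using s by (auto simp: cosh_def exp_minus exp_diff E_def T_def inverse_eq_divide mult.commute)
  \<comment> \<open>The distance equations to \<open>k 0\<close> and \<open>k 1\<close>: their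
    difference is linear in \<open>w\<close>, and putting \<open>w\<close> back into the first
    forces the real part to vanish.\<close>
  have k1: "(Re (k t))\<^sup>2 + w\<^sup>2 + y0\<^sup>2 = w * y0 * (T + 1 / T)"
   using e0[of t] unfolding c w_def by (simp add: power2_eq_square algebra_simps)
  have k2: "(Re (k t))\<^sup>2 + w\<^sup>2 + y1\<^sup>2 = w * y1 * (T / E + E / T)"
   using e1[of t] unfolding c w_def by (simp add: power2_eq_square algebra_simps)
  have "y1\<^sup>2 - y0\<^sup>2 = w * y1 * (T / E + E / T) - w * y0 * (T + 1 / T)" using k1 k2 by simp
  moreover have "w * y1 * (T / E + E / T) - w * y0 * (T + 1 / T) = w * y0 * ((E\<^sup>2 - 1) / T)"
   unfolding y1 E_def[symmetric] using ET(1,2) by (simp add: power2_eq_square field_simps)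
  moreover have "y1\<^sup>2 - y0\<^sup>2 = y0\<^sup>2 * (E\<^sup>2 - 1)" unfolding y1 E_def by (simp add: power2_eq_square algebra_simps)
  ultimately have "y0\<^sup>2 * (E\<^sup>2 - 1) = w * y0 * ((E\<^sup>2 - 1) / T)" by simp
  then have "(y0 * (E\<^sup>2 - 1)) * y0 = (y0 * (E\<^sup>2 - 1)) * (w / T)" by (simp add: power2_eq_square ac_simps)
  moreover have "y0 * (E\<^sup>2 - 1) \<noteq> 0" using y ET by simp
  ultimately have "y0 = w / T" by (metis mult_left_cancel)
  then have w: "w = y0 * T" using ET by simp
  have "(Re (k t))\<^sup>2 = 0" using k1 ET unfolding w by (simp add: power2_eq_square field_simps)
  then show ?thesis using w by (simp add: complex_eq_iff w_def T_def)
 qed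
 have rk: "range k = imag_ray"
 proof
  show "range k \<subseteq> imag_ray" using y by (auto simp: imag_ray_def k)
  show "imag_ray \<subseteq> range k"
  proof
   fix w assume w: "w \<in> imag_ray"
   then have "w = k (s * ln (Im w / y0))" using s y by (auto simp: imag_ray_def complex_eq_iff k)
   then show "w \<in> range k" by blast
  qed
 qed
 obtain B where B: "B \<in> PSL2R" "\<And>x. A (B x) = x" "\<And>x. B (A x) = x" using PSL2R_inverse A by blast
 show ?thesis
 proof (rule that[OF B(1)])
  have "A (Fin (g t)) = Fin (k t)" for t using PSL2R_act(1)[OF A(1), of "g t"] g(1)[of t] by (simp add: k_def)
  then have "Fin (g t) = B (Fin (k t))" for t using B(3) by metis
  then show "Fin ` L = B ` Fin ` imag_ray" unfolding g(3) rk[symmetric] by (auto simp: image_iff)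
 qed
qed

subsection \<open>Conformal automorphisms\<close>

text \<open>Schwarz's lemma for the map and for its left inverse gives equality of norms at 1/2,
  which is the rigid case of the lemma.\<close>

lemma disc_automorphism_fixing_0:
 assumes f: "f holomorphic_on ball 0 1" "\<And>z. norm z < 1 \<Longrightarrow> norm (f z) < 1" "f 0 = 0"
  and g: "g holomorphic_on ball 0 1" "\<And>z. norm z < 1 \<Longrightarrow> norm (g z) < 1" "\<And>z. norm z < 1 \<Longrightarrow> g (f z) = z"
 obtains \<mu> where "norm \<mu> = 1" "\<And>z. norm z < 1 \<Longrightarrow> f z = \<mu> * z"
proof -
 have g0: "g 0 = 0" using g(3)[of 0] f(3) by simp
 have "norm (f (1/2)) \<le> norm (1/2 :: complex)" by (rule Schwarz_Lemma(1)[OF f(1,3,2)]) auto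
 moreover have "norm (g (f (1/2))) \<le> norm (f (1/2))" by (rule Schwarz_Lemma(1)[OF g(1) g0 g(2)]) (auto intro: f(2))
 ultimately have "norm (f (1/2)) = norm (1/2 :: complex)" using g(3)[of "1/2"] by simp
 then have "\<exists>\<alpha>. (\<forall>z. norm z < 1 \<longrightarrow> f z = \<alpha> * z) \<and> norm \<alpha> = 1"
  by (intro Schwarz_Lemma(3)[OF f(1,3,2), of 0]) (auto intro: exI[of _ "1/2"])
 then show ?thesis using that by blast
qed

definition cayley :: "complex \<Rightarrow> complex" where "cayley w = (w - \<i>) / (w + \<i>)"
definition cayley_inv :: "complex \<Rightarrow> complex" where "cayley_inv u = \<i> * (1 + u) / (1 - u)"

lemma cayley_ball: "norm (cayley w) < 1 \<longleftrightarrow> Im w > 0" if "w \<noteq> - \<i>"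
proof -
 have n: "w + \<i> \<noteq> 0" using that by (simp add: add_eq_0_iff2)
 have "norm (cayley w) < 1 \<longleftrightarrow> norm (w - \<i>) < norm (w + \<i>)" using n by (simp add: cayley_def norm_divide)
 also have "\<dots> \<longleftrightarrow> (norm (w - \<i>))\<^sup>2 < (norm (w + \<i>))\<^sup>2" by (auto intro!: power_strict_mono elim: power_less_imp_less_base)
 also have "\<dots> \<longleftrightarrow> Im w > 0" unfolding cmod_power2 by (simp add: power2_eq_square algebra_simps)
 finally show ?thesis .
qed

lemma Im_gt_not: "Im w > 0 \<Longrightarrow> w \<noteq> - \<i>" "Im w > 0 \<Longrightarrow> w + \<i> \<noteq> 0" by (auto simp: complex_eq_iff)

lemma cayley_less_1: "Im w > 0 \<Longrightarrow> norm (cayley w) < 1" using cayley_ball Im_gt_not by blast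

lemma cayley_inv_cayley: "Im w > 0 \<Longrightarrow> cayley_inv (cayley w) = w"
proof -
 assume w: "Im w > 0"
 have n: "w + \<i> \<noteq> 0" using Im_gt_not w by blast
 have "1 + cayley w = 2 * w / (w + \<i>)" "1 - cayley w = 2 * \<i> / (w + \<i>)" using n by (auto simp: cayley_def field_simps)
 then show ?thesis using n by (simp add: cayley_inv_def)
qed

lemma cayley_cayley_inv: "norm u < 1 \<Longrightarrow> cayley (cayley_inv u) = u" and cayley_inv_Im: "norm u < 1 \<Longrightarrow> Im (cayley_inv u) > 0"
proof -
 assume u: "norm u < 1"
 then have n: "1 - u \<noteq> 0" by auto
 have "cayley_inv u - \<i> = 2 * \<i> * u / (1 - u)" "cayley_inv u + \<i> = 2 * \<i> / (1 - u)" using n by (auto simp: cayley_inv_def field_simps)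
 then show c: "cayley (cayley_inv u) = u" using n by (simp add: cayley_def)
 have "cayley_inv u + \<i> \<noteq> 0" using \<open>cayley_inv u + \<i> = 2 * \<i> / (1 - u)\<close> n by simp
 then have "cayley_inv u \<noteq> - \<i>" by (metis add.left_inverse)
 then show "Im (cayley_inv u) > 0" using cayley_ball c u by metis
qed

lemma holomorphic_cayley: "cayley holomorphic_on {w. Im w > 0}" unfolding cayley_def using Im_gt_not by (intro holomorphic_intros) auto

lemma holomorphic_cayley_inv: "cayley_inv holomorphic_on ball 0 1" unfolding cayley_inv_def by (intro holomorphic_intros) auto

lemma Fin_in_upper_half [simp]: "Fin w \<in> upper_half \<longleftrightarrow> Im w > 0"
 and Fin_in_lower_half [simp]: "Fin w \<in> lower_half \<longleftrightarrow> Im w < 0" by (auto simp: upper_half_def lower_half_def)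

lemma conformal_upper_planar:
 assumes f: "conformal_map f upper_half V" and V: "Infty \<notin> V" shows "(\<lambda>w. affine (f (Fin w))) holomorphic_on {w. Im w > 0}"
proof (rule holomorphic_sphere_planar)
 show "holomorphic_sphere f upper_half" using f by (simp add: conformal_map_def)
 show "Fin w \<in> upper_half \<and> f (Fin w) \<noteq> Infty" if "w \<in> {w. Im w > 0}" for w
 proof -
  have u: "Fin w \<in> upper_half" using that by simp
  then have "f (Fin w) \<in> V" using f bij_betwE unfolding conformal_map_def by blast
  then show ?thesis using u V by auto
 qed
qed

text \<open>The Cayley map turns the automorphism into one of the disc fixing 0, hence into a
  rotation; the rotation is then identified with a real Moebius map.\<close>

lemma upper_half_automorphism_fixing_i:
 assumes f: "conformal_map f upper_half upper_half" and fi: "f (Fin \<i>) = Fin \<i>"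
 obtains A where "A \<in> PSL2R" "\<And>x. x \<in> upper_half \<Longrightarrow> f x = A x"
proof -
 have inf: "Infty \<notin> upper_half" by (auto simp: upper_half_def)
 define F where "F w = affine (f (Fin w))" for w
 define g where "g = inv_into upper_half f"
 have g: "conformal_map g upper_half upper_half" unfolding g_def by (rule conformal_map_inverse(3)[OF f])
 define G where "G w = affine (g (Fin w))" for w
 have bij: "bij_betw f upper_half upper_half" using f by (simp add: conformal_map_def)
 have fup: "f x \<in> upper_half" if "x \<in> upper_half" for x using bij_betwE[OF bij] that by blast
 have gup: "g x \<in> upper_half" if "x \<in> upper_half" for x using g bij_betwE that unfolding conformal_map_def by blast
 have F: "F holomorphic_on {w. Im w > 0}" "f (Fin w) = Fin (F w)" "Im (F w) > 0" if "Im w > 0" for w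
 proof -
  show "F holomorphic_on {w. Im w > 0}" unfolding F_def by (rule conformal_upper_planar[OF f inf])
  show "f (Fin w) = Fin (F w)" "Im (F w) > 0" using fup[of "Fin w"] that by (auto simp: F_def upper_half_def)
 qed
 have G: "G holomorphic_on {w. Im w > 0}" "g (Fin w) = Fin (G w)" "Im (G w) > 0" if "Im w > 0" for w
 proof -
  show "G holomorphic_on {w. Im w > 0}" unfolding G_def by (rule conformal_upper_planar[OF g inf])
  show "g (Fin w) = Fin (G w)" "Im (G w) > 0" using gup[of "Fin w"] that by (auto simp: G_def upper_half_def)
 qed
 have GF: "G (F w) = w" if "Im w > 0" for w
 proof -
  have "g (f (Fin w)) = Fin w" unfolding g_def by (rule bij_betw_inv_into_left[OF bij]) (use that in simp)
  then show ?thesis using F[OF that] G[of "F w"] by simp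
 qed
 have cF: "(\<lambda>u. cayley (H (cayley_inv u))) holomorphic_on ball 0 1"
  if H: "H holomorphic_on {w. Im w > 0}" "\<And>w. Im w > 0 \<Longrightarrow> Im (H w) > 0" for H
 proof -
  have "(\<lambda>u. H (cayley_inv u)) holomorphic_on ball 0 1"
   by (rule holomorphic_on_compose_gen[OF holomorphic_cayley_inv H(1), unfolded o_def]) (auto intro: cayley_inv_Im)
  then show ?thesis by (rule holomorphic_on_compose_gen[OF _ holomorphic_cayley, unfolded o_def]) (auto intro!: cayley_inv_Im H(2))
 qed
 obtain \<mu> where \<mu>: "norm \<mu> = 1" "\<And>u. norm u < 1 \<Longrightarrow> cayley (F (cayley_inv u)) = \<mu> * u"
 proof (rule disc_automorphism_fixing_0[of "\<lambda>u. cayley (F (cayley_inv u))" "\<lambda>u. cayley (G (cayley_inv u))"])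
  show "(\<lambda>u. cayley (F (cayley_inv u))) holomorphic_on ball 0 1" by (rule cF) (use F[of \<i>] F in auto)
  show "(\<lambda>u. cayley (G (cayley_inv u))) holomorphic_on ball 0 1" by (rule cF) (use G[of \<i>] G in auto)
  show "cayley (F (cayley_inv 0)) = 0" using fi by (simp add: cayley_inv_def cayley_def F_def)
  show "norm (cayley (F (cayley_inv z))) < 1" if "norm z < 1" for z using cayley_less_1[OF F(3)[OF cayley_inv_Im[OF that]]] .
  show "norm (cayley (G (cayley_inv z))) < 1" if "norm z < 1" for z using cayley_less_1[OF G(3)[OF cayley_inv_Im[OF that]]] .
  show "cayley (G (cayley_inv (cayley (F (cayley_inv z))))) = z" if "norm z < 1" for z
   using that cayley_inv_Im F GF cayley_inv_cayley cayley_cayley_inv by simp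
 qed (use that in blast)
 obtain \<theta> where \<theta>: "\<mu> = exp (\<i> * of_real (2 * \<theta>))"
 proof -
  have "\<mu> = exp (\<i> * of_real (2 * (Arg \<mu> / 2)))" using Arg_eq[of \<mu>] \<mu>(1) by (cases "\<mu> = 0") (auto simp: mult.commute)
  then show ?thesis using that by blast
 qed
 define C S where "C = cos \<theta>" and "S = sin \<theta>"
 have CS: "C\<^sup>2 + S\<^sup>2 = 1" by (simp add: C_def S_def)
 have "of_real C + \<i> * of_real S = exp (\<i> * of_real \<theta>)" by (simp add: exp_Euler cos_of_real sin_of_real C_def S_def)
 moreover have "\<mu> = exp (2 * (\<i> * of_real \<theta>))" unfolding \<theta> by (simp add: mult.left_commute)
 ultimately have l: "\<mu> = (of_real C + \<i> * of_real S)\<^sup>2" by (simp only: exp_double)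
 have l1: "(of_real C + \<i> * of_real S) * (of_real C - \<i> * of_real S) = (1::complex)"
  using CS by (simp add: algebra_simps power2_eq_square flip: of_real_mult of_real_add)
 \<comment> \<open>The rotation about \<i>. In the Cayley coordinate it multiplies by the square of
   \<open>C + \<i> * S\<close>, which is why \<theta> is half the argument of \<mu>.\<close>
 define A where "A = moebius (of_real C) (of_real S) (of_real (- S)) (of_real C)"
 have A: "A \<in> PSL2R" unfolding A_def by (rule moebius_PSL2R) (use CS in \<open>simp add: power2_eq_square\<close>)
 have Aw: "act A w = F w" if w: "Im w > 0" for w
 proof -
  have n: "of_real (- S) * w + of_real C \<noteq> 0"
   by (rule real_moebius_denominator[of C C S]) (use CS w in \<open>auto simp: power2_eq_square\<close>)
  let ?d = "of_real (- S) * w + of_real C"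
  have a: "act A w = (of_real C * w + of_real S) / ?d" using n by (simp add: A_def act_def)
  have Im: "Im (act A w) > 0" using PSL2R_act(2)[OF A, of w] w by (simp add: zero_less_mult_iff)
  have m: "act A w - \<i> = (of_real C + \<i> * of_real S) * (w - \<i>) / ?d" "act A w + \<i> = (of_real C - \<i> * of_real S) * (w + \<i>) / ?d"
   unfolding a using n by (auto simp: field_simps)
  have "cayley (act A w) = (of_real C + \<i> * of_real S) * (w - \<i>) / ((of_real C - \<i> * of_real S) * (w + \<i>))"
   unfolding cayley_def m using n by simp
  also have "\<dots> = (of_real C + \<i> * of_real S) / (of_real C - \<i> * of_real S) * cayley w" by (simp add: cayley_def)
  also have "(of_real C + \<i> * of_real S) / (of_real C - \<i> * of_real S) = \<mu>"
  proof -
   have n: "of_real C - \<i> * of_real S \<noteq> (0::complex)" using l1 by auto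
   have "(of_real C + \<i> * of_real S) / (of_real C - \<i> * of_real S)
     = (of_real C + \<i> * of_real S) * ((of_real C + \<i> * of_real S) * (of_real C - \<i> * of_real S)) / (of_real C - \<i> * of_real S)"
    unfolding l1 by simp
   then show ?thesis using n by (simp add: l power2_eq_square)
  qed
  also have "\<mu> * cayley w = cayley (F w)" using \<mu>(2)[OF cayley_less_1[OF w]] cayley_inv_cayley[OF w] by simp
  finally show ?thesis using cayley_inv_cayley Im F(3)[OF w] by metis
 qed
 show ?thesis
 proof (rule that[OF A])
  fix x assume "x \<in> upper_half"
  then obtain w where w: "x = Fin w" "Im w > 0" by (auto simp: upper_half_def)
  then show "f x = A x" using F(2) Aw PSL2R_act(1)[OF A, of w] by simp
 qed
qed

lemma upper_half_automorphism:
 assumes f: "conformal_map f upper_half upper_half"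
 obtains A where "A \<in> PSL2R" "\<And>x. x \<in> upper_half \<Longrightarrow> f x = A x"
proof -
 have "f (Fin \<i>) \<in> upper_half" using f bij_betwE unfolding conformal_map_def by fastforce
 then obtain v where v: "f (Fin \<i>) = Fin v" "Im v > 0" by (auto simp: upper_half_def)
 \<comment> \<open>The real affine map taking \<i> to its image \<open>v\<close> reduces to the case
   of a fixed \<i>.\<close>
 define B where "B = moebius (of_real (Im v)) (of_real (Re v)) (of_real 0) (of_real 1)"
 have B: "B \<in> PSL2R" unfolding B_def by (rule moebius_PSL2R) (use v in simp)
 have Bi: "B (Fin \<i>) = Fin v" by (simp add: B_def complex_eq_iff)
 obtain B' where B': "B' \<in> PSL2R" "\<And>x. B (B' x) = x" "\<And>x. B' (B x) = x" using PSL2R_inverse B by blast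
 obtain A where A: "A \<in> PSL2R" "\<And>x. x \<in> upper_half \<Longrightarrow> B' (f x) = A x"
 proof (rule upper_half_automorphism_fixing_i)
  show "conformal_map (\<lambda>x. B' (f x)) upper_half upper_half" by (rule conformal_map_compose[OF f PSL2R_conformal_half(1)[OF B'(1)]])
  show "B' (f (Fin \<i>)) = Fin \<i>" using v Bi B' by metis
 qed (rule that)
 show ?thesis by (rule that[OF PSL2R_comp[OF B A(1)]]) (use A B' in \<open>metis comp_apply\<close>)
qed

text \<open>Conjugation by \<open>w \<mapsto> - w\<close> exchanges the half-planes and only changes
  the signs of the off-diagonal entries, so it preserves \<open>PSL2R\<close>.\<close>

lemma lower_half_automorphism:
 assumes f: "conformal_map f lower_half lower_half"
 obtains A where "A \<in> PSL2R" "\<And>x. x \<in> lower_half \<Longrightarrow> f x = A x"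
proof -
 define N where "N = moebius (-1) 0 0 1"
 have N: "N \<in> PSL2C" unfolding N_def by (rule moebius_PSL2C) simp
 have NN: "N (N x) = x" for x unfolding N_def by (cases x) auto
 have Nul: "N x \<in> lower_half \<longleftrightarrow> x \<in> upper_half" for x by (cases x) (auto simp: N_def upper_half_def lower_half_def)
 have Nlu: "N x \<in> upper_half \<longleftrightarrow> x \<in> lower_half" for x using Nul[of "N x"] NN by simp
 have c1: "conformal_map N upper_half lower_half" "conformal_map N lower_half upper_half" unfolding conformal_simps
  using holomorphic_sphere_PSL2C[OF N] open_upper_half open_lower_half PSL2C_inj[OF N] Nul Nlu NN by (auto simp: image_iff) (metis NN Nul Nlu)+
 have "conformal_map (\<lambda>x. N (f (N x))) upper_half upper_half" by (rule conformal_map_compose[OF conformal_map_compose[OF c1(1) f] c1(2)])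
 then obtain A where A: "A \<in> PSL2R" "\<And>x. x \<in> upper_half \<Longrightarrow> N (f (N x)) = A x"
  by (rule upper_half_automorphism) (rule that)
 obtain a b c d :: real where
  abcd: "A = moebius (of_real a) (of_real b) (of_real c) (of_real d)" "a * d - b * c = 1" using A by (auto simp: PSL2R_def)
 have cn: "complex_of_real a * of_real d - of_real b * of_real c \<noteq> 0" using abcd by (metis of_real_1 of_real_diff of_real_mult zero_neq_one)
 define A' where "A' = moebius (of_real a) (of_real (- b)) (of_real (- c)) (of_real d)"
 have A': "A' \<in> PSL2R" unfolding A'_def by (rule moebius_PSL2R) (use abcd in simp)
 have NA: "N (A (N x)) = A' x" for x
 proof -
  have "A (N x) = moebius (- of_real a) (of_real b) (- of_real c) (of_real d) x" unfolding N_def abcd(1) using cn by (subst moebius_compose) auto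
  also have "N \<dots> = moebius (of_real a) (- of_real b) (- of_real c) (of_real d) x"
   unfolding N_def using cn by (subst moebius_compose) (auto simp: algebra_simps)
  finally show ?thesis by (simp add: A'_def)
 qed
 show ?thesis
 proof (rule that[OF A'])
  fix x assume "x \<in> lower_half"
  then have "N (f (N (N x))) = A (N x)" using A(2) Nlu by blast
  then show "f x = A' x" using NA NN by metis
 qed
qed

section \<open>Charts across a geodesic arc\<close>

definition right_quadrant :: "complex set" where "right_quadrant = {w. Re w > 0 \<and> Im w > 0}"
definition left_quadrant :: "complex set" where "left_quadrant = {w. Re w < 0 \<and> Im w > 0}"

text \<open>Squaring opens the two quadrants to the two half-planes and folds nothing over: the
  imaginary ray between them goes to the negative real axis.\<close>

definition square :: "riemann_sphere \<Rightarrow> riemann_sphere" where "square x = Fin ((affine x)\<^sup>2)"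

lemma square_holomorphic: "holomorphic_sphere square upper_half"
proof -
 have "holomorphic_sphere (\<lambda>x. Fin ((\<lambda>w. w\<^sup>2) (affine x))) (Fin ` {w. Im w > 0})"
  by (rule holomorphic_sphere_Fin) (auto intro!: holomorphic_intros simp: open_halfspace_Im_gt)
 then show ?thesis by (simp add: upper_half_def square_def[abs_def])
qed

lemma square_inj: "inj_on square upper_half" by (rule inj_onI) (auto simp: upper_half_def square_def power2_eq_iff)

lemma square_right: "square ` Fin ` right_quadrant = upper_half"
proof
 show "square ` Fin ` right_quadrant \<subseteq> upper_half" by (auto simp: square_def right_quadrant_def upper_half_def power2_eq_square)
 show "upper_half \<subseteq> square ` Fin ` right_quadrant"
 proof
  fix x assume "x \<in> upper_half"
  then obtain z where z: "x = Fin z" "Im z > 0" by (auto simp: upper_half_def)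
  define w where "w = csqrt z"
  have w: "w\<^sup>2 = z" by (simp add: w_def)
  have "Im (w\<^sup>2) > 0" using z w by simp
  then have "Re w * Im w > 0" by (simp add: power2_eq_square mult.commute)
  moreover have "Re w \<ge> 0" using csqrt_principal[of z] by (auto simp: w_def)
  ultimately have "w \<in> right_quadrant" by (auto simp: right_quadrant_def zero_less_mult_iff)
  moreover have "x = square (Fin w)" using z w by (simp add: square_def)
  ultimately show "x \<in> square ` Fin ` right_quadrant" by blast
 qed
qed

lemma square_left: "square ` Fin ` left_quadrant = lower_half"
proof
 show "square ` Fin ` left_quadrant \<subseteq> lower_half"
  by (auto simp: square_def left_quadrant_def lower_half_def power2_eq_square mult_less_0_iff)
 show "lower_half \<subseteq> square ` Fin ` left_quadrant"
 proof
  fix x assume "x \<in> lower_half"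
  then obtain z where z: "x = Fin z" "Im z < 0" by (auto simp: lower_half_def)
  define w where "w = csqrt z"
  have w: "w\<^sup>2 = z" by (simp add: w_def)
  have "Im (w\<^sup>2) < 0" using z w by simp
  then have "Re w * Im w < 0" by (simp add: power2_eq_square mult.commute)
  moreover have "Re w \<ge> 0" using csqrt_principal[of z] by (auto simp: w_def)
  ultimately have "- w \<in> left_quadrant" by (auto simp: left_quadrant_def mult_less_0_iff)
  moreover have "x = square (Fin (- w))" using z w by (simp add: square_def)
  ultimately show "x \<in> square ` Fin ` left_quadrant" by blast
 qed
qed

lemma quadrants:
 "upper_half = Fin ` imag_ray \<union> Fin ` right_quadrant \<union> Fin ` left_quadrant"
 "imag_ray \<inter> right_quadrant = {}" "imag_ray \<inter> left_quadrant = {}" "right_quadrant \<inter> left_quadrant = {}"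
proof -
 have "{w. Im w > 0} = imag_ray \<union> right_quadrant \<union> left_quadrant"
  by (rule Set.set_eqI) (simp add: imag_ray_def right_quadrant_def left_quadrant_def; linarith)
 then show "upper_half = Fin ` imag_ray \<union> Fin ` right_quadrant \<union> Fin ` left_quadrant" by (simp add: upper_half_def image_Un)
qed (auto simp: imag_ray_def right_quadrant_def left_quadrant_def)

lemma open_quadrants: "open right_quadrant" "open left_quadrant" and connected_quadrants: "connected right_quadrant" "connected left_quadrant"
 and quadrants_nonempty: "right_quadrant \<noteq> {}" "left_quadrant \<noteq> {}"
proof -
 have r: "right_quadrant = {w. Re w > 0} \<inter> {w. Im w > 0}" and l: "left_quadrant = {w. Re w < 0} \<inter> {w. Im w > 0}"
  by (auto simp: right_quadrant_def left_quadrant_def)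
 show "open right_quadrant" "open left_quadrant" unfolding r l
  by (auto intro!: open_Int simp: open_halfspace_Im_gt open_halfspace_Re_gt open_halfspace_Re_lt)
 show "connected right_quadrant" "connected left_quadrant" unfolding r l
  by (auto intro!: convex_connected convex_Int simp: convex_halfspace_Im_gt convex_halfspace_Re_gt convex_halfspace_Re_lt)
 have "Complex 1 1 \<in> right_quadrant" "Complex (-1) 1 \<in> left_quadrant" by (auto simp: right_quadrant_def left_quadrant_def)
 then show "right_quadrant \<noteq> {}" "left_quadrant \<noteq> {}" by blast+
qed

lemma components_two:
 fixes A B :: "'a::topological_space set"
 assumes "open A" "open B" "connected A" "connected B" "A \<inter> B = {}" "A \<noteq> {}" "B \<noteq> {}" shows "components (A \<union> B) = {A, B}"
proof -
 have *: "C \<subseteq> A \<or> C \<subseteq> B" if "connected C" "C \<subseteq> A \<union> B" for C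
 proof (rule ccontr)
  assume "\<not> ?thesis"
  then have "A \<inter> C \<noteq> {}" "B \<inter> C \<noteq> {}" using that by auto
  then show False using connectedD[OF that(1) assms(1,2)] assms(5) that(2) by auto
 qed
 have A: "A \<in> components (A \<union> B)" unfolding in_components_maximal using assms * by (auto; blast)
 have B: "B \<in> components (A \<union> B)" unfolding in_components_maximal using assms * by (auto; blast)
 have "C = A \<or> C = B" if C: "C \<in> components (A \<union> B)" for C
 proof -
  have "C \<subseteq> A \<or> C \<subseteq> B" using C * by (simp add: in_components_connected in_components_subset)
  then show ?thesis using C assms unfolding in_components_maximal by (metis Un_upper1 Un_upper2)
 qed
 then show ?thesis using A B by auto
qed

text \<open>A real Moebius map moves the geodesic to the imaginary ray. The ray cuts the half-plane
  into two quadrants, and their images are open, connected and disjoint, so they are exactly the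
  components of the complement of the curve.\<close>

lemma geodesic_chart:
 assumes D: "hyperbolic_geodesic (- \<gamma> \<union> a) a" and a: "a \<subseteq> \<gamma>" and \<Omega>: "\<Omega> \<in> components (- \<gamma>)"
 obtains \<phi> where "conformal_map \<phi> upper_half (- \<gamma> \<union> a)" "\<phi> ` Fin ` imag_ray = a"
  "\<phi> ` Fin ` right_quadrant = \<Omega>" "\<phi> ` Fin ` left_quadrant = - \<gamma> - \<Omega>" "components (- \<gamma>) = {\<Omega>, - \<gamma> - \<Omega>}"
proof -
 obtain \<phi>0 L where \<phi>0: "conformal_map \<phi>0 upper_half (- \<gamma> \<union> a)" "geodesic_line L" "a = \<phi>0 ` Fin ` L"
  using D unfolding hyperbolic_geodesic_def by blast
 obtain A where A: "A \<in> PSL2R" "Fin ` L = A ` Fin ` imag_ray" using geodesic_line_image \<phi>0 by blast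
 have char: "conformal_map (\<lambda>x. \<phi>0 (B x)) upper_half (- \<gamma> \<union> a)" if "B \<in> PSL2R" for B
  by (rule conformal_map_compose[OF PSL2R_conformal_half(1)[OF that] \<phi>0(1)])
 have *: "\<exists>P Q. \<phi> ` Fin ` right_quadrant = P \<and> \<phi> ` Fin ` left_quadrant = Q \<and> components (- \<gamma>) = {P, Q} \<and> Q = - \<gamma> - P \<and> P = - \<gamma> - Q"
  if \<phi>: "conformal_map \<phi> upper_half (- \<gamma> \<union> a)" "\<phi> ` Fin ` imag_ray = a" for \<phi>
 proof -
  have inj: "inj_on \<phi> upper_half" and im: "\<phi> ` upper_half = - \<gamma> \<union> a" and hol: "holomorphic_sphere \<phi> upper_half"
   using \<phi>(1) by (auto simp: conformal_simps)
  define R L where R: "R = \<phi> ` Fin ` right_quadrant" and L: "L = \<phi> ` Fin ` left_quadrant"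
  have sub: "Fin ` right_quadrant \<subseteq> upper_half" "Fin ` left_quadrant \<subseteq> upper_half" "Fin ` imag_ray \<subseteq> upper_half"
   using quadrants(1) by auto
  have all: "- \<gamma> \<union> a = a \<union> R \<union> L" using im \<phi>(2) unfolding quadrants(1) R L by (simp add: image_Un)
  have d: "Fin ` X \<inter> Fin ` Y = {}" if "X \<inter> Y = {}" for X Y using that by auto
  have dis: "a \<inter> R = {}" "a \<inter> L = {}" "R \<inter> L = {}" unfolding \<phi>(2)[symmetric] R L
   using inj_on_image_Int[OF inj] sub d quadrants(2-4) by (metis image_empty)+
  have eq: "- \<gamma> = R \<union> L" using all dis a by auto
  have "components (R \<union> L) = {R, L}"
  proof (rule components_two)
   show "open R" "open L" unfolding R L by (intro open_image_inj_holomorphic[OF hol inj] sub; simp add: open_Fin_image_iff open_quadrants)+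
   have c: "continuous_on S \<phi>" if "S \<subseteq> upper_half" for S
    using holomorphic_sphere_continuous[OF hol] that continuous_on_subset by blast
   show "connected R" "connected L" unfolding R L by (intro connected_continuous_image c sub continuous_on_Fin connected_quadrants)+
  qed (use dis quadrants_nonempty R L in auto)
  then have comp: "components (- \<gamma>) = {R, L}" unfolding eq .
  have "L = - \<gamma> - R" "R = - \<gamma> - L" unfolding eq using dis(3) by auto
  then show ?thesis unfolding R[symmetric] L[symmetric] using comp by (intro exI[of _ R] exI[of _ L] conjI refl)
 qed
 define \<phi> where "\<phi> x = \<phi>0 (A x)" for x
 have \<phi>: "conformal_map \<phi> upper_half (- \<gamma> \<union> a)" unfolding \<phi>_def by (rule char[OF A(1)])
 have \<phi>a: "\<phi> ` Fin ` imag_ray = a" unfolding \<phi>_def \<phi>0(3) A(2) by (simp add: image_image)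
 obtain P Q where PQ: "\<phi> ` Fin ` right_quadrant = P" "\<phi> ` Fin ` left_quadrant = Q" "components (- \<gamma>) = {P, Q}"
  "Q = - \<gamma> - P" "P = - \<gamma> - Q" using *[OF \<phi> \<phi>a] by (elim exE conjE) (rule that)
 show ?thesis
 proof (cases "\<Omega> = P")
  case True
  show ?thesis by (rule that[OF \<phi> \<phi>a]) (simp_all only: True PQ(1,2,3) flip: PQ(4))
 next
  case False
  then have Q: "\<Omega> = Q" using False \<Omega> unfolding PQ(3) by auto
  \<comment> \<open>If \<Omega> is the image of the left quadrant,
    \<open>w \<mapsto> - 1 / w\<close> swaps the quadrants while keeping the ray.\<close>
  define J where "J = moebius (of_real 0) (of_real (- 1)) (of_real 1) (of_real 0)"
  have J: "J \<in> PSL2R" unfolding J_def by (rule moebius_PSL2R) simp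
  have Jw: "J (Fin w) = Fin (- 1 / w)" if "Im w > 0" for w using that by (auto simp: J_def)
  have Re: "Re (- 1 / w) = - Re w / (cmod w)\<^sup>2" "Im (- 1 / w) = Im w / (cmod w)\<^sup>2" for w
   by (simp_all add: Re_divide Im_divide cmod_power2)
  have n0: "(cmod w)\<^sup>2 > 0" if "Im w > 0" for w using that by (auto simp: complex_eq_iff)
  have JJ: "J (J (Fin w)) = Fin w" if "Im w > 0" for w using that by (auto simp: J_def)
  have step: "J ` Fin ` S = Fin ` T" if ST: "\<And>w. w \<in> S \<Longrightarrow> Im w > 0 \<and> - 1 / w \<in> T" "\<And>w. w \<in> T \<Longrightarrow> Im w > 0 \<and> - 1 / w \<in> S" for S T
  proof
   show "J ` Fin ` S \<subseteq> Fin ` T" using ST(1) Jw by auto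
   show "Fin ` T \<subseteq> J ` Fin ` S"
   proof
    fix x assume "x \<in> Fin ` T"
    then obtain w where w: "w \<in> T" "x = Fin w" by auto
    then have "x = J (Fin (- 1 / w))" using JJ[of w] Jw[of w] ST(2)[of w] by simp
    then show "x \<in> J ` Fin ` S" using ST(2) w by blast
   qed
  qed
  have Jr: "J ` Fin ` right_quadrant = Fin ` left_quadrant" and Jl: "J ` Fin ` left_quadrant = Fin ` right_quadrant"
   and Ji: "J ` Fin ` imag_ray = Fin ` imag_ray"
   by (rule step; use n0 Re in \<open>force simp: right_quadrant_def left_quadrant_def imag_ray_def divide_less_0_iff zero_less_divide_iff\<close>)+
  define \<phi>' where "\<phi>' x = \<phi> (J x)" for x
  have "conformal_map \<phi>' upper_half (- \<gamma> \<union> a)" unfolding \<phi>'_def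
   by (rule conformal_map_compose[OF PSL2R_conformal_half(1)[OF J] \<phi>])
  moreover have "\<phi>' ` S = \<phi> ` J ` S" for S unfolding \<phi>'_def by (simp add: image_image)
  moreover have "components (- \<gamma>) = {\<Omega>, - \<gamma> - \<Omega>}" unfolding Q PQ(3) using PQ(5) by (metis insert_commute)
  moreover have "P = - \<gamma> - \<Omega>" unfolding Q by (rule PQ(5))
  ultimately show ?thesis by (intro that[of \<phi>']) (simp_all only: Jr Jl Ji \<phi>a PQ(1,2) Q)
 qed
qed

text \<open>On \<Omega> the square of \<psi> already maps onto the upper half-plane, so it differs
  from the inverse of \<open>f\<close> by an automorphism \<open>A\<close> of the half-plane.
  \<open>B\<close> undoes \<open>A\<close>, and the product continues across the arc.\<close>

lemma conformal_extension:
 assumes D: "hyperbolic_geodesic (- \<gamma> \<union> a) a" and a: "a \<subseteq> \<gamma>" and \<Omega>: "\<Omega> \<in> components (- \<gamma>)"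
  and f: "conformal_map f upper_half \<Omega>"
 obtains \<psi> g B where "conformal_map \<psi> (- \<gamma> \<union> a) upper_half" "\<psi> ` a = Fin ` imag_ray"
  "\<psi> ` \<Omega> = Fin ` right_quadrant" "\<psi> ` (- \<gamma> - \<Omega>) = Fin ` left_quadrant"
  "B \<in> PSL2R" "\<And>x. g x = B (square (\<psi> x))"
  "conformal_map g (- \<gamma> \<union> a) (upper_half \<union> lower_half \<union> g ` a)" "\<And>w. w \<in> upper_half \<Longrightarrow> g (f w) = w"
  "g ` \<Omega> = upper_half" "g ` (- \<gamma> - \<Omega>) = lower_half"
proof -
 obtain \<phi> where \<phi>: "conformal_map \<phi> upper_half (- \<gamma> \<union> a)" "\<phi> ` Fin ` imag_ray = a"
  "\<phi> ` Fin ` right_quadrant = \<Omega>" "\<phi> ` Fin ` left_quadrant = - \<gamma> - \<Omega>"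
  by (rule geodesic_chart[OF D a \<Omega>]) (rule that)
 have inj\<phi>: "inj_on \<phi> upper_half" using \<phi>(1) by (simp add: conformal_simps)
 define \<psi> where "\<psi> = inv_into upper_half \<phi>"
 have \<psi>: "conformal_map \<psi> (- \<gamma> \<union> a) upper_half" unfolding \<psi>_def by (rule conformal_map_inverse(3)[OF \<phi>(1)])
 have \<psi>im: "\<psi> ` \<phi> ` S = S" if "S \<subseteq> upper_half" for S
  unfolding \<psi>_def using inj\<phi> that by (simp add: inv_into_image_cancel)
 have sub: "Fin ` right_quadrant \<subseteq> upper_half" "Fin ` left_quadrant \<subseteq> upper_half" "Fin ` imag_ray \<subseteq> upper_half"
  using quadrants(1) by auto
 have \<psi>a: "\<psi> ` a = Fin ` imag_ray" "\<psi> ` \<Omega> = Fin ` right_quadrant" "\<psi> ` (- \<gamma> - \<Omega>) = Fin ` left_quadrant"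
  using \<psi>im[OF sub(3)] \<psi>im[OF sub(1)] \<psi>im[OF sub(2)] \<phi>(2-4) by simp_all
 have \<Omega>sub: "\<Omega> \<subseteq> - \<gamma>" using \<Omega> in_components_subset by blast
 have o\<Omega>: "open \<Omega>" using conformal_map_inverse(2)[OF f] .
 have c1: "conformal_map \<psi> \<Omega> (Fin ` right_quadrant)" using conformal_map_subset[OF \<psi> _ o\<Omega>] \<Omega>sub \<psi>a(2) by auto
 have c2: "conformal_map square (Fin ` right_quadrant) upper_half" unfolding conformal_simps
  using holomorphic_sphere_subset[OF square_holomorphic sub(1)] open_quadrants square_right inj_on_subset[OF square_inj sub(1)]
  by (auto simp: open_Fin_image_iff)
 have "conformal_map (\<lambda>w. square (\<psi> (f w))) upper_half upper_half" by (rule conformal_map_compose[OF conformal_map_compose[OF f c1] c2])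
 then obtain A where A: "A \<in> PSL2R" "\<And>w. w \<in> upper_half \<Longrightarrow> square (\<psi> (f w)) = A w"
  by (rule upper_half_automorphism) (rule that)
 obtain B where B: "B \<in> PSL2R" "\<And>x. A (B x) = x" "\<And>x. B (A x) = x" using PSL2R_inverse A by blast
 have BC: "B \<in> PSL2C" using B PSL2R_subset_PSL2C by blast
 define g where "g x = B (square (\<psi> x))" for x
 have gim: "g ` S = B ` square ` \<psi> ` S" for S by (simp add: g_def image_image)
 have gup: "g ` \<Omega> = upper_half" "g ` (- \<gamma> - \<Omega>) = lower_half"
  unfolding gim \<psi>a square_right square_left using PSL2R_half[OF B(1)] by auto
 have \<psi>b: "bij_betw \<psi> (- \<gamma> \<union> a) upper_half" and \<psi>h: "holomorphic_sphere \<psi> (- \<gamma> \<union> a)"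
  using \<psi> by (auto simp: conformal_map_def)
 show ?thesis
 proof (rule that[OF \<psi> \<psi>a B(1) g_def _ _ gup])
  show "conformal_map g (- \<gamma> \<union> a) (upper_half \<union> lower_half \<union> g ` a)" unfolding conformal_simps
  proof (intro conjI)
   show "holomorphic_sphere g (- \<gamma> \<union> a)" unfolding g_def
    by (intro holomorphic_sphere_PSL2C_comp[OF holomorphic_sphere_compose[OF \<psi>h square_holomorphic] BC])
     (use \<psi>b in \<open>auto simp: bij_betw_def\<close>)
   show "inj_on g (- \<gamma> \<union> a)"
   proof (rule inj_onI)
    fix x y assume xy: "x \<in> - \<gamma> \<union> a" "y \<in> - \<gamma> \<union> a" "g x = g y"
    then have "square (\<psi> x) = square (\<psi> y)" using PSL2C_inj[OF BC, of UNIV] by (auto simp: g_def dest: injD)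
    then have "\<psi> x = \<psi> y" using square_inj xy \<psi>b by (meson bij_betwE inj_onD)
    then show "x = y" using xy \<psi>b by (meson bij_betw_def inj_onD)
   qed
   have "- \<gamma> \<union> a = \<Omega> \<union> (- \<gamma> - \<Omega>) \<union> a" using \<Omega>sub by auto
   then show "g ` (- \<gamma> \<union> a) = upper_half \<union> lower_half \<union> g ` a" using gup by (metis image_Un)
  qed
  show "g (f w) = w" if "w \<in> upper_half" for w using A(2)[OF that] B(3) by (simp add: g_def)
 qed
qed

text \<open>The geodesic chart itself uniformizes the side, after a branch of the square root has
  taken the half-plane to the right quadrant.\<close>

lemma geodesic_side_conformal:
 assumes D: "hyperbolic_geodesic (- \<gamma> \<union> a) a" and a: "a \<subseteq> \<gamma>" and \<Omega>: "\<Omega> \<in> components (- \<gamma>)"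
 obtains f where "conformal_map f upper_half \<Omega>"
proof -
 obtain \<phi> where \<phi>: "conformal_map \<phi> upper_half (- \<gamma> \<union> a)" "\<phi> ` Fin ` right_quadrant = \<Omega>"
  by (rule geodesic_chart[OF D a \<Omega>]) (rule that)
 have sub: "Fin ` right_quadrant \<subseteq> upper_half" using quadrants(1) by auto
 have c2: "conformal_map square (Fin ` right_quadrant) upper_half" unfolding conformal_simps
  using holomorphic_sphere_subset[OF square_holomorphic sub] open_quadrants square_right inj_on_subset[OF square_inj sub]
  by (auto simp: open_Fin_image_iff)
 have c1: "conformal_map \<phi> (Fin ` right_quadrant) \<Omega>"
  using conformal_map_subset[OF \<phi>(1) sub] open_quadrants \<phi>(2) by (auto simp: open_Fin_image_iff)
 show ?thesis by (rule that, rule conformal_map_compose[OF conformal_map_inverse(3)[OF c2] c1])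
qed

section \<open>Arcs of a Jordan curve\<close>

text \<open>Finitely many disjoint relatively closed sets are also relatively open in their union,
  so a connected subset meets only one of them.\<close>

lemma components_closed_family:
 assumes I: "finite I" and con: "\<And>i. i \<in> I \<Longrightarrow> connected (a i)" and ne: "\<And>i. i \<in> I \<Longrightarrow> a i \<noteq> {}"
  and cl: "\<And>i. i \<in> I \<Longrightarrow> closedin (top_of_set (\<Union>i\<in>I. a i)) (a i)"
  and dis: "\<And>i j. i \<in> I \<Longrightarrow> j \<in> I \<Longrightarrow> i \<noteq> j \<Longrightarrow> a i \<inter> a j = {}"
 shows "components (\<Union>i\<in>I. a i) = a ` I"
proof -
 let ?S = "\<Union>i\<in>I. a i"
 have *: "d \<subseteq> a i" if d: "connected d" "d \<subseteq> ?S" "i \<in> I" "d \<inter> a i \<noteq> {}" for d i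
 proof -
  have "closedin (top_of_set ?S) (\<Union>j\<in>I - {i}. a j)" by (rule closedin_Union) (use I cl in auto)
  moreover have "?S - a i = (\<Union>j\<in>I - {i}. a j)"
  proof
   show "?S - a i \<subseteq> (\<Union>j\<in>I - {i}. a j)" by auto
   show "(\<Union>j\<in>I - {i}. a j) \<subseteq> ?S - a i" using dis[OF d(3)] by blast
  qed
  ultimately obtain T' where T': "closed T'" "?S - a i = ?S \<inter> T'" by (auto simp: closedin_closed)
  obtain T where T: "closed T" "a i = ?S \<inter> T" using cl[OF d(3)] by (auto simp: closedin_closed)
  have "d \<inter> a i = d \<inter> T" using d(2) by (subst T(2)) blast
  moreover have "d - d \<inter> a i = d \<inter> (?S - a i)" using d(2) by blast
  then have "d - d \<inter> a i = d \<inter> T'" unfolding T'(2) using d(2) by blast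
  ultimately have "closedin (top_of_set d) (d \<inter> a i)" "closedin (top_of_set d) (d - d \<inter> a i)"
   using T(1) T'(1) by (metis closedin_closed_Int)+
  then have "d \<inter> a i = {} \<or> d \<inter> a i = d" using d(1)[unfolded connected_clopen, rule_format, of "d \<inter> a i"]
   by (simp add: openin_closedin_eq)
  then show ?thesis using d(4) by auto
 qed
 have in_comp: "a i \<in> components ?S" if i: "i \<in> I" for i unfolding in_components_maximal
 proof (intro conjI allI impI)
  fix D assume D: "D \<noteq> {} \<and> a i \<subseteq> D \<and> D \<subseteq> ?S \<and> connected D"
  then have "D \<inter> a i \<noteq> {}" using ne[OF i] by auto
  then show "D = a i" using *[of D i] D i by auto
 qed (use i con ne in auto)
 show ?thesis
 proof
  show "a ` I \<subseteq> components ?S" using in_comp by auto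
  show "components ?S \<subseteq> a ` I"
  proof
   fix C assume C: "C \<in> components ?S"
   then have C': "C \<noteq> {}" "C \<subseteq> ?S" "connected C" unfolding in_components_maximal by auto
   then obtain x where x: "x \<in> C" by blast
   then obtain i where i0: "i \<in> I" "x \<in> a i" using C'(2) by blast
   then have i: "i \<in> I" "C \<inter> a i \<noteq> {}" using x by blast+
   then have "C \<subseteq> a i" using * C' by blast
   moreover have "a i \<noteq> {} \<and> C \<subseteq> a i \<and> a i \<subseteq> ?S \<and> connected (a i)" using con ne i \<open>C \<subseteq> a i\<close> by auto
   ultimately have "a i = C" using C unfolding in_components_maximal by blast
   then show "C \<in> a ` I" using i by blast
  qed
 qed
qed

lemma next_index_in: "n \<ge> 1 \<Longrightarrow> k \<in> {1..n} \<Longrightarrow> next_index n k \<in> {1..n}" by (auto simp: next_index_def)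

text \<open>This is where three marked points are used: with two, both arcs have the same pair of
  end points and the definite description of an arc fails.\<close>

lemma next_index_2_cycle: "n \<ge> 3 \<Longrightarrow> k \<in> {1..n} \<Longrightarrow> j \<in> {1..n} \<Longrightarrow>
  {k, next_index n k} \<subseteq> {j, next_index n j} \<Longrightarrow> j = k" by (auto simp: next_index_def split: if_splits)

lemma increasing_timesD:
 assumes "increasing_times n t"
 shows "j \<in> {1..n} \<Longrightarrow> k \<in> {1..n} \<Longrightarrow> j < k \<Longrightarrow> t j < t k" "k \<in> {1..n} \<Longrightarrow> t k \<in> {0..<1}"
 using assms unfolding increasing_times_def by (blast intro: strict_mono_onD)+

text \<open>With the first marked point at parameter 0 every arc is the image of one parameter
  interval, and none wraps around.\<close>

lemma jordan_param_shift:
 assumes q: "jordan_param q \<gamma>" and n: "n \<ge> 1" and t: "increasing_times n t" "\<And>k. k \<in> {1..n} \<Longrightarrow> q (t k) = z k"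
 obtains t' where "jordan_param (shiftpath (t 1) q) \<gamma>" "increasing_times n t'"
  "\<And>k. k \<in> {1..n} \<Longrightarrow> shiftpath (t 1) q (t' k) = z k" "t' 1 = 0" "t 1 \<in> {0..<1}"
proof (rule that)
 have t1: "t 1 \<in> {0..<1}" and tk: "\<And>k. k \<in> {1..n} \<Longrightarrow> t k \<in> {0..<1}"
  using increasing_timesD(2)[OF t(1)] n by (force, blast)
 show "t 1 \<in> {0..<1}" by (rule t1)
 have mono: "\<And>j k. j \<in> {1..n} \<Longrightarrow> k \<in> {1..n} \<Longrightarrow> j < k \<Longrightarrow> t j < t k"
  using increasing_timesD(1)[OF t(1)] .
 have le: "t 1 \<le> t k" if "k \<in> {1..n}" for k using mono[of 1 k] that n by (cases "k = 1") auto
 have q': "simple_path q" "pathfinish q = pathstart q" "path_image q = \<gamma>" using q by (auto simp: jordan_param_def)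
 show "jordan_param (shiftpath (t 1) q) \<gamma>" unfolding jordan_param_def using q' t1
  by (auto intro!: simple_path_shiftpath simp: path_image_shiftpath closed_shiftpath)
 show "increasing_times n (\<lambda>k. t k - t 1)" unfolding increasing_times_def
 proof
  show "strict_mono_on {1..n} (\<lambda>k. t k - t 1)" using mono by (auto simp: strict_mono_on_def)
  show "(\<lambda>k. t k - t 1) ` {1..n} \<subseteq> {0..<1}"
  proof safe
   fix k assume "k \<in> {1..n}"
   then show "t k - t 1 \<in> {0..<1}" using tk[of k] le[of k] t1 by auto
  qed
 qed
 show "shiftpath (t 1) q (t k - t 1) = z k" if "k \<in> {1..n}" for k using tk[OF that] t(2)[OF that] by (auto simp: shiftpath_def)
qed auto

lemma open_arcs:
 assumes n: "n \<ge> 3" and inj: "inj_on z {1..n}" and q0: "jordan_param q0 \<gamma>" "increasing_times n t0"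
  "\<And>k. k \<in> {1..n} \<Longrightarrow> q0 (t0 k) = z k" shows "(\<Union>k\<in>{1..n}. open_arc n z \<gamma> k) = \<gamma> - z ` {1..n}"
  and "components (\<gamma> - z ` {1..n}) = open_arc n z \<gamma> ` {1..n}"
  and "\<And>j k. j \<in> {1..n} \<Longrightarrow> k \<in> {1..n} \<Longrightarrow> j \<noteq> k \<Longrightarrow> open_arc n z \<gamma> j \<inter> open_arc n z \<gamma> k = {}"
  and "\<And>k. k \<in> {1..n} \<Longrightarrow> z k \<in> closure (open_arc n z \<gamma> k)"
  and "\<And>k. k \<in> {1..n} \<Longrightarrow> z (next_index n k) \<in> closure (open_arc n z \<gamma> k)"
proof -
 obtain t where q: "jordan_param (shiftpath (t0 1) q0) \<gamma>" and t: "increasing_times n t"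
  "\<And>k. k \<in> {1..n} \<Longrightarrow> shiftpath (t0 1) q0 (t k) = z k" "t 1 = 0"
  using jordan_param_shift[OF q0(1) _ q0(2,3)] n by (metis le_trans one_le_numeral)
 define p where "p = shiftpath (t0 1) q0"
 have p: "path p" "path_image p = \<gamma>" "p 1 = p 0" and pt: "\<And>k. k \<in> {1..n} \<Longrightarrow> p (t k) = z k"
  and lf: "\<And>x y. x \<in> {0..1} \<Longrightarrow> y \<in> {0..1} \<Longrightarrow> p x = p y \<Longrightarrow> x = y \<or> x = 0 \<and> y = 1 \<or> x = 1 \<and> y = 0"
  using q[folded p_def] t(2)[folded p_def] by (auto simp: jordan_param_def simple_path_def loop_free_def pathfinish_def pathstart_def)
 have contp: "continuous_on {0..1} p" using p by (simp add: path_def)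
 have mono: "\<And>j k. j \<in> {1..n} \<Longrightarrow> k \<in> {1..n} \<Longrightarrow> j < k \<Longrightarrow> t j < t k" and t01: "\<And>k. k \<in> {1..n} \<Longrightarrow> 0 \<le> t k \<and> t k < 1"
  using increasing_timesD[OF t(1)] by auto
 \<comment> \<open>End of the k-th parameter interval; the last arc returns to the first marked
   point at parameter 1, not at \<open>t 1 = 0\<close>.\<close>
 define T where "T k = (if k = n then 1 else t (k + 1))" for k
 have T: "t k < T k" "T k \<le> 1" if "k \<in> {1..n}" for k using mono[of k "k + 1"] t01[of k] t01[of "k + 1"] that by (auto simp: T_def)
 have pT: "p (T k) = z (next_index n k)" if "k \<in> {1..n}" for k
 proof (cases "k = n")
  case True then show ?thesis using p(3) pt[of 1] t(3) n by (simp add: T_def next_index_def)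
 next
  case False then show ?thesis using pt[of "k + 1"] that by (simp add: T_def next_index_def)
 qed
 define a where "a k = p ` {t k<..<T k}" for k
 have sub: "{t k..T k} \<subseteq> {0..1}" if "k \<in> {1..n}" for k using T[OF that] t01[OF that] by auto
 have between: "\<exists>k\<in>{1..n}. t k \<le> x \<and> x < T k" if x: "x \<in> {0..<1}" for x
 proof -
  let ?A = "{k \<in> {1..n}. t k \<le> x}"
  have A: "finite ?A" "1 \<in> ?A" using x n t(3) by auto
  define k where "k = Max ?A"
  have k: "k \<in> ?A" unfolding k_def using A Max_in by blast
  have "x < T k"
  proof (cases "k = n")
   case True then show ?thesis using x by (simp add: T_def)
  next
   case False
   then have "k + 1 \<in> {1..n}" using k by auto
   moreover have "k + 1 \<notin> ?A" using Max_ge[OF A(1), of "k + 1"] unfolding k_def[symmetric] by auto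
   ultimately show ?thesis using False by (auto simp: T_def)
  qed
  then show ?thesis using k by auto
 qed
 have order: "T j \<le> t k" if "j \<in> {1..n}" "k \<in> {1..n}" "j < k" for j k
 proof -
  have "j + 1 \<in> {1..n}" "j \<noteq> n" using that by auto
  then show ?thesis using mono[of "j + 1" k] that by (cases "j + 1 = k") (auto simp: T_def)
 qed
 have image: "\<gamma> = p ` {0..<1}"
 proof -
  have "{0..1::real} = insert 1 {0..<1}" by auto
  then have "\<gamma> = insert (p 1) (p ` {0..<1})" using p(2) by (simp add: path_image_def)
  moreover have "p 1 \<in> p ` {0..<1}" using p(3) by auto
  ultimately show ?thesis by auto
 qed
 have inj01: "inj_on p {0..<1}" using lf by (fastforce simp: inj_on_def)
 have "z ` {1..n} = (\<lambda>k. p (t k)) ` {1..n}" by (rule image_cong) (use pt in auto)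
 then have zt: "z ` {1..n} = p ` t ` {1..n}" by (simp add: image_image)
 have aI: "{t k<..<T k} \<subseteq> {0..<1}" if "k \<in> {1..n}" for k using T[OF that] t01[OF that] by auto
 have union: "\<gamma> - z ` {1..n} = (\<Union>k\<in>{1..n}. a k)"
 proof -
  have "\<gamma> - z ` {1..n} = p ` ({0..<1} - t ` {1..n})"
   unfolding image zt by (rule inj_on_image_set_diff[OF inj01, symmetric]) (use t01 in auto)
  also have "{0..<1} - t ` {1..n} = (\<Union>k\<in>{1..n}. {t k<..<T k})"
  proof
   show "{0..<1} - t ` {1..n} \<subseteq> (\<Union>k\<in>{1..n}. {t k<..<T k})"
   proof
    fix x assume x: "x \<in> {0..<1} - t ` {1..n}"
    then obtain k where k: "k \<in> {1..n}" "t k \<le> x" "x < T k" using between by blast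
    moreover have "x \<noteq> t k" using x k by auto
    ultimately have "x \<in> {t k<..<T k}" by simp
    then show "x \<in> (\<Union>k\<in>{1..n}. {t k<..<T k})" using k(1) by blast
   qed
   show "(\<Union>k\<in>{1..n}. {t k<..<T k}) \<subseteq> {0..<1} - t ` {1..n}"
   proof
    fix x assume "x \<in> (\<Union>k\<in>{1..n}. {t k<..<T k})"
    then obtain k where k: "k \<in> {1..n}" "t k < x" "x < T k" by auto
    have "x \<noteq> t j" if j: "j \<in> {1..n}" for j using order[OF k(1) j] mono[OF j k(1)] k by (cases j k rule: linorder_cases) auto
    then have "x \<notin> t ` {1..n}" by blast
    then show "x \<in> {0..<1} - t ` {1..n}" using k aI[OF k(1)] by auto
   qed
  qed
  finally show ?thesis by (simp add: a_def image_UN)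
 qed
 have disj: "a j \<inter> a k = {}" if jk: "j \<in> {1..n}" "k \<in> {1..n}" "j \<noteq> k" for j k
 proof -
  have "{t j<..<T j} \<inter> {t k<..<T k} = {}" using order[OF jk(1,2)] order[OF jk(2,1)] jk(3) by (cases j k rule: linorder_cases) auto
  then show ?thesis unfolding a_def using inj_on_image_Int[OF inj01 aI[OF jk(1)] aI[OF jk(2)]] by simp
 qed
 \<comment> \<open>The closed parameter interval has a compact image, which bounds the closure from
   above; continuity bounds it from below.\<close>
 have clos: "closure (a k) = a k \<union> {z k, z (next_index n k)}" if k: "k \<in> {1..n}" for k
 proof
  have I: "{t k..T k} = insert (t k) (insert (T k) {t k<..<T k})" using T[OF k] by auto
  have e: "p ` {t k..T k} = a k \<union> {z k, z (next_index n k)}" unfolding I using pt[OF k] pT[OF k] by (auto simp: a_def)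
  have ck: "continuous_on {t k..T k} p" using contp sub[OF k] continuous_on_subset by blast
  have "compact (p ` {t k..T k})" by (rule compact_continuous_image[OF ck]) simp
  then have "closed (p ` {t k..T k})" by (rule compact_imp_closed)
  moreover have "a k \<subseteq> p ` {t k..T k}" unfolding e by auto
  ultimately show "closure (a k) \<subseteq> a k \<union> {z k, z (next_index n k)}" unfolding e[symmetric] by (rule closure_minimal[rotated])
  have "p ` closure {t k<..<T k} \<subseteq> closure (a k)"
   by (rule image_closure_subset) (use ck T[OF k] closure_subset[of "a k"] in \<open>auto simp: a_def\<close>)
  then show "a k \<union> {z k, z (next_index n k)} \<subseteq> closure (a k)" using T[OF k] e by simp
 qed
 have zn: "z k \<in> z ` {1..n}" "z (next_index n k) \<in> z ` {1..n}" if "k \<in> {1..n}" for k using that next_index_in[of n k] n by auto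
 have cl: "closedin (top_of_set (\<Union>k\<in>{1..n}. a k)) (a k)" if k: "k \<in> {1..n}" for k
 proof -
  have "a k = (\<Union>k\<in>{1..n}. a k) \<inter> closure (a k)" unfolding clos[OF k] using k zn[OF k] union by blast
  then show ?thesis by (metis closed_closure closedin_closed_Int)
 qed
 have comp: "components (\<gamma> - z ` {1..n}) = a ` {1..n}" unfolding union
 proof (rule components_closed_family)
  fix k assume k: "k \<in> {1..n}"
  show "connected (a k)" unfolding a_def by (intro connected_continuous_image continuous_on_subset[OF contp]) (use aI[OF k] in auto)
  show "a k \<noteq> {}" using T[OF k] by (simp add: a_def)
 qed (use cl disj in auto)
 have arc: "open_arc n z \<gamma> k = a k" if k: "k \<in> {1..n}" for k unfolding open_arc_def
 proof (rule the_equality)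
  show "a k \<in> components (\<gamma> - z ` {1..n}) \<and> {z k, z (next_index n k)} \<subseteq> closure (a k)" using comp clos[OF k] k by auto
  fix A assume A: "A \<in> components (\<gamma> - z ` {1..n}) \<and> {z k, z (next_index n k)} \<subseteq> closure A"
  then obtain j where j: "j \<in> {1..n}" "A = a j" using comp by auto
  have "a j \<inter> z ` {1..n} = {}" using union j by blast
  then have "{z k, z (next_index n k)} \<subseteq> {z j, z (next_index n j)}" using A j clos[OF j(1)] zn[OF k] by blast
  then have "z ` {k, next_index n k} \<subseteq> z ` {j, next_index n j}" by simp
  then have "{k, next_index n k} \<subseteq> {j, next_index n j}"
   using inj_on_image_subset_iff[OF inj, of "{k, next_index n k}" "{j, next_index n j}"]
    next_index_in[of n] k j n by simp
  then show "A = a k" using next_index_2_cycle[OF n k j(1)] j by simp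
 qed
 show "(\<Union>k\<in>{1..n}. open_arc n z \<gamma> k) = \<gamma> - z ` {1..n}" using union arc by simp
 show "components (\<gamma> - z ` {1..n}) = open_arc n z \<gamma> ` {1..n}" using comp arc by simp
 show "open_arc n z \<gamma> j \<inter> open_arc n z \<gamma> k = {}" if "j \<in> {1..n}" "k \<in> {1..n}" "j \<noteq> k" for j k
  using disj that arc by simp
 show "z k \<in> closure (open_arc n z \<gamma> k)" if "k \<in> {1..n}" for k using arc clos that by simp
 show "z (next_index n k) \<in> closure (open_arc n z \<gamma> k)" if "k \<in> {1..n}" for k using arc clos that by simp
qed

section \<open>The positive side\<close>

text \<open>The parameter change is injective and continuous on the open interval, hence strictly
  monotone. Two further common points met in the same order exclude the decreasing case, so
  orientations agree.\<close>

lemma simple_loop_reparametrization: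
 fixes p q :: "real \<Rightarrow> 'a::t2_space"
 assumes p: "simple_path p" "p 1 = p 0" and q: "simple_path q" "q 1 = q 0" and im: "path_image p = path_image q" and pq0: "p 0 = q 0"
  and a: "a \<in> {0<..<1}" "a' \<in> {0<..<1}" "p a = q a'" and b: "b \<in> {0<..<1}" "b' \<in> {0<..<1}" "p b = q b'" and ab: "a < b" "a' < b'"
 obtains \<theta> where "continuous_on {0..1} \<theta>" "\<theta> \<in> {0..1} \<rightarrow> {0..1}" "\<theta> 0 = 0" "\<theta> 1 = (1::real)"
  "\<And>s. s \<in> {0..1} \<Longrightarrow> q s = p (\<theta> s)"
proof -
 have contp: "continuous_on {0..1} p" and contq: "continuous_on {0..1} q" using p q by (auto simp: simple_path_def path_def)
 have lfp: "\<And>x y. x \<in> {0..1} \<Longrightarrow> y \<in> {0..1} \<Longrightarrow> p x = p y \<Longrightarrow> x = y \<or> x = 0 \<and> y = 1 \<or> x = 1 \<and> y = 0"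
  and lfq: "\<And>x y. x \<in> {0..1} \<Longrightarrow> y \<in> {0..1} \<Longrightarrow> q x = q y \<Longrightarrow> x = y \<or> x = 0 \<and> y = 1 \<or> x = 1 \<and> y = 0"
  using p q by (auto simp: simple_path_def loop_free_def)
 have ex: "\<exists>u\<in>{0<..<1}. p u = q s" if s: "s \<in> {0<..<1}" for s
 proof -
  have "q s \<in> path_image p" unfolding im using s by (auto simp: path_image_def)
  then obtain u where u: "u \<in> {0..1}" "p u = q s" by (auto simp: path_image_def)
  have "u \<noteq> 0 \<and> u \<noteq> 1"
  proof (rule ccontr)
   assume "\<not> (u \<noteq> 0 \<and> u \<noteq> 1)"
   then have "q 0 = q s" using u p(2) pq0 by auto
   then show False using lfq[of 0 s] s by auto
  qed
  then show ?thesis using u by (intro bexI[of _ u]) auto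
 qed
 have ex': "\<exists>s\<in>{0<..<1}. p u = q s" if u: "u \<in> {0<..<1}" for u
 proof -
  have "p u \<in> path_image q" unfolding im[symmetric] using u by (auto simp: path_image_def)
  then obtain s where s: "s \<in> {0..1}" "p u = q s" by (auto simp: path_image_def)
  have "s \<noteq> 0 \<and> s \<noteq> 1"
  proof (rule ccontr)
   assume "\<not> (s \<noteq> 0 \<and> s \<noteq> 1)"
   then have "p 0 = p u" using s q(2) pq0 by auto
   then show False using lfp[of 0 u] u by auto
  qed
  then show ?thesis using s by (intro bexI[of _ s]) auto
 qed
 \<comment> \<open>The base point has the two parameters 0 and 1, so the end values are prescribed;
   in between \<theta> is the inverse of \<open>p\<close> after \<open>q\<close>.\<close>
 define \<theta> where "\<theta> s = (if s \<le> 0 then 0 else if s \<ge> 1 then 1 else (SOME u. u \<in> {0<..<1} \<and> p u = q s))" for s :: real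
 have \<theta>: "\<theta> s \<in> {0<..<1}" "p (\<theta> s) = q s" if s: "s \<in> {0<..<1}" for s
 proof -
  have "\<theta> s = (SOME u. u \<in> {0<..<1} \<and> p u = q s)" using s by (simp add: \<theta>_def)
  moreover have "(SOME u. u \<in> {0<..<1} \<and> p u = q s) \<in> {0<..<1} \<and> p (SOME u. u \<in> {0<..<1} \<and> p u = q s) = q s"
   by (rule someI_ex) (use ex[OF s] in blast)
  ultimately show "\<theta> s \<in> {0<..<1}" "p (\<theta> s) = q s" by auto
 qed
 have \<theta>01: "\<theta> 0 = 0" "\<theta> 1 = 1" by (auto simp: \<theta>_def)
 have uni: "\<theta> s = u" if "s \<in> {0<..<1}" "u \<in> {0<..<1}" "p u = q s" for s u
  using lfp[of "\<theta> s" u] \<theta>[OF that(1)] that by auto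
 have surj: "\<exists>s\<in>{0<..<1}. \<theta> s = u" if "u \<in> {0<..<1}" for u using ex'[OF that] uni that by blast
 have cont: "continuous_on {0<..<1} \<theta>" unfolding continuous_on_eq_continuous_at[OF open_greaterThanLessThan] continuous_at_eps_delta
 proof (intro ballI allI impI)
  fix s e :: real assume s: "s \<in> {0<..<1}" and e: "0 < e"
  let ?u = "\<theta> s"
  \<comment> \<open>Parameters away from \<open>?u\<close> form a compact set whose image misses
    \<open>q s\<close>; values near \<open>q s\<close> miss it too, so their parameters are close to
    \<open>?u\<close>.\<close>
  define K where "K = {0..1} - ball ?u e"
  have "compact (p ` K)" by (rule compact_continuous_image[OF continuous_on_subset[OF contp]]) (auto simp: K_def intro: compact_diff)
  then have "closed (p ` K)" by (rule compact_imp_closed)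
  have nK: "q s \<notin> p ` K"
  proof
   assume "q s \<in> p ` K"
   then obtain u where u: "u \<in> {0..1}" "u \<notin> ball ?u e" "p u = q s" by (auto simp: K_def)
   then have "u = ?u" using lfp[of u ?u] \<theta>[OF s] by auto
   then show False using u e by simp
  qed
  have "open ({0<..<1} \<inter> q -` (- (p ` K)))"
   by (rule continuous_open_preimage) (use \<open>closed (p ` K)\<close> in \<open>auto intro: continuous_on_subset[OF contq]\<close>)
  moreover have "s \<in> {0<..<1} \<inter> q -` (- (p ` K))" using s nK by auto
  ultimately obtain d where d: "d > 0" "ball s d \<subseteq> {0<..<1} \<inter> q -` (- (p ` K))" by (meson open_contains_ball)
  show "\<exists>d>0. \<forall>x'. dist x' s < d \<longrightarrow> dist (\<theta> x') (\<theta> s) < e"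
  proof (intro exI[of _ d] conjI allI impI d)
   fix s' assume "dist s' s < d"
   then have "s' \<in> ball s d" by (simp add: dist_commute)
   then have s': "s' \<in> {0<..<1}" "q s' \<notin> p ` K" using d by blast+
   have "\<theta> s' \<notin> K" using \<theta>[OF s'(1)] s'(2) by (metis imageI)
   then show "dist (\<theta> s') (\<theta> s) < e" using \<theta>[OF s'(1)] by (auto simp: K_def dist_commute)
  qed
 qed
 have inj: "inj_on \<theta> {0<..<1}"
 proof (rule inj_onI)
  fix s s' assume s: "s \<in> {0<..<1}" "s' \<in> {0<..<1}" "\<theta> s = \<theta> s'"
  then have "q s = q s'" using \<theta> by metis
  then show "s = s'" using lfq[of s s'] s by auto
 qed
 have "is_interval {0<..<1::real}" by (simp add: is_interval_convex_1)
 then have "strict_mono_on {0<..<1} \<theta> \<or> strict_antimono_on {0<..<1} \<theta>" using injective_eq_monotone_map cont inj by blast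
 moreover have "\<theta> a' = a" "\<theta> b' = b" using uni a b by auto
 moreover have "\<not> strict_antimono_on {0<..<1} \<theta>"
 proof
  assume "strict_antimono_on {0<..<1} \<theta>"
  then have "\<theta> b' < \<theta> a'" using a(2) b(2) ab(2) unfolding monotone_on_def by blast
  then show False using \<open>\<theta> a' = a\<close> \<open>\<theta> b' = b\<close> ab(1) by simp
 qed
 ultimately have sm: "strict_mono_on {0<..<1} \<theta>" by blast
 then have mono: "\<theta> s < \<theta> s'" if "s \<in> {0<..<1}" "s' \<in> {0<..<1}" "s < s'" for s s' using that by (auto simp: strict_mono_on_def)
 have "continuous_on {0..1} \<theta>" unfolding continuous_on_eq_continuous_within
 proof
  fix s :: real assume "s \<in> {0..1}"
  then consider "s \<in> {0<..<1}" | "s = 0" | "s = 1" by fastforce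
  then show "continuous (at s within {0..1}) \<theta>"
  proof cases
   case 1
   then have "continuous (at s) \<theta>" using cont by (simp add: continuous_on_eq_continuous_at)
   then show ?thesis by (rule continuous_at_imp_continuous_at_within)
  next
   case 2
   show ?thesis unfolding continuous_within_eps_delta
   proof (intro allI impI)
    fix e :: real assume e: "e > 0"
    define u where "u = min e (1/2)"
    have u: "u \<in> {0<..<1}" "u \<le> e" using e by (auto simp: u_def)
    \<comment> \<open>By surjectivity some \<open>s0\<close> has the small value \<open>u\<close>,
      and monotonicity keeps \<theta> below \<open>u\<close> before \<open>s0\<close>; the other end
      is treated in the same way.\<close>
    obtain s0 where s0: "s0 \<in> {0<..<1}" "\<theta> s0 = u" using surj u by blast
    show "\<exists>d>0. \<forall>x'\<in>{0..1}. dist x' s < d \<longrightarrow> dist (\<theta> x') (\<theta> s) < e"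
    proof (intro exI[of _ s0] conjI ballI impI)
     show "s0 > 0" using s0 by simp
     fix x' :: real assume x': "x' \<in> {0..1}" "dist x' s < s0"
     show "dist (\<theta> x') (\<theta> s) < e"
     proof (cases "x' = 0")
      case True then show ?thesis using 2 e by simp
     next
      case False
      then have "x' \<in> {0<..<1}" "x' < s0" using x' 2 s0 by (auto simp: dist_real_def)
      then show ?thesis using mono[of x' s0] s0 u \<theta>(1)[of x'] 2 \<theta>01 by (auto simp: dist_real_def)
     qed
    qed
   qed
  next
   case 3
   show ?thesis unfolding continuous_within_eps_delta
   proof (intro allI impI)
    fix e :: real assume e: "e > 0"
    define u where "u = 1 - min e (1/2)"
    have u: "u \<in> {0<..<1}" "1 - u \<le> e" using e by (auto simp: u_def)
    obtain s0 where s0: "s0 \<in> {0<..<1}" "\<theta> s0 = u" using surj u by blast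
    show "\<exists>d>0. \<forall>x'\<in>{0..1}. dist x' s < d \<longrightarrow> dist (\<theta> x') (\<theta> s) < e"
    proof (intro exI[of _ "1 - s0"] conjI ballI impI)
     show "1 - s0 > 0" using s0 by simp
     fix x' :: real assume x': "x' \<in> {0..1}" "dist x' s < 1 - s0"
     show "dist (\<theta> x') (\<theta> s) < e"
     proof (cases "x' = 1")
      case True then show ?thesis using 3 e by simp
     next
      case False
      then have "x' \<in> {0<..<1}" "s0 < x'" using x' 3 s0 by (auto simp: dist_real_def)
      then show ?thesis using mono[of s0 x'] s0 u \<theta>(1)[of x'] 3 \<theta>01 by (auto simp: dist_real_def)
     qed
    qed
   qed
  qed
 qed
 moreover have "\<theta> \<in> {0..1} \<rightarrow> {0..1}"
 proof
  fix s :: real assume "s \<in> {0..1}"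
  then consider "s \<in> {0<..<1}" | "s = 0" | "s = 1" by fastforce
  then show "\<theta> s \<in> {0..1}" by cases (use \<theta>(1)[of s] \<theta>01 in auto)
 qed
 moreover have "q s = p (\<theta> s)" if "s \<in> {0..1}" for s
 proof -
  consider "s \<in> {0<..<1}" | "s = 0" | "s = 1" using \<open>s \<in> {0..1}\<close> by fastforce
  then show ?thesis by cases (use \<theta>(2)[of s] \<theta>01 p(2) q(2) pq0 in auto)
 qed
 ultimately show ?thesis using that \<theta>01 by blast
qed

text \<open>Three marked points in order fix the orientation: with the first as base point, the
  other two rule out a reversal, and a reparametrization does not change the winding number.\<close>

lemma winding_number_same_orientation:
 assumes q: "jordan_param q \<gamma>" "jordan_param q' \<gamma>" and n: "n \<ge> 3"
  and t: "increasing_times n t" "\<And>k. k \<in> {1..n} \<Longrightarrow> q (t k) = z k"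
  and t': "increasing_times n t'" "\<And>k. k \<in> {1..n} \<Longrightarrow> q' (t' k) = z k"
  and M: "continuous_on \<gamma> M" and y: "y \<notin> M ` \<gamma>"
 shows "winding_number (\<lambda>s. M (q s)) y = winding_number (\<lambda>s. M (q' s)) y"
proof -
 have n1: "n \<ge> 1" using n by simp
 obtain s where s: "jordan_param (shiftpath (t 1) q) \<gamma>" "increasing_times n s"
  "\<And>k. k \<in> {1..n} \<Longrightarrow> shiftpath (t 1) q (s k) = z k" "s 1 = 0" "t 1 \<in> {0..<1}"
  by (rule jordan_param_shift[OF q(1) n1 t]) (assumption | rule that)+
 obtain s' where s': "jordan_param (shiftpath (t' 1) q') \<gamma>" "increasing_times n s'"
  "\<And>k. k \<in> {1..n} \<Longrightarrow> shiftpath (t' 1) q' (s' k) = z k" "s' 1 = 0" "t' 1 \<in> {0..<1}"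
  by (rule jordan_param_shift[OF q(2) n1 t']) (assumption | rule that)+
 define p p' where "p = shiftpath (t 1) q" and "p' = shiftpath (t' 1) q'"
 have shift: "winding_number (\<lambda>s. M (q s)) y = winding_number (\<lambda>s. M (shiftpath u q s)) y"
  if "jordan_param q \<gamma>" "u \<in> {0..<1}" for q u
 proof -
  have q: "path q" "path_image q = \<gamma>" "q 1 = q 0" using that by (auto simp: jordan_param_def simple_path_def pathstart_def pathfinish_def)
  have "path (M \<circ> q)" by (rule path_continuous_image[OF q(1)]) (use M q in simp)
  moreover have "path_image (M \<circ> q) = M ` \<gamma>" using q by (simp add: path_image_compose)
  ultimately have "winding_number (shiftpath u (M \<circ> q)) y = winding_number (M \<circ> q) y"
   using that y q by (intro winding_number_shiftpath) (auto simp: pathstart_def pathfinish_def)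
  moreover have "shiftpath u (M \<circ> q) = (\<lambda>s. M (shiftpath u q s))" by (auto simp: shiftpath_def)
  ultimately show ?thesis by (simp add: o_def)
 qed
 have jp: "simple_path p" "p 1 = p 0" "path_image p = \<gamma>" and jp': "simple_path p'" "p' 1 = p' 0" "path_image p' = \<gamma>"
  using s(1) s'(1) by (auto simp: p_def p'_def jordan_param_def pathstart_def pathfinish_def)
 have in3: "1 \<in> {1..n}" "2 \<in> {1..n}" "3 \<in> {1..n}" using n by auto
 have tim: "0 < u 2" "u 2 < u 3" "u 3 < 1" if "increasing_times n u" "u 1 = 0" for u
 proof -
  have m: "\<And>j k. j \<in> {1..n} \<Longrightarrow> k \<in> {1..n} \<Longrightarrow> j < k \<Longrightarrow> u j < u k" and l: "\<And>k. k \<in> {1..n} \<Longrightarrow> u k < 1"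
   using increasing_timesD[OF that(1)] by auto
  show "0 < u 2" "u 2 < u 3" "u 3 < 1" using m[of 1 2] m[of 2 3] l[of 3] in3 that by auto
 qed
 have pz: "p 0 = z 1" "p (s 2) = z 2" "p (s 3) = z 3" "p' 0 = z 1" "p' (s' 2) = z 2" "p' (s' 3) = z 3"
  using s(3)[OF in3(1)] s(3)[OF in3(2)] s(3)[OF in3(3)] s'(3)[OF in3(1)] s'(3)[OF in3(2)] s'(3)[OF in3(3)] s(4) s'(4) by (auto simp: p_def p'_def)
 have ti: "s 2 \<in> {0<..<1}" "s' 2 \<in> {0<..<1}" "s 3 \<in> {0<..<1}" "s' 3 \<in> {0<..<1}" "s 2 < s 3" "s' 2 < s' 3"
  using tim[OF s(2,4)] tim[OF s'(2,4)] by auto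
 have ei: "path_image p = path_image p'" "p 0 = p' 0" "p (s 2) = p' (s' 2)" "p (s 3) = p' (s' 3)" using jp jp' pz by auto
 obtain \<theta> where \<theta>: "continuous_on {0..1} \<theta>" "\<theta> \<in> {0..1} \<rightarrow> {0..1}" "\<theta> 0 = 0" "\<theta> 1 = (1::real)"
  "\<And>s. s \<in> {0..1} \<Longrightarrow> p' s = p (\<theta> s)"
  by (rule simple_loop_reparametrization[OF jp(1,2) jp'(1,2) ei(1,2) ti(1,2) ei(3) ti(3,4) ei(4) ti(5,6)]) (rule that)
 have pp: "path (M \<circ> p)" "path_image (M \<circ> p) = M ` \<gamma>"
  using jp M by (auto intro!: path_continuous_image simp: simple_path_def path_image_compose)
 have "homotopic_paths (- {y}) (M \<circ> p) (M \<circ> p')"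
  by (rule homotopic_paths_reparametrize[OF pp(1) _ \<theta>(1-4)]) (use pp y \<theta>(5) in auto)
 then have "winding_number (M \<circ> p) y = winding_number (M \<circ> p') y" by (rule winding_number_homotopic_paths)
 then show ?thesis using shift[OF q(1) s(5)] shift[OF q(2) s'(5)] by (simp add: p_def p'_def o_def)
qed

text \<open>Relative to the image of \<open>x\<close>, the new curve is a constant times
  \<open>(w - x) / (w - \<pi>)\<close>, where \<pi> is the pole; continuous logarithms of numerator
  and denominator subtract.\<close>

lemma winding_number_moebius:
 fixes c :: "real \<Rightarrow> complex"
 assumes c: "path c" "pathfinish c = pathstart c" and N: "N \<in> PSL2C" "N (Fin \<pi>) = Infty"
  and x: "x \<notin> path_image c" "\<pi> \<notin> path_image c" "x \<noteq> \<pi>"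
 shows "winding_number (\<lambda>s. affine (N (Fin (c s)))) (affine (N (Fin x))) = winding_number c x - winding_number c \<pi>"
proof -
 obtain A B C D where N': "N = moebius A B C D" "A * D - B * C = 1" using N by (auto simp: PSL2C_def)
 have CD: "C * \<pi> + D = 0" using N(2) N'(1) by (auto split: if_splits)
 have C: "C \<noteq> 0" using CD N'(2) by auto
 have D: "D = - C * \<pi>" using CD by (simp add: eq_neg_iff_add_eq_0 add.commute)
 have den: "C * w + D = C * (w - \<pi>)" for w unfolding D by (simp add: algebra_simps)
 define \<kappa> where "\<kappa> = 1 / (C * (C * (x - \<pi>)))"
 have \<kappa>: "\<kappa> \<noteq> 0" using C x by (simp add: \<kappa>_def)
 have diff: "affine (N (Fin w)) - affine (N (Fin x)) = \<kappa> * ((w - x) / (w - \<pi>))" if w: "w \<noteq> \<pi>" for w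
 proof -
  have n: "C * w + D \<noteq> 0" "C * x + D \<noteq> 0" unfolding den using C w x by auto
  have "affine (N (Fin w)) - affine (N (Fin x)) = (A * w + B) / (C * w + D) - (A * x + B) / (C * x + D)" using n by (simp add: N'(1))
  also have "\<dots> = ((A * w + B) * (C * x + D) - (A * x + B) * (C * w + D)) / ((C * w + D) * (C * x + D))" using n by (simp add: diff_frac_eq)
  also have "(A * w + B) * (C * x + D) - (A * x + B) * (C * w + D) = (A * D - B * C) * (w - x)" by (simp add: algebra_simps)
  finally show ?thesis unfolding N'(2) den by (simp add: \<kappa>_def)
 qed
 obtain q1 where q1: "path q1" "pathfinish q1 - pathstart q1 = 2 * of_real pi * \<i> * winding_number c x"
  "\<And>t. t \<in> {0..1} \<Longrightarrow> c t = x + exp (q1 t)" using winding_number_as_continuous_log[OF c(1) x(1)] by metis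
 obtain q2 where q2: "path q2" "pathfinish q2 - pathstart q2 = 2 * of_real pi * \<i> * winding_number c \<pi>"
  "\<And>t. t \<in> {0..1} \<Longrightarrow> c t = \<pi> + exp (q2 t)" using winding_number_as_continuous_log[OF c(1) x(2)] by metis
 define r where "r t = q1 t - q2 t + Ln \<kappa>" for t
 have r: "path r" unfolding r_def path_def by (intro continuous_intros) (use q1 q2 in \<open>auto simp: path_def\<close>)
 have "winding_number (\<lambda>s. affine (N (Fin (c s)))) (affine (N (Fin x)))
   = winding_number (\<lambda>s. affine (N (Fin (c s))) - affine (N (Fin x))) 0" by (rule winding_number_offset)
 also have "\<dots> = winding_number (exp \<circ> r) 0"
 proof (rule winding_number_cong)
  fix t :: real assume t: "0 \<le> t" "t \<le> 1"
  have w: "c t \<noteq> \<pi>" using t x(2) by (auto simp: path_image_def)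
  have "c t - x = exp (q1 t)" "c t - \<pi> = exp (q2 t)" using q1(3)[of t] q2(3)[of t] t by (auto simp: algebra_simps)
  then show "affine (N (Fin (c t))) - affine (N (Fin x)) = (exp \<circ> r) t"
   unfolding diff[OF w] r_def using \<kappa> by (simp add: exp_add exp_diff)
 qed
 also have "\<dots> = (pathfinish r - pathstart r) / (2 * of_real pi * \<i>)" by (rule winding_number_compose_exp[OF r])
 also have "pathfinish r - pathstart r = 2 * of_real pi * \<i> * (winding_number c x - winding_number c \<pi>)"
  using q1(2) q2(2) by (simp add: r_def pathfinish_def pathstart_def algebra_simps)
 also have "\<dots> / (2 * of_real pi * \<i>) = winding_number c x - winding_number c \<pi>" by simp
 finally show ?thesis .
qed

lemma moebius_pole: obtains M where "M \<in> PSL2C" "M P = Infty"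
proof (cases P)
 case (Fin p)
 have "moebius 0 1 1 (- p) \<in> PSL2C" by (rule moebius_PSL2C) simp
 then show ?thesis using that Fin by (metis add.right_inverse moebius.simps(1) mult_1)
next
 case Infty then show ?thesis using that[OF id_PSL2C] by simp
qed

lemma moebius_finite_off_pole: "M \<in> PSL2C \<Longrightarrow> M P = Infty \<Longrightarrow> x \<noteq> P \<Longrightarrow> M x \<noteq> Infty"
 using PSL2C_inj[of M UNIV] by (metis injD)

text \<open>The point \<open>P1\<close> outside \<open>U\<close> is moved to Infty, which turns
  \<open>U\<close> into a plane open set, where deleting a point keeps connectedness.\<close>

lemma connected_delete_sphere:
 fixes U :: "riemann_sphere set"
 assumes "open U" "connected U" "P1 \<notin> U" shows "connected (U - {P})"
proof -
 obtain M where M: "M \<in> PSL2C" "M P1 = Infty" by (rule moebius_pole)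
 obtain M' where M': "M' \<in> PSL2C" "\<And>x. M (M' x) = x" "\<And>x. M' (M x) = x" using PSL2C_inverse M by blast
 define W where "W = Fin -` (M ` U)"
 have fin: "M x \<noteq> Infty" if "x \<in> U" for x by (rule moebius_finite_off_pole[OF M]) (use that assms in auto)
 have W: "M ` U = Fin ` W" unfolding W_def using fin by (auto simp: image_iff) (metis Fin_affine)
 have oW: "open W" unfolding W_def using assms M by (intro open_Fin_vimage open_image_PSL2C)
 have "W = affine ` M ` U" unfolding W by force
 moreover have "connected (affine ` M ` U)" by (intro connected_continuous_image continuous_on_affine continuous_on_PSL2C M assms) (metis fin imageE)
 ultimately have "connected W" by simp
 then have "connected (W - {affine (M P)})" using oW by (intro connected_open_delete) auto
 then have c: "connected (M' ` Fin ` (W - {affine (M P)}))" by (intro connected_continuous_image continuous_on_Fin continuous_on_PSL2C M')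
 show ?thesis
 proof (cases "P \<in> U")
  case True
  have "Fin ` (W - {affine (M P)}) = M ` U - {M P}" using W fin[OF True] by (auto simp: image_iff) (metis Fin_affine riemann_sphere.sel)+
  also have "\<dots> = M ` (U - {P})" using inj_on_image_set_diff[OF PSL2C_inj[OF M(1), of UNIV], of U "{P}"] by simp
  also have "M' ` \<dots> = U - {P}" using M'(3) by (simp add: image_image)
  finally show ?thesis using c by simp
 next
  case False then show ?thesis using assms by simp
 qed
qed

text \<open>With a point of \<Omega>2 at infinity the winding number vanishes far out and is
  constant on each side. Since a simple closed curve has points of winding number 1 or -1, these
  must fill \<Omega>1.\<close>

lemma curve_sides:
 assumes q: "jordan_param q \<gamma>" and comp: "components (- \<gamma>) = {\<Omega>1, \<Omega>2}" "\<Omega>1 \<inter> \<Omega>2 = {}" "open \<Omega>1" "open \<Omega>2"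
  and M: "M \<in> PSL2C" "M P = Infty" "P \<in> \<Omega>2"
 obtains w where "w \<in> {1, -1}" "\<And>x. x \<in> \<Omega>1 \<Longrightarrow> winding_number (\<lambda>s. affine (M (q s))) (affine (M x)) = w"
  "\<exists>x\<in>\<Omega>2. x \<noteq> P \<and> winding_number (\<lambda>s. affine (M (q s))) (affine (M x)) = 0"
proof -
 have q': "simple_path q" "pathfinish q = pathstart q" "path_image q = \<gamma>" using q by (auto simp: jordan_param_def)
 have un: "- \<gamma> = \<Omega>1 \<union> \<Omega>2" using Union_components[of "- \<gamma>"] comp by auto
 have con: "connected \<Omega>1" "connected \<Omega>2" using comp(1) in_components_connected by blast+
 have ne: "\<Omega>1 \<noteq> {}" using comp(1) in_components_nonempty by blast
 have P\<gamma>: "P \<notin> \<gamma>" "P \<notin> \<Omega>1" using M(3) un comp(2) by auto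
 have fin: "M x \<noteq> Infty" if "x \<noteq> P" for x using moebius_finite_off_pole[OF M(1,2) that] .
 have cM: "continuous_on S (\<lambda>x. affine (M x))" if "P \<notin> S" for S
 proof (rule continuous_on_compose2[OF continuous_on_affine continuous_on_PSL2C[OF M(1)]])
  show "Infty \<notin> M ` S" using fin that by (metis imageE)
 qed auto
 have injM: "x = y" if "x \<noteq> P" "y \<noteq> P" "affine (M x) = affine (M y)" for x y
 proof -
  have "M x = M y" using fin that by (metis Fin_affine)
  then show ?thesis using PSL2C_inj[OF M(1), of UNIV] by (auto dest: injD)
 qed
 define c where "c s = affine (M (q s))" for s
 have c: "c = (\<lambda>x. affine (M x)) \<circ> q" by (auto simp: c_def)
 have sc: "simple_path c" unfolding c
 proof (rule simple_path_continuous_image)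
  show "inj_on (\<lambda>x. affine (M x)) (path_image q)" by (rule inj_onI, rule injM) (use q' P\<gamma> in auto)
 qed (use q' cM P\<gamma> in auto)
 have pc: "path c" "pathfinish c = pathstart c" and pic: "path_image c = (\<lambda>x. affine (M x)) ` \<gamma>"
  using sc q' by (auto simp: simple_path_def pathfinish_def pathstart_def c_def path_image_compose c)
 have nim: "affine (M x) \<notin> path_image c" if "x \<notin> \<gamma>" "x \<noteq> P" for x
 proof
  assume "affine (M x) \<in> path_image c"
  then obtain v where v: "v \<in> \<gamma>" "affine (M x) = affine (M v)" unfolding pic by blast
  then have "x = v" using injM[of x v] that P\<gamma> by auto
  then show False using v that by simp
 qed
 \<comment> \<open>\<open>M\<close> sends \<open>P\<close> to Infty, where \<open>affine\<close>
   takes the default value 0; so \<open>P\<close> is removed before winding numbers on this side are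
   compared.\<close>
 define \<Omega>2' where "\<Omega>2' = \<Omega>2 - {P}"
 have con2: "connected \<Omega>2'" unfolding \<Omega>2'_def using connected_delete_sphere[OF comp(4) con(2)] ne comp(2) by blast
 have const: "winding_number c (affine (M x)) = winding_number c (affine (M y))"
  if "x \<in> S" "y \<in> S" "connected S" "S \<inter> \<gamma> = {}" "P \<notin> S" for x y S
 proof -
  have "winding_number c constant_on ((\<lambda>x. affine (M x)) ` S)"
  proof (rule winding_number_constant[OF pc])
   show "connected ((\<lambda>x. affine (M x)) ` S)" by (intro connected_continuous_image cM that)
   show "(\<lambda>x. affine (M x)) ` S \<inter> path_image c = {}" using nim that by blast
  qed
  then show ?thesis using that unfolding constant_on_def by auto
 qed
 obtain B where B: "\<And>z. B \<le> norm z \<Longrightarrow> winding_number c z = 0" using winding_number_zero_at_infinity[OF pc] by blast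
 have "\<exists>x\<in>\<Omega>2'. B \<le> norm (affine (M x))"
 proof -
  have o: "open (M ` \<Omega>2)" "Infty \<in> M ` \<Omega>2" using comp(4) M open_image_PSL2C by (auto intro: rev_image_eqI)
  then have "compact (- (Fin -` (M ` \<Omega>2)))" by (simp add: open_riemann_sphere_def)
  then obtain R where R: "\<And>w. w \<in> - (Fin -` (M ` \<Omega>2)) \<Longrightarrow> norm w \<le> R"
   using compact_imp_bounded bounded_iff by metis
  define w where "w = complex_of_real (max \<bar>B\<bar> \<bar>R\<bar> + 1)"
  have nw: "norm w = max \<bar>B\<bar> \<bar>R\<bar> + 1" unfolding w_def norm_of_real by linarith
  have "w \<in> Fin -` (M ` \<Omega>2)" using R[of w] nw by force
  then obtain x where x: "x \<in> \<Omega>2" "M x = Fin w" by auto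
  then have "x \<noteq> P" using M by auto
  then show ?thesis using x nw by (intro bexI[of _ x]) (auto simp: \<Omega>2'_def)
 qed
 then obtain x2 where x2: "x2 \<in> \<Omega>2'" "winding_number c (affine (M x2)) = 0" using B by blast
 have sub2: "\<Omega>2' \<inter> \<gamma> = {}" "P \<notin> \<Omega>2'" using un by (auto simp: \<Omega>2'_def)
 have zero: "winding_number c (affine (M x)) = 0" if "x \<in> \<Omega>2'" for x using const[OF that x2(1) con2 sub2] x2(2) by simp
 obtain z0 where z0: "z0 \<in> inside (path_image c)" "cmod (winding_number c z0) = 1" using simple_closed_path_wn3[OF sc pc(2)] by metis
 obtain y where y: "M y = Fin z0" using M(1) PSL2C_inverse by metis
 have yP: "y \<noteq> P" using y M by auto
 have "z0 \<notin> path_image c" using z0(1) inside_no_overlap by blast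
 then have "y \<notin> \<gamma>" unfolding pic using y by (metis imageI riemann_sphere.sel)
 then have "y \<in> \<Omega>1 \<or> y \<in> \<Omega>2'" using un yP by (auto simp: \<Omega>2'_def)
 moreover have "y \<notin> \<Omega>2'" using zero[of y] y z0 by auto
 ultimately have y1: "y \<in> \<Omega>1" by simp
 have sub1: "\<Omega>1 \<inter> \<gamma> = {}" using un by auto
 define w where "w = winding_number c z0"
 have "w \<in> {-1, 0, 1}" unfolding w_def by (rule simple_closed_path_winding_number_cases[OF sc pc(2) \<open>z0 \<notin> path_image c\<close>])
 then have "w \<in> {1, -1}" using z0(2) by (auto simp: w_def)
 moreover have "winding_number c (affine (M x)) = w" if "x \<in> \<Omega>1" for x
  using const[OF that y1 con(1) sub1 P\<gamma>(2)] y by (simp add: w_def)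
 moreover have "\<exists>x\<in>\<Omega>2. x \<noteq> P \<and> winding_number c (affine (M x)) = 0" using x2 by (auto simp: \<Omega>2'_def)
 ultimately show ?thesis using that unfolding c_def by blast
qed

text \<open>Shows that the definite description is proper. Moving the point at infinity to the other
  side shifts all winding numbers by a constant, so exactly one side is encircled with winding
  number 1.\<close>

lemma positive_side_component:
 assumes n: "n \<ge> 3" and inj: "inj_on z {1..n}" and q: "jordan_param q \<gamma>" "increasing_times n t"
  "\<And>k. k \<in> {1..n} \<Longrightarrow> q (t k) = z k"
  and comp: "components (- \<gamma>) = {\<Omega>1, \<Omega>2}" "\<Omega>1 \<inter> \<Omega>2 = {}" "open \<Omega>1" "open \<Omega>2"
 shows "positive_side n z \<gamma> \<in> components (- \<gamma>)"
proof -
 have un: "- \<gamma> = \<Omega>1 \<union> \<Omega>2" using Union_components[of "- \<gamma>"] comp by auto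
 have ne: "\<Omega>1 \<noteq> {}" "\<Omega>2 \<noteq> {}" using comp(1) in_components_nonempty by blast+
 \<comment> \<open>\<open>Pos\<close> is tied to the one parametrization \<open>q\<close>; the
   comparison of orientations later removes this dependence.\<close>
 define Pos where "Pos \<Omega> \<longleftrightarrow> (\<exists>M\<in>PSL2C. Infty \<notin> M ` (\<gamma> \<union> \<Omega>) \<and>
  (\<forall>x\<in>\<Omega>. winding_number (\<lambda>s. affine (M (q s))) (affine (M x)) = 1))" for \<Omega>
 have qim: "path_image q = \<gamma>" "path q" "pathfinish q = pathstart q" using q(1) by (auto simp: jordan_param_def simple_path_def)
 \<comment> \<open>Exchanging the point at infinity \<open>P\<close> for \<open>P'\<close> subtracts
   the old winding number of \<open>P'\<close> everywhere.\<close>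
 have jump: "winding_number (\<lambda>s. affine (M' (q s))) (affine (M' x)) =
   winding_number (\<lambda>s. affine (M (q s))) (affine (M x)) - winding_number (\<lambda>s. affine (M (q s))) (affine (M P'))"
  if M: "M \<in> PSL2C" "M P = Infty" and M': "M' \<in> PSL2C" "M' P' = Infty" and PP: "P \<notin> \<gamma>" "P' \<notin> \<gamma>" "P \<noteq> P'"
   and x: "x \<notin> \<gamma>" "x \<noteq> P" "x \<noteq> P'" for M M' P P' x
 proof -
  obtain N where N: "N \<in> PSL2C" "\<And>x. M (N x) = x" "\<And>x. N (M x) = x" using PSL2C_inverse M by blast
  have fin: "Fin (affine (M u)) = M u" if "u \<noteq> P" for u using moebius_finite_off_pole[OF M that] by (simp add: Fin_affine)
  define c where "c s = affine (M (q s))" for s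
  have c: "c = (\<lambda>x. affine (M x)) \<circ> q" by (auto simp: c_def)
  have "continuous_on \<gamma> (\<lambda>x. affine (M x))"
  proof (rule continuous_on_compose2[OF continuous_on_affine continuous_on_PSL2C[OF M(1)]])
   show "Infty \<notin> M ` \<gamma>" using moebius_finite_off_pole[OF M] PP by (metis imageE)
  qed auto
  then have pc: "path c" unfolding c using qim path_continuous_image by metis
  have pic: "path_image c = (\<lambda>x. affine (M x)) ` \<gamma>" unfolding c using qim by (simp add: path_image_compose)
  have nim: "affine (M u) \<notin> path_image c" if u: "u \<notin> \<gamma>" "u \<noteq> P" for u
  proof
   assume "affine (M u) \<in> path_image c"
   then obtain v where v: "v \<in> \<gamma>" "affine (M u) = affine (M v)" unfolding pic by blast
   then have "M u = M v" using fin[of u] fin[of v] PP u by metis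
   then show False using N(3) v u by metis
  qed
  have NP: "(M' \<circ> N) (Fin (affine (M u))) = M' u" if "u \<noteq> P" for u using fin[OF that] N by simp
  have "winding_number (\<lambda>s. affine ((M' \<circ> N) (Fin (c s)))) (affine ((M' \<circ> N) (Fin (affine (M x)))))
   = winding_number c (affine (M x)) - winding_number c (affine (M P'))"
  proof (rule winding_number_moebius[OF pc])
   show "pathfinish c = pathstart c" using qim by (simp add: c_def pathfinish_def pathstart_def)
   show "M' \<circ> N \<in> PSL2C" using PSL2C_comp M' N by blast
   show "(M' \<circ> N) (Fin (affine (M P'))) = Infty" using NP PP M' by metis
   show "affine (M x) \<notin> path_image c" "affine (M P') \<notin> path_image c" using nim x PP by auto
   show "affine (M x) \<noteq> affine (M P')" using fin[of x] fin[of P'] x PP N by metis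
  qed
  moreover have "winding_number (\<lambda>s. affine ((M' \<circ> N) (Fin (c s)))) y = winding_number (\<lambda>s. affine (M' (q s))) y" for y
  proof (rule winding_number_cong)
   fix s :: real assume "0 \<le> s" "s \<le> 1"
   then have "q s \<in> \<gamma>" unfolding qim(1)[symmetric] by (auto simp: path_image_def)
   then show "affine ((M' \<circ> N) (Fin (c s))) = affine (M' (q s))" unfolding c_def using NP[of "q s"] PP by metis
  qed
  ultimately show ?thesis using NP[OF x(2)] by (simp add: c_def[abs_def])
 qed
 have sym: "components (- \<gamma>) = {\<Omega>2, \<Omega>1}" "\<Omega>2 \<inter> \<Omega>1 = {}" using comp by auto
 obtain P1 P2 where P: "P1 \<in> \<Omega>1" "P2 \<in> \<Omega>2" using ne by auto
 have P': "P1 \<notin> \<gamma>" "P2 \<notin> \<gamma>" "P1 \<noteq> P2" "P1 \<notin> \<Omega>2" "P2 \<notin> \<Omega>1" using P un comp by auto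
 obtain M1 where M1: "M1 \<in> PSL2C" "M1 P2 = Infty" by (rule moebius_pole)
 obtain M2 where M2: "M2 \<in> PSL2C" "M2 P1 = Infty" by (rule moebius_pole)
 obtain w1 where w1: "w1 \<in> {1, -1}" "\<And>x. x \<in> \<Omega>1 \<Longrightarrow> winding_number (\<lambda>s. affine (M1 (q s))) (affine (M1 x)) = w1"
  "\<exists>x\<in>\<Omega>2. x \<noteq> P2 \<and> winding_number (\<lambda>s. affine (M1 (q s))) (affine (M1 x)) = 0"
  by (rule curve_sides[OF q(1) comp M1 P(2)]) (rule that)
 obtain w2 where w2: "w2 \<in> {1, -1}" "\<And>x. x \<in> \<Omega>2 \<Longrightarrow> winding_number (\<lambda>s. affine (M2 (q s))) (affine (M2 x)) = w2"
  "\<exists>x\<in>\<Omega>1. x \<noteq> P1 \<and> winding_number (\<lambda>s. affine (M2 (q s))) (affine (M2 x)) = 0"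
  by (rule curve_sides[OF q(1) sym comp(4,3) M2 P(1)]) (rule that)
 have fin: "Infty \<notin> M ` (\<gamma> \<union> \<Omega>)" if "M \<in> PSL2C" "M P = Infty" "P \<notin> \<gamma> \<union> \<Omega>" for M P \<Omega>
  using moebius_finite_off_pole[OF that(1,2)] that(3) by (metis imageE)
 have ex: "Pos \<Omega>1 \<or> Pos \<Omega>2"
 proof (cases "w1 = 1")
  case True
  then have "Pos \<Omega>1" unfolding Pos_def using M1 w1(2) fin[OF M1, of \<Omega>1] P' by (intro bexI[of _ M1]) auto
  then show ?thesis ..
 next
  case False
  then have w: "w1 = -1" using w1 by auto
  obtain x2 where x2: "x2 \<in> \<Omega>2" "x2 \<noteq> P2" "winding_number (\<lambda>s. affine (M1 (q s))) (affine (M1 x2)) = 0" using w1(3) by blast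
  have "x2 \<notin> \<gamma>" "x2 \<noteq> P1" using x2 un P' by auto
  \<comment> \<open>At \<open>x2\<close> the formula reads \<open>w2 = 0 - w1\<close> with
    \<open>w1 = -1\<close>.\<close>
  then have "w2 = 1" using jump[OF M1 M2, of x2] w2(2)[OF x2(1)] w1(2)[OF P(1)] x2 P' w by auto
  then have "Pos \<Omega>2" unfolding Pos_def using M2 w2(2) fin[OF M2, of \<Omega>2] P' by (intro bexI[of _ M2]) auto
  then show ?thesis ..
 qed
 have not_both: "\<not> (Pos A \<and> Pos B)" if AB: "components (- \<gamma>) = {A, B}" "A \<inter> B = {}" "open A" "open B" for A B
 proof
  assume pos: "Pos A \<and> Pos B"
  have unAB: "- \<gamma> = A \<union> B" using Union_components[of "- \<gamma>"] AB by auto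
  obtain M where M: "M \<in> PSL2C" "Infty \<notin> M ` (\<gamma> \<union> A)"
   "\<And>x. x \<in> A \<Longrightarrow> winding_number (\<lambda>s. affine (M (q s))) (affine (M x)) = 1" using pos unfolding Pos_def by blast
  obtain M' where M': "M' \<in> PSL2C" "Infty \<notin> M' ` (\<gamma> \<union> B)"
   "\<And>x. x \<in> B \<Longrightarrow> winding_number (\<lambda>s. affine (M' (q s))) (affine (M' x)) = 1" using pos unfolding Pos_def by blast
  obtain Q where Q: "M Q = Infty" using PSL2C_inverse M(1) by metis
  obtain Q' where Q': "M' Q' = Infty" using PSL2C_inverse M'(1) by metis
  have QB: "Q \<in> B" "Q \<notin> \<gamma>" "Q' \<in> A" "Q' \<notin> \<gamma>" using Q Q' M(2) M'(2) unAB by (metis ComplI UnE UnI1 UnI2 imageI)+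
  obtain x where x: "x \<in> B" "x \<noteq> Q" "winding_number (\<lambda>s. affine (M (q s))) (affine (M x)) = 0"
  proof (rule curve_sides[OF q(1) AB M(1) Q QB(1)])
  qed (use that in blast)
  \<comment> \<open>Two positive sides would give \<open>1 = 0 - 1\<close> in \<open>jump\<close> at
    \<open>x\<close>.\<close>
  have "x \<notin> \<gamma>" "x \<noteq> Q'" "Q \<noteq> Q'" using x unAB QB AB by auto
  then show False using jump[OF M(1) Q M'(1) Q', of x] M'(3)[OF x(1)] M(3)[OF QB(3)] x QB by auto
 qed
 have "\<exists>!\<Omega>. \<Omega> \<in> components (- \<gamma>) \<and> Pos \<Omega>" using ex not_both[OF comp] comp(1) by auto
 moreover have "Pos \<Omega> \<longleftrightarrow> (\<exists>q t. jordan_param q \<gamma> \<and> increasing_times n t \<and> (\<forall>k\<in>{1..n}. q (t k) = z k) \<and>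
     (\<exists>M\<in>PSL2C. Infty \<notin> M ` (\<gamma> \<union> \<Omega>) \<and>
       (\<forall>x\<in>\<Omega>. winding_number (\<lambda>s. affine (M (q s))) (affine (M x)) = 1)))" (is "_ \<longleftrightarrow> ?P")
  if \<Omega>: "\<Omega> \<in> components (- \<gamma>)" for \<Omega>
 proof
  assume "Pos \<Omega>" then show ?P unfolding Pos_def using q by blast
 next
  assume ?P
  then obtain q' t' M where q': "jordan_param q' \<gamma>" "increasing_times n t'" "\<forall>k\<in>{1..n}. q' (t' k) = z k"
   and M: "M \<in> PSL2C" "Infty \<notin> M ` (\<gamma> \<union> \<Omega>)" "\<forall>x\<in>\<Omega>. winding_number (\<lambda>s. affine (M (q' s))) (affine (M x)) = 1" by blast
  have "winding_number (\<lambda>s. affine (M (q s))) (affine (M x)) = 1" if x: "x \<in> \<Omega>" for x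
  proof -
   have "winding_number (\<lambda>s. affine (M (q s))) (affine (M x)) = winding_number (\<lambda>s. affine (M (q' s))) (affine (M x))"
   proof (rule winding_number_same_orientation[OF q(1) q'(1) n q(2,3) q'(2)])
    show "continuous_on \<gamma> (\<lambda>x. affine (M x))"
     by (rule continuous_on_compose2[OF continuous_on_affine continuous_on_PSL2C[OF M(1)]]) (use M in auto)
    have "x \<notin> \<gamma>" using x \<Omega> in_components_subset by blast
    moreover have "M u \<noteq> Infty" if "u \<in> insert x \<gamma>" for u using M(2) x that by (metis UnI1 UnI2 image_eqI insertE)
    ultimately show "affine (M x) \<notin> (\<lambda>x. affine (M x)) ` \<gamma>"
     using PSL2C_inj[OF M(1), of UNIV] by (metis (no_types, lifting) Fin_affine imageE injD insertCI)
   qed (use q' in auto)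
   then show ?thesis using M(3) x by simp
  qed
  then show "Pos \<Omega>" unfolding Pos_def using M by blast
 qed
 ultimately have "\<exists>!\<Omega>. \<Omega> \<in> components (- \<gamma>) \<and> (\<exists>q t. jordan_param q \<gamma> \<and> increasing_times n t \<and> (\<forall>k\<in>{1..n}. q (t k) = z k) \<and>
     (\<exists>M\<in>PSL2C. Infty \<notin> M ` (\<gamma> \<union> \<Omega>) \<and>
       (\<forall>x\<in>\<Omega>. winding_number (\<lambda>s. affine (M (q s))) (affine (M x)) = 1)))" by (simp cong: conj_cong)
 then show ?thesis unfolding positive_side_def by (rule theI'[THEN conjunct1])
qed

section \<open>The structure of a curve with the geodesic property\<close>

lemma compatibleE:
 assumes "compatible c c'" "x \<in> fst c" "x \<in> fst c'"
 obtains W A where "open W" "x \<in> W" "W \<subseteq> fst c \<inter> fst c'" "A \<in> PSL2C" "\<forall>y\<in>W. snd c' y = A (snd c y)"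
proof -
 have "\<exists>W. open W \<and> x \<in> W \<and> W \<subseteq> fst c \<inter> fst c' \<and> (\<exists>A\<in>PSL2C. \<forall>y\<in>W. snd c' y = A (snd c y))"
  using assms unfolding compatible_def by simp
 then show ?thesis by (elim exE conjE bexE) (rule that)
qed

lemma (in sphere_atlas) transitionE:
 assumes "j \<in> K" "k \<in> K" "y \<in> D j" "y \<in> D k"
 obtains T W where "T \<in> PSL2R" "open W" "y \<in> W" "W \<subseteq> D j \<inter> D k" "\<forall>x\<in>W. g j x = T (g k x)"
 using transition[OF assms] by (elim exE conjE bexE) (rule that)

lemma open_quadrant_images:
 assumes "holomorphic_sphere \<phi> upper_half" "inj_on \<phi> upper_half"
 shows "open (\<phi> ` Fin ` right_quadrant)" "open (\<phi> ` Fin ` left_quadrant)" by (rule open_image_inj_holomorphic[OF assms];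
   simp add: open_Fin_image_iff open_quadrants quadrants(1) le_supI1 le_supI2)+

locale geodesic_curve =
 fixes n :: nat and z :: "nat \<Rightarrow> riemann_sphere" and \<gamma> :: "riemann_sphere set"
  and q0 :: "real \<Rightarrow> riemann_sphere" and t0 :: "nat \<Rightarrow> real"
 assumes n3: "n \<ge> 3" and inj_z: "inj_on z {1..n}"
  and q0: "jordan_param q0 \<gamma>" "increasing_times n t0" "\<And>k. k \<in> {1..n} \<Longrightarrow> q0 (t0 k) = z k"
  and geo: "geodesic_property n z \<gamma>"
begin

abbreviation "edge \<equiv> open_arc n z \<gamma>"
abbreviation "D k \<equiv> - \<gamma> \<union> edge k"
abbreviation "\<Omega> \<equiv> positive_side n z \<gamma>"
abbreviation "\<Omega>' \<equiv> - \<gamma> - \<Omega>"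
abbreviation "S \<equiv> - z ` {1..n}"

lemma arcs: "(\<Union>k\<in>{1..n}. edge k) = \<gamma> - z ` {1..n}" "components (\<gamma> - z ` {1..n}) = edge ` {1..n}"
 "\<And>j k. j \<in> {1..n} \<Longrightarrow> k \<in> {1..n} \<Longrightarrow> j \<noteq> k \<Longrightarrow> edge j \<inter> edge k = {}"
 "\<And>k. k \<in> {1..n} \<Longrightarrow> z k \<in> closure (edge k)"
 "\<And>k. k \<in> {1..n} \<Longrightarrow> z (next_index n k) \<in> closure (edge k)" by (rule open_arcs[OF n3 inj_z q0]; assumption)+

lemma arc_subset: "k \<in> {1..n} \<Longrightarrow> edge k \<subseteq> \<gamma>" using arcs(1) by blast

lemma geodesic_arc: "k \<in> {1..n} \<Longrightarrow> hyperbolic_geodesic (D k) (edge k)" using geo by (simp add: geodesic_property_def)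

lemma one_in: "1 \<in> {1..n}" using n3 by simp

lemma z_in_curve: "z ` {1..n} \<subseteq> \<gamma>"
proof safe
 fix k assume k: "k \<in> {1..n}"
 have "t0 k \<in> {0..1}" using increasing_timesD(2)[OF q0(2) k] by auto
 then have "z k \<in> q0 ` {0..1}" by (rule image_eqI[where f = q0, OF q0(3)[OF k, symmetric]])
 then show "z k \<in> \<gamma>" using q0(1) by (simp add: jordan_param_def path_image_def)
qed

lemma Union_D: "(\<Union>k\<in>{1..n}. D k) = S"
proof -
 have "(\<Union>k\<in>{1..n}. D k) = - \<gamma> \<union> (\<Union>k\<in>{1..n}. edge k)" using one_in by blast
 then show ?thesis using arcs(1) z_in_curve by auto
qed

text \<open>\<open>geodesic_chart\<close> starts from a component, so a point off the curve comes
  first: the image of a point of the half-plane that is not on the geodesic.\<close>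

lemma sides_exist:
 obtains \<Omega>1 \<Omega>2 where "components (- \<gamma>) = {\<Omega>1, \<Omega>2}" "\<Omega>1 \<inter> \<Omega>2 = {}" "open \<Omega>1" "open \<Omega>2"
proof -
 have "- \<gamma> \<noteq> {}"
 proof -
  obtain \<phi> L where \<phi>: "conformal_map \<phi> upper_half (D 1)" "geodesic_line L" "edge 1 = \<phi> ` Fin ` L"
   using geodesic_arc[OF one_in] unfolding hyperbolic_geodesic_def by blast
  obtain A where A: "A \<in> PSL2R" "Fin ` L = A ` Fin ` imag_ray" using geodesic_line_image \<phi>(2) by blast
  define x where "x = A (Fin (Complex 1 1))"
  have AC: "inj A" using A PSL2R_subset_PSL2C PSL2C_inj by blast
  have u: "x \<in> upper_half" using PSL2R_half(1)[OF A(1)] unfolding x_def by force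
  have nL: "x \<notin> Fin ` L" unfolding x_def A(2) inj_image_mem_iff[OF AC] by (auto simp: imag_ray_def)
  have sub: "Fin ` L \<subseteq> upper_half"
   unfolding A(2) using PSL2R_half(1)[OF A(1)] by (auto simp: imag_ray_def image_iff) (metis Fin_in_upper_half image_eqI)
  have "\<phi> x \<notin> edge 1"
  proof
   assume "\<phi> x \<in> edge 1"
   then obtain y where "y \<in> Fin ` L" "\<phi> x = \<phi> y" unfolding \<phi>(3) by blast
   then show False using \<phi>(1) u nL sub unfolding conformal_simps by (metis inj_onD subsetD)
  qed
  moreover have "\<phi> x \<in> D 1" using \<phi>(1) u unfolding conformal_simps by blast
  ultimately show ?thesis by blast
 qed
 then obtain \<Omega>1 where \<Omega>1: "\<Omega>1 \<in> components (- \<gamma>)" by (metis Union_components Union_empty ex_in_conv)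
 obtain \<phi> where \<phi>: "conformal_map \<phi> upper_half (D 1)" "\<phi> ` Fin ` right_quadrant = \<Omega>1"
  "\<phi> ` Fin ` left_quadrant = - \<gamma> - \<Omega>1" "components (- \<gamma>) = {\<Omega>1, - \<gamma> - \<Omega>1}"
  by (rule geodesic_chart[OF geodesic_arc[OF one_in] arc_subset[OF one_in] \<Omega>1]) (rule that)
 have h: "holomorphic_sphere \<phi> upper_half" "inj_on \<phi> upper_half" using \<phi>(1) by (auto simp: conformal_simps)
 have "open \<Omega>1" by (subst \<phi>(2)[symmetric]) (rule open_quadrant_images[OF h])
 moreover have "open (- \<gamma> - \<Omega>1)" by (subst \<phi>(3)[symmetric]) (rule open_quadrant_images[OF h])
 ultimately show ?thesis using that[of \<Omega>1 "- \<gamma> - \<Omega>1"] \<phi>(4) by blast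
qed

lemma \<Omega>_component: "\<Omega> \<in> components (- \<gamma>)"
proof -
 obtain \<Omega>1 \<Omega>2 where s: "components (- \<gamma>) = {\<Omega>1, \<Omega>2}" "\<Omega>1 \<inter> \<Omega>2 = {}" "open \<Omega>1" "open \<Omega>2" by (rule sides_exist)
 show ?thesis by (rule positive_side_component[OF n3 inj_z q0(1,2) _ s]) (rule q0(3))
qed

lemma \<Omega>_subset: "\<Omega> \<subseteq> - \<gamma>" using \<Omega>_component in_components_subset by blast

lemma \<Omega>_nonempty: "\<Omega> \<noteq> {}" using \<Omega>_component in_components_nonempty by blast

end

text \<open>One uniformization \<open>f\<close> and one set of extensions are fixed here;
  \<open>other_uniformization\<close> and \<open>extends_across_unique\<close> show that other
  choices differ only by real Moebius maps.\<close>

locale geodesic_charts = geodesic_curve +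
 fixes f :: "riemann_sphere \<Rightarrow> riemann_sphere" and \<psi> g B :: "nat \<Rightarrow> riemann_sphere \<Rightarrow> riemann_sphere"
 assumes f: "conformal_map f upper_half \<Omega>" and \<psi>: "\<And>k. k \<in> {1..n} \<Longrightarrow> conformal_map (\<psi> k) (D k) upper_half"
  and \<psi>_arc: "\<And>k. k \<in> {1..n} \<Longrightarrow> \<psi> k ` edge k = Fin ` imag_ray"
  and \<psi>_\<Omega>: "\<And>k. k \<in> {1..n} \<Longrightarrow> \<psi> k ` \<Omega> = Fin ` right_quadrant"
  and \<psi>_\<Omega>': "\<And>k. k \<in> {1..n} \<Longrightarrow> \<psi> k ` \<Omega>' = Fin ` left_quadrant"
  and B: "\<And>k. k \<in> {1..n} \<Longrightarrow> B k \<in> PSL2R"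
  and g_def: "\<And>k x. k \<in> {1..n} \<Longrightarrow> g k x = B k (square (\<psi> k x))"
  and g: "\<And>k. k \<in> {1..n} \<Longrightarrow> conformal_map (g k) (D k) (upper_half \<union> lower_half \<union> g k ` edge k)"
  and gf: "\<And>k w. k \<in> {1..n} \<Longrightarrow> w \<in> upper_half \<Longrightarrow> g k (f w) = w"
  and g_\<Omega>: "\<And>k. k \<in> {1..n} \<Longrightarrow> g k ` \<Omega> = upper_half"
  and g_\<Omega>': "\<And>k. k \<in> {1..n} \<Longrightarrow> g k ` \<Omega>' = lower_half"

lemma (in geodesic_curve) geodesic_charts_exist:
 obtains f \<psi> g B where "geodesic_charts n z \<gamma> q0 t0 f \<psi> g B"
proof -
 obtain f where f: "conformal_map f upper_half \<Omega>"
  by (rule geodesic_side_conformal[OF geodesic_arc[OF one_in] arc_subset[OF one_in] \<Omega>_component])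
 have "\<exists>\<psi> g B. conformal_map \<psi> (D k) upper_half \<and> \<psi> ` edge k = Fin ` imag_ray \<and>
  \<psi> ` \<Omega> = Fin ` right_quadrant \<and> \<psi> ` \<Omega>' = Fin ` left_quadrant \<and>
  B \<in> PSL2R \<and> (\<forall>x. g x = B (square (\<psi> x))) \<and>
  conformal_map g (D k) (upper_half \<union> lower_half \<union> g ` edge k) \<and> (\<forall>w\<in>upper_half. g (f w) = w) \<and>
  g ` \<Omega> = upper_half \<and> g ` \<Omega>' = lower_half" if k: "k \<in> {1..n}" for k
 proof -
  obtain \<psi> g B where c: "conformal_map \<psi> (D k) upper_half" "\<psi> ` edge k = Fin ` imag_ray"
   "\<psi> ` \<Omega> = Fin ` right_quadrant" "\<psi> ` \<Omega>' = Fin ` left_quadrant" "B \<in> PSL2R" "\<And>x. g x = B (square (\<psi> x))"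
   "conformal_map g (D k) (upper_half \<union> lower_half \<union> g ` edge k)" "\<And>w. w \<in> upper_half \<Longrightarrow> g (f w) = w"
   "g ` \<Omega> = upper_half" "g ` \<Omega>' = lower_half"
   by (rule conformal_extension[OF geodesic_arc[OF k] arc_subset[OF k] \<Omega>_component f]) (rule that)
  show ?thesis by (intro exI[of _ \<psi>] exI[of _ g] exI[of _ B] conjI allI ballI c)
 qed
 then obtain \<psi> g B where *: "\<And>k. k \<in> {1..n} \<Longrightarrow> conformal_map (\<psi> k) (D k) upper_half \<and> \<psi> k ` edge k = Fin ` imag_ray \<and>
  \<psi> k ` \<Omega> = Fin ` right_quadrant \<and> \<psi> k ` \<Omega>' = Fin ` left_quadrant \<and>
  B k \<in> PSL2R \<and> (\<forall>x. g k x = B k (square (\<psi> k x))) \<and>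
  conformal_map (g k) (D k) (upper_half \<union> lower_half \<union> g k ` edge k) \<and> (\<forall>w\<in>upper_half. g k (f w) = w) \<and>
  g k ` \<Omega> = upper_half \<and> g k ` \<Omega>' = lower_half" by metis
 have c: "conformal_map (\<psi> k) (D k) upper_half" "\<psi> k ` edge k = Fin ` imag_ray"
  "\<psi> k ` \<Omega> = Fin ` right_quadrant" "\<psi> k ` \<Omega>' = Fin ` left_quadrant" "B k \<in> PSL2R"
  "conformal_map (g k) (D k) (upper_half \<union> lower_half \<union> g k ` edge k)"
  "g k ` \<Omega> = upper_half" "g k ` \<Omega>' = lower_half" if "k \<in> {1..n}" for k by (insert *[OF that], (elim conjE, assumption)+)
 have "g k x = B k (square (\<psi> k x))" if "k \<in> {1..n}" for k x by (insert *[OF that], elim conjE, erule allE, assumption)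
 moreover have "g k (f w) = w" if "k \<in> {1..n}" "w \<in> upper_half" for k w
  by (insert *[OF that(1)], elim conjE, rule bspec[OF _ that(2)], assumption)
 ultimately have "geodesic_charts n z \<gamma> q0 t0 f \<psi> g B" by unfold_locales ((rule f) | (rule c; assumption) | blast)+
 then show ?thesis by (rule that)
qed

context geodesic_charts
begin

lemma open_side: "open \<Omega>" and open_side': "open \<Omega>'" and connected_side: "connected \<Omega>"
proof -
 have h: "holomorphic_sphere (\<psi> 1) (D 1)" "inj_on (\<psi> 1) (D 1)" using \<psi>[OF one_in] by (auto simp: conformal_simps)
 let ?\<phi> = "inv_into (D 1) (\<psi> 1)"
 have c: "conformal_map ?\<phi> upper_half (D 1)" by (rule conformal_map_inverse(3)[OF \<psi>[OF one_in]])
 then have h': "holomorphic_sphere ?\<phi> upper_half" "inj_on ?\<phi> upper_half" by (auto simp: conformal_simps)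
 have "?\<phi> ` \<psi> 1 ` \<Omega> = \<Omega>" "?\<phi> ` \<psi> 1 ` \<Omega>' = \<Omega>'"
  by (rule inv_into_image_cancel[OF h(2)]; use \<Omega>_subset in auto)+
 then have e: "\<Omega> = ?\<phi> ` Fin ` right_quadrant" "\<Omega>' = ?\<phi> ` Fin ` left_quadrant" using \<psi>_\<Omega>[OF one_in] \<psi>_\<Omega>'[OF one_in] by auto
 have o: "open (?\<phi> ` Fin ` right_quadrant)" "open (?\<phi> ` Fin ` left_quadrant)" by (rule open_quadrant_images[OF h'])+
 show "open \<Omega>" by (subst e(1)) (rule o(1))
 show "open \<Omega>'" by (subst e(2)) (rule o(2))
 show "connected \<Omega>" using \<Omega>_component in_components_connected by blast
qed

lemma g_hol: "k \<in> {1..n} \<Longrightarrow> holomorphic_sphere (g k) (D k)" and g_inj: "k \<in> {1..n} \<Longrightarrow> inj_on (g k) (D k)"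
 using g by (auto simp: conformal_simps)

lemma f_onto: "x \<in> \<Omega> \<Longrightarrow> \<exists>w\<in>upper_half. x = f w" using f by (auto simp: conformal_simps)

lemma g_eq_on_\<Omega>: "j \<in> {1..n} \<Longrightarrow> k \<in> {1..n} \<Longrightarrow> x \<in> \<Omega> \<Longrightarrow> g j x = g k x"
 using f_onto gf by metis

lemma g_conformal_sides:
 assumes k: "k \<in> {1..n}" shows "conformal_map (g k) \<Omega> upper_half" "conformal_map (g k) \<Omega>' lower_half"
proof -
 have "\<Omega> \<subseteq> D k" "\<Omega>' \<subseteq> D k" using \<Omega>_subset by auto
 from conformal_map_subset[OF g[OF k] this(1) open_side] conformal_map_subset[OF g[OF k] this(2) open_side']
 show "conformal_map (g k) \<Omega> upper_half" "conformal_map (g k) \<Omega>' lower_half" unfolding g_\<Omega>[OF k] g_\<Omega>'[OF k] by auto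
qed

lemma g_transition_\<Omega>':
 assumes "j \<in> {1..n}" "k \<in> {1..n}"
 obtains A where "A \<in> PSL2R" "\<And>x. x \<in> \<Omega>' \<Longrightarrow> g j x = A (g k x)"
proof -
 let ?i = "inv_into \<Omega>' (g k)"
 have "conformal_map (\<lambda>w. g j (?i w)) lower_half lower_half"
  by (rule conformal_map_compose[OF conformal_map_inverse(3) g_conformal_sides(2)])
   (rule g_conformal_sides(2), (rule assms)+)
 then obtain A where A: "A \<in> PSL2R" "\<And>w. w \<in> lower_half \<Longrightarrow> g j (?i w) = A w"
  by (rule lower_half_automorphism) (rule that)
 show ?thesis
 proof (rule that[OF A(1)])
  fix x assume x: "x \<in> \<Omega>'"
  then have "g k x \<in> lower_half" using g_\<Omega>'[OF assms(2)] by blast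
  moreover have "?i (g k x) = x" by (rule inv_into_f_f[OF inj_on_subset[OF g_inj[OF assms(2)]] x]) auto
  ultimately show "g j x = A (g k x)" using A(2) by metis
 qed
qed

lemma D_inter: "j \<in> {1..n} \<Longrightarrow> k \<in> {1..n} \<Longrightarrow> j \<noteq> k \<Longrightarrow> D j \<inter> D k = - \<gamma>"
 using arcs(3)[of j k] arc_subset by blast

text \<open>Distinct domains meet exactly in the complement of the curve. On \<Omega> the transition
  is the identity, since both extensions invert \<open>f\<close>; on \<Omega>' it is an automorphism
  of the lower half-plane.\<close>

sublocale sphere_atlas "{1..n}" "\<lambda>k. D k" g
proof
 fix j k y assume jk: "j \<in> {1..n}" "k \<in> {1..n}" and y: "y \<in> D j" "y \<in> D k"
 show "\<exists>T\<in>PSL2R. \<exists>W. open W \<and> y \<in> W \<and> W \<subseteq> D j \<inter> D k \<and> (\<forall>x\<in>W. g j x = T (g k x))"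
 proof (cases "j = k")
  case True
  then show ?thesis using y holomorphic_sphere_open[OF g_hol[OF jk(2)]] by (intro bexI[of _ id] exI[of _ "D k"]) (auto simp: id_PSL2R)
 next
  case False
  then have "y \<in> - \<gamma>" using D_inter[OF jk] y by blast
  then consider "y \<in> \<Omega>" | "y \<in> \<Omega>'" by blast
  then show ?thesis
  proof cases
   case 1
   then show ?thesis using g_eq_on_\<Omega>[OF jk] open_side \<Omega>_subset by (intro bexI[of _ id] exI[of _ \<Omega>]) (auto simp: id_PSL2R)
  next
   case 2
   obtain A where "A \<in> PSL2R" "\<And>x. x \<in> \<Omega>' \<Longrightarrow> g j x = A (g k x)" by (rule g_transition_\<Omega>'[OF jk]) (rule that)
   then show ?thesis using 2 open_side' by (intro bexI[of _ A] exI[of _ \<Omega>']) auto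
  qed
 qed
qed (use g_hol g_inj in auto)

lemma connected_D: assumes k: "k \<in> {1..n}" shows "connected (D k)"
proof -
 let ?\<phi> = "inv_into (D k) (\<psi> k)"
 have c: "conformal_map ?\<phi> upper_half (D k)" by (rule conformal_map_inverse(3)[OF \<psi>[OF k]])
 then have "D k = ?\<phi> ` upper_half" "continuous_on upper_half ?\<phi>" by (auto simp: conformal_simps holomorphic_sphere_continuous)
 moreover have "connected upper_half" unfolding upper_half_def
  by (intro connected_continuous_image continuous_on_Fin convex_connected convex_halfspace_Im_gt)
 ultimately show ?thesis using connected_continuous_image by metis
qed

text \<open>Two uniformizations of \<Omega> differ by an automorphism of the upper half-plane; all
  \<open>g k\<close> agree on \<Omega>, so one real map \<open>C\<close> works for every
  \<open>k\<close>.\<close>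

lemma other_uniformization:
 assumes f': "conformal_map f' upper_half \<Omega>"
 obtains C where "C \<in> PSL2R" "\<And>k x. k \<in> {1..n} \<Longrightarrow> x \<in> \<Omega> \<Longrightarrow> inv_into upper_half f' x = C (g k x)"
proof -
 have "conformal_map (\<lambda>w. g 1 (f' w)) upper_half upper_half" by (rule conformal_map_compose[OF f' g_conformal_sides(1)[OF one_in]])
 then obtain A where A: "A \<in> PSL2R" "\<And>w. w \<in> upper_half \<Longrightarrow> g 1 (f' w) = A w"
  by (rule upper_half_automorphism) (rule that)
 obtain C where C: "C \<in> PSL2R" "\<And>x. A (C x) = x" "\<And>x. C (A x) = x" using PSL2R_inverse A by blast
 have inj: "inj_on f' upper_half" "f' ` upper_half = \<Omega>" using f' by (auto simp: conformal_simps)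
 show ?thesis
 proof (rule that[OF C(1)])
  fix k x assume k: "k \<in> {1..n}" and x: "x \<in> \<Omega>"
  then obtain w where w: "w \<in> upper_half" "x = f' w" using inj by blast
  then show "inv_into upper_half f' x = C (g k x)" using g_eq_on_\<Omega>[OF k one_in x] A(2)[OF w(1)] C(3) inj(1) by (simp add: inv_into_f_f)
 qed
qed

lemma extends_across_g: "k \<in> {1..n} \<Longrightarrow> extends_across n z \<gamma> f k (g k)" unfolding extends_across_def using g gf by auto

text \<open>Equality holds on \<Omega> and spreads over the connected domain \<open>D k\<close> by
  the identity theorem.\<close>

lemma extends_across_unique:
 assumes f': "conformal_map f' upper_half \<Omega>" and k: "k \<in> {1..n}" and e: "extends_across n z \<gamma> f' k g'"
 obtains C where "C \<in> PSL2R" "\<And>x. x \<in> D k \<Longrightarrow> g' x = C (g k x)"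
proof -
 obtain C where C: "C \<in> PSL2R" "\<And>k x. k \<in> {1..n} \<Longrightarrow> x \<in> \<Omega> \<Longrightarrow> inv_into upper_half f' x = C (g k x)"
  by (rule other_uniformization[OF f']) (rule that)
 have CC: "C \<in> PSL2C" using C PSL2R_subset_PSL2C by blast
 have inj: "inj_on f' upper_half" "f' ` upper_half = \<Omega>" using f' by (auto simp: conformal_simps)
 have "g' x = C (g k x)" if x: "x \<in> D k" for x
 proof (rule sphere_identity[of "D k" g' "\<lambda>x. C (g k x)" \<Omega> x])
  show "connected (D k)" by (rule connected_D[OF k])
  show "holomorphic_sphere g' (D k)" using e by (simp add: extends_across_def conformal_map_def)
  show "holomorphic_sphere (\<lambda>x. C (g k x)) (D k)" by (rule holomorphic_sphere_PSL2C_comp[OF g_hol[OF k] CC])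
  show "g' y = C (g k y)" if y: "y \<in> \<Omega>" for y
  proof -
   obtain w where w: "w \<in> upper_half" "y = f' w" using inj y by blast
   have "g' y = w" using e w by (simp add: extends_across_def)
   also have "w = inv_into upper_half f' y" using w inj by (simp add: inv_into_f_f)
   finally show ?thesis using C(2)[OF k y] by simp
  qed
 qed (use open_side \<Omega>_nonempty \<Omega>_subset x in auto)
 then show ?thesis using that C by blast
qed

text \<open>The definition quantifies over all uniformizations and all extensions; each of these is
  a real Moebius image of a fixed \<open>g k\<close>, so finitely many conditions suffice.\<close>

lemma curve_structure_iff:
 "c \<in> curve_structure n z \<gamma> \<longleftrightarrow> c \<in> holomorphic_charts S \<and> (\<forall>k\<in>{1..n}. compatible (D k, g k) c)"
proof
 assume "c \<in> curve_structure n z \<gamma>"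
 then show "c \<in> holomorphic_charts S \<and> (\<forall>k\<in>{1..n}. compatible (D k, g k) c)"
  unfolding curve_structure_def using f extends_across_g by blast
next
 assume c: "c \<in> holomorphic_charts S \<and> (\<forall>k\<in>{1..n}. compatible (D k, g k) c)"
 have "compatible (D k, g') c" if h: "conformal_map f' upper_half \<Omega>" "k \<in> {1..n}" "extends_across n z \<gamma> f' k g'" for f' k g'
 proof -
  obtain C where C: "C \<in> PSL2R" "\<And>x. x \<in> D k \<Longrightarrow> g' x = C (g k x)" by (rule extends_across_unique[OF h]) (rule that)
  obtain C' where C': "C' \<in> PSL2R" "\<And>x. C' (C x) = x" using PSL2R_inverse C by metis
  show ?thesis unfolding compatible_def
  proof
   fix x assume x: "x \<in> fst (D k, g') \<inter> fst c"
   have ck: "compatible (D k, g k) c" using c h by blast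
   obtain W A where W: "open W" "x \<in> W" "W \<subseteq> D k \<inter> fst c" "A \<in> PSL2C" "\<forall>y\<in>W. snd c y = A (g k y)"
    by (rule compatibleE[OF ck, of x]) (use x in auto)
   show "\<exists>W. open W \<and> x \<in> W \<and> W \<subseteq> fst (D k, g') \<inter> fst c \<and> (\<exists>A\<in>PSL2C. \<forall>y\<in>W. snd c y = A (snd (D k, g') y))"
   proof (intro exI conjI bexI ballI)
    show "A \<circ> C' \<in> PSL2C" using PSL2C_comp W(4) C' PSL2R_subset_PSL2C by blast
    show "snd c y = (A \<circ> C') (snd (D k, g') y)" if "y \<in> W" for y using W(3,5) that C(2)[of y] C'(2) by auto
   qed (use W in auto)
  qed
 qed
 then show "c \<in> curve_structure n z \<gamma>" unfolding curve_structure_def using c by blast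
qed

lemma chart_in_curve_structure:
 assumes k: "k \<in> {1..n}" and U: "open U" "U \<subseteq> D k" and A: "A \<in> PSL2C" and \<phi>: "\<And>x. x \<in> U \<Longrightarrow> \<phi> x = A (g k x)"
 shows "(U, \<phi>) \<in> curve_structure n z \<gamma>" unfolding curve_structure_iff
proof
 have "holomorphic_sphere (\<lambda>x. A (g k x)) U" using holomorphic_sphere_PSL2C_comp[OF holomorphic_sphere_subset[OF g_hol[OF k] U(2,1)] A] .
 then have "holomorphic_sphere \<phi> U" using holomorphic_sphere_cong[of U \<phi> "\<lambda>x. A (g k x)"] \<phi> by simp
 moreover have "inj_on \<phi> U"
 proof (rule inj_onI)
  fix x y assume xy: "x \<in> U" "y \<in> U" "\<phi> x = \<phi> y"
  then have "g k x = g k y" using \<phi> PSL2C_inj[OF A, of UNIV] by (auto dest: injD)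
  then show "x = y" using g_inj[OF k] xy U by (meson inj_onD subsetD)
 qed
 moreover have "U \<subseteq> S" using U Union_D k by blast
 ultimately show "(U, \<phi>) \<in> holomorphic_charts S" by (simp add: holomorphic_charts_def)
 show "\<forall>j\<in>{1..n}. compatible (D j, g j) (U, \<phi>)" unfolding compatible_def
 proof (intro ballI)
  fix j x assume j: "j \<in> {1..n}" and x: "x \<in> fst (D j, g j) \<inter> fst (U, \<phi>)"
  obtain T W where T: "T \<in> PSL2R" "open W" "x \<in> W" "W \<subseteq> D k \<inter> D j" "\<forall>y\<in>W. g k y = T (g j y)"
   by (rule transitionE[OF k j, of x]) (use x U in auto)
  show "\<exists>W. open W \<and> x \<in> W \<and> W \<subseteq> fst (D j, g j) \<inter> fst (U, \<phi>) \<and> (\<exists>A\<in>PSL2C. \<forall>y\<in>W. snd (U, \<phi>) y = A (snd (D j, g j) y))"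
  proof (intro exI conjI bexI ballI)
   show "A \<circ> T \<in> PSL2C" using PSL2C_comp A T PSL2R_subset_PSL2C by blast
   show "snd (U, \<phi>) y = (A \<circ> T) (snd (D j, g j) y)" if "y \<in> W \<inter> U" for y using that T \<phi> by auto
  qed (use T U x in auto)
 qed
qed

theorem projective_structure_curve: "projective_structure S (curve_structure n z \<gamma>)" unfolding projective_structure_def
proof (intro conjI allI impI)
 have basic: "(D k, g k) \<in> curve_structure n z \<gamma>" if "k \<in> {1..n}" for k
  by (rule chart_in_curve_structure[OF that open_D[OF that] subset_refl id_PSL2C]) simp
 have sub: "curve_structure n z \<gamma> \<subseteq> holomorphic_charts S" using curve_structure_iff by blast
 show "projective_atlas S (curve_structure n z \<gamma>)" unfolding projective_atlas_def
 proof (intro conjI ballI)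
  show "curve_structure n z \<gamma> \<subseteq> holomorphic_charts S" by (rule sub)
  show "\<Union> (fst ` curve_structure n z \<gamma>) = S"
  proof
   show "\<Union> (fst ` curve_structure n z \<gamma>) \<subseteq> S"
   proof (rule UN_least)
    fix c assume "c \<in> curve_structure n z \<gamma>"
    then have "c \<in> holomorphic_charts S" using sub by blast
    then show "fst c \<subseteq> S" by (auto simp: holomorphic_charts_def)
   qed
   show "S \<subseteq> \<Union> (fst ` curve_structure n z \<gamma>)"
   proof
    fix x assume "x \<in> S"
    then obtain k where k: "k \<in> {1..n}" "x \<in> D k" using Union_D by blast
    then show "x \<in> \<Union> (fst ` curve_structure n z \<gamma>)" using basic[OF k(1)] by force
   qed
  qed
  fix c c' assume c: "c \<in> curve_structure n z \<gamma>" "c' \<in> curve_structure n z \<gamma>"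
  show "compatible c c'" unfolding compatible_def
  proof
   fix x assume x: "x \<in> fst c \<inter> fst c'"
   have "c \<in> holomorphic_charts S" using c sub by blast
   then have "fst c \<subseteq> S" by (auto simp: holomorphic_charts_def)
   then have "x \<in> S" using x by blast
   then obtain k where k: "k \<in> {1..n}" "x \<in> D k" using Union_D by blast
   have cc: "compatible (D k, g k) c" "compatible (D k, g k) c'" using c k curve_structure_iff by blast+
   obtain W A where W: "open W" "x \<in> W" "W \<subseteq> D k \<inter> fst c" "A \<in> PSL2C" "\<forall>y\<in>W. snd c y = A (g k y)"
    by (rule compatibleE[OF cc(1), of x]) (use x k in auto)
   obtain W' A' where W': "open W'" "x \<in> W'" "W' \<subseteq> D k \<inter> fst c'" "A' \<in> PSL2C" "\<forall>y\<in>W'. snd c' y = A' (g k y)"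
    by (rule compatibleE[OF cc(2), of x]) (use x k in auto)
   obtain A1 where A1: "A1 \<in> PSL2C" "\<And>y. A1 (A y) = y" using PSL2C_inverse W(4) by metis
   show "\<exists>W. open W \<and> x \<in> W \<and> W \<subseteq> fst c \<inter> fst c' \<and> (\<exists>A\<in>PSL2C. \<forall>y\<in>W. snd c' y = A (snd c y))"
   proof (intro exI conjI bexI ballI)
    show "A' \<circ> A1 \<in> PSL2C" using PSL2C_comp W' A1 by blast
    show "snd c' y = (A' \<circ> A1) (snd c y)" if "y \<in> W \<inter> W'" for y using that W W' A1 by auto
   qed (use W W' in auto)
  qed
 qed
 fix Z' assume Z': "projective_atlas S Z' \<and> curve_structure n z \<gamma> \<subseteq> Z'"
 \<comment> \<open>A larger atlas contains the charts \<open>(D k, g k)\<close>, and compatibility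
   with these is the membership criterion.\<close>
 have "c \<in> curve_structure n z \<gamma>" if "c \<in> Z'" for c
  unfolding curve_structure_iff using Z' basic that unfolding projective_atlas_def by blast
 then show "Z' = curve_structure n z \<gamma>" using Z' by blast
qed

end

section \<open>The developing map and its holonomy representation\<close>

lemma spread_open_subset:
 assumes X: "spread X p" and V: "open_in X V" shows "spread V p" unfolding spread_def
proof
 fix x assume x: "x \<in> V"
 then have xX: "x \<in> X" using V openin_imp_subset by blast
 obtain V' q where V': "open_in X V'" "x \<in> V'" "V' \<subseteq> V" "p ` V' \<subseteq> UNIV" "open (p ` V')"
  "path_connected (p ` V')" "path_connected V'" "homeomorphism V' (p ` V') p q" by (rule spread_small[OF X xX V x open_UNIV UNIV_I]) (rule that)
 have "open_in V V'" using V'(1,3) V openin_imp_subset openin_subset_trans by metis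
 then show "\<exists>V'. open_in V V' \<and> x \<in> V' \<and> open (p ` V') \<and> (\<exists>q. homeomorphism V' (p ` V') p q)" using V' by blast
qed

lemma spread_open_map:
 assumes X: "spread X p" and V: "open_in X V" shows "open (p ` V)"
proof (subst open_subopen, intro ballI)
 fix y assume "y \<in> p ` V"
 then obtain x where x: "x \<in> V" "y = p x" by blast
 then have xX: "x \<in> X" using V openin_imp_subset by blast
 obtain V' where "x \<in> V'" "V' \<subseteq> V" "open (p ` V')" by (rule spread_small[OF X xX V x(1) open_UNIV UNIV_I]) (rule that)
 then show "\<exists>T. open T \<and> y \<in> T \<and> T \<subseteq> p ` V" using x by (intro exI[of _ "p ` V'"]) auto
qed

lemma (in sphere_atlas) devel_open_subset:
 assumes X: "spread X p" and V: "open_in X V" and h: "devel X p h" shows "devel V p h" unfolding devel_def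
proof
 fix x assume x: "x \<in> V"
 then have xX: "x \<in> X" using V openin_imp_subset by blast
 have ld: "local_devel X p h x" using develD[OF h xX] .
 then obtain k where k: "k \<in> K" "p x \<in> D k" unfolding local_devel_def by blast
 obtain V' B where V': "open_in X V'" "x \<in> V'" "V' \<subseteq> V" "p ` V' \<subseteq> D k" "open (p ` V')" "path_connected V'"
  "B \<in> PSL2R" "\<And>y. y \<in> V' \<Longrightarrow> h y = B (g k (p y))" by (rule local_devel_chart[OF X ld xX k V x]) (rule that)
 have "open_in V V'" using V'(1,3) V openin_imp_subset openin_subset_trans by metis
 then show "local_devel V p h x" unfolding local_devel_def using V' k by blast
qed

lemma (in sphere_atlas) devel_holomorphic_chart:
 assumes X: "spread X p" and h: "devel X p h" and x: "x \<in> X"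
 obtains V k B where "open_in X V" "x \<in> V" "inj_on p V" "open (p ` V)" "k \<in> K" "p ` V \<subseteq> D k" "B \<in> PSL2R"
  "\<And>y. y \<in> p ` V \<Longrightarrow> (h \<circ> inv_into V p) y = B (g k y)"
proof -
 obtain V k B where V: "open_in X V" "x \<in> V" "k \<in> K" "B \<in> PSL2R" "p ` V \<subseteq> D k"
  "\<forall>y\<in>V. h y = B (g k (p y))" by (rule local_develE[OF develD[OF h x]]) (rule that)
 obtain V' q where V': "open_in X V'" "x \<in> V'" "V' \<subseteq> V" "p ` V' \<subseteq> UNIV" "open (p ` V')"
  "path_connected (p ` V')" "path_connected V'" "homeomorphism V' (p ` V') p q" by (rule spread_small[OF X x V(1,2) open_UNIV UNIV_I]) (rule that)
 have inj: "inj_on p V'" using V'(8) unfolding homeomorphism_def by (auto intro: inj_on_inverseI)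
 show ?thesis
 proof (rule that[OF V'(1,2) inj V'(5) V(3) _ V(4)])
  show "p ` V' \<subseteq> D k" using V V' by blast
  fix y assume "y \<in> p ` V'"
  then obtain x' where x': "x' \<in> V'" "y = p x'" by blast
  then show "(h \<circ> inv_into V' p) y = B (g k y)" using inj V V' by (simp add: inv_into_f_f subsetD)
 qed
qed

context geodesic_charts
begin

lemma developing_map_of_devel:
 assumes X: "spread X p" and h: "devel X p h" shows "developing_map X p (curve_structure n z \<gamma>) h" unfolding developing_map_def
proof
 fix x assume x: "x \<in> X"
 obtain V k A where V: "open_in X V" "x \<in> V" "inj_on p V" "open (p ` V)" "k \<in> {1..n}" "p ` V \<subseteq> D k" "A \<in> PSL2R"
  "\<And>y. y \<in> p ` V \<Longrightarrow> (h \<circ> inv_into V p) y = A (g k y)" by (rule devel_holomorphic_chart[OF X h x]) (rule that)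
 have "(p ` V, h \<circ> inv_into V p) \<in> curve_structure n z \<gamma>"
  by (rule chart_in_curve_structure[where \<phi> = "h \<circ> inv_into V p" and A = A, OF V(5,4,6)]) (use V(7,8) PSL2R_subset_PSL2C in blast)+
 then show "\<exists>V. open_in X V \<and> x \<in> V \<and> inj_on p V \<and> (p ` V, h \<circ> inv_into V p) \<in> curve_structure n z \<gamma>"
  using V by blast
qed

lemma holomorphic_on_cover_of_devel:
 assumes X: "spread X p" and h: "devel X p h" shows "holomorphic_on_cover X p h" unfolding holomorphic_on_cover_def
proof
 fix x assume x: "x \<in> X"
 obtain V k A where V: "open_in X V" "x \<in> V" "inj_on p V" "open (p ` V)" "k \<in> {1..n}" "p ` V \<subseteq> D k" "A \<in> PSL2R"
  "\<And>y. y \<in> p ` V \<Longrightarrow> (h \<circ> inv_into V p) y = A (g k y)" by (rule devel_holomorphic_chart[OF X h x]) (rule that)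
 have A: "A \<in> PSL2C" using V(7) PSL2R_subset_PSL2C by blast
 have "holomorphic_sphere (\<lambda>y. A (g k y)) (p ` V)"
  by (rule holomorphic_sphere_PSL2C_comp[OF holomorphic_sphere_subset[OF g_hol[OF V(5)] V(6,4)] A])
 then have "holomorphic_sphere (h \<circ> inv_into V p) (p ` V)"
  using holomorphic_sphere_cong[of "p ` V" "h \<circ> inv_into V p" "\<lambda>y. A (g k y)"] V(8) by blast
 then show "\<exists>V. open_in X V \<and> x \<in> V \<and> inj_on p V \<and> holomorphic_sphere (h \<circ> inv_into V p) (p ` V)" using V by blast
qed

lemma open_S: "open S" using Union_D open_D open_UN[of "{1..n}" "\<lambda>k. D k"] by simp

text \<open>Take any development \<open>h\<close> and a sheet \<open>V\<close> over \<Omega>. On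
  \<open>V\<close> it differs from the inverse of \<open>f\<close> by a real Moebius map
  \<open>A\<close>, and \<open>A\<close> after \<open>h\<close> is the required
  continuation.\<close>

lemma continued_map_exists:
 assumes X: "universal_covering X p S" shows "\<exists>h. continued_map X p n z \<gamma> h"
proof -
 have cov: "covering_space X p S" and sc: "simply_connected X" using X by (auto simp: universal_covering_def)
 have sp: "spread X p" by (rule covering_space_spread[OF cov open_S])
 have pX: "p ` X \<subseteq> (\<Union>k\<in>{1..n}. D k)" using cov Union_D by (simp add: covering_space_def)
 have contp: "continuous_on X p" using cov by (simp add: covering_space_def)
 obtain h where h: "devel X p h" by (rule devel_exists[OF sp sc pX])
 have f': "inj_on f upper_half" "f ` upper_half = \<Omega>" "holomorphic_sphere f upper_half" using f by (auto simp: conformal_simps)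
 let ?Y = "{w. Im w > 0}"
 have Y: "convex ?Y" "open ?Y" "?Y \<noteq> {}" by (auto simp: convex_halfspace_Im_gt open_halfspace_Im_gt intro!: exI[of _ \<i>])
 have fY: "(\<lambda>w. f (Fin w)) ` ?Y = \<Omega>" using f'(2) by (simp add: upper_half_def image_image)
 obtain V where V: "open_in X V" "bij_betw p V ((\<lambda>w. f (Fin w)) ` ?Y)"
 proof (rule covering_sheet[OF cov open_S Y])
  show "continuous_on ?Y (\<lambda>w. f (Fin w))"
   by (rule continuous_on_compose2[OF holomorphic_sphere_continuous[OF f'(3)] continuous_on_Fin]) auto
  show "inj_on (\<lambda>w. f (Fin w)) ?Y"
  proof (rule inj_onI)
   fix v w assume "v \<in> ?Y" "w \<in> ?Y" "f (Fin v) = f (Fin w)"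
   then show "v = w" using inj_onD[OF f'(1), of "Fin v" "Fin w"] by simp
  qed
  show "(\<lambda>w. f (Fin w)) ` ?Y \<subseteq> S" unfolding fY using \<Omega>_subset z_in_curve by blast
  show "open ((\<lambda>w. f (Fin w)) ` W)" if "open W" "W \<subseteq> ?Y" for W
  proof -
   have "Fin ` W \<subseteq> upper_half" using that(2) by auto
   then have "open (f ` Fin ` W)" using open_image_inj_holomorphic[OF f'(3,1)] that(1) by (simp add: open_Fin_image_iff)
   then show ?thesis by (simp add: image_image)
  qed
 qed (rule that)
 then have pV: "inj_on p V" "p ` V = \<Omega>" using fY by (auto simp: bij_betw_def)
 have VX: "V \<subseteq> X" using V(1) openin_imp_subset by blast
 have spV: "spread V p" by (rule spread_open_subset[OF sp V(1)])
 obtain r where r: "homeomorphism V \<Omega> p r"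
 proof (rule homeomorphism_injective_open_map[OF continuous_on_subset[OF contp VX] pV(2,1)])
  fix U assume "open_in V U"
  then have "open (p ` U)" by (rule spread_open_map[OF spV])
  moreover have "p ` U \<subseteq> \<Omega>" using \<open>open_in V U\<close> pV openin_imp_subset by blast
  ultimately show "open_in \<Omega> (p ` U)" by (simp add: open_subset)
 qed (rule that)
 have "V = r ` \<Omega>" "continuous_on \<Omega> r" using r by (auto simp: homeomorphism_def)
 then have conV: "connected V" using connected_continuous_image connected_side by metis
 have dV: "devel V p h" by (rule devel_open_subset[OF sp V(1) h])
 have "devel V p (\<lambda>x. g 1 (p x))" unfolding devel_def local_devel_def
  using pV one_in \<Omega>_subset id_PSL2R by (intro ballI exI[of _ V] conjI bexI[of _ 1] bexI[of _ id]) auto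
 then obtain A where A: "A \<in> PSL2R" "\<And>x. x \<in> V \<Longrightarrow> g 1 (p x) = A (h x)" by (rule devel_unique[OF spV conV dV]) (rule that)
 have "devel X p (\<lambda>x. A (h x))" by (rule devel_PSL2R[OF h A(1)])
 then have "holomorphic_on_cover X p (\<lambda>x. A (h x))" by (rule holomorphic_on_cover_of_devel[OF sp])
 moreover have "A (h x) = inv_into upper_half f (p x)" if x: "x \<in> V" for x
 proof -
  have "p x \<in> \<Omega>" using pV x by blast
  then obtain w where w: "w \<in> upper_half" "p x = f w" using f_onto by blast
  then have "g 1 (p x) = w" using gf one_in by simp
  then show ?thesis using A(2)[OF x] w f'(1) by (simp add: inv_into_f_f)
 qed
 moreover have "bij_betw p V \<Omega>" using pV by (simp add: bij_betw_def)
 ultimately have "continued_map X p n z \<gamma> (\<lambda>x. A (h x))" unfolding continued_map_def using f V(1) by blast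
 then show ?thesis by blast
qed

text \<open>At a point of the sheet \<open>V\<close> the map is a real Moebius image of
  \<open>g 1\<close>; analytic continuation carries this form over all of \<open>X\<close>.\<close>

lemma continued_map_devel:
 assumes X: "universal_covering X p S" and h: "continued_map X p n z \<gamma> h" shows "devel X p h"
proof -
 have cov: "covering_space X p S" and sc: "simply_connected X" using X by (auto simp: universal_covering_def)
 have sp: "spread X p" by (rule covering_space_spread[OF cov open_S])
 have pX: "p ` X \<subseteq> (\<Union>k\<in>{1..n}. D k)" using cov Union_D by (simp add: covering_space_def)
 have con: "connected X" using simply_connected_imp_path_connected'[OF sc] path_connected_imp_connected by blast
 obtain f' V where h': "holomorphic_on_cover X p h" "conformal_map f' upper_half \<Omega>"
  "open_in X V" "bij_betw p V \<Omega>" "\<forall>x\<in>V. h x = inv_into upper_half f' (p x)" using h unfolding continued_map_def by blast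
 have pV: "p ` V = \<Omega>" using h'(4) by (simp add: bij_betw_def)
 then obtain x0 where x0: "x0 \<in> V" using \<Omega>_nonempty by blast
 obtain C where C: "C \<in> PSL2R" "\<And>k x. k \<in> {1..n} \<Longrightarrow> x \<in> \<Omega> \<Longrightarrow> inv_into upper_half f' x = C (g k x)"
  by (rule other_uniformization[OF h'(2)]) (rule that)
 have "h x = C (g 1 (p x))" if "x \<in> V" for x
 proof -
  have "p x \<in> \<Omega>" using pV that by blast
  then show ?thesis using C(2)[OF one_in] h'(5) that by simp
 qed
 then have "local_devel X p h x0" unfolding local_devel_def using x0 h'(3) one_in C(1) pV \<Omega>_subset
  by (intro exI[of _ V] conjI bexI[of _ 1] bexI[of _ C]) auto
 moreover have "x0 \<in> X" using x0 h'(3) openin_imp_subset by blast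
 ultimately show ?thesis using devel_of_holomorphic[OF sp con pX h'(1)] by blast
qed

text \<open>\<open>h\<close> and \<open>h \<circ> \<alpha>\<close> are both developments, so they
  differ by a real map; rigidity makes this map unique, and uniqueness gives the homomorphism
  law.\<close>

lemma holonomy_exists:
 assumes X: "universal_covering X p S" and h: "devel X p h"
 obtains \<rho> where "holonomy_representation X p h \<rho>" "\<rho> ` deck_transformations X p \<subseteq> PSL2R"
proof -
 have cov: "covering_space X p S" and sc: "simply_connected X" using X by (auto simp: universal_covering_def)
 have sp: "spread X p" by (rule covering_space_spread[OF cov open_S])
 have con: "connected X" using simply_connected_imp_path_connected'[OF sc] path_connected_imp_connected by blast
 have "p ` X = S" using cov by (simp add: covering_space_def)
 moreover have "S \<noteq> {}" using Union_D \<Omega>_nonempty \<Omega>_subset one_in by blast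
 ultimately obtain x0 where x0: "x0 \<in> X" by blast
 have "\<exists>C\<in>PSL2R. \<forall>x\<in>X. h (\<alpha> x) = C (h x)" if \<alpha>: "\<alpha> \<in> deck_transformations X p" for \<alpha>
 proof -
  have a: "continuous_on X \<alpha>" "\<alpha> ` X \<subseteq> X" "\<And>x. x \<in> X \<Longrightarrow> p (\<alpha> x) = p x"
   using \<alpha> by (auto simp: deck_transformations_def homeomorphism_def)
  obtain C where "C \<in> PSL2R" "\<And>x. x \<in> X \<Longrightarrow> h (\<alpha> x) = C (h x)"
   by (rule devel_unique[OF sp con h devel_deck[OF h a]]) (assumption | rule that)+
  then show ?thesis by blast
 qed
 then obtain \<rho> where \<rho>: "\<And>\<alpha>. \<alpha> \<in> deck_transformations X p \<Longrightarrow> \<rho> \<alpha> \<in> PSL2R \<and> (\<forall>x\<in>X. h (\<alpha> x) = \<rho> \<alpha> (h x))"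
  by metis
 have \<rho>C: "\<rho> \<alpha> \<in> PSL2C" if "\<alpha> \<in> deck_transformations X p" for \<alpha> using \<rho>[OF that] PSL2R_subset_PSL2C by blast
 have bij: "A \<in> Bij UNIV" if A: "A \<in> PSL2C" for A
 proof -
  obtain A' where "\<And>x. A (A' x) = x" "\<And>x. A' (A x) = x" by (rule PSL2C_inverse[OF A]) (rule that)
  then have "bij A" by (intro o_bij[of A']) auto
  then show ?thesis by (simp add: Bij_def)
 qed
 have dX: "\<alpha> \<in> Bij X" "\<alpha> ` X \<subseteq> X" if "\<alpha> \<in> deck_transformations X p" for \<alpha>
  using that by (auto simp: deck_transformations_def homeomorphism_def)
 have uni: "A = C" if "A \<in> PSL2C" "C \<in> PSL2C" "\<And>x. x \<in> X \<Longrightarrow> A (h x) = C (h x)" for A C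
  by (rule devel_rigid[OF sp develD[OF h x0] x0 openin_subtopology_self x0 that(1,2)]) (rule that(3))
 have "holonomy_representation X p h \<rho>" unfolding holonomy_representation_def
 proof (intro conjI ballI)
  show "\<rho> \<in> hom (BijGroup X\<lparr>carrier := deck_transformations X p\<rparr>) (BijGroup UNIV\<lparr>carrier := PSL2C\<rparr>)"
   unfolding hom_def
  proof (intro CollectI conjI ballI)
   show "\<rho> \<in> carrier (BijGroup X\<lparr>carrier := deck_transformations X p\<rparr>) \<rightarrow> carrier (BijGroup UNIV\<lparr>carrier := PSL2C\<rparr>)"
    using \<rho>C by auto
   fix \<alpha> \<beta> assume "\<alpha> \<in> carrier (BijGroup X\<lparr>carrier := deck_transformations X p\<rparr>)"
    "\<beta> \<in> carrier (BijGroup X\<lparr>carrier := deck_transformations X p\<rparr>)"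
   then have ab: "\<alpha> \<in> deck_transformations X p" "\<beta> \<in> deck_transformations X p" by auto
   have m1: "\<alpha> \<otimes>\<^bsub>BijGroup X\<lparr>carrier := deck_transformations X p\<rparr>\<^esub> \<beta> = compose X \<alpha> \<beta>"
    using dX ab by (simp add: BijGroup_def)
   have m2: "\<rho> \<alpha> \<otimes>\<^bsub>BijGroup UNIV\<lparr>carrier := PSL2C\<rparr>\<^esub> \<rho> \<beta> = \<rho> \<alpha> \<circ> \<rho> \<beta>"
    using bij \<rho>C ab by (simp add: BijGroup_def compose_def o_def restrict_UNIV)
   \<comment> \<open>The product in \<open>BijGroup X\<close> is composition restricted to
     \<open>X\<close>, so homeomorphism and inverse are transferred from the plain composition
     pointwise on \<open>X\<close>.\<close>
   have comp: "compose X \<alpha> \<beta> \<in> deck_transformations X p"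
   proof -
    obtain a' b' where hom: "homeomorphism X X \<alpha> a'" "homeomorphism X X \<beta> b'" using ab by (auto simp: deck_transformations_def)
    have Bc: "compose X \<alpha> \<beta> \<in> Bij X" using dX ab compose_Bij by blast
    have h1: "homeomorphism X X (\<alpha> \<circ> \<beta>) (b' \<circ> a')" by (rule homeomorphism_compose[OF hom(2,1)])
    have cm: "compose X \<alpha> \<beta> x = (\<alpha> \<circ> \<beta>) x" if "x \<in> X" for x using that by (simp add: compose_def)
    have bx: "\<beta> x \<in> X" if "x \<in> X" for x using dX(2)[OF ab(2)] that by blast
    have inv: "inv_into X (compose X \<alpha> \<beta>) y = (b' \<circ> a') y" if y: "y \<in> X" for y
    proof -
     have "(b' \<circ> a') y \<in> X" "(\<alpha> \<circ> \<beta>) ((b' \<circ> a') y) = y" using h1 y by (auto simp: homeomorphism_def)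
     then show ?thesis using Bc cm by (auto simp: Bij_def bij_betw_def intro!: inv_into_f_eq)
    qed
    have "homeomorphism X X (compose X \<alpha> \<beta>) (inv_into X (compose X \<alpha> \<beta>))"
     by (rule homeomorphism_cong[OF h1]) (use cm inv in auto)
    moreover have "p (compose X \<alpha> \<beta> x) = p x" if "x \<in> X" for x
     using ab bx[OF that] that cm[OF that] by (simp add: deck_transformations_def)
    ultimately show ?thesis using Bc by (simp add: deck_transformations_def)
   qed
   have "\<rho> (compose X \<alpha> \<beta>) = \<rho> \<alpha> \<circ> \<rho> \<beta>"
   proof (rule uni)
    fix x assume x: "x \<in> X"
    have bx: "\<beta> x \<in> X" using dX(2)[OF ab(2)] x by blast
    have "\<rho> (compose X \<alpha> \<beta>) (h x) = h (compose X \<alpha> \<beta> x)" using \<rho>[OF comp] x by simp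
    also have "\<dots> = h (\<alpha> (\<beta> x))" using x by (simp add: compose_def)
    also have "\<dots> = \<rho> \<alpha> (h (\<beta> x))" using \<rho>[OF ab(1)] bx by simp
    also have "\<dots> = \<rho> \<alpha> (\<rho> \<beta> (h x))" using \<rho>[OF ab(2)] x by simp
    finally show "\<rho> (compose X \<alpha> \<beta>) (h x) = (\<rho> \<alpha> \<circ> \<rho> \<beta>) (h x)" by simp
   qed (use \<rho>C comp ab PSL2C_comp in auto)
   then show "\<rho> (\<alpha> \<otimes>\<^bsub>BijGroup X\<lparr>carrier := deck_transformations X p\<rparr>\<^esub> \<beta>) = \<rho> \<alpha> \<otimes>\<^bsub>BijGroup UNIV\<lparr>carrier := PSL2C\<rparr>\<^esub> \<rho> \<beta>"
    using m1 m2 by simp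
  qed
  show "\<rho> \<alpha> (h x) = h (\<alpha> x)" if "\<alpha> \<in> deck_transformations X p" "x \<in> X" for \<alpha> x using \<rho> that by simp
 qed
 then show ?thesis using that \<rho> by blast
qed

end

section \<open>Reflection across an arc with a tangent\<close>

text \<open>Bloch's theorem plays the role of Koebe's distortion theorem: the image of \<open>ln \<xi>\<close> contains no two
 points that differ by \<open>2 \<pi> \<i>\<close>, hence no disc of radius 4.\<close>

lemma bloch_log_bound:
 assumes \<xi>: "\<xi> holomorphic_on {w. Im w > 0}" "inj_on \<xi> {w. Im w > 0}" "\<And>v. Im v > 0 \<Longrightarrow> \<xi> v \<noteq> 0" and y: "y > 0"
 shows "y * norm (deriv \<xi> (\<i> * of_real y)) \<le> 48 * norm (\<xi> (\<i> * of_real y))"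
proof -
 define a where "a = \<i> * complex_of_real y"
 have ball: "Im w > 0" if "w \<in> ball a y" for w
 proof -
  have "\<bar>Im (a - w)\<bar> \<le> norm (a - w)" by (rule abs_Im_le_cmod)
  then show ?thesis using that by (auto simp: a_def dist_norm)
 qed
 have aH: "a \<in> ball a y" "Im a > 0" using y by (auto simp: a_def)
 obtain K where K: "K holomorphic_on ball a y" "\<And>w. w \<in> ball a y \<Longrightarrow> \<xi> w = exp (K w)"
 proof (rule contractible_imp_holomorphic_log[of \<xi> "ball a y"])
  show "\<xi> holomorphic_on ball a y" using \<xi>(1) by (rule holomorphic_on_subset) (use ball in auto)
  show "contractible (ball a y)" by (simp add: convex_imp_contractible)
  show "\<xi> w \<noteq> 0" if "w \<in> ball a y" for w using \<xi>(3) ball that by blast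
 qed (rule that)
 have "(K has_field_derivative deriv K a) (at a)" using holomorphic_derivI[OF K(1)] aH by blast
 then have "((\<lambda>w. exp (K w)) has_field_derivative exp (K a) * deriv K a) (at a)" by (rule DERIV_fun_exp)
 then have "(\<xi> has_field_derivative exp (K a) * deriv K a) (at a)"
  by (rule has_field_derivative_transform_within_open[OF _ open_ball aH(1)]) (use K in simp)
 then have d: "deriv \<xi> a = \<xi> a * deriv K a" using K(2)[OF aH(1)] by (simp add: DERIV_imp_deriv)
 have "y * norm (deriv K a) \<le> 48"
 proof (rule ccontr)
  assume "\<not> ?thesis"
  \<comment> \<open>48 is 4 times the 12 of Bloch's theorem, and the radius 4 exceeds pi, so the
    disc contains two points at distance \<open>2 * pi\<close> on a vertical line.\<close>
  then have "4 \<le> y * norm (deriv K a) / 12" by simp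
  then obtain b where b: "ball b 4 \<subseteq> K ` ball a y" using Bloch[OF K(1) y] by blast
  have "b + \<i> * of_real pi \<in> ball b 4" "b - \<i> * of_real pi \<in> ball b 4" using pi_less_4 by (auto simp: dist_norm norm_mult)
  then obtain u1 u2 where u: "u1 \<in> ball a y" "u2 \<in> ball a y" "b + \<i> * of_real pi = K u1" "b - \<i> * of_real pi = K u2" using b by blast
  have "exp (K u1) = exp (K u2)" unfolding u(3,4)[symmetric] by (simp add: exp_add exp_diff)
  then have "\<xi> u1 = \<xi> u2" using K(2) u by simp
  then have "u1 = u2" using \<xi>(2) ball u by (simp add: inj_onD)
  then have "b + \<i> * of_real pi = b - \<i> * of_real pi" using u by simp
  then show False by (simp add: complex_eq_iff)
 qed
 then have "norm (\<xi> a) * (y * norm (deriv K a)) \<le> norm (\<xi> a) * 48" by (rule mult_left_mono) simp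
 then show ?thesis unfolding a_def[symmetric] d norm_mult by (simp add: ac_simps)
qed

text \<open>The closed sector about the negative axis is left out, because the other arc may enter
  the corner there. Radius 2 leaves room around the points 1, \<i> and \<open>- \<i>\<close> that
  matter.\<close>

definition slit_disc :: "complex set" where
 "slit_disc = {w. norm w < 2 \<and> Re w + \<bar>Im w\<bar> > 0}"

lemma open_slit_disc: "open slit_disc"
proof -
 have "slit_disc = {w. norm w < 2} \<inter> {w. 0 < Re w + \<bar>Im w\<bar>}" by (auto simp: slit_disc_def)
 moreover have "open ({w::complex. norm w < 2} \<inter> {w. 0 < Re w + \<bar>Im w\<bar>})" by (intro open_Int open_Collect_less continuous_intros)
 ultimately show ?thesis by simp
qed

lemma connected_slit_disc: "connected slit_disc"
proof (rule starlike_imp_connected)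
 have "closed_segment 1 w \<subseteq> slit_disc" if w: "w \<in> slit_disc" for w
 proof
  fix v assume "v \<in> closed_segment 1 w"
  then obtain t where t: "v = (1 - t) *\<^sub>R 1 + t *\<^sub>R w" "0 \<le> t" "t \<le> 1" by (auto simp: closed_segment_def)
  have "v \<in> ball 0 2"
  proof -
   have "convex (ball (0::complex) 2)" by simp
   then show ?thesis unfolding t(1) using w t(2,3) by (intro convexD) (auto simp: slit_disc_def)
  qed
  moreover have "Re v + \<bar>Im v\<bar> = (1 - t) + t * (Re w + \<bar>Im w\<bar>)" unfolding t(1) using t(2,3) by (simp add: abs_mult algebra_simps)
  moreover have "(1 - t) + t * (Re w + \<bar>Im w\<bar>) > 0"
  proof (cases "t = 1")
   case True then show ?thesis using w by (simp add: slit_disc_def)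
  next
   case False
   have "t * (Re w + \<bar>Im w\<bar>) \<ge> 0" using t w by (simp add: slit_disc_def)
   then show ?thesis using False t by simp
  qed
  ultimately show "v \<in> slit_disc" by (simp add: slit_disc_def)
 qed
 moreover have "1 \<in> slit_disc" by (simp add: slit_disc_def)
 ultimately show "starlike slit_disc" unfolding starlike_def by blast
qed

lemma slit_disc_near_1: "cball 1 (1/4) \<subseteq> slit_disc"
proof
 fix w :: complex assume "w \<in> cball 1 (1/4)"
 then have n: "norm (1 - w) \<le> 1/4" by (simp add: dist_norm)
 have "\<bar>Re (1 - w)\<bar> \<le> 1/4" using abs_Re_le_cmod[of "1 - w"] n by linarith
 then have "3/4 \<le> Re w" unfolding abs_le_iff minus_complex.sel one_complex.sel by linarith
 moreover have "norm w \<le> norm (1 - w) + norm (1::complex)" by (metis norm_minus_commute norm_triangle_sub add.commute)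
 then have "norm w < 2" using n by simp
 ultimately show "w \<in> slit_disc" by (simp add: slit_disc_def add_pos_nonneg)
qed

lemma hq_scale: "s > 0 \<Longrightarrow> hq (of_real s * v) (of_real s * w) = hq v w"
 unfolding hq_def by (simp add: norm_mult power_mult_distrib power2_eq_square flip: right_diff_distrib)

lemma cayley_inv_cnj: "cayley_inv (cnj u) = - cnj (cayley_inv u)" by (simp add: cayley_inv_def)

lemma Im_cayley: "Im w > 0 \<Longrightarrow> Im (cayley w) * (norm (w + \<i>))\<^sup>2 = - 2 * Re w"
proof -
 assume w: "Im w > 0"
 then have n: "w + \<i> \<noteq> 0" using Im_gt_not by blast
 have "Im (cayley w) = (Im (w - \<i>) * Re (w + \<i>) - Re (w - \<i>) * Im (w + \<i>)) / (norm (w + \<i>))\<^sup>2"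
  by (simp add: cayley_def Im_divide cmod_power2)
 then show ?thesis using n by (simp add: algebra_simps)
qed

text \<open>Zoom in at the corner. Montel gives a limit of the rescaled maps in the Cayley
  coordinate; it is not constant by the Bloch bound and real on the tangent ray by tangency, so it
  commutes with conjugation. Evaluating it at \<i> and \<open>- \<i>\<close> gives the
  claim.\<close>

lemma tangent_reflection:
 fixes \<psi> \<xi> :: "complex \<Rightarrow> complex" and r :: "nat \<Rightarrow> real" and s1 s2 :: real
 assumes D: "open D" "0 \<notin> D"
  and \<psi>: "\<psi> holomorphic_on D" "\<And>w. w \<in> D \<Longrightarrow> Im (\<psi> w) > 0" "\<And>w. w \<in> D \<Longrightarrow> \<xi> (\<psi> w) = w"
  and \<xi>: "\<xi> holomorphic_on {w. Im w > 0}" "\<And>v. Im v > 0 \<Longrightarrow> \<xi> v \<in> D" "\<And>v. Im v > 0 \<Longrightarrow> \<psi> (\<xi> v) = v"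
  and cone: "r0 > 0" "\<And>w. norm w < r0 \<Longrightarrow> Re w + \<bar>Im w\<bar> > 0 \<Longrightarrow> w \<in> D"
  and tang: "\<And>\<epsilon>. \<epsilon> > 0 \<Longrightarrow> \<exists>\<rho>0>0. \<forall>\<rho>. 0 < \<rho> \<and> \<rho> < \<rho>0 \<longrightarrow> (\<exists>w\<in>D. norm (w - of_real \<rho>) < \<epsilon> * \<rho> \<and> Re (\<psi> w) = 0)"
  and s: "s1 \<in> {1, -1}" "s2 \<in> {1, -1}"
  and sgn1: "\<And>w. norm w < r0 \<Longrightarrow> \<bar>Re w\<bar> < Im w \<Longrightarrow> s1 * Re (\<psi> w) \<ge> 0"
  and sgn2: "\<And>w. norm w < r0 \<Longrightarrow> \<bar>Re w\<bar> < - Im w \<Longrightarrow> s2 * Re (\<psi> w) \<ge> 0"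
  and r: "\<And>j. r j > 0" "r \<longlonglongrightarrow> 0"
 obtains \<phi> where "s2 = - s1" "strict_mono (\<phi> :: nat \<Rightarrow> nat)"
  "(\<lambda>j. hq ((\<psi> (\<i> * of_real (r (\<phi> j))))\<^sup>2) (cnj ((\<psi> (- \<i> * of_real (r (\<phi> j))))\<^sup>2))) \<longlonglongrightarrow> 0"
proof -
 \<comment> \<open>Tolerance 1/8 puts the rescaled arc point \<open>W j\<close> so near 1 that a
   disc of radius 1/8 about it stays in \<open>cball 1 (1/4)\<close>, where Cauchy's inequality is
   used below.\<close>
 obtain \<rho>0 where \<rho>0: "\<rho>0 > 0" "\<And>\<rho>. 0 < \<rho> \<Longrightarrow> \<rho> < \<rho>0 \<Longrightarrow> \<exists>w\<in>D. norm (w - of_real \<rho>) < (1/8) * \<rho> \<and> Re (\<psi> w) = 0"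
  using tang[of "1/8"] by auto
 have "eventually (\<lambda>j. r j < min (r0 / 2) \<rho>0) sequentially" using r(2) cone(1) \<rho>0(1) by (intro order_tendstoD(2)) auto
 then obtain J where J: "\<And>j. j \<ge> J \<Longrightarrow> r j < min (r0 / 2) \<rho>0" by (auto simp: eventually_sequentially)
 define R where "R j = r (j + J)" for j
 have R: "R j > 0" "2 * R j < r0" "R j < \<rho>0" for j using r(1) J[of "j + J"] by (auto simp: R_def)
 have R0: "R \<longlonglongrightarrow> 0" unfolding R_def by (rule LIMSEQ_ignore_initial_segment[OF r(2)])
 have "\<exists>w. w \<in> D \<and> norm (w - of_real (R j)) < (1/8) * R j \<and> Re (\<psi> w) = 0" for j using \<rho>0(2) R by blast
 then obtain w' where w': "\<And>j. w' j \<in> D \<and> norm (w' j - of_real (R j)) < (1/8) * R j \<and> Re (\<psi> (w' j)) = 0" by metis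
 define W where "W j = w' j / of_real (R j)" for j
 have RW: "of_real (R j) * W j = w' j" for j using R[of j] by (simp add: W_def)
 have W1: "norm (W j - 1) < 1/8" for j
 proof -
  have "W j - 1 = (w' j - of_real (R j)) / of_real (R j)" using R[of j] by (simp add: W_def field_simps)
  then have "norm (W j - 1) = norm (w' j - of_real (R j)) / R j" using R[of j] by (simp add: norm_divide)
  then show ?thesis using w'[of j] R[of j] by (simp add: pos_divide_less_eq)
 qed
 define y where "y j = Im (\<psi> (w' j))" for j
 have y: "y j > 0" "\<psi> (w' j) = \<i> * of_real (y j)" for j using w'[of j] \<psi>(2) by (auto simp: y_def complex_eq_iff)
 \<comment> \<open>The argument is scaled by the distance to the corner and the value by
   \<open>y j\<close>, so that the arc point \<open>W j\<close> goes to \<i> and, under the Cayley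
   map, to 0.\<close>
 define F where "F j w = \<psi> (of_real (R j) * w) / of_real (y j)" for j w
 define G where "G j w = cayley (F j w)" for j w
 have inD: "of_real (R j) * w \<in> D" if "w \<in> slit_disc" for j w
 proof (rule cone(2))
  have w: "norm w < 2" "Re w + \<bar>Im w\<bar> > 0" using that by (auto simp: slit_disc_def)
  have "norm (of_real (R j) * w) = R j * norm w" using R[of j] by (simp add: norm_mult)
  also have "\<dots> < R j * 2" using w R[of j] by simp
  finally show "norm (of_real (R j) * w) < r0" using R(2)[of j] by simp
  have "Re (of_real (R j) * w) + \<bar>Im (of_real (R j) * w)\<bar> = R j * (Re w + \<bar>Im w\<bar>)"
   using R(1)[of j] by (simp add: abs_mult algebra_simps)
  then show "Re (of_real (R j) * w) + \<bar>Im (of_real (R j) * w)\<bar> > 0" using w(2) R(1)[of j] by simp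
 qed
 have ImF: "Im (F j w) > 0" if "w \<in> slit_disc" for j w using \<psi>(2)[OF inD[OF that]] y(1)[of j] by (simp add: F_def)
 have Gball: "norm (G j w) < 1" if "w \<in> slit_disc" for j w unfolding G_def by (rule cayley_less_1[OF ImF[OF that]])
 have holF: "F j holomorphic_on slit_disc" for j
 proof -
  have "(\<lambda>w. \<psi> (of_real (R j) * w)) holomorphic_on slit_disc"
   by (rule holomorphic_on_compose_gen[OF _ \<psi>(1), unfolded o_def]) (use inD in \<open>auto intro!: holomorphic_intros\<close>)
  then show ?thesis unfolding F_def using y(1)[of j] by (intro holomorphic_intros) auto
 qed
 have holG: "G j holomorphic_on slit_disc" for j
  unfolding G_def by (rule holomorphic_on_compose_gen[OF holF holomorphic_cayley, unfolded o_def]) (use ImF in auto)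
 obtain g \<phi> where g: "g holomorphic_on slit_disc" and \<phi>: "strict_mono (\<phi> :: nat \<Rightarrow> nat)"
  and lim: "\<And>w. w \<in> slit_disc \<Longrightarrow> (\<lambda>j. G (\<phi> j) w) \<longlonglongrightarrow> g w"
  and ulim: "\<And>C. compact C \<Longrightarrow> C \<subseteq> slit_disc \<Longrightarrow> uniform_limit C (G \<circ> \<phi>) g sequentially"
 proof (rule Montel[OF open_slit_disc, of "range G" G])
  show "h holomorphic_on slit_disc" if "h \<in> range G" for h using that holG by auto
  show "\<exists>B. \<forall>h\<in>range G. \<forall>w\<in>C. norm (h w) \<le> B" if "C \<subseteq> slit_disc" for C
   using that Gball by (intro exI[of _ 1]) (auto simp: less_imp_le subset_iff)
 qed auto
 have WU: "cball (W j) (1/8) \<subseteq> cball 1 (1/4)" for j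
 proof
  fix w assume "w \<in> cball (W j) (1/8)"
  then have "norm (W j - w) \<le> 1/8" by (simp add: dist_norm)
  moreover have "norm (1 - w) \<le> norm (1 - W j) + norm (W j - w)" using norm_triangle_ineq[of "1 - W j" "W j - w"] by simp
  ultimately show "w \<in> cball 1 (1/4)" using W1[of j] by (simp add: dist_norm norm_minus_commute)
 qed
 have WS: "W j \<in> slit_disc" "W j \<in> cball 1 (1/4)" for j
  using WU[of j] slit_disc_near_1 centre_in_cball[of "W j" "1/8"] by (auto simp del: centre_in_cball mem_cball)
 have GW: "G j (W j) = 0" for j unfolding G_def F_def RW using y[of j] by (simp add: cayley_def)
 \<comment> \<open>The Bloch bound gives
   \<open>y j \<le> 48 * (9/8) * R j * norm (deriv \<psi> (w' j))\<close>, and the Cayley map has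
   derivative of norm 1/2 at \<i>. This yields 1/108, rounded down to 1/120.\<close>
 have dG: "norm (deriv (G j) (W j)) \<ge> 1/120" for j
 proof -
  have "(\<psi> has_field_derivative deriv \<psi> (w' j)) (at (w' j))" using holomorphic_derivI[OF \<psi>(1) D(1)] w' by blast
  then have "(\<psi> has_field_derivative deriv \<psi> (w' j)) (at (of_real (R j) * W j))" by (simp add: RW)
  then have "((\<lambda>w. \<psi> (of_real (R j) * w)) has_field_derivative deriv \<psi> (w' j) * of_real (R j)) (at (W j))"
   by (rule DERIV_chain2) (auto intro!: derivative_eq_intros)
  then have dF: "(F j has_field_derivative deriv \<psi> (w' j) * of_real (R j) / of_real (y j)) (at (W j))" unfolding F_def by (rule DERIV_cdivide)
  have Fi: "F j (W j) = \<i>" unfolding F_def RW using y[of j] by simp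
  have "(cayley has_field_derivative 1 / (2 * \<i>)) (at \<i>)"
   unfolding cayley_def by (auto intro!: derivative_eq_intros simp: power2_eq_square field_simps)
  then have "(cayley has_field_derivative 1 / (2 * \<i>)) (at (F j (W j)))" by (simp add: Fi)
  then have "(G j has_field_derivative (1 / (2 * \<i>)) * (deriv \<psi> (w' j) * of_real (R j) / of_real (y j))) (at (W j))"
   unfolding G_def by (rule DERIV_chain2[OF _ dF])
  then have "norm (deriv (G j) (W j)) = norm (deriv \<psi> (w' j)) * R j / (2 * y j)"
   using R[of j] y[of j] by (simp add: DERIV_imp_deriv norm_mult norm_divide)
  moreover have "norm (deriv \<psi> (w' j)) * R j / (2 * y j) \<ge> 1/120"
  proof -
   let ?a = "\<i> * complex_of_real (y j)"
   have Ha: "Im ?a > 0" using y[of j] by simp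
   have inj: "inj_on \<xi> {w. Im w > 0}" by (rule inj_on_inverseI[of _ \<psi>]) (use \<xi> in auto)
   have "\<xi> v \<noteq> 0" if "Im v > 0" for v using \<xi>(2)[OF that] D(2) by auto
   then have bl: "y j * norm (deriv \<xi> ?a) \<le> 48 * norm (\<xi> ?a)" by (rule bloch_log_bound[OF \<xi>(1) inj _ y(1)])
   have \<xi>a: "\<xi> ?a = w' j" using \<psi>(3)[of "w' j"] w'[of j] y(2)[of j] by simp
   have "(\<xi> has_field_derivative deriv \<xi> ?a) (at ?a)" using holomorphic_derivI[OF \<xi>(1) open_halfspace_Im_gt] Ha by blast
   moreover have "(\<psi> has_field_derivative deriv \<psi> (w' j)) (at (\<xi> ?a))"
    unfolding \<xi>a using holomorphic_derivI[OF \<psi>(1) D(1)] w' by blast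
   ultimately have "((\<lambda>v. \<psi> (\<xi> v)) has_field_derivative deriv \<psi> (w' j) * deriv \<xi> ?a) (at ?a)"
    by (rule DERIV_chain2[rotated])
   then have "((\<lambda>v. v) has_field_derivative deriv \<psi> (w' j) * deriv \<xi> ?a) (at ?a)"
    by (rule has_field_derivative_transform_within_open[OF _ open_halfspace_Im_gt[of 0]]) (use Ha \<xi>(3) in auto)
   then have one: "deriv \<psi> (w' j) * deriv \<xi> ?a = 1" using DERIV_unique DERIV_ident by blast
   then have prod: "norm (deriv \<psi> (w' j)) * norm (deriv \<xi> ?a) = 1" by (metis norm_mult norm_one)
   have nw: "norm (w' j) \<le> 9/8 * R j"
   proof -
    have "norm (w' j) \<le> norm (w' j - of_real (R j)) + norm (complex_of_real (R j))"
     using norm_triangle_ineq[of "w' j - of_real (R j)" "of_real (R j)"] by simp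
    then show ?thesis using w'[of j] R(1)[of j] by simp
   qed
   have "y j = norm (deriv \<psi> (w' j)) * (y j * norm (deriv \<xi> ?a))" using prod by (simp add: ac_simps)
   also have "\<dots> \<le> norm (deriv \<psi> (w' j)) * (48 * norm (w' j))" using bl by (intro mult_left_mono) (auto simp: \<xi>a)
   also have "\<dots> \<le> norm (deriv \<psi> (w' j)) * (48 * (9/8 * R j))" using nw by (intro mult_left_mono) auto
   finally have "y j \<le> 54 * (norm (deriv \<psi> (w' j)) * R j)" by simp
   then show ?thesis using y(1)[of j] by (simp add: field_simps)
  qed
  ultimately show ?thesis by simp
 qed
 have near1: "1 \<in> slit_disc" using slit_disc_near_1 by auto
 \<comment> \<open>A constant limit would be within 1/2000 of 0, since \<open>G j\<close> vanishes
   at \<open>W j\<close>. Then \<open>G j\<close> is at most 1/1000 near 1, and Cauchy's inequality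
   on radius 1/8 bounds the derivative by 1/125, below 1/120.\<close>
 have nc: "\<not> g constant_on slit_disc"
 proof
  assume "g constant_on slit_disc"
  then obtain \<kappa> where \<kappa>: "\<And>w. w \<in> slit_disc \<Longrightarrow> g w = \<kappa>" by (auto simp: constant_on_def)
  have u: "uniform_limit (cball 1 (1/4)) (G \<circ> \<phi>) g sequentially" by (rule ulim) (auto simp: slit_disc_near_1)
  have "eventually (\<lambda>j. \<forall>w\<in>cball 1 (1/4). dist ((G \<circ> \<phi>) j w) (g w) < 1/2000) sequentially"
   using u unfolding uniform_limit_iff by (meson zero_less_divide_1_iff zero_less_numeral)
  then obtain j where j: "\<And>w. w \<in> cball 1 (1/4) \<Longrightarrow> dist (G (\<phi> j) w) (g w) < 1/2000"
   unfolding eventually_sequentially o_def by blast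
  let ?j = "\<phi> j"
  have \<kappa>0: "norm \<kappa> < 1/2000" using j[OF WS(2)[of ?j]] GW[of ?j] \<kappa>[OF WS(1)[of ?j]] by (simp add: dist_norm)
  have small: "norm (G ?j w) \<le> 1/1000" if "w \<in> cball 1 (1/4)" for w
  proof -
   have "dist (G ?j w) \<kappa> < 1/2000" using j[OF that] \<kappa> slit_disc_near_1 that by auto
   then have "norm (G ?j w - \<kappa>) < 1/2000" by (simp add: dist_norm)
   then show ?thesis using norm_triangle_ineq[of "G ?j w - \<kappa>" \<kappa>] \<kappa>0 by simp
  qed
  have "norm ((deriv ^^ 1) (G ?j) (W ?j)) \<le> fact 1 * (1/1000) / (1/8)^1"
  proof (rule Cauchy_inequality)
   have sub: "cball (W ?j) (1/8) \<subseteq> slit_disc" using WU slit_disc_near_1 by blast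
   show "G ?j holomorphic_on ball (W ?j) (1/8)" by (rule holomorphic_on_subset[OF holG]) (use sub in auto)
   show "continuous_on (cball (W ?j) (1/8)) (G ?j)" by (rule holomorphic_on_imp_continuous_on[OF holomorphic_on_subset[OF holG sub]])
   show "norm (G ?j x) \<le> 1/1000" if "norm (W ?j - x) = 1/8" for x
    by (rule small[OF subsetD[OF WU[of ?j]]]) (use that in \<open>simp add: dist_norm\<close>)
  qed simp
  then show False using dG[of ?j] by simp
 qed
 have gle: "norm (g w) \<le> 1" if "w \<in> slit_disc" for w using tendsto_norm[OF lim[OF that]] Gball[OF that]
  by (intro LIMSEQ_le_const2[of "\<lambda>j. norm (G (\<phi> j) w)"]) (auto simp: less_imp_le)
 \<comment> \<open>The maximum principle keeps the limit strictly inside the disc, so the inverse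
   Cayley map is continuous at its values.\<close>
 have gl: "norm (g w) < 1" if w: "w \<in> slit_disc" for w
 proof (rule ccontr)
  assume "\<not> norm (g w) < 1"
  then have "norm (g v) \<le> norm (g w)" if "v \<in> slit_disc" for v using gle[OF that] by simp
  then have "g constant_on slit_disc" using maximum_modulus_principle[OF g open_slit_disc connected_slit_disc open_slit_disc subset_refl w] by blast
  then show False using nc by blast
 qed
 \<comment> \<open>The Cayley map is real on the imaginary ray. Tangency with tolerance
   \<open>e / x\<close> supplies points of the rescaled arc within \<open>e\<close> of
   \<open>x\<close>, and there \<open>G\<close> is real.\<close>
 have real: "Im (g (of_real x)) = 0" if x: "0 < x" "x < 2" for x :: real
 proof (rule ccontr)
  assume ne: "Im (g (of_real x)) \<noteq> 0"
  define \<eta> where "\<eta> = \<bar>Im (g (of_real x))\<bar>"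
  have \<eta>: "\<eta> > 0" using ne by (simp add: \<eta>_def)
  have xS: "of_real x \<in> slit_disc" using x by (simp add: slit_disc_def)
  have "continuous_on slit_disc g" using g holomorphic_on_imp_continuous_on by blast
  then have "open (slit_disc \<inter> g -` ball (g (of_real x)) (\<eta>/2))" by (intro continuous_open_preimage open_slit_disc) auto
  moreover have "of_real x \<in> slit_disc \<inter> g -` ball (g (of_real x)) (\<eta>/2)" using xS \<eta> by simp
  ultimately obtain e where e: "e > 0" "cball (of_real x) e \<subseteq> slit_disc \<inter> g -` ball (g (of_real x)) (\<eta>/2)"
   by (meson open_contains_cball)
  have "uniform_limit (cball (of_real x) e) (G \<circ> \<phi>) g sequentially" by (rule ulim) (use e in auto)
  then have ev: "eventually (\<lambda>j. \<forall>w\<in>cball (of_real x) e. dist ((G \<circ> \<phi>) j w) (g w) < \<eta>/2) sequentially"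
   using \<eta> unfolding uniform_limit_iff o_def by (elim allE[of _ "\<eta> / 2"]) simp
  obtain \<rho>1 where \<rho>1: "\<rho>1 > 0" "\<And>\<rho>. 0 < \<rho> \<Longrightarrow> \<rho> < \<rho>1 \<Longrightarrow> \<exists>w\<in>D. norm (w - of_real \<rho>) < (e / x) * \<rho> \<and> Re (\<psi> w) = 0"
   using tang[of "e / x"] e x by auto
  have "(\<lambda>j. R (\<phi> j) * x) \<longlonglongrightarrow> 0 * x"
   using LIMSEQ_subseq_LIMSEQ[OF R0 \<phi>] by (intro tendsto_intros) (simp add: o_def)
  then have "eventually (\<lambda>j. R (\<phi> j) * x < \<rho>1) sequentially" using \<rho>1 by (intro order_tendstoD(2)) auto
  with ev have "eventually (\<lambda>j. (\<forall>w\<in>cball (of_real x) e. dist ((G \<circ> \<phi>) j w) (g w) < \<eta>/2) \<and> R (\<phi> j) * x < \<rho>1) sequentially"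
   by (rule eventually_conj)
  then obtain j where j: "\<And>w. w \<in> cball (of_real x) e \<Longrightarrow> dist (G (\<phi> j) w) (g w) < \<eta>/2" "R (\<phi> j) * x < \<rho>1"
   unfolding eventually_sequentially o_def by blast
  let ?R = "R (\<phi> j)"
  obtain u where u: "u \<in> D" "norm (u - of_real (?R * x)) < (e / x) * (?R * x)" "Re (\<psi> u) = 0"
   using \<rho>1(2)[of "?R * x"] j(2) x R(1)[of "\<phi> j"] by auto
  define v where "v = u / of_real ?R"
  have Rv: "of_real ?R * v = u" using R(1)[of "\<phi> j"] by (simp add: v_def)
  have "u - of_real (?R * x) = of_real ?R * (v - of_real x)" unfolding Rv[symmetric] by (simp add: algebra_simps)
  then have "?R * norm (v - of_real x) < e * ?R" using u(2) x R(1)[of "\<phi> j"] by (simp add: norm_mult)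
  then have vb: "v \<in> cball (of_real x) e" using R(1)[of "\<phi> j"] by (simp add: dist_norm norm_minus_commute)
  have "Im (G (\<phi> j) v) = 0"
  proof -
   have "Im (F (\<phi> j) v) > 0" using ImF vb e by auto
   moreover have "Re (F (\<phi> j) v) = 0" unfolding F_def Rv using u(3) by simp
   moreover have "norm (F (\<phi> j) v + \<i>) \<noteq> 0" using Im_gt_not(2)[OF \<open>Im (F (\<phi> j) v) > 0\<close>] by simp
   ultimately show ?thesis using Im_cayley[of "F (\<phi> j) v"] by (simp add: G_def)
  qed
  moreover have "\<bar>Im (G (\<phi> j) v - g v)\<bar> < \<eta>/2"
   using j(1)[OF vb] abs_Im_le_cmod[of "G (\<phi> j) v - g v"] by (simp add: dist_norm)
  moreover have "\<bar>Im (g (of_real x) - g v)\<bar> < \<eta>/2"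
  proof -
   have "g v \<in> ball (g (of_real x)) (\<eta>/2)" using e vb by blast
   then show ?thesis using abs_Im_le_cmod[of "g (of_real x) - g v"] by (simp add: dist_norm)
  qed
  ultimately show False unfolding \<eta>_def minus_complex.sel by linarith
 qed
 have cnjS: "cnj w \<in> slit_disc \<longleftrightarrow> w \<in> slit_disc" for w by (simp add: slit_disc_def)
 have cnjim: "cnj ` slit_disc = slit_disc" using cnjS by (force simp: image_iff)
 \<comment> \<open>Both sides are holomorphic and agree on the segment \<open>(0, 2)\<close>, so the
   identity theorem applies.\<close>
 have sym: "g (cnj w) = cnj (g w)" if w: "w \<in> slit_disc" for w
 proof -
  have h: "(cnj \<circ> g \<circ> cnj) holomorphic_on slit_disc" by (rule holomorphic_on_compose_cnj_cnj) (use g cnjim open_slit_disc in auto)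
  have "(\<lambda>w. (cnj \<circ> g \<circ> cnj) w - g w) w = 0"
  proof (rule analytic_continuation[of "\<lambda>w. (cnj \<circ> g \<circ> cnj) w - g w" slit_disc "complex_of_real ` {0<..<2}" 1])
   show "(\<lambda>w. (cnj \<circ> g \<circ> cnj) w - g w) holomorphic_on slit_disc" by (rule holomorphic_on_diff[OF h g])
   show "complex_of_real ` {0<..<2} \<subseteq> slit_disc" by (auto simp: slit_disc_def)
   show "1 islimpt complex_of_real ` {0<..<2}"
   proof (rule connected_imp_perfect)
    have S: "complex_of_real t \<in> complex_of_real ` {0<..<2}" if "0 < t" "t < 2" for t by (intro imageI) (use that in simp)
    show "1 \<in> complex_of_real ` {0<..<2}" using S[of 1] by simp
    show "complex_of_real ` {0<..<2} \<noteq> {x}" for x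
    proof
     assume x: "complex_of_real ` {0<..<2} = {x}"
     have "complex_of_real 1 = x" "complex_of_real (1/2) = x" using S[of 1] S[of "1/2"] unfolding x by auto
     then show False by (auto simp: complex_eq_iff)
    qed
    show "connected (complex_of_real ` {0<..<2})" by (intro connected_continuous_image continuous_intros) simp
   qed
   show "(cnj \<circ> g \<circ> cnj) w - g w = 0" if "w \<in> complex_of_real ` {0<..<2}" for w using that real by (auto simp: complex_eq_iff)
  qed (use open_slit_disc connected_slit_disc near1 w in auto)
  then show ?thesis by (metis comp_apply complex_cnj_cnj eq_iff_diff_eq_0)
 qed
 let ?U = "{w. norm w < 2 \<and> \<bar>Re w\<bar> < Im w}"
 have US: "?U \<subseteq> slit_disc" by (auto simp: slit_disc_def)
 have oU: "open ?U"
 proof -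
  have "?U = {w. norm w < 2} \<inter> {w. \<bar>Re w\<bar> < Im w}" by auto
  moreover have "open ({w::complex. norm w < 2} \<inter> {w. \<bar>Re w\<bar> < Im w})" by (intro open_Int open_Collect_less continuous_intros)
  ultimately show ?thesis by simp
 qed
 \<comment> \<open>By \<open>Im_cayley\<close> the imaginary part of \<open>G\<close> has the sign
   opposite to the real part of \<open>F\<close>; weak inequalities survive the limit.\<close>
 have signlim: "s * Im (g w) \<le> 0" if w: "w \<in> slit_disc" and sg: "\<And>j. s * Re (\<psi> (of_real (R j) * w)) \<ge> 0" for s w
 proof -
  have "s * Im (G j w) \<le> 0" for j
  proof -
   have n: "(norm (F j w + \<i>))\<^sup>2 > 0" using Im_gt_not(2)[OF ImF[OF w]] by simp
   have "s * Re (F j w) \<ge> 0" using sg[of j] y(1)[of j] by (simp add: F_def)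
   then have "s * Im (G j w) * (norm (F j w + \<i>))\<^sup>2 \<le> 0" using Im_cayley[OF ImF[OF w]] unfolding G_def by (simp add: mult.assoc)
   then show ?thesis using n by (metis mult_le_0_iff not_less)
  qed
  moreover have "(\<lambda>j. s * Im (G (\<phi> j) w)) \<longlonglongrightarrow> s * Im (g w)" by (intro tendsto_intros lim w)
  ultimately show ?thesis by (intro LIMSEQ_le_const2) auto
 qed
 have scale: "norm (of_real (R j) * w) < r0" "Re (of_real (R j) * w) = R j * Re w" "Im (of_real (R j) * w) = R j * Im w"
  if "norm w < 2" for j w
 proof -
  have "norm (of_real (R j) * w) = R j * norm w" using R[of j] by (simp add: norm_mult)
  also have "\<dots> < R j * 2" using that R[of j] by simp
  finally show "norm (of_real (R j) * w) < r0" using R(2)[of j] by simp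
 qed auto
 have up: "s1 * Im (g w) \<le> 0" if w: "w \<in> ?U" for w
 proof (rule signlim)
  fix j show "s1 * Re (\<psi> (of_real (R j) * w)) \<ge> 0" by (rule sgn1) (use w scale[of w j] R(1)[of j] in \<open>auto simp: abs_mult\<close>)
 qed (use US w in blast)
 have down: "s2 * Im (g (cnj w)) \<le> 0" if w: "w \<in> ?U" for w
 proof (rule signlim)
  fix j show "s2 * Re (\<psi> (of_real (R j) * cnj w)) \<ge> 0"
   by (rule sgn2) (use w scale[of "cnj w" j] R(1)[of j] in \<open>auto simp: abs_mult\<close>)
 qed (use US w cnjS in blast)
 have iU: "\<i> \<in> ?U" by simp
 have ogU: "open (g ` ?U)" by (rule open_mapping_thm[OF g open_slit_disc connected_slit_disc oU US nc])
 \<comment> \<open>If this value were real, the open mapping theorem would give values of both signs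
   in the upper sector, against \<open>up\<close>.\<close>
 have Imgi: "Im (g \<i>) \<noteq> 0"
 proof
  assume 0: "Im (g \<i>) = 0"
  have "g \<i> \<in> g ` ?U" using iU by blast
  then obtain e where e: "e > 0" "ball (g \<i>) e \<subseteq> g ` ?U" using ogU by (meson open_contains_ball)
  have "g \<i> + \<i> * of_real (s1 * (e / 2)) \<in> ball (g \<i>) e" using e s by (auto simp: dist_norm norm_mult)
  then obtain w where w: "w \<in> ?U" "g w = g \<i> + \<i> * of_real (s1 * (e / 2))" using e by (metis (no_types, lifting) imageE subsetD)
  then have "s1 * Im (g w) = s1 * s1 * (e / 2)" using 0 by simp
  also have "\<dots> > 0" using s e by auto
  finally show False using up[OF w(1)] by simp
 qed
 \<comment> \<open>The imaginary parts at \<i> and \<open>- \<i>\<close> are opposite and nonzero,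
   so the two sectors cannot have the same sign.\<close>
 have opp: "s2 = - s1"
 proof (rule ccontr)
  assume "s2 \<noteq> - s1"
  then have "s2 = s1" using s by auto
  then have "s1 * Im (g \<i>) \<ge> 0" using down[OF iU] sym[OF subsetD[OF US iU]] by simp
  then show False using up[OF iU] Imgi s by auto
 qed
 have iS: "\<i> \<in> slit_disc" "- \<i> \<in> slit_disc" by (auto simp: slit_disc_def)
 define \<beta> where "\<beta> = g \<i>"
 have \<beta>: "norm \<beta> < 1" "Im \<beta> \<noteq> 0" using gl[OF iS(1)] Imgi by (auto simp: \<beta>_def)
 have g_i: "g (- \<i>) = cnj \<beta>" using sym[OF iS(1)] by (simp add: \<beta>_def)
 define b where "b = cayley_inv \<beta>"
 have Imb: "Im b > 0" unfolding b_def by (rule cayley_inv_Im[OF \<beta>(1)])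
 have Reb: "Re b \<noteq> 0"
 proof
  assume "Re b = 0"
  then have "Im (cayley b) * (norm (b + \<i>))\<^sup>2 = 0" using Im_cayley[OF Imb] by simp
  moreover have "b + \<i> \<noteq> 0" using Im_gt_not(2)[OF Imb] .
  ultimately have "Im (cayley b) = 0" by simp
  then show False using \<beta> cayley_cayley_inv by (simp add: b_def)
 qed
 have ci: "isCont cayley_inv u" if "norm u < 1" for u
  using holomorphic_cayley_inv that holomorphic_on_imp_continuous_on continuous_on_eq_continuous_at[of "ball 0 1" cayley_inv] by auto
 have FG: "F j w = cayley_inv (G j w)" if "w \<in> slit_disc" for j w unfolding G_def by (rule cayley_inv_cayley[symmetric, OF ImF[OF that]])
 have L1: "(\<lambda>j. F (\<phi> j) \<i>) \<longlonglongrightarrow> b"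
  unfolding FG[OF iS(1)] b_def \<beta>_def by (rule isCont_tendsto_compose[OF ci[OF gl[OF iS(1)]] lim[OF iS(1)]])
 \<comment> \<open>Conjugation in the disc is reflection in the imaginary axis of the half-plane.
   Squaring turns that reflection into conjugation, so the limiting \<open>hq\<close> compares a
   point with itself.\<close>
 have L2: "(\<lambda>j. F (\<phi> j) (- \<i>)) \<longlonglongrightarrow> - cnj b"
 proof -
  have "(\<lambda>j. F (\<phi> j) (- \<i>)) \<longlonglongrightarrow> cayley_inv (g (- \<i>))"
   unfolding FG[OF iS(2)] by (rule isCont_tendsto_compose[OF ci[OF gl[OF iS(2)]] lim[OF iS(2)]])
  then show ?thesis by (simp add: g_i cayley_inv_cnj b_def)
 qed
 have Imb2: "Im (b\<^sup>2) \<noteq> 0" using Imb Reb by (simp add: power2_eq_square)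
 have "(\<lambda>j. hq ((F (\<phi> j) \<i>)\<^sup>2) (cnj ((F (\<phi> j) (- \<i>))\<^sup>2))) \<longlonglongrightarrow> hq (b\<^sup>2) (cnj ((- cnj b)\<^sup>2))"
  unfolding hq_def by (intro tendsto_intros L1 L2) (use Imb2 in auto)
 moreover have "hq (b\<^sup>2) (cnj ((- cnj b)\<^sup>2)) = 0" by (simp add: hq_def)
 moreover have "hq ((F j \<i>)\<^sup>2) (cnj ((F j (- \<i>))\<^sup>2))
  = hq ((\<psi> (\<i> * of_real (R j)))\<^sup>2) (cnj ((\<psi> (- \<i> * of_real (R j)))\<^sup>2))" for j
 proof -
  have e: "\<psi> (\<i> * of_real (R j)) = of_real (y j) * F j \<i>" "\<psi> (- \<i> * of_real (R j)) = of_real (y j) * F j (- \<i>)"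
   using y(1)[of j] by (auto simp: F_def mult.commute)
  have "hq (of_real ((y j)\<^sup>2) * (F j \<i>)\<^sup>2) (of_real ((y j)\<^sup>2) * cnj ((F j (- \<i>))\<^sup>2)) = hq ((F j \<i>)\<^sup>2) (cnj ((F j (- \<i>))\<^sup>2))"
   by (rule hq_scale) (use y(1)[of j] in simp)
  then show ?thesis unfolding e by (simp add: power_mult_distrib)
 qed
 ultimately have "(\<lambda>j. hq ((\<psi> (\<i> * of_real (R (\<phi> j))))\<^sup>2) (cnj ((\<psi> (- \<i> * of_real (R (\<phi> j))))\<^sup>2))) \<longlonglongrightarrow> 0" by simp
 moreover have "strict_mono (\<lambda>j. \<phi> j + J)" using \<phi> by (auto simp: strict_mono_def)
 ultimately show ?thesis using that[of "\<lambda>j. \<phi> j + J"] opp by (simp add: R_def)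
qed

section \<open>Displacement and parabolicity\<close>

lemma hq_nonneg: "Im v > 0 \<Longrightarrow> Im w > 0 \<Longrightarrow> hq v w \<ge> 0" by (simp add: hq_def less_imp_le)

lemma hq_commute: "hq v w = hq w v" by (simp add: hq_def norm_minus_commute mult.commute)

text \<open>Values below 1/4 force the imaginary parts to be comparable up to the factor 2, so the
  Euclidean triangle inequality gives one for \<open>hq\<close> with constant 4. Only null sequences
  are compared with it.\<close>

lemma hq_quasi_triangle:
 assumes I: "Im v > 0" "Im w > 0" "Im u > 0" and s: "hq v w < 1/4" "hq w u < 1/4" shows "hq v u \<le> 4 * hq v w + 4 * hq w u"
proof -
 have comparable: "Im a \<le> 2 * Im b" if ab: "Im a > 0" "Im b > 0" "hq a b < 1/4" for a b
 proof (rule ccontr)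
  assume n: "\<not> Im a \<le> 2 * Im b"
  have "(Im a - Im b)\<^sup>2 \<le> (norm (a - b))\<^sup>2" using abs_Im_le_cmod[of "a - b"] by (simp add: abs_le_square_iff[symmetric])
  also have "(norm (a - b))\<^sup>2 < 1/4 * (Im a * Im b)" using ab by (simp add: hq_def field_simps)
  finally have "(Im a - Im b)\<^sup>2 < 1/4 * (Im a * Im b)" .
  moreover have "(Im a - Im b)\<^sup>2 \<ge> (Im a / 2)\<^sup>2" using n ab by (intro power_mono) auto
  moreover have "Im a * Im b \<le> Im a * (Im a / 2)" using n ab by (intro mult_left_mono) auto
  ultimately have "(Im a / 2)\<^sup>2 < 1/4 * (Im a * (Im a / 2))" by linarith
  then show False using ab by (simp add: power2_eq_square)
 qed
 have vw: "(norm (v - w))\<^sup>2 = hq v w * (Im v * Im w)" and wu: "(norm (w - u))\<^sup>2 = hq w u * (Im w * Im u)" using I by (auto simp: hq_def)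
 have "norm (v - u) \<le> norm (v - w) + norm (w - u)" using norm_triangle_ineq[of "v - w" "w - u"] by simp
 then have "(norm (v - u))\<^sup>2 \<le> (norm (v - w) + norm (w - u))\<^sup>2" by (rule power_mono) simp
 also have "\<dots> \<le> 2 * (norm (v - w))\<^sup>2 + 2 * (norm (w - u))\<^sup>2"
  using zero_le_power2[of "norm (v - w) - norm (w - u)"] by (simp add: power2_eq_square algebra_simps)
 also have "\<dots> = 2 * hq v w * (Im v * Im w) + 2 * hq w u * (Im w * Im u)" unfolding vw wu by simp
 also have "\<dots> \<le> 2 * hq v w * (Im v * (2 * Im u)) + 2 * hq w u * ((2 * Im v) * Im u)"
 proof (rule add_mono)
  show "2 * hq v w * (Im v * Im w) \<le> 2 * hq v w * (Im v * (2 * Im u))"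
   using comparable[OF I(2,3) s(2)] I hq_nonneg[OF I(1,2)] by (intro mult_left_mono) auto
  have "hq w v < 1/4" using s(1) by (simp add: hq_commute)
  then show "2 * hq w u * (Im w * Im u) \<le> 2 * hq w u * ((2 * Im v) * Im u)"
   using comparable[OF I(2,1)] I hq_nonneg[OF I(2,3)] by (intro mult_left_mono mult_right_mono) auto
 qed
 also have "\<dots> = (4 * hq v w + 4 * hq w u) * (Im v * Im u)" by (simp add: algebra_simps)
 finally show ?thesis using I unfolding hq_def[of v u] by (simp add: pos_divide_le_eq)
qed

lemma hq_null_trans:
 assumes I: "\<And>j. Im (v j) > 0" "\<And>j. Im (w j) > 0" "\<And>j. Im (u j) > 0"
  and l: "(\<lambda>j. hq (v j) (w j)) \<longlonglongrightarrow> 0" "(\<lambda>j. hq (w j) (u j)) \<longlonglongrightarrow> 0"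
 shows "(\<lambda>j::nat. hq (v j) (u j)) \<longlonglongrightarrow> 0"
proof (rule tendsto_sandwich[of "\<lambda>_. 0" _ _ "\<lambda>j. 4 * hq (v j) (w j) + 4 * hq (w j) (u j)"])
 show "eventually (\<lambda>j. 0 \<le> hq (v j) (u j)) sequentially" using hq_nonneg I by simp
 have "eventually (\<lambda>j. hq (v j) (w j) < 1/4) sequentially" "eventually (\<lambda>j. hq (w j) (u j) < 1/4) sequentially"
  using l[THEN order_tendstoD(2), of "1/4"] by simp_all
 then show "eventually (\<lambda>j. hq (v j) (u j) \<le> 4 * hq (v j) (w j) + 4 * hq (w j) (u j)) sequentially"
  by eventually_elim (rule hq_quasi_triangle[OF I])
 have "(\<lambda>j. 4 * hq (v j) (w j) + 4 * hq (w j) (u j)) \<longlonglongrightarrow> 4 * 0 + 4 * 0" by (intro tendsto_intros l)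
 then show "(\<lambda>j. 4 * hq (v j) (w j) + 4 * hq (w j) (u j)) \<longlonglongrightarrow> 0" by simp
qed simp

text \<open>The displacement is governed by the quadratic \<open>q\<close> whose zeros are the fixed
  points. A positive discriminant bounds it away from 0, a negative one forces convergence to the
  fixed point in the half-plane; so the discriminant \<Delta> vanishes.\<close>

lemma parabolic_of_displacement:
 assumes A: "A \<in> PSL2R" and v: "\<And>j. Im (v j) > 0" and l: "(\<lambda>j. hq (v j) (act A (v j))) \<longlonglongrightarrow> 0"
  and leave: "\<And>w. Im w > 0 \<Longrightarrow> \<not> v \<longlonglongrightarrow> w"
 obtains a b c d :: real where "A = moebius (of_real a) (of_real b) (of_real c) (of_real d)" "a * d - b * c = 1" "(a + d)\<^sup>2 = 4"
proof -
 obtain a0 b0 c0 d0 :: real where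
  A0: "A = moebius (of_real a0) (of_real b0) (of_real c0) (of_real d0)" "a0 * d0 - b0 * c0 = 1" using A by (auto simp: PSL2R_def)
 \<comment> \<open>The matrix is determined up to sign only; the choice makes the lower left entry
   nonnegative, so that \<open>u\<close> below lies in the upper half-plane.\<close>
 define e where "e = (if c0 \<ge> 0 then 1 else - 1 :: real)"
 have e: "e \<noteq> 0" "e * e = 1" "e * c0 \<ge> 0" by (auto simp: e_def)
 define a b c d where abcd: "a = e * a0" "b = e * b0" "c = e * c0" "d = e * d0"
 have AA: "A = moebius (of_real a) (of_real b) (of_real c) (of_real d)" unfolding A0(1) abcd of_real_mult using e by (subst moebius_scale) auto
 have "a * d - b * c = e * e * (a0 * d0 - b0 * c0)" unfolding abcd by (simp add: algebra_simps)
 then have det: "a * d - b * c = 1" using e A0 by simp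
 have c: "c \<ge> 0" using e by (simp add: abcd)
 define \<Delta> where "\<Delta> = (a + d)\<^sup>2 - 4"
 have \<Delta>: "\<Delta> = (d - a)\<^sup>2 + 4 * (b * c)"
 proof -
  have "(d - a)\<^sup>2 + 4 * (b * c) = (a + d)\<^sup>2 - 4 * (a * d - b * c)" by (simp add: power2_eq_square algebra_simps)
  then show ?thesis using det by (simp add: \<Delta>_def)
 qed
 define q where "q w = of_real c * w\<^sup>2 + of_real (d - a) * w - of_real b" for w :: complex
 have hq: "hq w (act A w) = (norm (q w) / Im w)\<^sup>2" if w: "Im w > 0" for w
 proof -
  have n: "of_real c * w + of_real d \<noteq> 0" by (rule real_moebius_denominator[OF det]) (use w in simp)
  let ?N = "norm (of_real c * w + of_real d)"
  have aw: "act A w = (of_real a * w + of_real b) / (of_real c * w + of_real d)" using n by (simp add: AA act_def)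
  have "w - act A w = q w / (of_real c * w + of_real d)" unfolding aw q_def using n by (simp add: field_simps power2_eq_square)
  then have "(norm (w - act A w))\<^sup>2 = (norm (q w))\<^sup>2 / ?N\<^sup>2" by (simp add: norm_divide power_divide)
  moreover have "Im (act A w) = Im w / ?N\<^sup>2" unfolding aw by (rule real_moebius_Im[OF det]) (use w in simp)
  ultimately show ?thesis unfolding hq_def using n w by (simp add: power_divide power2_eq_square)
 qed
 define E where "E j = norm (q (v j)) / Im (v j)" for j
 have "(\<lambda>j. (E j)\<^sup>2) \<longlonglongrightarrow> 0" using l by (simp add: hq v E_def)
 then have E0: "E \<longlonglongrightarrow> 0" by (subst (asm) power_tendsto_0_iff) simp_all
 have "\<Delta> = 0"
 proof (cases "c = 0")
  case True
  have "\<bar>d - a\<bar> \<le> E j" for j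
  proof -
   have "\<bar>Im (q (v j))\<bar> = \<bar>d - a\<bar> * Im (v j)" using v[of j] True by (simp add: q_def abs_mult)
   then have "\<bar>d - a\<bar> * Im (v j) \<le> norm (q (v j))" using abs_Im_le_cmod[of "q (v j)"] by simp
   then show ?thesis using v[of j] by (simp add: E_def pos_le_divide_eq)
  qed
  then have "\<bar>d - a\<bar> \<le> 0" by (intro LIMSEQ_le_const[OF E0]) simp
  then show ?thesis using True \<Delta> by simp
 next
  case False
  then have c0: "c > 0" using c by simp
  \<comment> \<open>Completing the square: the square of \<open>u\<close> minus \<Delta> is
    \<open>4 * c * q\<close>, so a small displacement relates \<open>u\<close> to the square roots
    of \<Delta>.\<close>
  define u where "u j = 2 * of_real c * v j + of_real (d - a)" for j
  have Imu: "Im (u j) = 2 * c * Im (v j)" for j by (simp add: u_def)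
  have Imu0: "Im (u j) > 0" for j using v[of j] c0 by (simp add: Imu)
  have uq: "(u j)\<^sup>2 - of_real \<Delta> = 4 * of_real c * q (v j)" for j
   unfolding u_def q_def \<Delta> by (simp add: power2_eq_square algebra_simps)
  have nE: "norm ((u j)\<^sup>2 - of_real \<Delta>) = 2 * Im (u j) * E j" for j unfolding uq Imu E_def using c0 v[of j] by (simp add: norm_mult)
  show ?thesis
  proof (rule ccontr)
   assume "\<Delta> \<noteq> 0"
   then consider "\<Delta> > 0" | "\<Delta> < 0" by linarith
   then show False
   proof cases
    case 1
    \<comment> \<open>Hyperbolic case: with real roots both factors are at least
      \<open>Im (u j)\<close>, and one of them is at least \<delta>, which keeps \<open>E\<close>
      away from 0.\<close>
    define \<delta> where "\<delta> = sqrt \<Delta>"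
    have \<delta>: "\<delta> > 0" "of_real \<Delta> = (of_real \<delta>)\<^sup>2" using 1 by (auto simp: \<delta>_def simp flip: of_real_power)
    have "\<delta> / 2 \<le> E j" for j
    proof -
     have p: "norm ((u j)\<^sup>2 - of_real \<Delta>) = norm (u j - of_real \<delta>) * norm (u j + of_real \<delta>)"
      unfolding \<delta>(2) norm_mult[symmetric] by (simp add: power2_eq_square algebra_simps)
     have i: "norm (u j - of_real \<delta>) \<ge> Im (u j)" "norm (u j + of_real \<delta>) \<ge> Im (u j)"
      using abs_Im_le_cmod[of "u j - of_real \<delta>"] abs_Im_le_cmod[of "u j + of_real \<delta>"] by auto
     have "2 * \<delta> \<le> norm (u j - of_real \<delta>) + norm (u j + of_real \<delta>)"
     proof -
      have "norm (of_real (2 * \<delta>) :: complex) \<le> norm (u j + of_real \<delta>) + norm (u j - of_real \<delta>)"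
       using norm_triangle_ineq4[of "u j + of_real \<delta>" "u j - of_real \<delta>"] by simp
      then show ?thesis using \<delta>(1) by simp
     qed
     then consider "norm (u j - of_real \<delta>) \<ge> \<delta>" | "norm (u j + of_real \<delta>) \<ge> \<delta>" by linarith
     then have "Im (u j) * \<delta> \<le> norm ((u j)\<^sup>2 - of_real \<Delta>)"
     proof cases
      case 1
      then have "\<delta> * Im (u j) \<le> norm (u j - of_real \<delta>) * norm (u j + of_real \<delta>)"
       using i \<delta> Imu0[of j] by (intro mult_mono) auto
      then show ?thesis unfolding p by (simp add: mult.commute)
     next
      case 2
      then show ?thesis unfolding p using i \<delta> Imu0[of j] by (intro mult_mono) auto
     qed
     then have "Im (u j) * \<delta> \<le> Im (u j) * (2 * E j)" unfolding nE by simp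
     then show ?thesis using Imu0[of j] by simp
    qed
    then have "\<delta> / 2 \<le> 0" by (intro LIMSEQ_le_const[OF E0]) simp
    then show False using \<delta> by simp
   next
    case 2
    \<comment> \<open>Elliptic case: the factor for the root in the lower half-plane is at least
      \<open>Im (u j)\<close>, so \<open>u\<close> must tend to the other root and \<open>v\<close>
      to an interior fixed point, against \<open>leave\<close>.\<close>
    define \<kappa> where "\<kappa> = sqrt (- \<Delta>)"
    have \<kappa>: "\<kappa> > 0" "\<kappa>\<^sup>2 = - \<Delta>" using 2 by (auto simp: \<kappa>_def)
    have k2: "complex_of_real \<Delta> = - (of_real \<kappa>)\<^sup>2" using \<kappa>(2) by (simp flip: of_real_power of_real_minus)
    have "norm (u j - \<i> * of_real \<kappa>) \<le> 2 * E j" for j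
    proof -
     have p: "norm ((u j)\<^sup>2 - of_real \<Delta>) = norm (u j - \<i> * of_real \<kappa>) * norm (u j + \<i> * of_real \<kappa>)"
      unfolding k2 norm_mult[symmetric] by (simp add: power2_eq_square algebra_simps)
     have "Im (u j) \<le> norm (u j + \<i> * of_real \<kappa>)" using abs_Im_le_cmod[of "u j + \<i> * of_real \<kappa>"] \<kappa>(1) by simp
     then have "norm (u j - \<i> * of_real \<kappa>) * Im (u j) \<le> norm ((u j)\<^sup>2 - of_real \<Delta>)"
      unfolding p by (rule mult_left_mono) simp
     then have "Im (u j) * norm (u j - \<i> * of_real \<kappa>) \<le> Im (u j) * (2 * E j)" unfolding nE by (simp add: mult.commute mult.left_commute)
     then show ?thesis using Imu0[of j] by simp
    qed
    then have "(\<lambda>j. u j - \<i> * of_real \<kappa>) \<longlonglongrightarrow> 0"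
     by (intro Lim_null_comparison[OF always_eventually tendsto_mult_right_zero[OF E0, of 2]]) simp
    then have "(\<lambda>j. (u j - \<i> * of_real \<kappa> + (\<i> * of_real \<kappa> - of_real (d - a))) / (2 * of_real c))
      \<longlonglongrightarrow> (0 + (\<i> * of_real \<kappa> - of_real (d - a))) / (2 * of_real c)" using c0 by (intro tendsto_intros) auto
    moreover have "(u j - \<i> * of_real \<kappa> + (\<i> * of_real \<kappa> - of_real (d - a))) / (2 * of_real c) = v j" for j
     using c0 by (simp add: u_def)
    ultimately have "v \<longlonglongrightarrow> (\<i> * of_real \<kappa> - of_real (d - a)) / (2 * of_real c)" by simp
    moreover have "Im ((\<i> * of_real \<kappa> - of_real (d - a)) / (2 * of_real c)) > 0"
    proof -
     have "(\<i> * of_real \<kappa> - of_real (d - a)) / (2 * of_real c) = Complex (- (d - a) / (2 * c)) (\<kappa> / (2 * c))"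
      using c0 by (simp add: complex_eq_iff Re_divide Im_divide power2_eq_square field_simps)
     then show ?thesis using \<kappa>(1) c0 by simp
    qed
    ultimately show False using leave by blast
   qed
  qed
 qed
 then have "(a + d)\<^sup>2 = 4" by (simp add: \<Delta>_def)
 then show ?thesis using that AA det by blast
qed

section \<open>Powers and conjugates of parabolic elements\<close>

lemma parabolic_PSL2C: "parabolic E \<Longrightarrow> E \<in> PSL2C" unfolding parabolic_def PSL2C_def by blast

text \<open>A matrix \<open>1 + X\<close> with \<open>X\<close> of square zero has the powers
  \<open>1 + m X\<close>, all of trace 2, for negative \<open>m\<close> as well; loops may turn
  around a puncture in either direction.\<close>

lemma parabolic_one_parameter:
 assumes "parabolic E"
 obtains P :: "int \<Rightarrow> riemann_sphere \<Rightarrow> riemann_sphere"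
 where "P 0 = id" "\<And>m x. P (m + 1) x = E (P m x)" "\<And>m. parabolic (P m)"
proof -
 obtain a0 b0 c0 d0 where E0: "E = moebius a0 b0 c0 d0" "a0 * d0 - b0 * c0 = 1" "(a0 + d0)\<^sup>2 = 4" using assms by (auto simp: parabolic_def)
 define e where "e = (a0 + d0) / 2"
 have ee: "e * e = 1" using E0(3) by (simp add: e_def power2_eq_square)
 then have e0: "e \<noteq> 0" by auto
 \<comment> \<open>The sign \<open>e\<close> makes the trace 2. What remains after subtracting the
   identity has rows \<open>x, b\<close> and \<open>c, - x\<close>, and its square is
   \<open>x * x + b * c\<close> times the identity, which is 0.\<close>
 define x b c where xbc: "x = e * a0 - 1" "b = e * b0" "c = e * c0"
 have tr: "e * a0 + e * d0 = 2"
 proof -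
  have "e * a0 + e * d0 = e * (a0 + d0)" by (simp add: algebra_simps)
  also have "a0 + d0 = 2 * e" by (simp add: e_def)
  finally show ?thesis using ee by simp
 qed
 then have d: "e * d0 = 1 - x" by (simp add: xbc algebra_simps)
 have "(1 + x) * (1 - x) - b * c = e * e * (a0 * d0 - b0 * c0)" unfolding d[symmetric] xbc(2,3) by (simp add: xbc(1) algebra_simps)
 then have nil: "x * x + b * c = 0" using ee E0(2) by (simp add: algebra_simps)
 have E: "E = moebius (1 + x) b c (1 - x)" unfolding E0(1) d[symmetric] using moebius_scale[OF e0, of a0 b0 c0 d0] by (simp add: xbc)
 define P where "P m = moebius (1 + of_int m * x) (of_int m * b) (of_int m * c) (1 - of_int m * x)" for m :: int
 have det: "(1 + m * x) * (1 - m * x) - (m * b) * (m * c) = 1" for m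
 proof -
  have "(1 + m * x) * (1 - m * x) - (m * b) * (m * c) = 1 - m * m * (x * x + b * c)" by (simp add: algebra_simps)
  then show ?thesis using nil by simp
 qed
 show ?thesis
 proof (rule that)
  show "P 0 = id" by (simp add: P_def moebius_1)
  show "parabolic (P m)" for m unfolding parabolic_def P_def by (intro exI conjI) (rule det, simp, rule refl)
  show "P (m + 1) y = E (P m y)" for m y
  proof -
   let ?m = "of_int m :: complex"
   have "E (P m y) = moebius ((1 + x) * (1 + ?m * x) + b * (?m * c)) ((1 + x) * (?m * b) + b * (1 - ?m * x))
     (c * (1 + ?m * x) + (1 - x) * (?m * c)) (c * (?m * b) + (1 - x) * (1 - ?m * x)) y"
    unfolding E P_def by (rule moebius_compose) (use det[of 1] det[of ?m] in auto)
   moreover have "(1 + x) * (1 + ?m * x) + b * (?m * c) = 1 + (?m + 1) * x + ?m * (x * x + b * c)"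
    "c * (?m * b) + (1 - x) * (1 - ?m * x) = 1 - (?m + 1) * x + ?m * (x * x + b * c)" "(1 + x) * (?m * b) + b * (1 - ?m * x) = (?m + 1) * b"
    "c * (1 + ?m * x) + (1 - x) * (?m * c) = (?m + 1) * c" by (simp_all add: algebra_simps)
   ultimately show ?thesis using nil by (simp add: P_def)
  qed
 qed
qed

text \<open>The intertwining relation makes \<open>R\<close> the map of the conjugated matrix,
  computed here in two products, and conjugation preserves determinant and trace.\<close>

lemma parabolic_conj:
 assumes E: "parabolic E" and A: "A \<in> PSL2C" "\<And>x. A (E x) = R (A x)" shows "parabolic R"
proof -
 obtain a b c d where e: "E = moebius a b c d" "a * d - b * c = 1" "(a + d)\<^sup>2 = 4" using E by (auto simp: parabolic_def)
 obtain p q r s where pq: "A = moebius p q r s" "p * s - q * r = 1" using A(1) by (auto simp: PSL2C_def)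
 define a1 b1 c1 d1 where 1: "a1 = a * s + b * - r" "b1 = a * - q + b * p" "c1 = c * s + d * - r" "d1 = c * - q + d * p"
 define a2 b2 c2 d2 where 2: "a2 = p * a1 + q * c1" "b2 = p * b1 + q * d1" "c2 = r * a1 + s * c1" "d2 = r * b1 + s * d1"
 have det1: "a1 * d1 - b1 * c1 = 1"
 proof -
  have "a1 * d1 - b1 * c1 = (a * d - b * c) * (p * s - q * r)" unfolding 1 by (simp add: algebra_simps)
  then show ?thesis using e pq by simp
 qed
 have det2: "a2 * d2 - b2 * c2 = 1"
 proof -
  have "a2 * d2 - b2 * c2 = (a1 * d1 - b1 * c1) * (p * s - q * r)" unfolding 2 by (simp add: algebra_simps)
  then show ?thesis using det1 pq by simp
 qed
 have tr: "a2 + d2 = a + d"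
 proof -
  have "a2 + d2 = (a + d) * (p * s - q * r)" unfolding 1 2 by (simp add: algebra_simps)
  then show ?thesis using pq by simp
 qed
 have "R y = moebius a2 b2 c2 d2 y" for y
 proof -
  let ?B = "moebius s (- q) (- r) p"
  have "R y = R (A (?B y))" using moebius_inverse(1)[of p s q r y] pq by simp
  also have "\<dots> = A (E (?B y))" by (simp add: A(2))
  also have "E (?B y) = moebius a1 b1 c1 d1 y" unfolding e(1) 1 by (rule moebius_compose) (use e pq in \<open>auto simp: algebra_simps\<close>)
  also have "A \<dots> = moebius a2 b2 c2 d2 y" unfolding pq(1) 2 by (rule moebius_compose) (use det1 pq in auto)
  finally show ?thesis .
 qed
 then have "R = moebius a2 b2 c2 d2" by blast
 then show ?thesis unfolding parabolic_def using det2 tr e(3) by metis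
qed

section \<open>Comparing developments along paths\<close>

context sphere_atlas
begin

text \<open>Relates developments on two different spaces over the sphere through points with the
  same projection, so no map between the spaces has to be constructed.\<close>

definition matches :: "'a::topological_space set \<Rightarrow> ('a \<Rightarrow> riemann_sphere) \<Rightarrow> ('a \<Rightarrow> riemann_sphere) \<Rightarrow>
  'b::topological_space set \<Rightarrow> ('b \<Rightarrow> riemann_sphere) \<Rightarrow> ('b \<Rightarrow> riemann_sphere) \<Rightarrow>
  'a \<Rightarrow> 'b \<Rightarrow> (riemann_sphere \<Rightarrow> riemann_sphere) \<Rightarrow> bool" where
 "matches X p h Y q F x y A \<longleftrightarrow> (\<exists>V W. open_in X V \<and> x \<in> V \<and> open_in Y W \<and> y \<in> W \<and>
  (\<forall>x'\<in>V. \<forall>y'\<in>W. p x' = q y' \<longrightarrow> h x' = A (F y')))"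

lemma matchesE:
 assumes "matches X p h Y q F x y A"
 obtains V W where "open_in X V" "x \<in> V" "open_in Y W" "y \<in> W"
  "\<And>x' y'. x' \<in> V \<Longrightarrow> y' \<in> W \<Longrightarrow> p x' = q y' \<Longrightarrow> h x' = A (F y')"
proof -
 from assms obtain V W where *: "open_in X V" "x \<in> V" "open_in Y W" "y \<in> W"
  "\<forall>x'\<in>V. \<forall>y'\<in>W. p x' = q y' \<longrightarrow> h x' = A (F y')" unfolding matches_def by (elim exE conjE)
 show ?thesis by (rule that[OF *(1-4)]) (rule *(5)[rule_format])
qed

lemma matches_exists:
 assumes "spread X p" "spread Y q" "devel X p h" "devel Y q F" "x \<in> X" "y \<in> Y" "p x = q y"
 obtains A where "A \<in> PSL2R" "matches X p h Y q F x y A"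
proof -
 obtain V k B where V: "open_in X V" "x \<in> V" "k \<in> K" "B \<in> PSL2R" "p ` V \<subseteq> D k"
  "\<forall>y\<in>V. h y = B (g k (p y))" by (rule local_develE[OF develD[OF assms(3,5)]]) (rule that)
 have k: "q y \<in> D k" using V(2,5) assms(7) by auto
 obtain W B' where W: "open_in Y W" "y \<in> W" "W \<subseteq> Y" "q ` W \<subseteq> D k" "open (q ` W)" "path_connected W"
  "B' \<in> PSL2R" "\<And>y. y \<in> W \<Longrightarrow> F y = B' (g k (q y))"
  by (rule local_devel_chart[OF assms(2) develD[OF assms(4,6)] assms(6) V(3) k openin_subtopology_self assms(6)]) (rule that)
 obtain C where C: "C \<in> PSL2R" "\<And>x. B' (C x) = x" "\<And>x. C (B' x) = x" by (rule PSL2R_inverse[OF W(7)]) (rule that)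
 have "matches X p h Y q F x y (B \<circ> C)" unfolding matches_def
 proof (intro exI[of _ V] exI[of _ W] conjI ballI impI V(1,2) W(1,2))
  fix x' y' assume "x' \<in> V" "y' \<in> W" "p x' = q y'"
  then show "h x' = (B \<circ> C) (F y')" using V(6) W(8) C(3) by simp
 qed
 then show ?thesis using that PSL2R_comp[OF V(4) C(1)] by blast
qed

lemma matches_unique:
 assumes X: "spread X p" and Y: "spread Y q" and F: "devel Y q F" and x: "x \<in> X" "y \<in> Y" "p x = q y"
  and AB: "A \<in> PSL2C" "B \<in> PSL2C" and m: "matches X p h Y q F x y A" "matches X p h Y q F x y B" shows "A = B"
proof -
 obtain V W where 1: "open_in X V" "x \<in> V" "open_in Y W" "y \<in> W"
  "\<And>x' y'. x' \<in> V \<Longrightarrow> y' \<in> W \<Longrightarrow> p x' = q y' \<Longrightarrow> h x' = A (F y')" by (rule matchesE[OF m(1)]) (rule that)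
 obtain V' W' where 2: "open_in X V'" "x \<in> V'" "open_in Y W'" "y \<in> W'"
  "\<And>x' y'. x' \<in> V' \<Longrightarrow> y' \<in> W' \<Longrightarrow> p x' = q y' \<Longrightarrow> h x' = B (F y')" by (rule matchesE[OF m(2)]) (rule that)
 have o: "open (p ` (V \<inter> V'))" by (rule spread_open_map[OF X openin_Int[OF 1(1) 2(1)]])
 have i: "q y \<in> p ` (V \<inter> V')" using 1(2) 2(2) x(3) by (metis IntI imageI)
 have W: "open_in Y (W \<inter> W')" "y \<in> W \<inter> W'" using 1 2 by (auto intro: openin_Int)
 obtain N r where N: "open_in Y N" "y \<in> N" "N \<subseteq> W \<inter> W'" "q ` N \<subseteq> p ` (V \<inter> V')" "open (q ` N)"
  "path_connected (q ` N)" "path_connected N" "homeomorphism N (q ` N) q r" by (rule spread_small[OF Y x(2) W o i]) (rule that)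
 show ?thesis
 proof (rule devel_rigid[OF Y develD[OF F x(2)] x(2) N(1,2) AB])
  fix y' assume y': "y' \<in> N"
  then have "q y' \<in> p ` (V \<inter> V')" using N(4) by blast
  then obtain x' where x': "x' \<in> V" "x' \<in> V'" "p x' = q y'" by auto
  show "A (F y') = B (F y')" proof -
   have "y' \<in> W" "y' \<in> W'" using N(3) y' by auto
   then have "h x' = A (F y')" "h x' = B (F y')" using 1(5)[OF x'(1) _ x'(3)] 2(5)[OF x'(2) _ x'(3)] by simp_all
   then show ?thesis by simp
  qed
 qed
qed

text \<open>Along two paths with the same projection the matching element is locally constant,
  because a match near one parameter is a match at all nearby ones and matches are unique.\<close>

lemma matches_along_path:
 assumes X: "spread X p" and Y: "spread Y q" and h: "devel X p h" and F: "devel Y q F"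
  and a: "path a" "path_image a \<subseteq> X" and b: "path b" "path_image b \<subseteq> Y"
  and ab: "\<And>s. s \<in> {0..1} \<Longrightarrow> p (a s) = q (b s)"
 obtains A where "A \<in> PSL2R" "matches X p h Y q F (a 0) (b 0) A" "matches X p h Y q F (a 1) (b 1) A"
proof -
 have aX: "a s \<in> X" "b s \<in> Y" if "s \<in> {0..1}" for s
  by (rule subsetD[OF a(2)[unfolded path_image_def] imageI[OF that]], rule subsetD[OF b(2)[unfolded path_image_def] imageI[OF that]])
 have "\<exists>A. A \<in> PSL2R \<and> matches X p h Y q F (a s) (b s) A" if s: "s \<in> {0..1}" for s
  by (rule matches_exists[OF X Y h F aX[OF s] ab[OF s]], rule exI, rule conjI)
 then have "\<forall>s\<in>{0..1}. \<exists>A. A \<in> PSL2R \<and> matches X p h Y q F (a s) (b s) A" by (rule ballI)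
 from bchoice[OF this] obtain M where M0: "\<forall>s\<in>{0..1}. M s \<in> PSL2R \<and> matches X p h Y q F (a s) (b s) (M s)" by (rule exE)
 note M = bspec[OF M0]
 have "M 0 = M 1"
 proof (rule connected_local_const[of "{0..1::real}"])
  show "\<forall>s\<in>{0..1}. eventually (\<lambda>t. M s = M t) (at s within {0..1})"
  proof
   fix s :: real assume s: "s \<in> {0..1}"
   obtain V W where 1: "open_in X V" "a s \<in> V" "open_in Y W" "b s \<in> W"
    "\<And>x' y'. x' \<in> V \<Longrightarrow> y' \<in> W \<Longrightarrow> p x' = q y' \<Longrightarrow> h x' = M s (F y')"
    by (rule matchesE[OF conjunct2[OF M[OF s]]]) (rule that)
   have c: "continuous_on {0..1} a" "a \<in> {0..1} \<rightarrow> X" "continuous_on {0..1} b" "b \<in> {0..1} \<rightarrow> Y"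
    using a(1) b(1) aX unfolding path_def by (simp_all add: Pi_iff)
   have "open_in {0..1} ({0..1} \<inter> a -` V)" "open_in {0..1} ({0..1} \<inter> b -` W)"
    using continuous_openin_preimage[OF c(1,2) 1(1)] continuous_openin_preimage[OF c(3,4) 1(3)] by auto
   then have "open_in {0..1} (({0..1} \<inter> a -` V) \<inter> ({0..1} \<inter> b -` W))" by (rule openin_Int)
   then obtain T where T: "open T" "({0..1} \<inter> a -` V) \<inter> ({0..1} \<inter> b -` W) = {0..1} \<inter> T" by (auto simp: openin_open)
   have "s \<in> ({0..1} \<inter> a -` V) \<inter> ({0..1} \<inter> b -` W)" using 1 s by simp
   then have sT: "s \<in> T" unfolding T(2) by simp
   have "M s = M t" if t: "t \<in> T" "t \<in> {0..1}" for t
   proof (rule matches_unique[OF X Y F aX[OF t(2)] ab[OF t(2)]])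
    show "M s \<in> PSL2C" "M t \<in> PSL2C" using M[OF s] M[OF t(2)] PSL2R_subset_PSL2C by auto
    show "matches X p h Y q F (a t) (b t) (M t)" by (rule conjunct2[OF M[OF t(2)]])
    have "t \<in> ({0..1} \<inter> a -` V) \<inter> ({0..1} \<inter> b -` W)" unfolding T(2) using t by simp
    then have "a t \<in> V" "b t \<in> W" by simp_all
    then show "matches X p h Y q F (a t) (b t) (M s)" unfolding matches_def using 1(1,3)
     by (intro exI[of _ V] exI[of _ W] conjI ballI impI 1(5)) assumption+
   qed
   then show "eventually (\<lambda>t. M s = M t) (at s within {0..1})" unfolding eventually_at_topological using T(1) sT by blast
  qed
 qed auto
 then have "matches X p h Y q F (a 1) (b 1) (M 0)" using M[of 1] by simp
 moreover have "M 0 \<in> PSL2R" "matches X p h Y q F (a 0) (b 0) (M 0)" using M[of 0] by simp_all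
 ultimately show ?thesis by (rule that[rotated 2])
qed

end

section \<open>Disc neighbourhoods of Jordan domains\<close>

text \<open>The exterior of a large disc, with a path to every point of \<open>Q\<close> attached,
  is a closed connected unbounded set in the outside of the curve. The component of its complement
  that contains the curve and its inside is the required domain.\<close>

lemma jordan_disc_neighbourhood:
 fixes c :: "real \<Rightarrow> complex"
 assumes c: "simple_path c" "pathfinish c = pathstart c" and Q: "finite Q" "Q \<subseteq> outside (path_image c)"
 obtains W where "open W" "simply_connected W" "W \<noteq> UNIV" "path_image c \<subseteq> W" "inside (path_image c) \<subseteq> W" "W \<inter> Q = {}"
proof -
 let ?I = "inside (path_image c)" and ?O = "outside (path_image c)"
 have J: "?I \<noteq> {}" "connected ?I" "open ?O" "connected ?O" "bounded ?I" "?I \<inter> ?O = {}"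
  "?I \<union> ?O = - path_image c" "frontier ?I = path_image c" by (insert Jordan_inside_outside[OF c], (elim conjE, assumption)+)
 have "bounded (path_image c)" using c by (simp add: bounded_simple_path_image)
 then have "bounded (path_image c \<union> ?I)" using J(5) by simp
 then obtain R where R: "path_image c \<union> ?I \<subseteq> ball 0 R" using bounded_subset_ballD by blast
 define E where "E = - ball (0::complex) R"
 have EO: "E \<subseteq> ?O" unfolding E_def using R J(7) by blast
 have conE: "connected E" unfolding E_def
  using path_connected_complement_bounded_convex[of "ball (0::complex) R"] by (simp add: path_connected_imp_connected)
 have "complex_of_real (\<bar>R\<bar> + 1) \<in> E" by (simp add: E_def)
 then obtain e where e: "e \<in> E" by blast
 have pc: "path_connected ?O" by (rule connected_open_path_connected[OF J(3,4)])
 have "\<exists>\<pi>. path \<pi> \<and> path_image \<pi> \<subseteq> ?O \<and> pathstart \<pi> = e \<and> pathfinish \<pi> = x" if "x \<in> Q" for x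
  using pc e EO Q(2) that unfolding path_connected_def by blast
 then obtain \<pi> where \<pi>: "\<And>x. x \<in> Q \<Longrightarrow> path (\<pi> x) \<and> path_image (\<pi> x) \<subseteq> ?O \<and> pathstart (\<pi> x) = e \<and> pathfinish (\<pi> x) = x"
  by metis
 define K where "K = E \<union> (\<Union>x\<in>Q. path_image (\<pi> x))"
 have "closed E" unfolding E_def by (simp add: closed_Compl)
 then have clK: "closed K" unfolding K_def using Q(1) \<pi> by (auto intro!: closed_Un closed_UN closed_path_image)
 have epi: "e \<in> path_image (\<pi> x)" if "x \<in> Q" for x using \<pi>[OF that] pathstart_in_path_image by metis
 have conK: "connected K"
 proof -
  have "K = E \<union> (\<Union>x\<in>Q. path_image (\<pi> x) \<union> E)" unfolding K_def by blast
  moreover have "connected (\<Union>(insert E ((\<lambda>x. path_image (\<pi> x) \<union> E) ` Q)))"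
  proof (rule connected_Union)
   show "connected s" if "s \<in> insert E ((\<lambda>x. path_image (\<pi> x) \<union> E) ` Q)" for s
    using that conE \<pi> epi e by (auto intro!: connected_Un connected_path_image)
   show "\<Inter> (insert E ((\<lambda>x. path_image (\<pi> x) \<union> E) ` Q)) \<noteq> {}" using e by auto
  qed
  ultimately show ?thesis by simp
 qed
 have KO: "K \<subseteq> ?O" unfolding K_def using EO \<pi> by blast
 have QK: "Q \<subseteq> K"
 proof
  fix x assume x: "x \<in> Q"
  then have "x \<in> path_image (\<pi> x)" using \<pi>[OF x] pathfinish_in_path_image[of "\<pi> x"] by simp
  then show "x \<in> K" unfolding K_def using x by blast
 qed
 have "connected (?I \<union> path_image c)"
 proof (rule connected_intermediate_closure[OF J(2)])
  show "?I \<union> path_image c \<subseteq> closure ?I" using J(8) closure_subset frontier_def by (metis Diff_subset Un_least)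
 qed auto
 moreover have IK: "?I \<union> path_image c \<subseteq> - K" using KO J(6,7) by blast
 moreover have "- K \<noteq> {}" using IK J(1) by blast
 ultimately obtain W where W: "W \<in> components (- K)" "?I \<union> path_image c \<subseteq> W" using exists_component_superset by blast
 have oW: "open W" using open_components[OF _ W(1)] clK by (simp add: open_Compl)
 have WK: "W \<subseteq> - K" by (rule in_components_subset[OF W(1)])
 \<comment> \<open>The complement of \<open>W\<close> is connected and unbounded, so it has no
   bounded component; this characterizes simple connectivity of plane domains.\<close>
 have conW: "connected (- W)" by (rule component_complement_connected[OF conK W(1)])
 have ub: "\<not> bounded E" unfolding E_def by (intro cobounded_imp_unbounded) simp
 then have "\<not> bounded (- W)" using WK bounded_subset unfolding K_def by blast
 moreover have "C = - W" if "C \<in> components (- W)" for C using conW that by (metis components_eq_sing_iff components_empty empty_iff singletonD)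
 ultimately have sc: "simply_connected W" unfolding simply_connected_eq_unbounded_complement_components[OF oW]
  using in_components_connected[OF W(1)] by metis
 show ?thesis
 proof (rule that[OF oW sc])
  show "W \<noteq> UNIV" using WK e unfolding K_def by blast
 qed (use W(2) WK QK in blast)+
qed

text \<open>A positive derivative at 0 keeps directions, so arguments in the disc coordinate are,
  near the puncture, arguments in the coordinate \<open>N\<close>.\<close>

lemma normalized_riemann_map:
 assumes W: "open W" "simply_connected W" "W \<noteq> UNIV" "(0::complex) \<in> W"
 obtains \<Phi> \<Psi> c0 where "\<Phi> holomorphic_on ball 0 1" "\<Phi> ` ball 0 1 = W" "\<Psi> holomorphic_on W"
  "\<And>w. w \<in> W \<Longrightarrow> \<Psi> w \<in> ball 0 1 \<and> \<Phi> (\<Psi> w) = w" "\<And>w. w \<in> ball 0 1 \<Longrightarrow> \<Psi> (\<Phi> w) = w"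
  "\<Phi> 0 = 0" "c0 > 0" "(\<Phi> has_field_derivative of_real c0) (at 0)"
proof -
 have "W \<noteq> {}" using W(4) by blast
 then obtain f g where fg: "f holomorphic_on W" "g holomorphic_on ball 0 1" "\<And>z. z \<in> W \<Longrightarrow> f z \<in> ball 0 1 \<and> g (f z) = z"
  "\<And>z. z \<in> ball 0 1 \<Longrightarrow> g z \<in> W \<and> f (g z) = z" using Riemann_mapping_theorem[of W] W(1-3) by blast
 have a: "f 0 \<in> ball 0 1" using fg(3) W(4) by blast
 obtain \<alpha> \<beta> where ab: "\<alpha> (f 0) = 0" "\<alpha> holomorphic_on ball 0 1" "\<alpha> ` ball 0 1 \<subseteq> ball 0 1"
  "\<beta> holomorphic_on ball 0 1" "\<beta> ` ball 0 1 \<subseteq> ball 0 1"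
  "\<And>z. z \<in> ball 0 1 \<Longrightarrow> \<alpha> (\<beta> z) = z" "\<And>z. z \<in> ball 0 1 \<Longrightarrow> \<beta> (\<alpha> z) = z"
  by (rule ball_biholomorphism_exists[OF a]) (rule that)
 have bl: "\<alpha> w \<in> ball 0 1" "\<beta> w \<in> ball 0 1" if "w \<in> ball 0 1" for w using ab that by blast+
 have b0: "\<beta> 0 = f 0" using ab(1,7) a by metis
 define G where "G w = g (\<beta> w)" for w
 have G: "G holomorphic_on ball 0 1" unfolding G_def by (rule holomorphic_on_compose_gen[OF ab(4) fg(2), unfolded o_def]) (use ab in auto)
 have G0: "G 0 = 0" using fg(3) W(4) by (simp add: G_def b0)
 have Ginj: "inj_on G (ball 0 1)"
 proof (rule inj_on_inverseI[of _ "\<lambda>w. \<alpha> (f w)"])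
  fix w :: complex assume "w \<in> ball 0 1"
  then show "\<alpha> (f (G w)) = w" using fg(4)[OF bl(2)] ab(6) by (simp add: G_def)
 qed
 define d where "d = deriv G 0"
 have d: "d \<noteq> 0" unfolding d_def by (rule holomorphic_injective_imp_regular[OF G open_ball Ginj]) simp
 have Gd: "(G has_field_derivative d) (at 0)" unfolding d_def by (rule holomorphic_derivI[OF G open_ball]) simp
 \<comment> \<open>The rotation that makes the derivative \<open>d * u\<close> equal to its
   modulus.\<close>
 define u where "u = cnj d / of_real (norm d)"
 have u: "norm u = 1" "d * u = of_real (norm d)" "u \<noteq> 0"
  using d by (auto simp: u_def norm_divide complex_norm_square[symmetric] power2_eq_square)
 have ub: "u * w \<in> ball 0 1" "w / u \<in> ball 0 1" if "w \<in> ball 0 1" for w using that u by (auto simp: norm_mult norm_divide)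
 show ?thesis
 proof (rule that[of "\<lambda>w. G (u * w)" "\<lambda>w. \<alpha> (f w) / u" "norm d"])
  show "(\<lambda>w. G (u * w)) holomorphic_on ball 0 1"
   by (rule holomorphic_on_compose_gen[OF _ G, unfolded o_def]) (use ub in \<open>auto intro!: holomorphic_intros\<close>)
  show "(\<lambda>w. \<alpha> (f w) / u) holomorphic_on W"
   by (rule holomorphic_on_divide[OF holomorphic_on_compose_gen[OF fg(1) ab(2), unfolded o_def]]) (use u fg(3) in auto)
  have in': "G (u * w) \<in> W" "\<alpha> (f (G (u * w))) / u = w" if w: "w \<in> ball 0 1" for w
   using fg(4)[OF bl(2)[OF ub(1)[OF w]]] ab(6)[OF ub(1)[OF w]] u(3) by (auto simp: G_def)
  have inv: "\<alpha> (f w) / u \<in> ball 0 1 \<and> G (u * (\<alpha> (f w) / u)) = w" if w: "w \<in> W" for w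
   using ub(2)[OF bl(1)] fg(3)[OF w] ab(7) u(3) by (auto simp: G_def)
  show "(\<lambda>w. G (u * w)) ` ball 0 1 = W"
  proof
   show "(\<lambda>w. G (u * w)) ` ball 0 1 \<subseteq> W" using in' by blast
   show "W \<subseteq> (\<lambda>w. G (u * w)) ` ball 0 1" using inv by (metis (no_types, lifting) image_iff subsetI)
  qed
  show "\<alpha> (f w) / u \<in> ball 0 1 \<and> G (u * (\<alpha> (f w) / u)) = w" if "w \<in> W" for w by (rule inv[OF that])
  show "\<alpha> (f (G (u * w))) / u = w" if "w \<in> ball 0 1" for w by (rule in'(2)[OF that])
  show "G (u * 0) = 0" using G0 by simp
  show "norm d > 0" using d by simp
  have "((\<lambda>w. u * w) has_field_derivative u) (at 0)" by (auto intro!: derivative_eq_intros)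
  then have "(G \<circ> (\<lambda>w. u * w) has_field_derivative d * u) (at 0)" by (intro DERIV_chain) (use Gd in auto)
  then show "((\<lambda>w. G (u * w)) has_field_derivative of_real (norm d)) (at 0)" by (simp add: o_def u(2))
 qed
qed

section \<open>Exponential coordinates near a puncture\<close>

text \<open>The sum stays positive up to the angle \<open>3 * pi / 4\<close>; stopping at
  \<open>2 * pi / 3\<close> leaves the margin 3/10, which beats the error of 1/10 in each of the two
  coordinates in \<open>near_exp_cone\<close>.\<close>

lemma cos_abs_sin_bound:
 fixes \<theta> :: real assumes "\<bar>\<theta>\<bar> < 2 * pi / 3" shows "cos \<theta> + \<bar>sin \<theta>\<bar> > 3/10"
proof (cases "cos \<theta> \<ge> 0")
 case True
 have "(cos \<theta>)\<^sup>2 \<le> cos \<theta>" using True by (simp add: power2_eq_square mult_left_le)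
 moreover have "(sin \<theta>)\<^sup>2 \<le> \<bar>sin \<theta>\<bar>"
  using abs_sin_le_one[of \<theta>] by (metis abs_ge_zero mult_left_le power2_abs power2_eq_square)
 ultimately show ?thesis using sin_cos_squared_add[of \<theta>] by linarith
next
 case False
 have "cos (2 * pi / 3) < cos \<bar>\<theta>\<bar>" by (rule cos_monotone_0_pi) (use assms pi_gt_zero in auto)
 then have c: "cos \<theta> > - 1/2" by (simp add: cos_120)
 have "(cos \<theta>)\<^sup>2 \<le> (1/2)\<^sup>2" using c False by (intro abs_le_square_iff[THEN iffD1]) auto
 then have "(sin \<theta>)\<^sup>2 \<ge> 3/4" using sin_cos_squared_add[of \<theta>] by (simp add: power2_eq_square)
 \<comment> \<open>4/5 is a rational lower bound for the sine, and
   \<open>4/5 - 1/2 = 3/10\<close>.\<close>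
 then have "(4/5)\<^sup>2 \<le> \<bar>sin \<theta>\<bar>\<^sup>2" by (simp add: power2_eq_square)
 then have "4/5 \<le> \<bar>sin \<theta>\<bar>" by (rule power2_le_imp_le) simp
 then show ?thesis using c by linarith
qed

lemma near_exp_cone:
 assumes \<zeta>: "\<bar>Im \<zeta>\<bar> < 2 * pi / 3" and w: "norm (w - of_real c0 * exp \<zeta>) \<le> (1/10) * norm (of_real c0 * exp \<zeta>)" and c0: "c0 > 0"
 shows "Re w + \<bar>Im w\<bar> > 0"
proof -
 let ?\<rho> = "c0 * exp (Re \<zeta>)" and ?v = "of_real c0 * exp \<zeta>"
 have \<rho>: "?\<rho> > 0" using c0 by simp
 have v: "Re ?v = ?\<rho> * cos (Im \<zeta>)" "Im ?v = ?\<rho> * sin (Im \<zeta>)" "norm ?v = ?\<rho>"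
  using c0 by (auto simp: Re_exp Im_exp norm_mult)
 have "\<bar>Re (w - ?v)\<bar> \<le> ?\<rho> / 10" "\<bar>Im (w - ?v)\<bar> \<le> ?\<rho> / 10"
  using w abs_Re_le_cmod[of "w - ?v"] abs_Im_le_cmod[of "w - ?v"] unfolding v(3) by linarith+
 moreover have "Re ?v + \<bar>Im ?v\<bar> > ?\<rho> * (3/10)"
 proof -
  have "Re ?v + \<bar>Im ?v\<bar> = ?\<rho> * (cos (Im \<zeta>) + \<bar>sin (Im \<zeta>)\<bar>)"
   unfolding v using \<rho> c0 by (simp add: abs_mult algebra_simps)
  also have "\<dots> > ?\<rho> * (3/10)" by (rule mult_strict_left_mono[OF cos_abs_sin_bound[OF \<zeta>] \<rho>])
  finally show ?thesis .
 qed
 ultimately show ?thesis using \<rho> unfolding minus_complex.sel by linarith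
qed

text \<open>On these two lines the model value is purely imaginary, and an error of one tenth of its
  modulus cannot leave the sector around the imaginary direction.\<close>

lemma near_exp_sector:
 assumes \<zeta>: "Im \<zeta> = e * (pi / 2)" "e \<in> {1, -1 :: real}"
  and w: "norm (w - of_real c0 * exp \<zeta>) \<le> (1/10) * norm (of_real c0 * exp \<zeta>)" and c0: "c0 > 0" shows "\<bar>Re w\<bar> < e * Im w"
proof -
 let ?\<rho> = "c0 * exp (Re \<zeta>)" and ?v = "of_real c0 * exp \<zeta>"
 have \<rho>: "?\<rho> > 0" using c0 by simp
 have "cos (Im \<zeta>) = 0" "sin (Im \<zeta>) = e" unfolding \<zeta>(1) using \<zeta>(2) by auto
 then have v: "Re ?v = 0" "Im ?v = ?\<rho> * e" "norm ?v = ?\<rho>" using c0 by (auto simp: Re_exp Im_exp norm_mult)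
 have "\<bar>Re (w - ?v)\<bar> \<le> ?\<rho> / 10" "\<bar>Im (w - ?v)\<bar> \<le> ?\<rho> / 10"
  using w abs_Re_le_cmod[of "w - ?v"] abs_Im_le_cmod[of "w - ?v"] unfolding v(3) by linarith+
 then have 1: "\<bar>Re w\<bar> \<le> ?\<rho> / 10" "\<bar>Im w - ?\<rho> * e\<bar> \<le> ?\<rho> / 10" by (simp_all only: minus_complex.sel v(1,2) diff_zero)
 show ?thesis
 proof (cases "e = 1")
  case True
  then show ?thesis using 1 \<rho> unfolding True mult_1 mult_1_right by linarith
 next
  case False
  then have e: "e = -1" using \<zeta>(2) by simp
  show ?thesis using 1 \<rho> unfolding e mult_minus1 mult_minus1_right by linarith
 qed
qed

lemma derivative_remainder:
 fixes \<Phi> :: "complex \<Rightarrow> complex"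
 assumes "(\<Phi> has_field_derivative of_real c0) (at 0)" "\<Phi> 0 = 0" "c0 > 0"
 obtains \<delta> where "\<delta> > 0" "\<And>w. norm w < \<delta> \<Longrightarrow> norm (\<Phi> w - of_real c0 * w) \<le> (1/10) * norm (of_real c0 * w)"
proof -
 have "(\<Phi> has_derivative (\<lambda>w. of_real c0 * w)) (at 0)" using assms(1) by (simp add: has_field_derivative_def)
 then obtain \<delta> where \<delta>: "\<delta> > 0" "\<And>w. norm (w - 0) < \<delta> \<Longrightarrow> norm (\<Phi> w - \<Phi> 0 - of_real c0 * (w - 0)) \<le> (c0 / 10) * norm (w - 0)"
  using assms(3) unfolding has_derivative_at_alt by (metis zero_less_divide_iff zero_less_numeral)
 then show ?thesis using that[of \<delta>] assms(2,3) by (simp add: norm_mult)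
qed

section \<open>Smooth curves near a marked point\<close>

lemma periodic_shift_int:
 fixes q :: "real \<Rightarrow> 'b" assumes per: "\<And>t. q (t + 1) = q t" shows "q (t + of_int m) = q t"
proof (induction m rule: int_induct[of _ 0])
 case (step1 i)
 then show ?case using per[of "t + of_int i"] by (simp add: add.assoc)
next
 case (step2 i)
 then show ?case using per[of "t + of_int (i - 1)"] by (simp add: algebra_simps)
qed simp

lemma periodic_inj_int:
 fixes q :: "real \<Rightarrow> 'b"
 assumes per: "\<And>t. q (t + 1) = q t" and inj: "inj_on q {0..<1}" and eq: "q s = q s'"
 obtains m :: int where "s' = s + of_int m"
proof -
 have f: "q (frac t) = q t" for t using periodic_shift_int[of q, OF per, of t "- \<lfloor>t\<rfloor>"] by (simp add: frac_def)
 have "q (frac s) = q (frac s')" unfolding f by (rule eq)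
 then have "frac s = frac s'" using inj_onD[OF inj, of "frac s" "frac s'"] by (simp add: frac_lt_1)
 then show ?thesis using that[of "\<lfloor>s'\<rfloor> - \<lfloor>s\<rfloor>"] by (simp add: frac_def algebra_simps)
qed

lemma connected_in_arc:
 assumes "components T = e ` {1..n::nat}" "connected C" "C \<subseteq> T" "C \<noteq> {}"
 obtains j where "j \<in> {1..n}" "C \<subseteq> e j"
proof -
 have "T \<noteq> {}" using assms by blast
 then obtain E where "E \<in> components T" "C \<subseteq> E" using exists_component_superset assms(2,3) by metis
 then show ?thesis using that assms(1) by auto
qed

text \<open>A smooth corner in a coordinate \<open>N\<close> with the marked point at 0, another
  marked point at Infty and the tangent along the real axis. Arc \<open>k1\<close> leaves in the
  positive and arc \<open>k2\<close> in the negative direction; \<open>near\<close> confines the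
  curve to two cones, \<open>tang1\<close> and \<open>tang2\<close> give arc points close to the
  tangent at every small scale.\<close>

locale geodesic_corner = geodesic_charts +
 fixes N N' :: "riemann_sphere \<Rightarrow> riemann_sphere" and k i k1 k2 :: nat and r0 :: real
 assumes N: "N \<in> PSL2C" "N' \<in> PSL2C" "\<And>x. N' (N x) = x" "\<And>x. N (N' x) = x"
  and k: "k \<in> {1..n}" "N (z k) = Fin 0" and i: "i \<in> {1..n}" "N (z i) = Infty" and r0: "r0 > 0" and k12: "k1 \<in> {1..n}" "k2 \<in> {1..n}"
  and near: "\<And>x w. x \<in> \<gamma> \<Longrightarrow> N x = Fin w \<Longrightarrow> norm w < r0 \<Longrightarrow>
    w = 0 \<or> (\<bar>Im w\<bar> < Re w \<and> x \<in> edge k1) \<or> (\<bar>Im w\<bar> < - Re w \<and> x \<in> edge k2)"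
  and tang1: "\<And>\<epsilon>. \<epsilon> > 0 \<Longrightarrow> \<exists>\<rho>0>0. \<forall>\<rho>. 0 < \<rho> \<and> \<rho> < \<rho>0 \<longrightarrow>
    (\<exists>x\<in>edge k1. \<exists>w. N x = Fin w \<and> norm (w - of_real \<rho>) < \<epsilon> * \<rho>)"
  and tang2: "\<And>\<epsilon>. \<epsilon> > 0 \<Longrightarrow> \<exists>\<rho>0>0. \<forall>\<rho>. 0 < \<rho> \<and> \<rho> < \<rho>0 \<longrightarrow>
    (\<exists>x\<in>edge k2. \<exists>w. N x = Fin w \<and> norm (w + of_real \<rho>) < \<epsilon> * \<rho>)"

lemma (in geodesic_charts) smooth_corner:
 assumes C1: "C1_smooth_curve \<gamma>" and k: "k \<in> {1..n}"
 obtains N N' i k1 k2 r0 where "geodesic_corner n z \<gamma> q0 t0 f \<psi> g B N N' k i k1 k2 r0"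
proof -
 obtain M and q :: "real \<Rightarrow> complex" where M: "M \<in> PSL2C" and q: "q C1_differentiable_on UNIV" "\<And>t. vector_derivative q (at t) \<noteq> 0"
  "\<And>t. q (t + 1) = q t" "inj_on q {0..<1}" "M ` \<gamma> = Fin ` range q"
  using C1 unfolding C1_smooth_curve_def by (elim bexE exE conjE) (rule that; blast)
 obtain M' where M': "M' \<in> PSL2C" "\<And>x. M (M' x) = x" "\<And>x. M' (M x) = x" by (rule PSL2C_inverse[OF M]) (rule that)
 have onq: "\<exists>t. M x = Fin (q t)" if "x \<in> \<gamma>" for x
 proof -
  have "M x \<in> Fin ` range q" using that q(5) by blast
  then show ?thesis by blast
 qed
 define i where "i = (if k = 1 then 2 else 1 :: nat)"
 have i: "i \<in> {1..n}" "i \<noteq> k" using n3 by (auto simp: i_def)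
 have zik: "z i \<noteq> z k" using inj_onD[OF inj_z] i k by blast
 have zg: "z k \<in> \<gamma>" "z i \<in> \<gamma>" using z_in_curve k i by blast+
 obtain t1 where t1: "M (z k) = Fin (q t1)" using onq zg by blast
 obtain tb where tb: "M (z i) = Fin (q tb)" using onq zg by blast
 define a b where ab: "a = q t1" "b = q tb"
 have anb: "a - b \<noteq> 0"
 proof
  assume "a - b = 0"
  then have "M (z i) = M (z k)" using t1 tb by (simp add: ab)
  then show False using M'(3) zik by metis
 qed
 define v where "v = vector_derivative q (at t1)"
 have v: "v \<noteq> 0" "(q has_vector_derivative v) (at t1)"
  using q(1,2) unfolding v_def C1_differentiable_on_eq by (auto simp: vector_derivative_works[symmetric])
 have contq: "continuous_on UNIV q" using C1_differentiable_imp_continuous_on[OF q(1)] .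
 \<comment> \<open>With this factor \<open>T\<close> has derivative \<open>1 / v\<close> at
   \<open>a\<close>, so the curve read in \<open>N\<close> has derivative 1 at the corner.\<close>
 define c where "c = (a - b) / v"
 have c: "c \<noteq> 0" using anb v by (simp add: c_def)
 \<comment> \<open>Sends the corner \<open>a\<close> to 0 and the other marked point
   \<open>b\<close> to Infty.\<close>
 define T where "T = moebius c (- c * a) 1 (- b)"
 have "c * (- b) - (- c * a) * 1 = c * (a - b)" by (simp add: algebra_simps)
 then have T: "T \<in> PSL2C" unfolding T_def using c anb by (intro moebius_PSL2C) auto
 define N where "N = T \<circ> M"
 have N: "N \<in> PSL2C" unfolding N_def by (rule PSL2C_comp[OF T M])
 have Nk: "N (z k) = Fin 0" using anb by (simp add: N_def T_def t1 ab)
 have Ni: "N (z i) = Infty" by (simp add: N_def T_def tb ab)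
 define Q where "Q s = (c * q (t1 + s) + - c * a) / (q (t1 + s) - b)" for s
 define \<sigma> where "\<sigma> s = M' (Fin (q (t1 + s)))" for s
 have N\<sigma>: "N (\<sigma> s) = (if q (t1 + s) = b then Infty else Fin (Q s))" for s by (simp add: N_def \<sigma>_def M'(2) T_def Q_def)
 have \<sigma>0: "\<sigma> 0 = z k" using M'(3)[of "z k"] by (simp add: \<sigma>_def t1)
 have \<sigma>\<gamma>: "\<sigma> s \<in> \<gamma>" for s
 proof -
  have "Fin (q (t1 + s)) \<in> M ` \<gamma>" unfolding q(5) by blast
  then show ?thesis unfolding \<sigma>_def using M'(3) by auto
 qed
 have cont\<sigma>: "continuous_on A \<sigma>" for A
 proof -
  have "continuous_on A (\<lambda>s. q (t1 + s))" by (rule continuous_on_compose2[OF contq]) (auto intro!: continuous_intros)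
  then have "continuous_on A (\<lambda>s. Fin (q (t1 + s)))" by (rule continuous_on_compose2[OF continuous_on_Fin]) auto
  then show ?thesis unfolding \<sigma>_def by (rule continuous_on_compose2[OF continuous_on_PSL2C[OF M'(1)]]) auto
 qed
 have \<sigma>inj: "s \<in> \<int>" if "\<sigma> s = z k" for s
 proof -
  have "Fin (q (t1 + s)) = Fin (q t1)" using that M'(2) t1 by (metis \<sigma>_def)
  then have "q t1 = q (t1 + s)" by simp
  then obtain m :: int where "t1 + s = t1 + of_int m" by (rule periodic_inj_int[of q, OF q(3,4)]) (rule that)
  then show ?thesis by simp
 qed
 have Qd: "(Q has_vector_derivative 1) (at 0)"
 proof -
  have "((\<lambda>s. t1 + s) has_vector_derivative 1) (at 0)" by (auto intro!: derivative_eq_intros)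
  from vector_diff_chain_at[OF this, of q v] v(2)
  have 1: "((\<lambda>s. q (t1 + s)) has_vector_derivative v) (at 0)" by (simp add: o_def)
  have "((\<lambda>w. (c * w + - c * a) / (w - b)) has_field_derivative 1 / v) (at a)"
  proof -
   have "((\<lambda>w. c * w + - c * a) has_field_derivative c) (at a)" "((\<lambda>w. w - b) has_field_derivative 1) (at a)"
    by (auto intro!: derivative_eq_intros)
   from DERIV_divide[OF this anb]
   have "((\<lambda>w. (c * w + - c * a) / (w - b)) has_field_derivative c * (a - b) / ((a - b) * (a - b))) (at a)" by simp
   moreover have "c * (a - b) / ((a - b) * (a - b)) = 1 / v" using anb v(1) by (simp add: c_def)
   ultimately show ?thesis by simp
  qed
  then have 2: "((\<lambda>w. (c * w + - c * a) / (w - b)) has_field_derivative 1 / v) (at (q (t1 + 0)))" by (simp add: ab)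
  show ?thesis using field_vector_diff_chain_at[OF 1 2] v(1) by (simp add: o_def Q_def[abs_def])
 qed
 have Q0: "Q 0 = 0" by (simp add: Q_def ab)
 have est: "\<exists>\<delta>>0. \<forall>s. \<bar>s\<bar> < \<delta> \<longrightarrow> norm (Q s - of_real s) \<le> e * \<bar>s\<bar>" if "e > 0" for e
 proof -
  have "\<exists>d>0. \<forall>y. norm (y - 0) < d \<longrightarrow> norm (Q y - Q 0 - (y - 0) *\<^sub>R 1) \<le> e * norm (y - 0)"
   using Qd that unfolding has_vector_derivative_def has_derivative_at_alt by blast
  then show ?thesis by (simp add: Q0 scaleR_conv_of_real)
 qed
 \<comment> \<open>With relative error 1/8 the imaginary part is at most 1/8 and the real part at
   least 7/8 of the parameter, in modulus, so the points lie in the cones of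
   \<open>near\<close>.\<close>
 obtain \<delta>1 where \<delta>1: "\<delta>1 > 0" "\<And>s. \<bar>s\<bar> < \<delta>1 \<Longrightarrow> norm (Q s - of_real s) \<le> (1/8) * \<bar>s\<bar>"
  using est[of "1/8"] by auto
 have "open (- z ` ({1..n} - {k}))" by (intro open_Compl finite_imp_closed) simp
 then have "open (\<sigma> -` (- z ` ({1..n} - {k})))" by (rule open_vimage[OF _ cont\<sigma>])
 moreover have "0 \<in> \<sigma> -` (- z ` ({1..n} - {k}))" using \<sigma>0 inj_onD[OF inj_z] k by auto
 ultimately obtain \<delta>2 where \<delta>2: "\<delta>2 > 0" "ball 0 \<delta>2 \<subseteq> \<sigma> -` (- z ` ({1..n} - {k}))" by (meson open_contains_ball)
 define \<delta> where "\<delta> = min (min \<delta>1 \<delta>2) (1/2)"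
 have \<delta>: "\<delta> > 0" "\<delta> \<le> \<delta>1" "\<delta> \<le> \<delta>2" "\<delta> \<le> 1/2" using \<delta>1 \<delta>2 by (auto simp: \<delta>_def)
 have off: "\<sigma> s \<notin> z ` ({1..n} - {k})" if "\<bar>s\<bar> < \<delta>" for s
 proof -
  have "s \<in> ball 0 \<delta>2" using that \<delta> by simp
  then show ?thesis using \<delta>2(2) by blast
 qed
 have N\<sigma>Q: "N (\<sigma> s) = Fin (Q s)" if "\<bar>s\<bar> < \<delta>" for s
 proof -
  have "\<sigma> s \<noteq> z i" using off[OF that] i by blast
  then have "N (\<sigma> s) \<noteq> Infty" using Ni PSL2C_inj[OF N, of UNIV] by (metis UNIV_I inj_onD)
  then show ?thesis using N\<sigma>[of s] by (metis (full_types))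
 qed
 have arcpt: "\<sigma> s \<in> \<gamma> - z ` {1..n}" if "\<bar>s\<bar> < \<delta>" "s \<noteq> 0" for s
 proof -
  have "\<sigma> s \<noteq> z k"
  proof
   assume "\<sigma> s = z k"
   then obtain m :: int where m: "s = of_int m" using \<sigma>inj Ints_cases by blast
   then have "\<bar>of_int m :: real\<bar> < 1" using that(1) \<delta>(4) by simp
   then have "m = 0" by linarith
   then show False using m that by simp
  qed
  then show ?thesis using off[OF that(1)] \<sigma>\<gamma> by blast
 qed
 obtain k1 where k1: "k1 \<in> {1..n}" "\<sigma> ` {0<..<\<delta>} \<subseteq> edge k1"
 proof (rule connected_in_arc[OF arcs(2)])
  show "connected (\<sigma> ` {0<..<\<delta>})" by (intro connected_continuous_image cont\<sigma>) simp
  show "\<sigma> ` {0<..<\<delta>} \<subseteq> \<gamma> - z ` {1..n}" using arcpt by (intro image_subsetI) simp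
 qed (use \<delta>(1) in simp, rule that)
 obtain k2 where k2: "k2 \<in> {1..n}" "\<sigma> ` {-\<delta><..<0} \<subseteq> edge k2"
 proof (rule connected_in_arc[OF arcs(2)])
  show "connected (\<sigma> ` {-\<delta><..<0})" by (intro connected_continuous_image cont\<sigma>) simp
  show "\<sigma> ` {-\<delta><..<0} \<subseteq> \<gamma> - z ` {1..n}" using arcpt by (intro image_subsetI) simp
 qed (use \<delta>(1) in simp, rule that)
 \<comment> \<open>The rest of the curve over one period is compact and does not contain
   \<open>z k\<close>, so it stays outside a disc of radius \<open>r0\<close>.\<close>
 define C where "C = \<sigma> ` ({-(1/2)..1/2} - {-\<delta><..<\<delta>})"
 have "compact ({-(1/2)..1/2} - {-\<delta><..<\<delta>})" by (intro compact_diff) auto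
 then have "compact C" unfolding C_def by (rule compact_continuous_image[OF cont\<sigma>])
 then have "open (- C)" using compact_imp_closed by blast
 then have "open (N ` (- C))" by (rule open_image_PSL2C[OF N])
 then have "open (Fin -` N ` (- C))" by (rule open_Fin_vimage)
 moreover have "z k \<notin> C"
 proof
  assume "z k \<in> C"
  then obtain s where s: "\<sigma> s = z k" "\<bar>s\<bar> \<le> 1/2" "\<not> \<bar>s\<bar> < \<delta>" unfolding C_def by (auto simp: abs_le_iff)
  obtain m :: int where m: "s = of_int m" using \<sigma>inj[OF s(1)] Ints_cases by blast
  then have "\<bar>of_int m :: real\<bar> < 1" using s(2) by simp
  then have "m = 0" by linarith
  then show False using m s(3) \<delta>(1) by simp
 qed
 then have "0 \<in> Fin -` N ` (- C)" using Nk by (metis ComplI image_eqI vimageI)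
 ultimately obtain r0 where r0: "r0 > 0" "ball 0 r0 \<subseteq> Fin -` N ` (- C)" by (meson open_contains_ball)
 obtain N' where N': "N' \<in> PSL2C" "\<And>x. N (N' x) = x" "\<And>x. N' (N x) = x" by (rule PSL2C_inverse[OF N]) (rule that)
 show ?thesis
 proof (rule that[of N N' i k1 k2 r0], rule geodesic_corner.intro[OF geodesic_charts_axioms], rule geodesic_corner_axioms.intro)
  fix x w assume x: "x \<in> \<gamma>" "N x = Fin w" "norm w < r0"
  have "w \<in> ball 0 r0" using x(3) by simp
  then have "N x \<in> N ` (- C)" using r0(2) x(2) by auto
  then have xC: "x \<notin> C" using PSL2C_inj[OF N, of UNIV] by (metis ComplD UNIV_I imageE inj_onD)
  obtain t where t: "M x = Fin (q t)" using onq[OF x(1)] by blast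
  \<comment> \<open>Rounding to the nearest integer brings the parameter into the period window of
    half-length 1/2 about the corner.\<close>
  define m where "m = \<lfloor>t - t1 + 1/2\<rfloor>"
  define s where "s = t - t1 - of_int m"
  have s: "- (1/2) \<le> s" "s \<le> 1/2" unfolding s_def m_def by linarith+
  have "t = (t1 + s) + of_int m" by (simp add: s_def)
  then have "q t = q (t1 + s)" using periodic_shift_int[of q, OF q(3)] by metis
  then have xs: "x = \<sigma> s" using t M'(3) by (metis \<sigma>_def)
  have sd: "\<bar>s\<bar> < \<delta>"
  proof (rule ccontr)
   assume "\<not> \<bar>s\<bar> < \<delta>"
   then have "s \<in> {-(1/2)..1/2} - {-\<delta><..<\<delta>}" using s by auto
   then show False using xC xs unfolding C_def by blast
  qed
  have w: "w = Q s" using N\<sigma>Q[OF sd] x(2) xs by simp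
  have e: "norm (w - of_real s) \<le> (1/8) * \<bar>s\<bar>" unfolding w using \<delta>1(2) sd \<delta> by simp
  have re: "\<bar>Re w - s\<bar> \<le> (1/8) * \<bar>s\<bar>" "\<bar>Im w\<bar> \<le> (1/8) * \<bar>s\<bar>"
   using abs_Re_le_cmod[of "w - of_real s"] abs_Im_le_cmod[of "w - of_real s"] e by simp_all
  consider "s = 0" | "s > 0" | "s < 0" by linarith
  then show "w = 0 \<or> (\<bar>Im w\<bar> < Re w \<and> x \<in> edge k1) \<or> (\<bar>Im w\<bar> < - Re w \<and> x \<in> edge k2)"
  proof cases
   case 1 then show ?thesis using w Q0 by simp
  next
   case 2
   have "x \<in> \<sigma> ` {0<..<\<delta>}" unfolding xs using 2 sd by (intro imageI) simp
   moreover have "\<bar>Im w\<bar> < Re w" using re 2 by linarith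
   ultimately show ?thesis using k1(2) by blast
  next
   case 3
   have "x \<in> \<sigma> ` {-\<delta><..<0}" unfolding xs using 3 sd by (intro imageI) simp
   moreover have "\<bar>Im w\<bar> < - Re w" using re 3 by linarith
   ultimately show ?thesis using k2(2) by blast
  qed
 next
  fix \<epsilon> :: real assume "\<epsilon> > 0"
  then obtain \<delta>' where \<delta>': "\<delta>' > 0" "\<And>s. \<bar>s\<bar> < \<delta>' \<Longrightarrow> norm (Q s - of_real s) \<le> (\<epsilon>/2) * \<bar>s\<bar>"
   using est[of "\<epsilon>/2"] by auto
  show "\<exists>\<rho>0>0. \<forall>\<rho>. 0 < \<rho> \<and> \<rho> < \<rho>0 \<longrightarrow> (\<exists>x\<in>edge k1. \<exists>w. N x = Fin w \<and> norm (w - of_real \<rho>) < \<epsilon> * \<rho>)"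
  proof (intro exI[of _ "min \<delta> \<delta>'"] conjI allI impI)
   show "min \<delta> \<delta>' > 0" using \<delta> \<delta>' by simp
   fix \<rho> assume \<rho>: "0 < \<rho> \<and> \<rho> < min \<delta> \<delta>'"
   have "norm (Q \<rho> - of_real \<rho>) \<le> (\<epsilon>/2) * \<rho>" using \<delta>'(2)[of \<rho>] \<rho> by simp
   moreover have "(\<epsilon>/2) * \<rho> < \<epsilon> * \<rho>" using \<rho> \<open>\<epsilon> > 0\<close> by simp
   moreover have "\<sigma> \<rho> \<in> edge k1" using k1(2) \<rho> by auto
   moreover have "N (\<sigma> \<rho>) = Fin (Q \<rho>)" using N\<sigma>Q[of \<rho>] \<rho> by simp
   ultimately show "\<exists>x\<in>edge k1. \<exists>w. N x = Fin w \<and> norm (w - of_real \<rho>) < \<epsilon> * \<rho>"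
    by (intro bexI[of _ "\<sigma> \<rho>"] exI[of _ "Q \<rho>"] conjI) linarith+
  qed
  show "\<exists>\<rho>0>0. \<forall>\<rho>. 0 < \<rho> \<and> \<rho> < \<rho>0 \<longrightarrow> (\<exists>x\<in>edge k2. \<exists>w. N x = Fin w \<and> norm (w + of_real \<rho>) < \<epsilon> * \<rho>)"
  proof (intro exI[of _ "min \<delta> \<delta>'"] conjI allI impI)
   show "min \<delta> \<delta>' > 0" using \<delta> \<delta>' by simp
   fix \<rho> assume \<rho>: "0 < \<rho> \<and> \<rho> < min \<delta> \<delta>'"
   have "norm (Q (- \<rho>) + of_real \<rho>) \<le> (\<epsilon>/2) * \<rho>" using \<delta>'(2)[of "- \<rho>"] \<rho> by simp
   moreover have "(\<epsilon>/2) * \<rho> < \<epsilon> * \<rho>" using \<rho> \<open>\<epsilon> > 0\<close> by simp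
   moreover have "\<sigma> (- \<rho>) \<in> edge k2" using k2(2) \<rho> by auto
   moreover have "N (\<sigma> (- \<rho>)) = Fin (Q (- \<rho>))" using N\<sigma>Q[of "- \<rho>"] \<rho> by simp
   ultimately show "\<exists>x\<in>edge k2. \<exists>w. N x = Fin w \<and> norm (w + of_real \<rho>) < \<epsilon> * \<rho>"
    by (intro bexI[of _ "\<sigma> (- \<rho>)"] exI[of _ "Q (- \<rho>)"] conjI) linarith+
  qed
 qed (rule N N' k Nk i(1) Ni r0(1) k1(1) k2(1))+
qed

section \<open>Reflection of the extensions at a corner\<close>

lemma hq_cnj: "hq (cnj v) (cnj w) = hq v w"
proof -
 have "norm (cnj v - cnj w) = norm (v - w)" by (metis complex_cnj_diff complex_mod_cnj)
 then show ?thesis by (simp add: hq_def)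
qed

lemma hq_cnj_commute: "hq v (cnj w) = hq w (cnj v)" using hq_cnj[of v "cnj w"] by (simp add: hq_commute)

lemma PSL2R_act_hq':
 assumes A: "A \<in> PSL2R" and I: "Im v * Im w > 0" shows "hq (act A v) (act A w) = hq v w"
proof (cases "Im v > 0")
 case True
 then show ?thesis using PSL2R_act_hq[OF A] I by (simp add: zero_less_mult_iff)
next
 case False
 then have n: "Im v < 0" "Im w < 0" using I by (auto simp: zero_less_mult_iff)
 have "hq (act A v) (act A w) = hq (cnj (act A v)) (cnj (act A w))" by (simp add: hq_cnj)
 also have "\<dots> = hq (act A (cnj v)) (act A (cnj w))" using PSL2R_act_cnj[OF A] n by simp
 also have "\<dots> = hq (cnj v) (cnj w)" by (rule PSL2R_act_hq[OF A]) (use n in auto)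
 finally show ?thesis by (simp add: hq_cnj)
qed

text \<open>\<open>\<psi> \<kappa>\<close> and its inverse are read in the coordinate
  \<open>N\<close>, and the planar reflection result applies. The square of the result differs from
  \<open>g \<kappa>\<close> by the real map \<open>B \<kappa>\<close>, under which \<open>hq\<close>
  is invariant.\<close>

lemma (in geodesic_charts) arc_reflection:
 fixes r :: "nat \<Rightarrow> real" and s1 s2 r0 :: real
 assumes \<kappa>: "\<kappa> \<in> {1..n}" and N: "N \<in> PSL2C" "N' \<in> PSL2C" "\<And>x. N' (N x) = x" "\<And>x. N (N' x) = x"
  and k: "k \<in> {1..n}" "N (z k) = Fin 0" and i: "i \<in> {1..n}" "N (z i) = Infty"
  and cone: "r0 > 0" "\<And>w. norm w < r0 \<Longrightarrow> Re w + \<bar>Im w\<bar> > 0 \<Longrightarrow> N' (Fin w) \<in> D \<kappa>"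
  and tang: "\<And>\<epsilon>. \<epsilon> > 0 \<Longrightarrow> \<exists>\<rho>0>0. \<forall>\<rho>. 0 < \<rho> \<and> \<rho> < \<rho>0 \<longrightarrow> (\<exists>x\<in>edge \<kappa>. \<exists>w. N x = Fin w \<and> norm (w - of_real \<rho>) < \<epsilon> * \<rho>)"
  and s: "s1 \<in> {1, -1}" "s2 \<in> {1, -1}"
  and side1: "\<And>w. norm w < r0 \<Longrightarrow> \<bar>Re w\<bar> < Im w \<Longrightarrow> N' (Fin w) \<in> (if s1 = 1 then \<Omega> else \<Omega>')"
  and side2: "\<And>w. norm w < r0 \<Longrightarrow> \<bar>Re w\<bar> < - Im w \<Longrightarrow> N' (Fin w) \<in> (if s2 = 1 then \<Omega> else \<Omega>')"
  and r: "\<And>j. 0 < r j" "\<And>j. r j < r0" "r \<longlonglongrightarrow> 0"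
 obtains \<phi> where "s2 = - s1" "strict_mono (\<phi> :: nat \<Rightarrow> nat)"
  "(\<lambda>j. hq (affine (g \<kappa> (N' (Fin (\<i> * of_real (r (\<phi> j)))))))
    (cnj (affine (g \<kappa> (N' (Fin (- \<i> * of_real (r (\<phi> j))))))))) \<longlonglongrightarrow> 0"
proof -
 have c: "conformal_map (\<psi> \<kappa>) (D \<kappa>) upper_half" by (rule \<psi>[OF \<kappa>])
 then have hc: "holomorphic_sphere (\<psi> \<kappa>) (D \<kappa>)" "inj_on (\<psi> \<kappa>) (D \<kappa>)" "\<psi> \<kappa> ` D \<kappa> = upper_half"
  by (auto simp: conformal_simps)
 let ?inv = "inv_into (D \<kappa>) (\<psi> \<kappa>)"
 have "conformal_map ?inv upper_half (D \<kappa>)" by (rule conformal_map_inverse(3)[OF c])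
 then have hi: "holomorphic_sphere ?inv upper_half" "?inv ` upper_half = D \<kappa>" by (auto simp: conformal_simps)
 have up: "\<psi> \<kappa> x = Fin (affine (\<psi> \<kappa> x))" "Im (affine (\<psi> \<kappa> x)) > 0" if "x \<in> D \<kappa>" for x
 proof -
  have "\<psi> \<kappa> x \<in> upper_half" using hc(3) that by blast
  then show "\<psi> \<kappa> x = Fin (affine (\<psi> \<kappa> x))" "Im (affine (\<psi> \<kappa> x)) > 0" by (auto simp: upper_half_def)
 qed
 have Dz: "D \<kappa> \<inter> z ` {1..n} = {}" using Union_D \<kappa> by blast
 have Nfin: "N x = Fin (affine (N x))" "affine (N x) \<noteq> 0" if "x \<in> D \<kappa>" for x
 proof -
  have "x \<noteq> z i" "x \<noteq> z k" using Dz that i k by auto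
  then have "N x \<noteq> Infty" "N x \<noteq> Fin 0" using N(3) i(2) k(2) by metis+
  then show "N x = Fin (affine (N x))" "affine (N x) \<noteq> 0" by (metis Fin_affine)+
 qed
 define D' where "D' = {w. N' (Fin w) \<in> D \<kappa>}"
 define \<psi>' where "\<psi>' w = affine (\<psi> \<kappa> (N' (Fin w)))" for w
 define \<xi>' where "\<xi>' v = affine (N (?inv (Fin v)))" for v
 have D': "N' (Fin w) \<in> D \<kappa>" if "w \<in> D'" for w using that by (simp add: D'_def)
 have \<psi>'F: "\<psi> \<kappa> (N' (Fin w)) = Fin (\<psi>' w)" "Im (\<psi>' w) > 0" if "w \<in> D'" for w
  using up[OF D'[OF that]] by (simp_all add: \<psi>'_def)
 have invD: "?inv (Fin v) \<in> D \<kappa>" if "Im v > 0" for v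
 proof -
  have "Fin v \<in> upper_half" using that by simp
  then show ?thesis using hi(2) by blast
 qed
 have \<xi>'F: "N (?inv (Fin v)) = Fin (\<xi>' v)" if "Im v > 0" for v unfolding \<xi>'_def by (rule Nfin(1)[OF invD[OF that]])
 have N'\<xi>: "N' (Fin (\<xi>' v)) = ?inv (Fin v)" if "Im v > 0" for v using \<xi>'F[OF that] N(3) by metis
 have right: "Re (\<psi>' w) > 0" if "N' (Fin w) \<in> \<Omega>" for w
 proof -
  have "\<psi> \<kappa> (N' (Fin w)) \<in> Fin ` right_quadrant" using \<psi>_\<Omega>[OF \<kappa>] that by blast
  then show ?thesis by (auto simp: \<psi>'_def right_quadrant_def)
 qed
 have left: "Re (\<psi>' w) < 0" if "N' (Fin w) \<in> \<Omega>'" for w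
 proof -
  have "\<psi> \<kappa> (N' (Fin w)) \<in> Fin ` left_quadrant" using \<psi>_\<Omega>'[OF \<kappa>] that by blast
  then show ?thesis by (auto simp: \<psi>'_def left_quadrant_def)
 qed
 have pos1: "s1 * Re (\<psi>' w) > 0" if "norm w < r0" "\<bar>Re w\<bar> < Im w" for w
  using side1[OF that] right[of w] left[of w] s(1) by (auto split: if_splits)
 have pos2: "s2 * Re (\<psi>' w) > 0" if "norm w < r0" "\<bar>Re w\<bar> < - Im w" for w
  using side2[OF that] right[of w] left[of w] s(2) by (auto split: if_splits)
 have oD: "open (N' -` D \<kappa>)" by (rule open_vimage_PSL2C[OF N(2) open_D[OF \<kappa>]])
 obtain \<phi> where \<phi>: "s2 = - s1" "strict_mono (\<phi> :: nat \<Rightarrow> nat)"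
  "(\<lambda>j. hq ((\<psi>' (\<i> * of_real (r (\<phi> j))))\<^sup>2) (cnj ((\<psi>' (- \<i> * of_real (r (\<phi> j))))\<^sup>2))) \<longlonglongrightarrow> 0"
 proof (rule tangent_reflection[of D' \<psi>' \<xi>' r0 s1 s2 r])
  have "D' = Fin -` (N' -` D \<kappa>)" by (auto simp: D'_def)
  then show "open D'" using open_Fin_vimage[OF oD] by simp
  show "0 \<notin> D'"
  proof
   assume "0 \<in> D'"
   then have "N (N' (Fin 0)) \<noteq> Fin 0" using Nfin[OF D'] by (metis riemann_sphere.sel(1))
   then show False by (simp add: N(4))
  qed
  have "holomorphic_sphere (\<lambda>x. \<psi> \<kappa> (N' x)) (N' -` D \<kappa>)"
   by (rule holomorphic_sphere_compose[OF holomorphic_sphere_PSL2C[OF N(2) oD] hc(1)]) auto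
  then show "\<psi>' holomorphic_on D'" unfolding \<psi>'_def[abs_def]
   by (rule holomorphic_sphere_planar) (use \<psi>'F(1) in \<open>auto simp: D'_def\<close>)
  show "Im (\<psi>' w) > 0" if "w \<in> D'" for w by (rule \<psi>'F(2)[OF that])
  show "\<xi>' (\<psi>' w) = w" if "w \<in> D'" for w
   unfolding \<xi>'_def \<psi>'F(1)[OF that, symmetric] using inv_into_f_f[OF hc(2) D'[OF that]] N(4) by simp
  have "holomorphic_sphere (\<lambda>x. N (?inv x)) upper_half" by (rule holomorphic_sphere_PSL2C_comp[OF hi(1) N(1)])
  then show "\<xi>' holomorphic_on {w. Im w > 0}" unfolding \<xi>'_def[abs_def] by (rule holomorphic_sphere_planar) (use \<xi>'F in auto)
  show "\<xi>' v \<in> D'" if "Im v > 0" for v unfolding D'_def using N'\<xi>[OF that] invD[OF that] by simp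
  show "\<psi>' (\<xi>' v) = v" if "Im v > 0" for v
  proof -
   have "Fin v \<in> \<psi> \<kappa> ` D \<kappa>" unfolding hc(3) using that by simp
   then show ?thesis unfolding \<psi>'_def N'\<xi>[OF that] by (simp add: f_inv_into_f)
  qed
  show "w \<in> D'" if "norm w < r0" "Re w + \<bar>Im w\<bar> > 0" for w unfolding D'_def using cone(2)[OF that] by simp
  show "s1 * Re (\<psi>' w) \<ge> 0" if "norm w < r0" "\<bar>Re w\<bar> < Im w" for w using pos1[OF that] by simp
  show "s2 * Re (\<psi>' w) \<ge> 0" if "norm w < r0" "\<bar>Re w\<bar> < - Im w" for w using pos2[OF that] by simp
  fix \<epsilon> :: real assume "\<epsilon> > 0"
  from tang[OF this] obtain \<rho>0 where \<rho>0: "\<rho>0 > 0"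
   "\<And>\<rho>. 0 < \<rho> \<and> \<rho> < \<rho>0 \<Longrightarrow> \<exists>x\<in>edge \<kappa>. \<exists>w. N x = Fin w \<and> norm (w - of_real \<rho>) < \<epsilon> * \<rho>" by blast
  show "\<exists>\<rho>0>0. \<forall>\<rho>. 0 < \<rho> \<and> \<rho> < \<rho>0 \<longrightarrow> (\<exists>w\<in>D'. norm (w - of_real \<rho>) < \<epsilon> * \<rho> \<and> Re (\<psi>' w) = 0)"
  proof (intro exI[of _ \<rho>0] conjI \<rho>0(1) allI impI)
   fix \<rho> assume "0 < \<rho> \<and> \<rho> < \<rho>0"
   from \<rho>0(2)[OF this] obtain x w where x: "x \<in> edge \<kappa>" "N x = Fin w" "norm (w - of_real \<rho>) < \<epsilon> * \<rho>" by blast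
   have xw: "N' (Fin w) = x" using N(3)[of x] x(2) by simp
   have "\<psi> \<kappa> x \<in> Fin ` imag_ray" using \<psi>_arc[OF \<kappa>] x(1) by blast
   then have "Re (\<psi>' w) = 0" by (auto simp: \<psi>'_def xw imag_ray_def)
   moreover have "w \<in> D'" unfolding D'_def using xw x(1) by simp
   ultimately show "\<exists>w\<in>D'. norm (w - of_real \<rho>) < \<epsilon> * \<rho> \<and> Re (\<psi>' w) = 0" using x(3) by blast
  qed
 qed (use cone(1) s r in \<open>assumption | simp\<close>)+
 have eq: "hq (affine (g \<kappa> (N' (Fin (\<i> * of_real (r j)))))) (cnj (affine (g \<kappa> (N' (Fin (- \<i> * of_real (r j)))))))
   = hq ((\<psi>' (\<i> * of_real (r j)))\<^sup>2) (cnj ((\<psi>' (- \<i> * of_real (r j)))\<^sup>2))" for j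
 proof -
  let ?u = "\<i> * of_real (r j)" and ?w = "- \<i> * of_real (r j)"
  have nr: "norm ?u < r0" "norm ?w < r0" using r(1,2)[of j] by (auto simp: norm_mult)
  have sec: "\<bar>Re ?u\<bar> < Im ?u" "\<bar>Re ?w\<bar> < - Im ?w" using r(1)[of j] by auto
  have mem: "?u \<in> D'" "?w \<in> D'" unfolding D'_def using cone(2)[OF nr(1)] cone(2)[OF nr(2)] r(1)[of j] by auto
  let ?a = "(\<psi>' ?u)\<^sup>2" and ?b = "(\<psi>' ?w)\<^sup>2"
  have Imsq: "Im (v\<^sup>2) = 2 * Re v * Im v" for v by (simp add: power2_eq_square)
  have pa: "s1 * Im ?a > 0"
  proof -
   have "s1 * Im ?a = (s1 * Re (\<psi>' ?u)) * (2 * Im (\<psi>' ?u))" by (simp add: Imsq)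
   then show ?thesis using pos1[OF nr(1) sec(1)] \<psi>'F(2)[OF mem(1)] by (metis mult_pos_pos zero_less_numeral)
  qed
  have pb: "s2 * Im ?b > 0"
  proof -
   have "s2 * Im ?b = (s2 * Re (\<psi>' ?w)) * (2 * Im (\<psi>' ?w))" by (simp add: Imsq)
   then show ?thesis using pos2[OF nr(2) sec(2)] \<psi>'F(2)[OF mem(2)] by (metis mult_pos_pos zero_less_numeral)
  qed
  have nz: "Im ?a \<noteq> 0" "Im ?b \<noteq> 0" using pa pb by auto
  \<comment> \<open>Since \<open>s2 = - s1\<close>, the values \<open>?a\<close> and
    \<open>?b\<close> lie in different half-planes, so \<open>?a\<close> and the conjugate of
    \<open>?b\<close> lie in the same one, as invariance of \<open>hq\<close> requires.\<close>
  have ab: "Im ?a * Im (cnj ?b) > 0"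
  proof -
   have "Im ?a * Im (cnj ?b) = (s1 * Im ?a) * (s2 * Im ?b)" using s(1) unfolding cnj.simps(2) \<phi>(1) by auto
   then show ?thesis using mult_pos_pos[OF pa pb] by (simp only:)
  qed
  have ga: "affine (g \<kappa> (N' (Fin ?u))) = act (B \<kappa>) ?a" by (simp add: g_def[OF \<kappa>] \<psi>'F(1)[OF mem(1)] square_def act_def)
  have gb: "affine (g \<kappa> (N' (Fin ?w))) = act (B \<kappa>) ?b"
   unfolding g_def[OF \<kappa>] \<psi>'F(1)[OF mem(2)] by (simp add: square_def act_def)
  show ?thesis unfolding ga gb PSL2R_act_cnj[OF B[OF \<kappa>] nz(2), symmetric] by (rule PSL2R_act_hq'[OF B[OF \<kappa>] ab])
 qed
 show ?thesis by (rule that[OF \<phi>(1,2)]) (use \<phi>(3) in \<open>simp only: eq\<close>)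
qed

section \<open>The transition map at a smooth corner\<close>

context geodesic_corner
begin

lemma cone1: "norm w < r0 \<Longrightarrow> Re w + \<bar>Im w\<bar> > 0 \<Longrightarrow> N' (Fin w) \<in> D k1"
proof (cases "N' (Fin w) \<in> \<gamma>")
 case True
 assume "norm w < r0" "Re w + \<bar>Im w\<bar> > 0"
 with near[OF True N(4)] show ?thesis by auto
qed simp

lemma cone2: "norm w < r0 \<Longrightarrow> - Re w + \<bar>Im w\<bar> > 0 \<Longrightarrow> N' (Fin w) \<in> D k2"
proof (cases "N' (Fin w) \<in> \<gamma>")
 case True
 assume "norm w < r0" "- Re w + \<bar>Im w\<bar> > 0"
 with near[OF True N(4)] show ?thesis by auto
qed simp

definition sector :: "real \<Rightarrow> complex set" where
 "sector e = {w. norm w < r0 \<and> \<bar>Re w\<bar> < e * Im w}"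

lemma sector_side: "N' ` Fin ` sector e \<subseteq> \<Omega> \<or> N' ` Fin ` sector e \<subseteq> \<Omega>'" if e: "e \<in> {1, -1}"
proof -
 have "sector e = ball 0 r0 \<inter> ({w. Complex 1 (- e) \<bullet> w < 0} \<inter> {w. Complex (-1) (- e) \<bullet> w < 0})"
  by (auto simp: sector_def inner_complex_def)
 then have "convex (sector e)" by (simp only: convex_Int convex_ball convex_halfspace_lt)
 then have "connected (N' ` Fin ` sector e)" by (intro connected_continuous_image continuous_on_Fin continuous_on_PSL2C[OF N(2)] convex_connected)
 moreover have "N' ` Fin ` sector e \<subseteq> - \<gamma>"
 proof clarify
  fix w assume w: "w \<in> sector e" "N' (Fin w) \<in> \<gamma>"
  then have n: "norm w < r0" "\<bar>Re w\<bar> < e * Im w" by (auto simp: sector_def)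
  have "\<bar>Re w\<bar> < \<bar>Im w\<bar>" using n(2) e by auto
  then show False using near[OF w(2) N(4) n(1)] by auto
 qed
 ultimately show ?thesis using components_maximal[OF \<Omega>_component] by blast
qed

text \<open>A sector around the normal is connected and avoids the curve, so it lies on one side.
  The side is coded as a sign to fit the sign conditions of \<open>arc_reflection\<close>.\<close>

definition side :: "real \<Rightarrow> real" where "side e = (if N' ` Fin ` sector e \<subseteq> \<Omega> then 1 else -1)"

lemma side: "side e \<in> {1, -1}" "e \<in> {1, -1} \<Longrightarrow> w \<in> sector e \<Longrightarrow> N' (Fin w) \<in> (if side e = 1 then \<Omega> else \<Omega>')"
 using sector_side[of e] by (auto simp: side_def split: if_splits)

text \<open>At normal points on \<Omega> both extensions agree, at normal points on \<Omega>' they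
  differ by \<open>A\<close>. Each value on \<Omega> is asymptotically mirrored by the value on
  \<Omega>' for both arcs, so the conjugate values on \<Omega>' are moved by \<open>A\<close> over a
  distance tending to 0.\<close>

lemma transition_parabolic:
 obtains A e where "A \<in> PSL2R" "parabolic A" "\<And>x. x \<in> \<Omega>' \<Longrightarrow> g k2 x = A (g k1 x)"
  "e \<in> {1, -1}" "\<And>w. w \<in> sector e \<Longrightarrow> N' (Fin w) \<in> \<Omega>" "\<And>w. w \<in> sector (- e) \<Longrightarrow> N' (Fin w) \<in> \<Omega>'"
proof -
 define r where "r j = (r0 / 2) * (1 / of_nat (Suc j))" for j :: nat
 have r: "0 < r j" "r j < r0" for j
 proof -
  have "1 / real (Suc j) \<le> 1" by simp
  then have "r j \<le> (r0 / 2) * 1" unfolding r_def using r0 by (intro mult_left_mono) auto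
  then show "r j < r0" using r0 by simp
  show "0 < r j" using r0 by (simp add: r_def)
 qed
 have rlim: "r \<longlonglongrightarrow> 0" unfolding r_def[abs_def]
  using tendsto_mult_right_zero[OF LIMSEQ_inverse_real_of_nat, of "r0/2"] by (simp add: inverse_eq_divide)
 have sec: "N' (Fin w) \<in> (if side 1 = 1 then \<Omega> else \<Omega>')" if "norm w < r0" "\<bar>Re w\<bar> < Im w" for w
  by (rule side(2)) (use that in \<open>auto simp: sector_def\<close>)
 have sec': "N' (Fin w) \<in> (if side (-1) = 1 then \<Omega> else \<Omega>')" if "norm w < r0" "\<bar>Re w\<bar> < - Im w" for w
  by (rule side(2)) (use that in \<open>auto simp: sector_def\<close>)
 obtain \<phi>1 where \<phi>1: "side (-1) = - side 1" "strict_mono (\<phi>1 :: nat \<Rightarrow> nat)"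
  "(\<lambda>j. hq (affine (g k1 (N' (Fin (\<i> * of_real (r (\<phi>1 j)))))))
    (cnj (affine (g k1 (N' (Fin (- \<i> * of_real (r (\<phi>1 j))))))))) \<longlonglongrightarrow> 0"
  by (rule arc_reflection[OF k12(1) N k i r0 cone1 tang1 side(1) side(1) sec sec' r rlim]) (assumption | rule that)+
 define neg where "neg = moebius (-1) 0 0 1"
 have neg: "neg \<in> PSL2C" "neg Infty = Infty" "\<And>w. neg (Fin w) = Fin (- w)" "\<And>x. neg (neg x) = x"
 proof -
  show "neg \<in> PSL2C" unfolding neg_def by (rule moebius_PSL2C) simp
  show "neg (neg x) = x" for x by (cases x) (simp_all add: neg_def)
 qed (simp_all add: neg_def)
 define M M' where M: "M x = neg (N x)" "M' x = N' (neg x)" for x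
 have MF: "M' (Fin w) = N' (Fin (- w))" for w by (simp add: M neg)
 \<comment> \<open>The half turn \<open>neg\<close> brings arc \<open>k2\<close> into the position
   of arc \<open>k1\<close> and exchanges the two sectors. It is applied along the subsequence
   already found, so that both limits hold together.\<close>
 obtain \<phi>2 where \<phi>2: "strict_mono (\<phi>2 :: nat \<Rightarrow> nat)"
  "(\<lambda>j. hq (affine (g k2 (M' (Fin (\<i> * of_real (r (\<phi>1 (\<phi>2 j))))))))
    (cnj (affine (g k2 (M' (Fin (- \<i> * of_real (r (\<phi>1 (\<phi>2 j)))))))))) \<longlonglongrightarrow> 0"
 proof (rule arc_reflection[of k2 M M' k i r0 "side (-1)" "side 1" "\<lambda>j. r (\<phi>1 j)"])
  show "M \<in> PSL2C" "M' \<in> PSL2C" using PSL2C_comp[OF neg(1) N(1)] PSL2C_comp[OF N(2) neg(1)] by (simp_all add: M[abs_def] o_def)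
  show "M' (M x) = x" "M (M' x) = x" for x by (simp_all add: M neg N)
  show "M (z k) = Fin 0" "M (z i) = Infty" by (simp_all add: M neg k i)
  show "M' (Fin w) \<in> D k2" if "norm w < r0" "Re w + \<bar>Im w\<bar> > 0" for w unfolding MF by (rule cone2) (use that in auto)
  show "\<exists>\<rho>0>0. \<forall>\<rho>. 0 < \<rho> \<and> \<rho> < \<rho>0 \<longrightarrow> (\<exists>x\<in>edge k2. \<exists>w. M x = Fin w \<and> norm (w - of_real \<rho>) < \<epsilon> * \<rho>)" if "\<epsilon> > 0" for \<epsilon>
  proof -
   from tang2[OF that] obtain \<rho>0 where \<rho>0: "\<rho>0 > 0"
    "\<And>\<rho>. 0 < \<rho> \<and> \<rho> < \<rho>0 \<Longrightarrow> \<exists>x\<in>edge k2. \<exists>w. N x = Fin w \<and> norm (w + of_real \<rho>) < \<epsilon> * \<rho>" by blast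
   show ?thesis
   proof (intro exI[of _ \<rho>0] conjI \<rho>0(1) allI impI)
    fix \<rho> assume "0 < \<rho> \<and> \<rho> < \<rho>0"
    from \<rho>0(2)[OF this] obtain x w where x: "x \<in> edge k2" "N x = Fin w" "norm (w + of_real \<rho>) < \<epsilon> * \<rho>" by blast
    have "- w - of_real \<rho> = - (w + of_real \<rho>)" by simp
    then have "norm (- w - of_real \<rho>) = norm (w + of_real \<rho>)" by (simp only: norm_minus_cancel)
    then have "M x = Fin (- w) \<and> norm (- w - of_real \<rho>) < \<epsilon> * \<rho>" using x by (simp add: M neg)
    then show "\<exists>x\<in>edge k2. \<exists>w. M x = Fin w \<and> norm (w - of_real \<rho>) < \<epsilon> * \<rho>" using x(1) by blast
   qed
  qed
  show "M' (Fin w) \<in> (if side (-1) = 1 then \<Omega> else \<Omega>')" if "norm w < r0" "\<bar>Re w\<bar> < Im w" for w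
   unfolding MF by (rule sec') (use that in auto)
  show "M' (Fin w) \<in> (if side 1 = 1 then \<Omega> else \<Omega>')" if "norm w < r0" "\<bar>Re w\<bar> < - Im w" for w
   unfolding MF by (rule sec) (use that in auto)
  show "(\<lambda>j. r (\<phi>1 j)) \<longlonglongrightarrow> 0" using LIMSEQ_subseq_LIMSEQ[OF rlim \<phi>1(2)] by (simp add: o_def)
 qed (use k12 k i r0 r side(1) that in \<open>assumption | simp\<close>)+
 define e where "e = side 1"
 have e: "e \<in> {1, -1}" unfolding e_def by (rule side(1))
 have \<Omega>e: "N' (Fin w) \<in> \<Omega>" if "w \<in> sector e" for w using side(2)[OF e that] \<phi>1(1) e by (auto simp: e_def)
 have \<Omega>'e: "N' (Fin w) \<in> \<Omega>'" if "w \<in> sector (- e)" for w using side(2)[OF _ that] \<phi>1(1) e by (auto simp: e_def)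
 define \<rho> where "\<rho> j = r (\<phi>1 (\<phi>2 j))" for j
 have \<rho>: "\<rho> j > 0" "\<rho> j < r0" for j using r by (auto simp: \<rho>_def)
 have \<rho>lim: "\<rho> \<longlonglongrightarrow> 0"
  using LIMSEQ_subseq_LIMSEQ[OF LIMSEQ_subseq_LIMSEQ[OF rlim \<phi>1(2)] \<phi>2(1)] by (simp add: o_def \<rho>_def[abs_def])
 \<comment> \<open>Points on the normal at distance \<open>\<rho> j\<close>; the sign
   \<open>e\<close> puts \<open>P\<close> on \<Omega> and \<open>P'\<close> on \<Omega>'.\<close>
 define P where "P j = N' (Fin (of_real e * (\<i> * of_real (\<rho> j))))" for j
 define P' where "P' j = N' (Fin (of_real (- e) * (\<i> * of_real (\<rho> j))))" for j
 have PO: "P j \<in> \<Omega>" "P' j \<in> \<Omega>'" for j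
  unfolding P_def P'_def by (rule \<Omega>e \<Omega>'e; use \<rho>[of j] e in \<open>auto simp: sector_def norm_mult\<close>)+
 have l1: "(\<lambda>j. hq (affine (g k1 (P j))) (cnj (affine (g k1 (P' j))))) \<longlonglongrightarrow> 0"
 proof -
  have l: "(\<lambda>j. hq (affine (g k1 (N' (Fin (\<i> * of_real (\<rho> j)))))) (cnj (affine (g k1 (N' (Fin (- \<i> * of_real (\<rho> j)))))))) \<longlonglongrightarrow> 0"
   using LIMSEQ_subseq_LIMSEQ[OF \<phi>1(3) \<phi>2(1)] by (simp add: o_def \<rho>_def)
  consider "e = 1" | "e = -1" using e by blast
  then show ?thesis
  proof cases
   case 1 then show ?thesis using l by (simp add: P_def P'_def)
  next
   case 2
   show ?thesis by (subst hq_cnj_commute) (use l 2 in \<open>simp add: P_def P'_def\<close>)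
  qed
 qed
 have l2: "(\<lambda>j. hq (affine (g k2 (P j))) (cnj (affine (g k2 (P' j))))) \<longlonglongrightarrow> 0"
 proof -
  have l: "(\<lambda>j. hq (affine (g k2 (N' (Fin (- (\<i> * of_real (\<rho> j))))))) (cnj (affine (g k2 (N' (Fin (\<i> * of_real (\<rho> j)))))))) \<longlonglongrightarrow> 0"
   using \<phi>2(2) by (simp add: MF \<rho>_def)
  consider "e = 1" | "e = -1" using e by blast
  then show ?thesis
  proof cases
   case 1
   show ?thesis by (subst hq_cnj_commute) (use l 1 in \<open>simp add: P_def P'_def\<close>)
  next
   case 2 then show ?thesis using l by (simp add: P_def P'_def)
  qed
 qed
 obtain A where A: "A \<in> PSL2R" "\<And>x. x \<in> \<Omega>' \<Longrightarrow> g k2 x = A (g k1 x)"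
  by (rule g_transition_\<Omega>'[OF k12(2,1)]) (rule that)
 define a where "a j = affine (g k1 (P j))" for j
 define b where "b j = affine (g k1 (P' j))" for j
 have a: "g k1 (P j) = Fin (a j)" "Im (a j) > 0" for j
 proof -
  have "g k1 (P j) \<in> upper_half" using g_\<Omega>[OF k12(1)] PO(1) by blast
  then show "g k1 (P j) = Fin (a j)" "Im (a j) > 0" by (auto simp: a_def upper_half_def)
 qed
 have b: "g k1 (P' j) = Fin (b j)" "Im (b j) < 0" for j
 proof -
  have "g k1 (P' j) \<in> lower_half" using g_\<Omega>'[OF k12(1)] PO(2) by blast
  then show "g k1 (P' j) = Fin (b j)" "Im (b j) < 0" by (auto simp: b_def lower_half_def)
 qed
 have b2: "cnj (affine (g k2 (P' j))) = act A (cnj (b j))" for j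
 proof -
  have "affine (g k2 (P' j)) = act A (b j)" by (simp add: A(2)[OF PO(2)] b(1) act_def)
  then show ?thesis using PSL2R_act_cnj[OF A(1), of "b j"] b(2)[of j] by simp
 qed
 have a2: "affine (g k2 (P j)) = a j" for j using g_eq_on_\<Omega>[OF k12(2,1) PO(1)] by (simp add: a_def)
 have I: "Im (cnj (b j)) > 0" "Im (act A (cnj (b j))) > 0" for j
  using PSL2R_act(2)[OF A(1), of "cnj (b j)"] b(2)[of j] by (auto simp: mult_less_0_iff)
 have l1': "(\<lambda>j. hq (cnj (b j)) (a j)) \<longlonglongrightarrow> 0" using l1 by (subst hq_commute) (simp add: a_def b_def)
 have l2': "(\<lambda>j. hq (a j) (act A (cnj (b j)))) \<longlonglongrightarrow> 0" using l2 by (simp only: a2 b2)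
 have disp: "(\<lambda>j. hq (cnj (b j)) (act A (cnj (b j)))) \<longlonglongrightarrow> 0" by (rule hq_null_trans[OF I(1) a(2) I(2) l1' l2'])
 \<comment> \<open>A limit inside the half-plane would give, through the inverse of
   \<open>g k1\<close>, a limit of \<open>P'\<close> inside \<Omega>'; but \<open>P'\<close> tends
   to the marked point on the curve.\<close>
 have leave: "\<not> (\<lambda>j. cnj (b j)) \<longlonglongrightarrow> w" if w: "Im w > 0" for w
 proof
  assume "(\<lambda>j. cnj (b j)) \<longlonglongrightarrow> w"
  from tendsto_cnj[OF this] have bl: "b \<longlonglongrightarrow> cnj w" by simp
  let ?inv = "inv_into \<Omega>' (g k1)"
  have cm: "conformal_map ?inv lower_half \<Omega>'" by (rule conformal_map_inverse(3)[OF g_conformal_sides(2)[OF k12(1)]])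
  have cw: "Fin (cnj w) \<in> lower_half" using w by simp
  have il: "?inv (Fin (cnj w)) \<in> \<Omega>'" using cm cw by (auto simp: conformal_simps)
  have ci: "continuous_on lower_half ?inv" using cm holomorphic_sphere_continuous by (auto simp: conformal_map_def)
  have "isCont ?inv (Fin (cnj w))" using ci cw open_lower_half continuous_on_eq_continuous_at by blast
  moreover have "isCont Fin (cnj w)" using continuous_on_Fin[of UNIV] continuous_on_eq_continuous_at[of UNIV Fin] by simp
  ultimately have "(\<lambda>j. ?inv (Fin (b j))) \<longlonglongrightarrow> ?inv (Fin (cnj w))"
   by (intro isCont_tendsto_compose[OF _ isCont_tendsto_compose[OF _ bl]])
  moreover have "?inv (Fin (b j)) = P' j" for j unfolding b(1)[symmetric] by (rule inv_into_f_f[OF inj_on_subset[OF g_inj[OF k12(1)]] PO(2)]) auto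
  ultimately have "P' \<longlonglongrightarrow> ?inv (Fin (cnj w))" by simp
  moreover have "P' \<longlonglongrightarrow> z k"
  proof -
   have "(\<lambda>j. of_real (- e) * (\<i> * of_real (\<rho> j))) \<longlonglongrightarrow> of_real (- e) * (\<i> * of_real 0 :: complex)"
    by (intro tendsto_intros \<rho>lim)
   then have z0: "(\<lambda>j. of_real (- e) * (\<i> * of_real (\<rho> j)) :: complex) \<longlonglongrightarrow> 0" by simp
   have "isCont N' (Fin 0)" using continuous_on_PSL2C[OF N(2), of UNIV] continuous_on_eq_continuous_at[of UNIV N'] by simp
   moreover have "isCont Fin 0" using continuous_on_Fin[of UNIV] continuous_on_eq_continuous_at[of UNIV Fin] by simp
   ultimately have "P' \<longlonglongrightarrow> N' (Fin 0)" unfolding P'_def[abs_def]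
    by (intro isCont_tendsto_compose[OF _ isCont_tendsto_compose[OF _ z0]])
   then show ?thesis using N(3)[of "z k"] k(2) by simp
  qed
  ultimately have "z k \<in> \<Omega>'" using LIMSEQ_unique il by metis
  then show False using z_in_curve k(1) by blast
 qed
 obtain a' b' c' d' :: real where A': "A = moebius (of_real a') (of_real b') (of_real c') (of_real d')"
  "a' * d' - b' * c' = 1" "(a' + d')\<^sup>2 = 4" by (rule parabolic_of_displacement[OF A(1) I(1) disp leave]) (assumption | rule that)+
 have "of_real a' * of_real d' - of_real b' * of_real c' = (of_real (a' * d' - b' * c') :: complex)"
  "(of_real a' + of_real d')\<^sup>2 = (of_real ((a' + d')\<^sup>2) :: complex)" by simp_all
 then have "of_real a' * of_real d' - of_real b' * of_real c' = (1 :: complex)"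
  "(of_real a' + of_real d')\<^sup>2 = (4 :: complex)" unfolding A'(2,3) by simp_all
 then have "parabolic A" unfolding parabolic_def A'(1) by blast
 then show ?thesis using that[of A e] A e \<Omega>e \<Omega>'e by blast
qed

end

text \<open>On a connected piece over one chart domain the chart itself is a development, so
  uniqueness replaces local coefficients by a single one.\<close>

lemma (in sphere_atlas) devel_on_chart:
 assumes X: "spread X p" and V: "open_in X V" "connected V" and h: "devel X p h" and k: "k \<in> K" "p ` V \<subseteq> D k"
 obtains C where "C \<in> PSL2R" "\<And>y. y \<in> V \<Longrightarrow> h y = C (g k (p y))"
proof (rule devel_unique[OF spread_open_subset[OF X V(1)] V(2) _ devel_open_subset[OF X V(1) h]])
 show "devel V p (\<lambda>y. g k (p y))" unfolding devel_def local_devel_def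
  using k id_PSL2R by (intro ballI exI[of _ V] conjI bexI[of _ k] bexI[of _ id]) auto
qed (rule that)

section \<open>The holonomy around a puncture\<close>

context geodesic_corner
begin

definition left_half :: "complex set" where "left_half = {\<zeta>. Re \<zeta> < 0}"

lemma left_half: "open left_half" "convex left_half" "simply_connected left_half" "\<zeta> \<in> left_half \<Longrightarrow> norm (exp \<zeta>) < 1"
 by (auto simp: left_half_def open_halfspace_Re_lt convex_halfspace_Re_lt convex_imp_simply_connected)

text \<open>The half-plane unrolls the punctured disc; a loop around the puncture becomes a path
  whose ends differ by a multiple of \<open>2 * pi * \<i>\<close>.\<close>

definition exp_chart :: "(complex \<Rightarrow> complex) \<Rightarrow> complex \<Rightarrow> riemann_sphere" where
 "exp_chart \<Phi> \<zeta> = N' (Fin (\<Phi> (exp \<zeta>)))"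

lemma exp_chart_period: "exp_chart \<Phi> (\<zeta> + of_int m * (2 * of_real pi * \<i>)) = exp_chart \<Phi> \<zeta>"
proof -
 have "exp (\<zeta> + of_int m * (2 * of_real pi * \<i>)) = exp \<zeta>" unfolding exp_eq by (intro exI[of _ m]) simp
 then show ?thesis by (simp add: exp_chart_def)
qed

lemma spread_exp_chart:
 assumes \<Phi>: "\<Phi> holomorphic_on ball 0 1" "inj_on \<Phi> (ball 0 1)" shows "spread left_half (exp_chart \<Phi>)" unfolding spread_def
proof
 fix \<zeta> assume \<zeta>: "\<zeta> \<in> left_half"
 then obtain e where e: "e > 0" "ball \<zeta> e \<subseteq> left_half" using left_half(1) by (meson open_contains_ball)
 \<comment> \<open>In a disc of radius 1 the imaginary parts differ by less than 2, which is below
   \<open>2 * pi\<close>, so exp is injective there.\<close>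
 define V where "V = ball \<zeta> (min e 1)"
 have V: "open V" "\<zeta> \<in> V" "V \<subseteq> left_half" using e by (auto simp: V_def)
 have hol: "(\<lambda>\<zeta>. \<Phi> (exp \<zeta>)) holomorphic_on left_half"
  by (rule holomorphic_on_compose_gen[OF holomorphic_on_exp \<Phi>(1), unfolded o_def]) (use left_half(4) in auto)
 have inj: "inj_on (\<lambda>\<zeta>. \<Phi> (exp \<zeta>)) V"
 proof (rule inj_onI)
  fix a b assume ab: "a \<in> V" "b \<in> V" "\<Phi> (exp a) = \<Phi> (exp b)"
  have "exp a \<in> ball 0 1" "exp b \<in> ball 0 1" using left_half(4)[of a] left_half(4)[of b] V(3) ab(1,2) by auto
  then have "exp a = exp b" using inj_onD[OF \<Phi>(2) ab(3)] by blast
  moreover have "\<bar>Im a - Im b\<bar> < 2 * pi"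
  proof -
   have "dist a b < 1 + 1" using dist_triangle_less_add[of a \<zeta> 1 b 1] ab by (auto simp: V_def dist_commute)
   then have "\<bar>Im (a - b)\<bar> < 2" using abs_Im_le_cmod[of "a - b"] by (simp add: dist_norm)
   then show ?thesis using pi_gt3 by simp
  qed
  ultimately show "a = b" by (rule exp_complex_eqI[rotated])
 qed
 have img: "open (exp_chart \<Phi> ` U)" if U: "open U" "U \<subseteq> V" for U
 proof -
  have "open ((\<lambda>\<zeta>. \<Phi> (exp \<zeta>)) ` U)"
   by (rule open_mapping_thm3[OF holomorphic_on_subset[OF hol] U(1) inj_on_subset[OF inj U(2)]]) (use U V in blast)
  then have "open (N' ` Fin ` (\<lambda>\<zeta>. \<Phi> (exp \<zeta>)) ` U)" by (intro open_image_PSL2C N(2)) (simp add: open_Fin_image_iff)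
  then show ?thesis by (simp add: exp_chart_def[abs_def] image_image)
 qed
 have cont: "continuous_on V (exp_chart \<Phi>)" unfolding exp_chart_def[abs_def]
  by (rule continuous_on_compose2[OF continuous_on_PSL2C[OF N(2), of UNIV]
     continuous_on_compose2[OF continuous_on_Fin[of UNIV] holomorphic_on_imp_continuous_on[OF holomorphic_on_subset[OF hol V(3)]]]]) auto
 have injp: "inj_on (exp_chart \<Phi>) V"
 proof (rule inj_onI)
  fix a b assume ab: "a \<in> V" "b \<in> V" "exp_chart \<Phi> a = exp_chart \<Phi> b"
  then have "Fin (\<Phi> (exp a)) = Fin (\<Phi> (exp b))" unfolding exp_chart_def using N(4) by metis
  then show "a = b" using inj_onD[OF inj _ ab(1,2)] by simp
 qed
 obtain q where q: "homeomorphism V (exp_chart \<Phi> ` V) (exp_chart \<Phi>) q"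
 proof (rule homeomorphism_injective_open_map[OF cont refl injp])
  fix U assume U: "open_in V U"
  then have oU: "open U" "U \<subseteq> V" using V(1) openin_open_trans openin_imp_subset by blast+
  show "open_in (exp_chart \<Phi> ` V) (exp_chart \<Phi> ` U)" by (rule open_subset[OF image_mono[OF oU(2)] img[OF oU]])
 qed (rule that)
 show "\<exists>V. open_in left_half V \<and> \<zeta> \<in> V \<and> open (exp_chart \<Phi> ` V) \<and>
   (\<exists>q. homeomorphism V (exp_chart \<Phi> ` V) (exp_chart \<Phi>) q)"
  by (intro exI[of _ V] conjI exI[of _ q] q V(2) img V(1) subset_refl open_subset V(3))
qed

text \<open>Far to the left, the strips about heights 0 and \<open>e * pi\<close> lie over
  \<open>D k1\<close> and \<open>D k2\<close>. Passing from one to the other through \<Omega> keeps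
  the coefficient; closing the turn through \<Omega>' introduces \<open>A\<close>. So a full turn
  acts as a conjugate of \<open>A\<close>, and other multiples as its powers.\<close>

lemma puncture_monodromy:
 assumes \<Phi>: "\<Phi> holomorphic_on ball 0 1" "inj_on \<Phi> (ball 0 1)" "\<Phi> 0 = 0"
  and c0: "c0 > 0" "(\<Phi> has_field_derivative of_real c0) (at 0)" and F: "devel left_half (exp_chart \<Phi>) F"
 obtains E where "parabolic E" "\<And>\<zeta>. \<zeta> \<in> left_half \<Longrightarrow> F (\<zeta> + of_int m * (2 * of_real pi * \<i>)) = E (F \<zeta>)"
proof -
 let ?p = "exp_chart \<Phi>" and ?L = left_half
 have sp: "spread ?L ?p" by (rule spread_exp_chart[OF \<Phi>(1,2)])
 have conL: "connected ?L" using left_half(2) convex_connected by blast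
 obtain A e where A: "A \<in> PSL2R" "parabolic A" "\<And>x. x \<in> \<Omega>' \<Longrightarrow> g k2 x = A (g k1 x)"
  and e: "e \<in> {1, -1}" "\<And>w. w \<in> sector e \<Longrightarrow> N' (Fin w) \<in> \<Omega>" "\<And>w. w \<in> sector (- e) \<Longrightarrow> N' (Fin w) \<in> \<Omega>'"
  by (rule transition_parabolic) (rule that)
 have e': "- e \<in> {1, -1}" using e(1) by auto
 obtain \<delta> where \<delta>: "\<delta> > 0" "\<And>w. norm w < \<delta> \<Longrightarrow> norm (\<Phi> w - of_real c0 * w) \<le> (1/10) * norm (of_real c0 * w)"
  by (rule derivative_remainder[OF c0(2) \<Phi>(3) c0(1)]) (rule that)
 \<comment> \<open>Below \<open>r0 / (2 * c0)\<close> the linear model is under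
   \<open>r0 / 2\<close>, and a ten percent error keeps \<Phi> under \<open>r0\<close>.\<close>
 define \<mu> where "\<mu> = min \<delta> (r0 / (2 * c0))"
 have \<mu>: "\<mu> > 0" using \<delta>(1) r0 c0 by (simp add: \<mu>_def)
 define R where "R = max 0 (- ln \<mu>)"
 have small: "norm (\<Phi> (exp \<zeta>) - of_real c0 * exp \<zeta>) \<le> (1/10) * norm (of_real c0 * exp \<zeta>)" "norm (\<Phi> (exp \<zeta>)) < r0"
  if "Re \<zeta> < - R" for \<zeta>
 proof -
  have "Re \<zeta> < ln \<mu>" using that by (simp add: R_def)
  then have "exp (Re \<zeta>) < \<mu>" using \<mu> by (metis exp_less_mono exp_ln)
  then have ex: "norm (exp \<zeta>) < \<delta>" "norm (exp \<zeta>) < r0 / (2 * c0)" by (auto simp: \<mu>_def)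
  show 1: "norm (\<Phi> (exp \<zeta>) - of_real c0 * exp \<zeta>) \<le> (1/10) * norm (of_real c0 * exp \<zeta>)" by (rule \<delta>(2)[OF ex(1)])
  have nc: "norm (of_real c0 * exp \<zeta>) < r0 / 2" using ex(2) c0(1) by (simp add: norm_mult field_simps)
  have "norm (\<Phi> (exp \<zeta>)) \<le> norm (\<Phi> (exp \<zeta>) - of_real c0 * exp \<zeta>) + norm (of_real c0 * exp \<zeta>)"
   using norm_triangle_ineq[of "\<Phi> (exp \<zeta>) - of_real c0 * exp \<zeta>" "of_real c0 * exp \<zeta>"] by simp
  then show "norm (\<Phi> (exp \<zeta>)) < r0" using 1 nc r0 by linarith
 qed
 define strip where "strip y = {\<zeta>. Re \<zeta> < - R \<and> \<bar>Im \<zeta> - y\<bar> < 2 * pi / 3}" for y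
 have RL: "\<zeta> \<in> ?L" if "Re \<zeta> < - R" for \<zeta> using that by (simp add: left_half_def R_def)
 have strip: "strip y \<subseteq> ?L" "open (strip y)" "connected (strip y)" for y
 proof -
  show "strip y \<subseteq> ?L" using RL by (auto simp: strip_def)
  have eq: "strip y = {\<zeta>. Re \<zeta> < - R} \<inter> ({\<zeta>. Im \<zeta> < y + 2 * pi / 3} \<inter> {\<zeta>. Im \<zeta> > y - 2 * pi / 3})"
   unfolding strip_def abs_diff_less_iff by auto
  show "open (strip y)" unfolding eq by (intro open_Int open_halfspace_Re_lt open_halfspace_Im_lt open_halfspace_Im_gt)
  show "connected (strip y)" unfolding eq
   by (intro convex_connected convex_Int convex_halfspace_Re_lt convex_halfspace_Im_lt convex_halfspace_Im_gt)
 qed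
 have oin: "open_in ?L (strip y)" for y by (rule open_subset[OF strip(1,2)])
 let ?y = "e * pi"
 have D1: "?p ` strip 0 \<subseteq> D k1"
 proof (rule image_subsetI)
  fix \<zeta> assume "\<zeta> \<in> strip 0"
  then have z: "Re \<zeta> < - R" "\<bar>Im \<zeta>\<bar> < 2 * pi / 3" by (auto simp: strip_def)
  show "?p \<zeta> \<in> D k1" unfolding exp_chart_def by (rule cone1[OF small(2)[OF z(1)] near_exp_cone[OF z(2) small(1)[OF z(1)] c0(1)]])
 qed
 have D2: "?p ` strip ?y \<subseteq> D k2"
 proof (rule image_subsetI)
  fix \<zeta> assume "\<zeta> \<in> strip ?y"
  then have z: "Re \<zeta> < - R" "\<bar>Im (\<zeta> - \<i> * of_real ?y)\<bar> < 2 * pi / 3" by (auto simp: strip_def)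
  \<comment> \<open>A half turn changes the sign of the model value, which reduces the cone of arc
    \<open>k2\<close> to the estimate for arc \<open>k1\<close>.\<close>
  have "exp (\<i> * of_real ?y) = (-1 :: complex)" using e(1) by (auto simp: exp_minus cis_conv_exp[symmetric])
  then have ex: "exp (\<zeta> - \<i> * of_real ?y) = - exp \<zeta>" by (simp add: exp_diff)
  have "norm (- \<Phi> (exp \<zeta>) - of_real c0 * exp (\<zeta> - \<i> * of_real ?y)) = norm (\<Phi> (exp \<zeta>) - of_real c0 * exp \<zeta>)"
   unfolding ex by (simp add: norm_minus_commute)
  then have "norm (- \<Phi> (exp \<zeta>) - of_real c0 * exp (\<zeta> - \<i> * of_real ?y)) \<le> (1/10) * norm (of_real c0 * exp (\<zeta> - \<i> * of_real ?y))"
   using small(1)[OF z(1)] unfolding ex by (simp add: norm_mult)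
  from near_exp_cone[OF z(2) this c0(1)]
  have "- Re (\<Phi> (exp \<zeta>)) + \<bar>Im (\<Phi> (exp \<zeta>))\<bar> > 0" by simp
  then show "?p \<zeta> \<in> D k2" unfolding exp_chart_def by (rule cone2[OF small(2)[OF z(1)]])
 qed
 obtain C1 where C1: "C1 \<in> PSL2R" "\<And>\<zeta>. \<zeta> \<in> strip 0 \<Longrightarrow> F \<zeta> = C1 (g k1 (?p \<zeta>))"
  by (rule devel_on_chart[OF sp oin strip(3) F k12(1) D1]) (rule that)
 obtain C2 where C2: "C2 \<in> PSL2R" "\<And>\<zeta>. \<zeta> \<in> strip ?y \<Longrightarrow> F \<zeta> = C2 (g k2 (?p \<zeta>))"
  by (rule devel_on_chart[OF sp oin strip(3) F k12(2) D2]) (rule that)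
 have sec: "?p (Complex (- R - 1) (e' * (pi / 2))) \<in> N' ` Fin ` sector e'" if "e' \<in> {1, -1}" for e'
 proof -
  let ?\<zeta> = "Complex (- R - 1) (e' * (pi / 2))"
  have z: "Re ?\<zeta> < - R" "Im ?\<zeta> = e' * (pi / 2)" by auto
  have "\<Phi> (exp ?\<zeta>) \<in> sector e'" unfolding sector_def
   using small(2)[OF z(1)] near_exp_sector[OF z(2) that small(1)[OF z(1)] c0(1)] by simp
  then show ?thesis unfolding exp_chart_def by blast
 qed
 \<comment> \<open>The overlap of the two strips contains points over \<Omega>, where the extensions
   coincide; rigidity makes the coefficients equal.\<close>
 have C12: "C1 = C2"
 proof (rule rigid[OF k12(1), of _ _ "?p ` (strip 0 \<inter> strip ?y) \<inter> \<Omega>"])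
  show "C1 \<in> PSL2C" "C2 \<in> PSL2C" using C1 C2 PSL2R_subset_PSL2C by auto
  show "open (?p ` (strip 0 \<inter> strip ?y) \<inter> \<Omega>)" by (intro open_Int open_side spread_open_map[OF sp] openin_Int oin)
  show "?p ` (strip 0 \<inter> strip ?y) \<inter> \<Omega> \<noteq> {}"
  proof -
   let ?\<zeta> = "Complex (- R - 1) (e * (pi / 2))"
   have "?\<zeta> \<in> strip 0 \<inter> strip ?y" using e(1) pi_gt_zero by (auto simp: strip_def)
   moreover have "?p ?\<zeta> \<in> \<Omega>" using sec[OF e(1)] e(2) by auto
   ultimately show ?thesis by blast
  qed
  show "?p ` (strip 0 \<inter> strip ?y) \<inter> \<Omega> \<subseteq> D k1" using D1 by blast
  fix x assume x: "x \<in> ?p ` (strip 0 \<inter> strip ?y) \<inter> \<Omega>"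
  then obtain \<zeta> where \<zeta>: "\<zeta> \<in> strip 0" "\<zeta> \<in> strip ?y" "x = ?p \<zeta>" by blast
  have "g k1 x = g k2 x" using g_eq_on_\<Omega>[OF k12] x by blast
  then show "C1 (g k1 x) = C2 (g k1 x)" using C1(2)[OF \<zeta>(1)] C2(2)[OF \<zeta>(2)] \<zeta>(3) by simp
 qed
 define \<tau> :: complex where "\<tau> = 2 * of_real pi * \<i>"
 have \<tau>L: "\<zeta> + of_int m * \<tau> \<in> ?L \<longleftrightarrow> \<zeta> \<in> ?L" for \<zeta> m by (simp add: left_half_def \<tau>_def)
 obtain ei :: int where ei: "e = of_int ei" using e(1) by (metis insertE of_int_1 of_int_minus singletonD)
 have eii: "ei * ei = 1"
 proof -
  have "of_int (ei * ei) = (1::real)" using e(1) unfolding of_int_mult ei[symmetric] by auto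
  then show ?thesis by linarith
 qed
 have per: "?p (\<zeta> + of_int m * \<tau>) = ?p \<zeta>" for \<zeta> m unfolding \<tau>_def by (rule exp_chart_period)
 have "devel ?L ?p (\<lambda>\<zeta>. F (\<zeta> + of_int ei * \<tau>))"
  by (rule devel_deck[OF F]) (use \<tau>L per in \<open>auto intro!: continuous_intros\<close>)
 then obtain E0 where E0: "E0 \<in> PSL2R" "\<And>\<zeta>. \<zeta> \<in> ?L \<Longrightarrow> F (\<zeta> + of_int ei * \<tau>) = E0 (F \<zeta>)"
  by (rule devel_unique[OF sp conL F]) (rule that)
 have C1C: "C1 \<in> PSL2C" "A \<in> PSL2C" "E0 \<in> PSL2C" using C1 A E0 PSL2R_subset_PSL2C by auto
 \<comment> \<open>A point at height \<open>- e * pi / 2\<close> moves by the full turn to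
   \<open>3 * e * pi / 2\<close>, which is still in the strip about \<open>e * pi\<close>. These
   points lie over \<Omega>', where \<open>A\<close> enters.\<close>
 define V2 where "V2 = strip 0 \<inter> (\<lambda>\<zeta>. \<zeta> + of_int ei * \<tau>) -` strip ?y"
 have oV2: "open_in ?L V2"
 proof (rule open_subset)
  show "V2 \<subseteq> ?L" using strip(1) by (auto simp: V2_def)
  have "continuous_on UNIV (\<lambda>\<zeta>. \<zeta> + of_int ei * \<tau>)" by (intro continuous_intros)
  then show "open V2" unfolding V2_def by (intro open_Int strip(2) open_vimage)
 qed
 have "E0 \<circ> C1 = C1 \<circ> A"
 proof (rule rigid[OF k12(1), of _ _ "?p ` V2 \<inter> \<Omega>'"])
  show "E0 \<circ> C1 \<in> PSL2C" "C1 \<circ> A \<in> PSL2C" using C1C PSL2C_comp by auto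
  show "open (?p ` V2 \<inter> \<Omega>')" by (intro open_Int open_side' spread_open_map[OF sp oV2])
  show "?p ` V2 \<inter> \<Omega>' \<noteq> {}"
  proof -
   let ?\<zeta> = "Complex (- R - 1) (- e * (pi / 2))"
   have im: "Im (of_int ei * \<tau>) = 2 * pi * e" "Re (of_int ei * \<tau>) = 0" by (simp_all add: \<tau>_def ei)
   have "?\<zeta> \<in> V2" using e(1) pi_gt_zero im by (auto simp: V2_def strip_def)
   moreover have "?p ?\<zeta> \<in> \<Omega>'" using sec[OF e'] e(3) by auto
   ultimately show ?thesis by blast
  qed
  show "?p ` V2 \<inter> \<Omega>' \<subseteq> D k1" using D1 by (auto simp: V2_def)
  fix x assume x: "x \<in> ?p ` V2 \<inter> \<Omega>'"
  then obtain \<zeta> where \<zeta>: "\<zeta> \<in> V2" "x = ?p \<zeta>" by blast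
  have z: "\<zeta> \<in> strip 0" "\<zeta> + of_int ei * \<tau> \<in> strip ?y" "\<zeta> \<in> ?L" using \<zeta>(1) strip(1) by (auto simp: V2_def)
  have "E0 (C1 (g k1 x)) = F (\<zeta> + of_int ei * \<tau>)" using E0(2)[OF z(3)] C1(2)[OF z(1)] \<zeta>(2) by simp
  also have "\<dots> = C1 (g k2 x)" using C2(2)[OF z(2)] \<zeta>(2) unfolding per C12 by simp
  also have "\<dots> = C1 (A (g k1 x))" using A(3) x by auto
  finally show "(E0 \<circ> C1) (g k1 x) = (C1 \<circ> A) (g k1 x)" by simp
 qed
 then have "C1 (A x) = E0 (C1 x)" for x by (metis comp_apply)
 then have parE: "parabolic E0" by (rule parabolic_conj[OF A(2) C1C(1)])
 obtain P :: "int \<Rightarrow> riemann_sphere \<Rightarrow> riemann_sphere" where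
  P: "P 0 = id" "\<And>m x. P (m + 1) x = E0 (P m x)" "\<And>m. parabolic (P m)" by (rule parabolic_one_parameter[OF parE]) (rule that)
 \<comment> \<open>\<open>E0\<close> belongs to the translation by \<open>ei * \<tau>\<close>, so
   powers are counted in multiples of \<open>ei\<close>; injectivity of \<open>E0\<close> drives the
   downward induction. Finally \<open>ei * ei = 1\<close> recovers every \<open>m\<close>.\<close>
 have FP: "F (\<zeta> + of_int (l * ei) * \<tau>) = P l (F \<zeta>)" if "\<zeta> \<in> ?L" for \<zeta> l
 proof (induction l rule: int_induct[of _ 0])
  case base
  then show ?case by (simp add: P(1))
 next
  case (step1 l)
  have "F ((\<zeta> + of_int (l * ei) * \<tau>) + of_int ei * \<tau>) = E0 (F (\<zeta> + of_int (l * ei) * \<tau>))"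
   by (rule E0(2)) (simp only: \<tau>L that)
  moreover have "(\<zeta> + of_int (l * ei) * \<tau>) + of_int ei * \<tau> = \<zeta> + of_int ((l + 1) * ei) * \<tau>" by (simp add: algebra_simps)
  ultimately have "F (\<zeta> + of_int ((l + 1) * ei) * \<tau>) = E0 (F (\<zeta> + of_int (l * ei) * \<tau>))" by (simp only:)
  then show ?case by (simp only: step1(2) P(2))
 next
  case (step2 l)
  have "F ((\<zeta> + of_int ((l - 1) * ei) * \<tau>) + of_int ei * \<tau>) = E0 (F (\<zeta> + of_int ((l - 1) * ei) * \<tau>))"
   by (rule E0(2)) (simp only: \<tau>L that)
  moreover have "(\<zeta> + of_int ((l - 1) * ei) * \<tau>) + of_int ei * \<tau> = \<zeta> + of_int (l * ei) * \<tau>" by (simp add: algebra_simps)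
  ultimately have "E0 (F (\<zeta> + of_int ((l - 1) * ei) * \<tau>)) = F (\<zeta> + of_int (l * ei) * \<tau>)" by (simp only:)
  also have "\<dots> = P l (F \<zeta>)" by (rule step2(2))
  also have "P l (F \<zeta>) = E0 (P (l - 1) (F \<zeta>))" using P(2)[of "l - 1"] by simp
  finally show ?case using PSL2C_inj[OF C1C(3), of UNIV] by (metis UNIV_I inj_onD)
 qed
 show ?thesis
 proof (rule that[of "P (m * ei)"])
  show "parabolic (P (m * ei))" by (rule P(3))
  show "F (\<zeta> + of_int m * (2 * of_real pi * \<i>)) = P (m * ei) (F \<zeta>)" if "\<zeta> \<in> left_half" for \<zeta>
   using FP[OF that, of "m * ei"] eii by (simp add: \<tau>_def mult.assoc)
 qed
qed

end

section \<open>Loops around a puncture\<close>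

lemma closure_outside_sphere:
 fixes O' :: "complex set"
 assumes "connected O'" "\<not> bounded O'" shows "connected (insert Infty (Fin ` O'))"
proof (rule connected_intermediate_closure)
 show "connected (Fin ` O')" by (intro connected_continuous_image continuous_on_Fin assms(1))
 have "Infty \<in> closure (Fin ` O')" unfolding closure_iff_nhds_not_empty
 proof (intro allI impI)
  fix A U :: "riemann_sphere set" assume U: "U \<subseteq> A" "open U" "Infty \<in> U"
  then have "compact (- (Fin -` U))" by (simp add: open_riemann_sphere_def)
  then have "\<not> O' \<subseteq> - (Fin -` U)" using assms(2) bounded_subset compact_imp_bounded by blast
  then show "Fin ` O' \<inter> A \<noteq> {}" using U(1) by blast
 qed
 then show "insert Infty (Fin ` O') \<subseteq> closure (Fin ` O')" by (simp add: closure_subset)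
qed auto

context geodesic_corner
begin

text \<open>In the coordinate \<open>N\<close> another marked point sits at Infty, so the side of
  the loop that contains only \<open>z k\<close> is the bounded one. A slightly larger disc still
  omits the other marked points and contains the loop itself.\<close>

lemma loop_disc:
 assumes c: "simple_loop_around n z k c"
 obtains \<Phi> \<Psi> c0 where "\<Phi> holomorphic_on ball 0 1" "inj_on \<Phi> (ball 0 1)" "\<Phi> 0 = 0"
  "c0 > 0" "(\<Phi> has_field_derivative of_real c0) (at 0)"
  "\<And>w. w \<in> ball 0 1 \<Longrightarrow> w \<noteq> 0 \<Longrightarrow> N' (Fin (\<Phi> w)) \<in> S"
  "path (\<lambda>s. \<Psi> (c s))" "\<And>s. s \<in> {0..1} \<Longrightarrow> \<Psi> (c s) \<in> ball 0 1 \<and> N' (Fin (\<Phi> (\<Psi> (c s)))) = c s"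
proof -
 have sc: "simple_path c" "pathfinish c = pathstart c" "path_image c \<subseteq> S" using c by (auto simp: simple_loop_around_def)
 obtain C where C: "C \<in> components (- path_image c)" "C \<inter> z ` {1..n} = {z k}" using c unfolding simple_loop_around_def by blast
 have cpt: "x \<noteq> z i \<and> x \<noteq> z k" if "x \<in> path_image c" for x using sc(3) that i(1) k(1) by blast
 have zik: "z i \<noteq> z k" using i(2) k(2) by auto
 define N0 where "N0 x = affine (N x)" for x
 have NF: "N x = Fin (N0 x)" if "x \<in> path_image c" for x
 proof -
  have "N x \<noteq> Infty" using cpt[OF that] N(3) i(2) by metis
  then show ?thesis by (simp add: N0_def Fin_affine)
 qed
 have NF': "N' (Fin (N0 x)) = x" if "x \<in> path_image c" for x using NF[OF that] N(3) by metis
 have N0c: "continuous_on (path_image c) N0"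
 proof -
  have "Infty \<notin> N ` path_image c" using NF by auto
  then show ?thesis unfolding N0_def[abs_def] by (rule continuous_on_compose2[OF continuous_on_affine continuous_on_PSL2C[OF N(1)]]) simp
 qed
 have N0inj: "inj_on N0 (path_image c)" by (rule inj_on_inverseI[of _ "\<lambda>w. N' (Fin w)"]) (rule NF')
 define c' where "c' = N0 \<circ> c"
 have c': "simple_path c'" "pathfinish c' = pathstart c'" "path_image c' = N0 ` path_image c"
  unfolding c'_def using simple_path_continuous_image[OF sc(1) N0c N0inj] sc(2)
  by (auto simp: path_image_def pathfinish_def pathstart_def image_comp)
 let ?I = "inside (path_image c')" and ?O = "outside (path_image c')"
 have J: "connected ?I" "connected ?O" "\<not> bounded ?O" "?I \<union> ?O = - path_image c'" "?I \<inter> ?O = {}"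
  by (insert Jordan_inside_outside[OF c'(1,2)], (elim conjE, assumption)+)
 have off: "N' (Fin w) \<notin> path_image c" if "w \<notin> path_image c'" for w
 proof
  assume "N' (Fin w) \<in> path_image c"
  then have "N0 (N' (Fin w)) \<in> path_image c'" unfolding c'(3) by (rule imageI)
  then show False using that by (simp add: N0_def N(4))
 qed
 have inC: "T \<subseteq> C" if "connected T" "T \<inter> path_image c = {}" "z k \<in> T" for T
  by (rule components_maximal[OF C(1) that(1)]) (use that C(2) in auto)
 have conN': "connected (N' ` T)" if "connected T" for T by (rule connected_continuous_image[OF continuous_on_PSL2C[OF N(2)] that])
 have zk: "N' (Fin 0) = z k" using N(3)[of "z k"] k(2) by simp
 have zi: "N' Infty = z i" using N(3)[of "z i"] i(2) by simp
 have not0: "0 \<notin> path_image c'"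
 proof
  assume "0 \<in> path_image c'"
  then obtain x where x: "x \<in> path_image c" "N0 x = 0" unfolding c'(3) by auto
  then have "x = z k" using NF'[OF x(1)] zk by simp
  then show False using cpt[OF x(1)] by simp
 qed
 \<comment> \<open>Otherwise the outside together with Infty would be a connected set off the loop
   joining \<open>z k\<close> to \<open>z i\<close>, although the component of \<open>z k\<close>
   has no other marked point.\<close>
 have in0: "0 \<in> ?I"
 proof (rule ccontr)
  assume "0 \<notin> ?I"
  then have 0: "0 \<in> ?O" using not0 J(4) by blast
  let ?T = "N' ` insert Infty (Fin ` ?O)"
  have "?T \<subseteq> C"
  proof (rule inC)
   show "connected ?T" by (rule conN'[OF closure_outside_sphere[OF J(2,3)]])
   have "z i \<notin> path_image c" using cpt by blast
   moreover have "N' (Fin w) \<notin> path_image c" if "w \<in> ?O" for w by (rule off) (use that J(4) in blast)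
   ultimately show "?T \<inter> path_image c = {}" using zi by auto
   show "z k \<in> ?T" unfolding zk[symmetric] using 0 by blast
  qed
  moreover have "z i \<in> ?T" unfolding zi[symmetric] by blast
  ultimately have "z i \<in> C \<inter> z ` {1..n}" using i(1) by blast
  then show False using zik unfolding C(2) by simp
 qed
 \<comment> \<open>The other marked points seen in the plane, which the disc has to avoid.\<close>
 define Q where "Q = {w. Fin w \<in> N ` z ` {1..n} \<and> w \<noteq> 0}"
 have "finite (Fin -` N ` z ` {1..n})" by (intro finite_vimageI) (auto intro: injI)
 then have finQ: "finite Q" by (rule finite_subset[rotated]) (auto simp: Q_def)
 have QO: "Q \<subseteq> ?O"
 proof
  fix w assume w: "w \<in> Q"
  then obtain x where x: "x \<in> z ` {1..n}" "Fin w = N x" by (auto simp: Q_def)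
  have xw: "N' (Fin w) = x" using x(2) N(3) by simp
  have xk: "x \<noteq> z k" using w x(2) k(2) by (auto simp: Q_def)
  have "w \<notin> path_image c'"
  proof
   assume "w \<in> path_image c'"
   then obtain y where y: "y \<in> path_image c" "w = N0 y" unfolding c'(3) by blast
   then have "x \<in> path_image c" using NF'[OF y(1)] xw by simp
   then show False using sc(3) x(1) by blast
  qed
  moreover have "w \<notin> ?I"
  proof
   assume wI: "w \<in> ?I"
   have "N' ` Fin ` ?I \<subseteq> C"
   proof (rule inC)
    show "connected (N' ` Fin ` ?I)" by (intro conN' connected_continuous_image continuous_on_Fin J(1))
    have "N' (Fin w) \<notin> path_image c" if "w \<in> ?I" for w by (rule off) (use that J(4) in blast)
    then show "N' ` Fin ` ?I \<inter> path_image c = {}" by auto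
    show "z k \<in> N' ` Fin ` ?I" unfolding zk[symmetric] using in0 by blast
   qed
   then have "x \<in> C \<inter> z ` {1..n}" using wI xw x(1) by blast
   then show False using xk unfolding C(2) by simp
  qed
  ultimately show "w \<in> ?O" using J(4) by blast
 qed
 obtain W where W: "open W" "simply_connected W" "W \<noteq> UNIV" "path_image c' \<subseteq> W" "?I \<subseteq> W" "W \<inter> Q = {}"
  by (rule jordan_disc_neighbourhood[OF c'(1,2) finQ QO]) (rule that)
 have W0: "0 \<in> W" using in0 W(5) by blast
 obtain \<Phi> \<Psi> c0 where \<Phi>: "\<Phi> holomorphic_on ball 0 1" "\<Phi> ` ball 0 1 = W" "\<Psi> holomorphic_on W"
  "\<And>w. w \<in> W \<Longrightarrow> \<Psi> w \<in> ball 0 1 \<and> \<Phi> (\<Psi> w) = w" "\<And>w. w \<in> ball 0 1 \<Longrightarrow> \<Psi> (\<Phi> w) = w"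
  "\<Phi> 0 = 0" "c0 > 0" "(\<Phi> has_field_derivative of_real c0) (at 0)" by (rule normalized_riemann_map[OF W(1-3) W0]) (rule that)
 have inj: "inj_on \<Phi> (ball 0 1)" by (rule inj_on_inverseI) (rule \<Phi>(5))
 show ?thesis
 proof (rule that[of \<Phi> c0 "\<lambda>x. \<Psi> (N0 x)", OF \<Phi>(1) inj \<Phi>(6-8)])
  fix w :: complex assume w: "w \<in> ball 0 1" "w \<noteq> 0"
  show "N' (Fin (\<Phi> w)) \<in> S"
  proof
   assume "N' (Fin (\<Phi> w)) \<in> z ` {1..n}"
   then have "N (N' (Fin (\<Phi> w))) \<in> N ` z ` {1..n}" by (rule imageI)
   then have "Fin (\<Phi> w) \<in> N ` z ` {1..n}" by (simp only: N(4))
   moreover have "\<Phi> w \<noteq> 0" using inj_onD[OF inj, of w 0] w \<Phi>(6) by auto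
   ultimately have "\<Phi> w \<in> Q" by (simp add: Q_def)
   moreover have "\<Phi> w \<in> W" using \<Phi>(2) w(1) by blast
   ultimately show False using W(6) by blast
  qed
 next
  have "continuous_on (path_image c) (\<lambda>x. \<Psi> (N0 x))"
   by (rule continuous_on_compose2[OF holomorphic_on_imp_continuous_on[OF \<Phi>(3)] N0c]) (use W(4) c'(3) in blast)
  from path_continuous_image[OF simple_path_imp_path[OF sc(1)] this]
  show "path (\<lambda>s. \<Psi> (N0 (c s)))" by (simp add: o_def)
  fix s :: real assume s: "s \<in> {0..1}"
  then have cs: "c s \<in> path_image c" by (simp add: path_image_def)
  then have "N0 (c s) \<in> W" using W(4) c'(3) by blast
  then show "\<Psi> (N0 (c s)) \<in> ball 0 1 \<and> N' (Fin (\<Phi> (\<Psi> (N0 (c s))))) = c s" using \<Phi>(4) NF'[OF cs] by simp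
 qed
qed

text \<open>The loop has a lift \<open>a\<close> to \<open>X\<close> and a logarithmic lift
  \<open>l\<close> to the half-plane. One element \<open>A\<close> matches the developments at both
  ends; there the end points differ from the initial ones by \<alpha> and by a translation, so
  \<open>R\<close> is a conjugate of the parabolic \<open>E\<close>.\<close>

lemma holonomy_parabolic:
 assumes X: "universal_covering X p S" and h: "devel X p h"
  and \<alpha>: "\<alpha> \<in> deck_transformations X p" and c: "simple_loop_around n z k c"
  and a: "path a" "path_image a \<subseteq> X" "\<And>s. s \<in> {0..1} \<Longrightarrow> p (a s) = c s" "\<alpha> (pathstart a) = pathfinish a"
  and R: "R \<in> PSL2C" "\<And>x. x \<in> X \<Longrightarrow> h (\<alpha> x) = R (h x)" shows "parabolic R"
proof -
 have cov: "covering_space X p S" using X by (auto simp: universal_covering_def)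
 have sp: "spread X p" by (rule covering_space_spread[OF cov open_S])
 have dk: "continuous_on X \<alpha>" "\<alpha> ` X \<subseteq> X" "\<And>x. x \<in> X \<Longrightarrow> p (\<alpha> x) = p x"
  using \<alpha> by (auto simp: deck_transformations_def homeomorphism_def)
 obtain \<Phi> \<Psi> c0 where \<Phi>: "\<Phi> holomorphic_on ball 0 1" "inj_on \<Phi> (ball 0 1)" "\<Phi> 0 = 0"
  "c0 > 0" "(\<Phi> has_field_derivative of_real c0) (at 0)"
  "\<And>w. w \<in> ball 0 1 \<Longrightarrow> w \<noteq> 0 \<Longrightarrow> N' (Fin (\<Phi> w)) \<in> S"
  "path (\<lambda>s. \<Psi> (c s))" "\<And>s. s \<in> {0..1} \<Longrightarrow> \<Psi> (c s) \<in> ball 0 1 \<and> N' (Fin (\<Phi> (\<Psi> (c s)))) = c s"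
  by (rule loop_disc[OF c]) (rule that)
 have cS: "c s \<in> S" if "s \<in> {0..1}" for s
 proof -
  have "path_image c \<subseteq> S" using c by (simp add: simple_loop_around_def)
  then show ?thesis unfolding path_image_def using that by (rule subsetD[OF _ imageI])
 qed
 have "0 \<notin> path_image (\<lambda>s. \<Psi> (c s))"
 proof
  assume "0 \<in> path_image (\<lambda>s. \<Psi> (c s))"
  then obtain s where s: "s \<in> {0..1}" "\<Psi> (c s) = 0" unfolding path_image_def by force
  then have "c s = N' (Fin 0)" using \<Phi>(8)[OF s(1)] \<Phi>(3) by simp
  then have "c s = z k" using N(3)[of "z k"] k(2) by simp
  then show False using cS[OF s(1)] k(1) by blast
 qed
 then obtain l where l: "path l" "\<And>s. s \<in> {0..1} \<Longrightarrow> \<Psi> (c s) = 0 + exp (l s)"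
  by (rule winding_number_as_continuous_log[OF \<Phi>(7)]) (rule that)
 have lL: "l s \<in> left_half" if s: "s \<in> {0..1}" for s
 proof -
  have "norm (exp (l s)) < 1" using \<Phi>(8)[OF s] l(2)[OF s] by simp
  then show ?thesis by (simp add: left_half_def)
 qed
 have lp: "exp_chart \<Phi> (l s) = c s" if "s \<in> {0..1}" for s using \<Phi>(8)[OF that] l(2)[OF that] by (simp add: exp_chart_def)
 have "c 1 = c 0" using c by (auto simp: simple_loop_around_def pathfinish_def pathstart_def)
 then have "exp (l 1) = exp (l 0)" using l(2)[of 0] l(2)[of 1] by simp
 \<comment> \<open>The loop closes, so its logarithm gains an integer number of turns;
   \<open>puncture_monodromy\<close> treats every such integer.\<close>
 then obtain m :: int where "l 1 = l 0 + of_real (of_int (2 * m) * pi) * \<i>" unfolding exp_eq by blast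
 then have lm: "l 1 = l 0 + of_int m * (2 * of_real pi * \<i>)" by (simp add: algebra_simps)
 have spL: "spread left_half (exp_chart \<Phi>)" by (rule spread_exp_chart[OF \<Phi>(1,2)])
 have "exp_chart \<Phi> ` left_half \<subseteq> (\<Union>k\<in>{1..n}. D k)" unfolding Union_D
 proof (rule image_subsetI)
  fix \<zeta> assume "\<zeta> \<in> left_half"
  then have "exp \<zeta> \<in> ball 0 1" using left_half(4) by simp
  then show "exp_chart \<Phi> \<zeta> \<in> S" unfolding exp_chart_def by (rule \<Phi>(6)) simp
 qed
 then obtain F where F: "devel left_half (exp_chart \<Phi>) F" by (rule devel_exists[OF spL left_half(3)])
 obtain E where E: "parabolic E" "\<And>\<zeta>. \<zeta> \<in> left_half \<Longrightarrow> F (\<zeta> + of_int m * (2 * of_real pi * \<i>)) = E (F \<zeta>)"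
  by (rule puncture_monodromy[OF \<Phi>(1-5) F]) (assumption | rule that)+
 have lpi: "path_image l \<subseteq> left_half" using lL by (auto simp: path_image_def)
 have eqp: "p (a s) = exp_chart \<Phi> (l s)" if "s \<in> {0..1}" for s using a(3)[OF that] lp[OF that] by simp
 obtain A where A: "A \<in> PSL2R" "matches X p h left_half (exp_chart \<Phi>) F (a 0) (l 0) A"
  "matches X p h left_half (exp_chart \<Phi>) F (a 1) (l 1) A"
  by (rule matches_along_path[OF sp spL h F a(1,2) l(1) lpi eqp]) (assumption | rule that)+
 have AC: "A \<in> PSL2C" using A(1) PSL2R_subset_PSL2C by blast
 have a0: "a 0 \<in> X" "l 0 \<in> left_half" "p (a 0) = exp_chart \<Phi> (l 0)" using a(2) lL[of 0] eqp[of 0] by (auto simp: path_image_def)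
 have a1: "\<alpha> (a 0) = a 1" using a(4) by (simp add: pathstart_def pathfinish_def)
 let ?\<tau> = "of_int m * (2 * of_real pi * \<i>) :: complex"
 \<comment> \<open>Both sides match \<open>h \<circ> \<alpha>\<close> with \<open>F\<close> at the
   initial points: one follows from the match there, the other pulls back the match at the end
   points by \<alpha> and by the translation.\<close>
 have "R \<circ> A = A \<circ> E"
 proof (rule matches_unique[OF sp spL F a0])
  show "R \<circ> A \<in> PSL2C" "A \<circ> E \<in> PSL2C" using PSL2C_comp R(1) AC parabolic_PSL2C[OF E(1)] by auto
  obtain V W where 1: "open_in X V" "a 0 \<in> V" "open_in left_half W" "l 0 \<in> W"
   "\<And>x' y'. x' \<in> V \<Longrightarrow> y' \<in> W \<Longrightarrow> p x' = exp_chart \<Phi> y' \<Longrightarrow> h x' = A (F y')" by (rule matchesE[OF A(2)]) (rule that)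
  show "matches X p (\<lambda>x. h (\<alpha> x)) left_half (exp_chart \<Phi>) F (a 0) (l 0) (R \<circ> A)" unfolding matches_def
  proof (intro exI[of _ V] exI[of _ W] conjI 1(1-4) ballI impI)
   fix x y assume xy: "x \<in> V" "y \<in> W" "p x = exp_chart \<Phi> y"
   have "x \<in> X" using xy(1) 1(1) openin_imp_subset by blast
   then show "h (\<alpha> x) = (R \<circ> A) (F y)" using R(2) 1(5)[OF xy] by simp
  qed
  obtain V1 W1 where 2: "open_in X V1" "a 1 \<in> V1" "open_in left_half W1" "l 1 \<in> W1"
   "\<And>x' y'. x' \<in> V1 \<Longrightarrow> y' \<in> W1 \<Longrightarrow> p x' = exp_chart \<Phi> y' \<Longrightarrow> h x' = A (F y')" by (rule matchesE[OF A(3)]) (rule that)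
  have oV: "open_in X (X \<inter> \<alpha> -` V1)" by (rule continuous_openin_preimage[OF dk(1) _ 2(1)]) (use dk(2) in blast)
  have oW1: "open W1" "W1 \<subseteq> left_half" using 2(3) left_half(1) openin_open_trans openin_imp_subset by blast+
  have oW: "open_in left_half ((\<lambda>y. y + ?\<tau>) -` W1)"
  proof (rule open_subset)
   show "(\<lambda>y. y + ?\<tau>) -` W1 \<subseteq> left_half" using oW1(2) by (auto simp: left_half_def)
   have "continuous_on UNIV (\<lambda>y. y + ?\<tau>)" by (intro continuous_intros)
   then show "open ((\<lambda>y. y + ?\<tau>) -` W1)" by (rule open_vimage[OF oW1(1)])
  qed
  show "matches X p (\<lambda>x. h (\<alpha> x)) left_half (exp_chart \<Phi>) F (a 0) (l 0) (A \<circ> E)" unfolding matches_def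
  proof (intro exI[of _ "X \<inter> \<alpha> -` V1"] exI[of _ "(\<lambda>y. y + ?\<tau>) -` W1"] conjI oV oW ballI impI)
   show "a 0 \<in> X \<inter> \<alpha> -` V1" using a0(1) a1 2(2) by simp
   show "l 0 \<in> (\<lambda>y. y + ?\<tau>) -` W1" using 2(4) lm by simp
   fix x y assume x: "x \<in> X \<inter> \<alpha> -` V1" and y: "y \<in> (\<lambda>y. y + ?\<tau>) -` W1" and xy: "p x = exp_chart \<Phi> y"
   have xX: "x \<in> X" "\<alpha> x \<in> V1" and yL: "y + ?\<tau> \<in> W1" using x y by auto
   have yl: "y \<in> left_half" using oW1(2) yL by (auto simp: left_half_def)
   have "p (\<alpha> x) = exp_chart \<Phi> (y + ?\<tau>)" unfolding dk(3)[OF xX(1)] exp_chart_period by (rule xy)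
   from 2(5)[OF xX(2) yL this] show "h (\<alpha> x) = (A \<circ> E) (F y)" using E(2)[OF yl] by simp
  qed
 qed
 then have "A (E x) = R (A x)" for x by (metis comp_apply)
 then show ?thesis by (rule parabolic_conj[OF E(1) AC])
qed

end

lemma (in geodesic_charts) smooth_holonomy_parabolic:
 assumes C1: "C1_smooth_curve \<gamma>" and k: "k \<in> {1..n}"
  and X: "universal_covering X p S" and h: "devel X p h" and \<rho>: "holonomy_representation X p h \<rho>"
  and A: "A \<in> holonomy_around X p n z \<rho> k" shows "parabolic A"
proof -
 obtain N N' i k1 k2 r0 where "geodesic_corner n z \<gamma> q0 t0 f \<psi> g B N N' k i k1 k2 r0" by (rule smooth_corner[OF C1 k]) (rule that)
 then interpret geodesic_corner n z \<gamma> q0 t0 f \<psi> g B N N' k i k1 k2 r0 .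
 obtain \<alpha> c a where a: "A = \<rho> \<alpha>" "\<alpha> \<in> deck_transformations X p" "simple_loop_around n z k c"
  "path a" "path_image a \<subseteq> X" "\<forall>s\<in>{0..1}. p (a s) = c s" "\<alpha> (pathstart a) = pathfinish a"
  using A unfolding holonomy_around_def by blast
 have "\<rho> \<alpha> \<in> PSL2C" using \<rho> a(2) by (auto simp: holonomy_representation_def hom_def)
 moreover have "h (\<alpha> x) = \<rho> \<alpha> (h x)" if "x \<in> X" for x using \<rho> a(2) that by (simp add: holonomy_representation_def)
 ultimately show ?thesis unfolding a(1) using holonomy_parabolic[OF X h a(2,3,4,5) _ a(7)] a(6) by blast
qed

theorem theorem5p3:
 fixes n :: nat and z :: "nat \<Rightarrow> riemann_sphere" and \<tau> \<gamma> :: "riemann_sphere set"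
  and X :: "'a::topological_space set" and p :: "'a \<Rightarrow> riemann_sphere"
 assumes "n \<ge> 3" and "inj_on z {1..n}" and "\<gamma> \<in> isotopy_class n z \<tau>" and "geodesic_property n z \<gamma>"
  and "universal_covering X p (- z ` {1..n})" shows "projective_structure (- z ` {1..n}) (curve_structure n z \<gamma>) \<and>
  (\<exists>h. continued_map X p n z \<gamma> h) \<and>
  (\<forall>h. continued_map X p n z \<gamma> h \<longrightarrow>
   developing_map X p (curve_structure n z \<gamma>) h \<and>
   (\<exists>\<rho>. holonomy_representation X p h \<rho> \<and>
     \<rho> ` deck_transformations X p \<subseteq> PSL2R \<and>
     (C1_smooth_curve \<gamma> \<longrightarrow>
      (\<forall>k\<in>{1..n}. \<forall>A\<in>holonomy_around X p n z \<rho> k. parabolic A))))"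
proof -
 obtain F :: "real \<times> real \<Rightarrow> riemann_sphere" and t where F: "increasing_times n t"
  "\<forall>s\<in>{0..1}. simple_path (\<lambda>x. F (s, x)) \<and> F (s, 1) = F (s, 0) \<and> (\<forall>k\<in>{1..n}. F (s, t k) = z k)"
  "path_image (\<lambda>x. F (1, x)) = \<gamma>" using assms(3) unfolding isotopy_class_def by blast
 \<comment> \<open>The last curve of the isotopy parametrizes \<gamma> through the marked points in
   their order, which is all that the construction uses.\<close>
 define q where "q x = F (1, x)" for x
 have q: "jordan_param q \<gamma>" "\<And>k. k \<in> {1..n} \<Longrightarrow> q (t k) = z k"
  using bspec[OF F(2), of 1] F(3) by (auto simp: q_def[abs_def] jordan_param_def pathfinish_def pathstart_def)
 interpret geodesic_curve n z \<gamma> q t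
  by (rule geodesic_curve.intro, rule assms(1), rule assms(2), rule q(1), rule F(1), (rule q(2); assumption), rule assms(4))
 obtain f \<psi> g B where "geodesic_charts n z \<gamma> q t f \<psi> g B" by (rule geodesic_charts_exist) (rule that)
 then interpret geodesic_charts n z \<gamma> q t f \<psi> g B .
 have sp: "spread X p" using assms(5) covering_space_spread open_S by (auto simp: universal_covering_def)
 show ?thesis
 proof (intro conjI allI impI)
  show "projective_structure S (curve_structure n z \<gamma>)" by (rule projective_structure_curve)
  show "\<exists>h. continued_map X p n z \<gamma> h" by (rule continued_map_exists[OF assms(5)])
  fix h assume "continued_map X p n z \<gamma> h"
  then have h: "devel X p h" by (rule continued_map_devel[OF assms(5)])
  show "developing_map X p (curve_structure n z \<gamma>) h" by (rule developing_map_of_devel[OF sp h])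
  obtain \<rho> where \<rho>: "holonomy_representation X p h \<rho>" "\<rho> ` deck_transformations X p \<subseteq> PSL2R"
   by (rule holonomy_exists[OF assms(5) h]) (rule that)
  show "\<exists>\<rho>. holonomy_representation X p h \<rho> \<and> \<rho> ` deck_transformations X p \<subseteq> PSL2R \<and>
     (C1_smooth_curve \<gamma> \<longrightarrow> (\<forall>k\<in>{1..n}. \<forall>A\<in>holonomy_around X p n z \<rho> k. parabolic A))"
   using \<rho> smooth_holonomy_parabolic[OF _ _ assms(5) h \<rho>(1)] by blast
 qed
qed

end
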